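(* Let $n\ge1$, $\alpha\in(0,1]$, $\beta\in(0,n)$, $\gamma\in(0,1]$, $\zeta>0$, $\zeta+n\gamma>n-p\beta$, and let $1<p<\min\{q,n/\beta\}$ or $1=p\le q<\infty$, where $q=\frac{p(\zeta+n\gamma)}{n-p\beta}$ (with $\beta\notin\mathbb{N}$ when $p=1$). If $d\mu_{\gamma,\zeta}(t,x)=t^{\zeta-1}|x|^{n(\gamma-1)}\,dt\,dx$ on $\mathbb{R}^{1+n}_{+}$, then $$\left(\mu_{\gamma,\zeta}(T(O))\right)^{\frac{n-p\beta}{\zeta+n\gamma}}\lesssim\mathrm{cap}_{\dot W^{\beta,p}(\mathbb{R}^n)}(O)\quad\text{for all open }O\subseteq\mathbb{R}^n.$$ Equivalently, $$\|v(t^{2\alpha},x)\|_{L^{\frac{(\zeta+n\gamma)p}{n-p\beta}}(\mathbb{R}^{1+n}_{+},\mu_{\gamma,\zeta})}\lesssim\|v_0\|_{\dot W^{\beta,p}(\mathbb{R}^n)}\quad\text{for all }v_0\in\dot W^{\beta,p}(\mathbb{R}^n),$$ where $v(t,x)=S_\alpha(t)v_0(x)$.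
   Context: $\mathbb{R}^{1+n}_{+}=(0,\infty)\times\mathbb{R}^n$. $U\lesssim V$ means $U\le\theta V$ for some constant $\theta>0$ independent of the functions or sets under consideration. $v(t,x)=S_\alpha(t)v_0(x):=(K^\alpha_t* v_0)(x)$ (convolution in the space variable), with $K^\alpha_t(x)=(2\pi)^{-n/2}\int_{\mathbb{R}^n}e^{ix\cdot\xi}e^{-t|\xi|^{2\alpha}}d\xi$; it solves $\partial_t v+(-\Delta)^\alpha v=0$ on $\mathbb{R}^{1+n}_{+}$, $v(0,\cdot)=v_0$. The function $v(t^{2\alpha},x)$ is regarded as a function of $(t,x)\in\mathbb{R}^{1+n}_{+}$. $\dot W^{\beta,p}(\mathbb{R}^n)$ is the completion of $C_0^\infty(\mathbb{R}^n)$ with respect to $\|f\|_{\dot W^{\beta,p}(\mathbb{R}^n)}=\|(-\Delta)^{\beta/2}f\|_{L^p}$ if $p\in(1,n/\beta)$, and $\|f\|_{\dot W^{\beta,p}(\mathbb{R}^n)}=\left(\int_{\mathbb{R}^n}\frac{\|\Delta_h^kf\|_{L^p}^p}{|h|^{n+p\beta}}dh\right)^{1/p}$ if $p=1$ and $\beta\in(0,n)\setminus\mathbb{N}$, where $k=1+[\beta]$ ($[\beta]$ the integer part), $\Delta_h^1f(x)=f(x+h)-f(x)$, $\Delta_h^kf=\Delta_h^1\Delta_h^{k-1}f$ for $k>1$. Here $(-\Delta)^{s}$ is the Fourier multiplier with symbol $|\xi|^{2s}$. For $S\subseteq\mathbb{R}^n$, $\mathrm{cap}_{\dot W^{\beta,p}(\mathbb{R}^n)}(S)=\inf\{\|f\|^p_{\dot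 W^{\beta,p}(\mathbb{R}^n)}: f\in\dot W^{\beta,p}(\mathbb{R}^n),\ f\ge0,\ S\subseteq\mathrm{Int}(\{f\ge1\})\}$. For open $O\subseteq\mathbb{R}^n$ the tent is $T(O)=\{(r,x)\in\mathbb{R}^{1+n}_{+}:B(x,r)\subseteq O\}$, with $B(x,r)$ the open ball of center $x$ and radius $r$. $\|f\|_{L^q(X,\mu)}=\left(\int_X|f|^qd\mu\right)^{1/q}$. *)

theory Defs
  imports "HOL-Analysis.Analysis"
begin

section \<open>Extended nonnegative powers and Lebesgue norms\<close>

text \<open>Only used with exponents \<open>a > 0\<close>, so that \<open>\<infinity>\<^sup>a = \<infinity>\<close>.\<close>

definition ennpowr :: "ennreal \<Rightarrow> real \<Rightarrow> ennreal" where
  "ennpowr x a = (if x = \<infinity> then \<infinity> else ennreal (enn2real x powr a))"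

definition Lp_norm :: "'b measure \<Rightarrow> real \<Rightarrow> ('b \<Rightarrow> 'c::real_normed_vector) \<Rightarrow> ennreal" where
  "Lp_norm M p f = ennpowr (\<integral>\<^sup>+ x. ennreal (norm (f x) powr p) \<partial>M) (1 / p)"

section \<open>Test functions\<close>

text \<open>
  Being \<open>k\<close> times continuously differentiable, phrased through iterated partial derivatives.
  Test functions are real valued; complex values occur only through Fourier integrals.
\<close>

primrec Ck :: "nat \<Rightarrow> ('a::euclidean_space \<Rightarrow> real) \<Rightarrow> bool" where
  "Ck 0 f \<longleftrightarrow> continuous_on UNIV f"
| "Ck (Suc k) f \<longleftrightarrow>
     (\<forall>x. f differentiable (at x)) \<and>
     (\<forall>b\<in>Basis. Ck k (\<lambda>x. frechet_derivative f (at x) b))"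

definition test_function :: "('a::euclidean_space \<Rightarrow> real) \<Rightarrow> bool" where
  "test_function f \<longleftrightarrow> (\<forall>k. Ck k f) \<and> compact (closure {x. f x \<noteq> 0})"

section \<open>Fractional Laplacian, differences and the homogeneous Sobolev norm\<close>

definition fourier :: "('a::euclidean_space \<Rightarrow> real) \<Rightarrow> 'a \<Rightarrow> complex" where
  "fourier f \<xi> = of_real ((2 * pi) powr (- real DIM('a) / 2)) *
     (LINT x|lborel. cis (- (x \<bullet> \<xi>)) * of_real (f x))"

text \<open>\<open>(-\<Delta>)\<^sup>s\<close> on test functions, for \<open>s > 0\<close>.\<close>

definition frac_laplacian :: "real \<Rightarrow> ('a::euclidean_space \<Rightarrow> real) \<Rightarrow> 'a \<Rightarrow> complex" where
  "frac_laplacian s f x = of_real ((2 * pi) powr (- real DIM('a) / 2)) *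
     (LINT \<xi>|lborel. cis (x \<bullet> \<xi>) * of_real (norm \<xi> powr (2 * s)) * fourier f \<xi>)"

definition fwd_diff :: "'a::euclidean_space \<Rightarrow> ('a \<Rightarrow> real) \<Rightarrow> 'a \<Rightarrow> real" where
  "fwd_diff h f = (\<lambda>x. f (x + h) - f x)"

definition test_norm :: "real \<Rightarrow> real \<Rightarrow> ('a::euclidean_space \<Rightarrow> real) \<Rightarrow> ennreal" where
  "test_norm \<beta> p f =
     (if p = 1
      then ennpowr (\<integral>\<^sup>+ h. ennpowr (Lp_norm lborel p ((fwd_diff h ^^ (1 + nat \<lfloor>\<beta>\<rfloor>)) f)) p
                          / ennreal (norm h powr (real DIM('a) + p * \<beta>)) \<partial>lborel) (1 / p)
      else Lp_norm lborel p (frac_laplacian (\<beta> / 2) f))"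

section \<open>The homogeneous Sobolev space and its capacity\<close>

text \<open>
  The completion of the test functions, realised as a space of functions: a Cauchy sequence of
  test functions is identified with its limit in \<open>L\<^sup>1\<^sub>l\<^sub>o\<^sub>c\<close>, which exists and determines the element
  of the completion by the Sobolev embedding into \<open>L\<^sup>n\<^sup>p\<^sup>/\<^sup>(\<^sup>n\<^sup>-\<^sup>p\<^sup>\<beta>\<^sup>)\<close>.
  The predicate says that \<open>f\<close> is (any representative of) an element of the completion and that
  its norm, the limit of the norms of a representing Cauchy sequence, is \<open>N\<close>.
\<close>

definition has_sobolev_norm :: "real \<Rightarrow> real \<Rightarrow> ('a::euclidean_space \<Rightarrow> real) \<Rightarrow> ennreal \<Rightarrow> bool" where
  "has_sobolev_norm \<beta> p f N \<longleftrightarrow>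
     f \<in> borel_measurable lebesgue \<and>
     (\<exists>\<phi>. (\<forall>k. test_function (\<phi> k)) \<and>
          (\<forall>e>0. \<exists>m. \<forall>j\<ge>m. \<forall>k\<ge>m. test_norm \<beta> p (\<lambda>x. \<phi> j x - \<phi> k x) < e) \<and>
          (\<forall>K. compact K \<longrightarrow>
             (\<lambda>k. \<integral>\<^sup>+ x\<in>K. ennreal \<bar>\<phi> k x - f x\<bar> \<partial>lebesgue) \<longlonglongrightarrow> 0) \<and>
          (\<lambda>k. test_norm \<beta> p (\<phi> k)) \<longlonglongrightarrow> N)"

text \<open>
  All representatives \<open>f\<close> of an element are admitted, so the pointwise conditions below amount to
  \<open>f \<ge> 0\<close> a.e. and \<open>f \<ge> 1\<close> a.e. on a neighbourhood of \<open>S\<close>. The value is \<open>\<infinity>\<close> if no \<open>f\<close> qualifies.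
\<close>

definition sobolev_cap :: "real \<Rightarrow> real \<Rightarrow> 'a::euclidean_space set \<Rightarrow> ennreal" where
  "sobolev_cap \<beta> p S =
     Inf {ennpowr N p | f N. has_sobolev_norm \<beta> p f N \<and> (\<forall>x. f x \<ge> 0) \<and>
                              S \<subseteq> interior {x. f x \<ge> 1}}"

section \<open>Tents, the weighted measure and the fractional heat extension\<close>

definition tent :: "'a::euclidean_space set \<Rightarrow> (real \<times> 'a) set" where
  "tent U = {(r, x). 0 < r \<and> ball x r \<subseteq> U}"

definition mu_weight :: "real \<Rightarrow> real \<Rightarrow> (real \<times> 'a::euclidean_space) measure" where
  "mu_weight \<gamma> \<zeta> =
     density (restrict_space lborel ({0<..} \<times> UNIV))
       (\<lambda>(t, x). ennreal (t powr (\<zeta> - 1) * norm x powr (real DIM('a) * (\<gamma> - 1))))"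

definition heat_kernel :: "real \<Rightarrow> real \<Rightarrow> 'a::euclidean_space \<Rightarrow> complex" where
  "heat_kernel \<alpha> t x = of_real ((2 * pi) powr (- real DIM('a) / 2)) *
     (LINT \<xi>|lborel. cis (x \<bullet> \<xi>) * of_real (exp (- t * norm \<xi> powr (2 * \<alpha>))))"

definition heat_ext :: "real \<Rightarrow> real \<Rightarrow> ('a::euclidean_space \<Rightarrow> real) \<Rightarrow> 'a \<Rightarrow> complex" where
  "heat_ext \<alpha> t f x = (LINT y|lebesgue. heat_kernel \<alpha> t (x - y) * of_real (f y))"

end

theory Submission
  imports Defs "HOL-Probability.Probability" "HOL-Complex_Analysis.Complex_Analysis"
begin

text \<open>
  By scaling one only needs \<open>t = 1\<close>, where finite differences of \<open>exp (- |\<xi>|\<^sup>2\<^sup>\<alpha>)\<close> give the bound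
  \<open>|K\<^sub>t(z)| \<lesssim> t\<^sup>e (t + |z|)\<^sup>-\<^sup>n\<^sup>-\<^sup>e\<close> with \<open>e = 2\<alpha>\<close> for the heat kernel at time \<open>t\<^sup>2\<^sup>\<alpha>\<close>. Hence \<open>|v(t\<^sup>2\<^sup>\<alpha>, x)|\<close> is at most
  a constant times the smoothing of \<open>|v\<^sub>0|\<close> by this majorant, and it suffices to bound the smoothing in
  \<open>L\<^sup>q(\<mu>)\<close> by the Sobolev norm; since the smoothing of a function that is at least 1 on \<open>B(x, r)\<close> is
  bounded below at \<open>(r, x)\<close>, the capacity estimate follows from the same bound. All that is used of
  \<open>\<mu>\<close> is that the cone \<open>{t + |x - y| < r}\<close> has measure at most \<open>A r\<^sup>a\<close>, where \<open>a = \<zeta> + n\<gamma>\<close>.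

  For \<open>p > 1\<close> a test function is dominated by the Riesz potential of \<open>g = |(-\<Delta>)\<^sup>\<beta>\<^sup>/\<^sup>2 f|\<close>, and its smoothing
  by the integral of \<open>r\<^sup>\<beta>\<^sup>-\<^sup>n\<^sup>-\<^sup>1 g(y)\<close> over the cone \<open>{t + |x - y| < r}\<close>. The strong type bound is
  obtained directly, without interpolation, by truncating \<open>g\<close> at a level that depends on \<open>r\<close>.
  For \<open>p = 1\<close> a test function is a telescoping sum of doubly averaged functions over the scales
  \<open>2\<^sup>-\<^sup>j\<close>; the averaging kernel is chosen such that the increments are controlled by differences
  of order \<open>k\<close>, that is, by the Besov type norm. Fatou's lemma passes to the completion.
\<close>

section \<open>Powers and radial integrals\<close>

text \<open>Scaling fixes q through q (n/p - \<beta>) = a, so all estimates have to balance exactly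
  over all radii. Room for convergence at both ends comes from the strict inequality p < q, which
  amounts to n - p \<beta> < a. For p > 1 a potential is tested by a level z: the part of it that is
  at most z / 2 is absorbed, and the factor z^(q - 1) left over is traded for a function of r and g
  alone, since otherwise Fubini could not be applied. The same truncation is lost at p = 1, where
  the integral over large radii needs n - n/p > 0. The difference norm repairs this: it controls the
  sum over scales of 2^(\<beta> j) times the L^1 norms of the increments, and against a measure of
  finite mass a power q > 1 costs only an inequality of Jensen type. Averaging twice is what writes
  an increment as an outer average of an inner difference, so that an L^1 norm of the latter
  suffices. Neither half of the theorem is deduced from the other; both are read off from one bound
  for the smoothing.\<close>

lemma ennpowr_ennreal: "0 \<le> x \<Longrightarrow> ennpowr (ennreal x) a = ennreal (x powr a)"
  by (simp add: ennpowr_def)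

lemma ennpowr_top [simp]: "ennpowr top a = top"
  by (simp add: ennpowr_def)

lemma ennpowr_0 [simp]: "ennpowr 0 a = 0"
  by (simp add: ennpowr_def)

lemma ennpowr_mono:
  assumes "0 \<le> a" "x \<le> y"
  shows "ennpowr x a \<le> ennpowr y a"
proof (cases "y = top")
  case False
  then obtain y' x' where "y = ennreal y'" "x = ennreal x'" "0 \<le> y'" "0 \<le> x'"
    using assms by (metis ennreal_cases neq_top_trans)
  then show ?thesis
    using assms by (auto simp: ennpowr_ennreal intro!: ennreal_leI powr_mono2)
qed simp

lemma ennpowr_mult:
  assumes "0 < c"
  shows "ennpowr (ennreal c * x) a = ennreal (c powr a) * ennpowr x a"
proof (cases x)
  case (real r)
  then show ?thesis
    using assms by (simp add: ennreal_mult[symmetric] ennpowr_ennreal powr_mult)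
next
  case top
  then show ?thesis
    using assms by (simp add: ennreal_mult_top)
qed

lemma ennpowr_ennpowr: "ennpowr (ennpowr x a) b = ennpowr x (a * b)"
  by (cases x) (simp_all add: ennpowr_ennreal powr_powr)

lemma ennpowr_one [simp]: "ennpowr x 1 = x"
  by (cases x) (simp_all add: ennpowr_ennreal)

lemma ennpowr_le_imp:
  assumes "0 < a" "ennpowr x a \<le> y"
  shows "x \<le> ennpowr y (1 / a)"
  using ennpowr_mono[OF _ assms(2), of "1 / a"] assms(1) by (simp add: ennpowr_ennpowr)

lemma borel_measurable_ennpowr [measurable (raw)]:
  assumes [measurable]: "f \<in> borel_measurable M"
  shows "(\<lambda>x. ennpowr (f x) a) \<in> borel_measurable M"
  unfolding ennpowr_def by measurable

text \<open>Tested on strict lower bounds y of the left side: these become lower bounds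
  \<open>ennpowr y (1 / a)\<close> of the base, so infinite values need no case of their own. This
  carries powers through Fatou's lemma.\<close>

lemma ennpowr_liminf_le:
  fixes u :: "nat \<Rightarrow> ennreal"
  assumes "0 < a" "x \<le> liminf u"
  shows "ennpowr x a \<le> liminf (\<lambda>k. ennpowr (u k) a)"
  unfolding le_Liminf_iff
proof safe
  fix y assume y: "y < ennpowr x a"
  have "ennpowr y (1 / a) < x"
  proof (rule ccontr)
    assume "\<not> ?thesis"
    then have "x \<le> ennpowr y (1 / a)" by simp
    from ennpowr_mono[OF _ this, of a] assms(1) y show False
      by (simp add: ennpowr_ennpowr)
  qed
  then have "eventually (\<lambda>k. ennpowr y (1 / a) < u k) sequentially"
    using assms(2) by (intro less_LiminfD) auto
  then show "\<forall>\<^sub>F k in sequentially. y < ennpowr (u k) a"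
  proof eventually_elim
    case (elim k)
    show ?case
    proof (rule ccontr)
      assume "\<not> ?case"
      then have "ennpowr (u k) a \<le> y" by simp
      from ennpowr_le_imp[OF assms(1) this] elim show False by simp
    qed
  qed
qed

section \<open>Fubini, powers on half lines and radial integrals\<close>

lemma nn_integral_swap:
  fixes f :: "'a::euclidean_space \<Rightarrow> 'b::euclidean_space \<Rightarrow> ennreal"
  assumes "(\<lambda>(x, y). f x y) \<in> borel_measurable borel"
  shows "(\<integral>\<^sup>+x. \<integral>\<^sup>+y. f x y \<partial>lborel \<partial>lborel) = (\<integral>\<^sup>+y. \<integral>\<^sup>+x. f x y \<partial>lborel \<partial>lborel)"
proof -
  have "sets (lborel \<Otimes>\<^sub>M lborel) = sets (borel :: ('a \<times> 'b) measure)"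
    unfolding lborel_prod by simp
  from measurable_cong_sets[OF this refl] assms show ?thesis
    by (intro lborel_pair.Fubini'[symmetric]) auto
qed

lemma nn_integral_powr_below:
  assumes "0 < k" "0 < R"
  shows "(\<integral>\<^sup>+r. (if 0 < r \<and> r < R then ennreal (r powr (k - 1)) else 0) \<partial>lborel) = ennreal (R powr k / k)"
proof -
  have "((\<lambda>r. r powr (k - 1)) has_integral (R powr (k - 1 + 1) / (k - 1 + 1))) {0..R}"
    by (rule has_integral_powr_from_0) (use assms in auto)
  then have "(\<integral>\<^sup>+r. ennreal (r powr (k - 1)) * indicator {0..R} r \<partial>lborel) = ennreal (R powr k / k)"
    using nn_integral_has_integral_lebesgue'[of "{0..R}" "\<lambda>r. r powr (k - 1)"]
    by (simp add: nn_integral_completion)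
  also have "(\<integral>\<^sup>+r. ennreal (r powr (k - 1)) * indicator {0..R} r \<partial>lborel) =
    (\<integral>\<^sup>+r. (if 0 < r \<and> r < R then ennreal (r powr (k - 1)) else 0) \<partial>lborel)"
  proof (rule nn_integral_cong_AE)
    show "AE r in lborel. ennreal (r powr (k - 1)) * indicator {0..R} r =
      (if 0 < r \<and> r < R then ennreal (r powr (k - 1)) else 0)"
      using AE_lborel_singleton[of 0] AE_lborel_singleton[of R]
      by eventually_elim (auto split: split_indicator)
  qed
  finally show ?thesis by simp
qed

lemma nn_integral_powr_above:
  assumes "0 < k" "0 < R"
  shows "(\<integral>\<^sup>+r. (if R < r then ennreal (r powr (- k - 1)) else 0) \<partial>lborel) = ennreal (R powr (- k) / k)"
proof -
  have "((\<lambda>r. r powr (- k - 1)) has_integral (- (R powr (- k - 1 + 1)) / (- k - 1 + 1))) {R..}"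
    by (rule has_integral_powr_to_inf) (use assms in auto)
  then have "(\<integral>\<^sup>+r. ennreal (r powr (- k - 1)) * indicator {R..} r \<partial>lborel) = ennreal (R powr (- k) / k)"
    using nn_integral_has_integral_lebesgue'[of "{R..}" "\<lambda>r. r powr (- k - 1)"]
    by (simp add: nn_integral_completion)
  also have "(\<integral>\<^sup>+r. ennreal (r powr (- k - 1)) * indicator {R..} r \<partial>lborel) =
    (\<integral>\<^sup>+r. (if R < r then ennreal (r powr (- k - 1)) else 0) \<partial>lborel)"
  proof (rule nn_integral_cong_AE)
    show "AE r in lborel. ennreal (r powr (- k - 1)) * indicator {R..} r =
      (if R < r then ennreal (r powr (- k - 1)) else 0)"
      using AE_lborel_singleton[of R]
      by eventually_elim (auto split: split_indicator)
  qed
  finally show ?thesis by simp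
qed

text \<open>Layer-cake form of a negative power. With R a distance it turns a decaying kernel into a
  superposition of indicators of balls or cones, to which Fubini and volume bounds apply.\<close>

lemma powr_eq_nn_integral:
  assumes "0 < k" "0 < R"
  shows "ennreal (R powr (- k)) = ennreal k * (\<integral>\<^sup>+r. (if R < r then ennreal (r powr (- k - 1)) else 0) \<partial>lborel)"
  using assms by (simp add: nn_integral_powr_above ennreal_mult[symmetric])

lemma emeasure_ball_powr:
  fixes c :: "'a::euclidean_space"
  assumes "0 < r"
  shows "emeasure lborel (ball c r) = ennreal (unit_ball_vol (DIM('a)) * r powr DIM('a))"
  using assms by (simp add: emeasure_ball powr_realpow)

lemma nn_integral_ball_indicator:
  fixes y :: "'a::euclidean_space"
  assumes "0 < r"
  shows "(\<integral>\<^sup>+x. (if norm (x - y) < r then c else 0) \<partial>lborel) = c * ennreal (unit_ball_vol (DIM('a)) * r powr DIM('a))"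
    "(\<integral>\<^sup>+x. (if norm (y - x) < r then c else 0) \<partial>lborel) = c * ennreal (unit_ball_vol (DIM('a)) * r powr DIM('a))"
proof -
  have "(\<integral>\<^sup>+x. (if norm (y - x) < r then c else 0) \<partial>lborel) = (\<integral>\<^sup>+x. c * indicator (ball y r) x \<partial>lborel)"
    by (intro nn_integral_cong) (auto simp: dist_norm split: split_indicator)
  then show "(\<integral>\<^sup>+x. (if norm (y - x) < r then c else 0) \<partial>lborel) = c * ennreal (unit_ball_vol (DIM('a)) * r powr DIM('a))"
    using emeasure_ball_powr[OF assms, of y] by (simp add: nn_integral_cmult_indicator)
  then show "(\<integral>\<^sup>+x. (if norm (x - y) < r then c else 0) \<partial>lborel) = c * ennreal (unit_ball_vol (DIM('a)) * r powr DIM('a))"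
    by (simp add: norm_minus_commute)
qed

lemma nn_integral_radial:
  fixes h :: "real \<Rightarrow> ennreal"
  assumes [measurable]: "h \<in> borel_measurable borel" and "\<And>r. r \<le> 0 \<Longrightarrow> h r = 0"
  shows "(\<integral>\<^sup>+x. \<integral>\<^sup>+r. (if norm x < r then h r else 0) \<partial>lborel \<partial>(lborel :: 'a::euclidean_space measure)) =
    (\<integral>\<^sup>+r. h r * ennreal (unit_ball_vol (DIM('a)) * r powr DIM('a)) \<partial>lborel)"
proof -
  have "(\<integral>\<^sup>+x. \<integral>\<^sup>+r. (if norm x < r then h r else 0) \<partial>lborel \<partial>(lborel :: 'a measure)) =
    (\<integral>\<^sup>+r. \<integral>\<^sup>+x. (if norm x < r then h r else 0) \<partial>(lborel :: 'a measure) \<partial>lborel)"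
    by (rule nn_integral_swap) (auto simp: borel_prod[symmetric])
  also have "\<dots> = (\<integral>\<^sup>+r. h r * ennreal (unit_ball_vol (DIM('a)) * r powr DIM('a)) \<partial>lborel)"
  proof (rule nn_integral_cong)
    fix r :: real
    show "(\<integral>\<^sup>+x. (if norm x < r then h r else 0) \<partial>(lborel :: 'a measure)) = h r * ennreal (unit_ball_vol (DIM('a)) * r powr DIM('a))"
    proof (cases "0 < r")
      case True
      with nn_integral_ball_indicator(1)[of r 0 "h r"] show ?thesis by simp
    qed (use assms(2)[of r] in \<open>simp add: not_less cong: if_cong\<close>)
  qed
  finally show ?thesis .
qed

section \<open>A Poisson type majorant\<close>

lemma nn_integral_lborel_pair:
  fixes f :: "'a::euclidean_space \<times> 'b::euclidean_space \<Rightarrow> ennreal"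
  assumes "f \<in> borel_measurable borel"
  shows "(\<integral>\<^sup>+z. f z \<partial>lborel) = (\<integral>\<^sup>+x. \<integral>\<^sup>+y. f (x, y) \<partial>lborel \<partial>lborel)"
  using assms by (subst lborel_prod[symmetric], subst lborel.nn_integral_fst)
    (auto simp: borel_prod[symmetric] cong: measurable_cong_sets)

lemma nn_integral_lborel_reflect:
  fixes f :: "'a::euclidean_space \<Rightarrow> ennreal"
  assumes [measurable]: "f \<in> borel_measurable borel"
  shows "(\<integral>\<^sup>+z. f (x - z) \<partial>lborel) = (\<integral>\<^sup>+z. f z \<partial>lborel)"
  by (subst (2) lborel_affine[of "-1" x]) (simp_all add: nn_integral_density nn_integral_distr)

lemma nn_integral_lborel_translate:
  fixes f :: "'a::euclidean_space \<Rightarrow> ennreal"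
  assumes [measurable]: "f \<in> borel_measurable borel"
  shows "(\<integral>\<^sup>+z. f (x + z) \<partial>lborel) = (\<integral>\<^sup>+z. f z \<partial>lborel)"
  by (subst (2) lborel_affine[of "1" x]) (simp_all add: nn_integral_density nn_integral_distr)

text \<open>Homogeneous of degree -n in (t, z) jointly, hence of mass bounded independently of t. At
  e = 1 it is comparable to the Poisson kernel of the half space.\<close>

definition majorant :: "real \<Rightarrow> real \<Rightarrow> 'a::euclidean_space \<Rightarrow> real" where
  "majorant e t z = t powr e * (t + norm z) powr (- real DIM('a) - e)"

lemma majorant_nonneg [simp]: "0 \<le> majorant e t z"
  by (simp add: majorant_def)

lemma borel_measurable_majorant [measurable]:
  "(\<lambda>(t, z). majorant e t z) \<in> borel_measurable (borel \<Otimes>\<^sub>M borel)" "majorant e t \<in> borel_measurable borel"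
  unfolding majorant_def by measurable

text \<open>Where t + |z| is at least R, the kernel is no larger than that of an average over a ball
  of radius R, up to a constant. The factor c is there because R will be a fixed fraction of a
  distance that may be due to t alone.\<close>

lemma majorant_le:
  assumes "0 < e" "0 < t" "0 < R" "R \<le> t + norm z" "t \<le> c * R" "0 < c"
  shows "majorant e t (z :: 'a::euclidean_space) \<le> c powr e * R powr (- real DIM('a))"
proof -
  have "majorant e t z \<le> (c * R) powr e * R powr (- real DIM('a) - e)"
    unfolding majorant_def using assms by (intro mult_mono powr_mono2 powr_mono2') auto
  also have "\<dots> = c powr e * R powr (- real DIM('a))"
    using assms by (simp add: powr_mult powr_diff)
  finally show ?thesis .
qed

text \<open>In the layer-cake formula {t + |z| < r} is enlarged to {t < r, |z| < r}. Each layer is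
  then a full ball, and the remaining integral over r > t is a multiple of t^(-e), which cancels
  t^e.\<close>

lemma nn_integral_majorant:
  assumes "0 < e" "0 < t"
  shows "(\<integral>\<^sup>+z. ennreal (majorant e t (z :: 'a::euclidean_space)) \<partial>lborel) \<le> ennreal ((real DIM('a) + e) * unit_ball_vol (real DIM('a)) / e)"
proof -
  let ?n = "real DIM('a)"
  define h where "h r = (if t < r then ennreal (r powr (- (?n + e) - 1)) else 0)" for r :: real
  have h0: "h r = 0" if "r \<le> 0" for r
    using that assms by (simp add: h_def)
  have [measurable]: "h \<in> borel_measurable borel"
    unfolding h_def by measurable
  have "(\<integral>\<^sup>+z. ennreal (majorant e t (z :: 'a)) \<partial>lborel) \<le>
    (\<integral>\<^sup>+z. ennreal (t powr e * (?n + e)) * (\<integral>\<^sup>+r. (if norm z < r then h r else 0) \<partial>lborel) \<partial>(lborel :: 'a measure))"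
  proof (rule nn_integral_mono)
    fix z :: 'a
    have "ennreal (majorant e t z) = ennreal (t powr e) * (ennreal (?n + e) * (\<integral>\<^sup>+r. (if t + norm z < r then ennreal (r powr (- (?n + e) - 1)) else 0) \<partial>lborel))"
      using assms powr_eq_nn_integral[of "?n + e" "t + norm z"]
      by (simp add: majorant_def ennreal_mult add_pos_nonneg)
    also have "\<dots> \<le> ennreal (t powr e) * (ennreal (?n + e) * (\<integral>\<^sup>+r. (if norm z < r then h r else 0) \<partial>lborel))"
      using assms le_less_trans[of t "t + norm z"] by (intro mult_left_mono nn_integral_mono) (auto simp: h_def)
    finally show "ennreal (majorant e t z) \<le> ennreal (t powr e * (?n + e)) * (\<integral>\<^sup>+r. (if norm z < r then h r else 0) \<partial>lborel)"
      using assms by (simp add: ennreal_mult ac_simps)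
  qed
  also have "\<dots> = ennreal (t powr e * (?n + e)) * (\<integral>\<^sup>+r. h r * ennreal (unit_ball_vol ?n * r powr ?n) \<partial>lborel)"
    by (subst nn_integral_cmult) (simp_all add: nn_integral_radial h0)
  also have "(\<integral>\<^sup>+r. h r * ennreal (unit_ball_vol ?n * r powr ?n) \<partial>lborel) =
      (\<integral>\<^sup>+r. ennreal (unit_ball_vol ?n) * (if t < r then ennreal (r powr (- e - 1)) else 0) \<partial>lborel)"
    using assms by (intro nn_integral_cong)
      (auto simp: h_def ennreal_mult[symmetric] powr_add[symmetric] mult.left_commute)
  also have "\<dots> = ennreal (unit_ball_vol ?n * (t powr (- e) / e))"
    using assms by (simp add: nn_integral_cmult nn_integral_powr_above ennreal_mult[symmetric])
  also have "ennreal (t powr e * (?n + e)) * \<dots> = ennreal ((?n + e) * unit_ball_vol ?n / e)"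
  proof -
    have "t powr e * t powr (- e) = 1"
      using assms by (simp add: powr_minus)
    then have "t powr e * (?n + e) * (unit_ball_vol ?n * (t powr (- e) / e)) = (?n + e) * unit_ball_vol ?n / e"
      using assms by (simp add: field_simps)
    then show ?thesis
      using assms by (subst ennreal_mult[symmetric]) auto
  qed
  finally show ?thesis .
qed

lemma nn_integral_majorant_diff:
  assumes "0 < e" "0 < t"
  shows "(\<integral>\<^sup>+z. ennreal (majorant e t (x - z :: 'a::euclidean_space)) \<partial>lborel) \<le> ennreal ((real DIM('a) + e) * unit_ball_vol (real DIM('a)) / e)"
  using nn_integral_majorant[OF assms] by (subst nn_integral_lborel_reflect) auto

lemma nn_integral_norm_powr_ball:
  assumes "0 \<le> b" "b < real DIM('a::euclidean_space)"
  obtains C where "0 < C" "\<And>R. 0 < R \<Longrightarrow>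
    (\<integral>\<^sup>+z. (if norm (z :: 'a) < R then ennreal (norm z powr (- b)) else 0) \<partial>lborel) \<le> ennreal (C * R powr (real DIM('a) - b))"
proof -
  let ?n = "real DIM('a)"
  \<comment> \<open>The exponent b may be 0, where the layer-cake formula breaks down. An exponent
    strictly between b and n avoids this; on the ball it costs only a factor R^(c - b).\<close>
  define c where "c = (b + ?n) / 2"
  have c: "0 < c" "b < c" "c < ?n"
    using assms DIM_positive[where 'a='a] by (auto simp: c_def)
  define V where "V = unit_ball_vol ?n"
  have V: "0 < V" by (simp add: V_def)
  define C where "C = c * (V / (?n - c) + V / c)"
  show thesis
  proof
    show "0 < C" using c V by (auto simp: C_def intro!: mult_pos_pos add_pos_pos divide_pos_pos)
    fix R :: real assume R: "0 < R"
    define h where "h r = (if 0 < r then ennreal (r powr (- c - 1)) else 0)" for r :: real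
    have [measurable]: "h \<in> borel_measurable borel"
      unfolding h_def by measurable
    have "(\<integral>\<^sup>+z. (if norm (z :: 'a) < R then ennreal (norm z powr (- b)) else 0) \<partial>lborel) \<le>
      (\<integral>\<^sup>+z. ennreal (R powr (c - b) * c) * (\<integral>\<^sup>+r. (if norm (z :: 'a) < R \<and> norm z < r then h r else 0) \<partial>lborel) \<partial>lborel)"
    proof (rule nn_integral_mono)
      fix z :: 'a
      show "(if norm (z :: 'a) < R then ennreal (norm z powr (- b)) else 0) \<le>
        ennreal (R powr (c - b) * c) * (\<integral>\<^sup>+r. (if norm (z :: 'a) < R \<and> norm z < r then h r else 0) \<partial>lborel)"
      \<comment> \<open>At z = 0 the power is 0 by the convention for \<open>powr\<close>, so the
        left side vanishes there.\<close>
      proof (cases "norm z < R \<and> z \<noteq> 0")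
        case True
        then have nz: "0 < norm z" by simp
        have "norm z powr (- b) = norm z powr (c - b) * norm z powr (- c)"
          by (simp add: powr_add[symmetric])
        also have "\<dots> \<le> R powr (c - b) * norm z powr (- c)"
          using True c by (intro mult_right_mono powr_mono2) auto
        finally have "ennreal (norm z powr (- b)) \<le> ennreal (R powr (c - b)) * ennreal (norm z powr (- c))"
          by (subst ennreal_mult[symmetric]) (auto intro: ennreal_leI)
        also have "\<dots> = ennreal (R powr (c - b) * c) * (\<integral>\<^sup>+r. (if norm z < r then ennreal (r powr (- c - 1)) else 0) \<partial>lborel)"
          using c nz by (subst powr_eq_nn_integral[of c "norm z"]) (auto simp: ennreal_mult ac_simps)
        also have "(\<integral>\<^sup>+r. (if norm z < r then ennreal (r powr (- c - 1)) else 0) \<partial>lborel) =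
          (\<integral>\<^sup>+r. (if norm (z :: 'a) < R \<and> norm z < r then h r else 0) \<partial>lborel)"
          using True less_trans[OF nz] by (intro nn_integral_cong) (auto simp: h_def)
        finally show ?thesis using True by simp
      qed (auto simp: zero_le)
    qed
    also have "\<dots> = ennreal (R powr (c - b) * c) * (\<integral>\<^sup>+z. (\<integral>\<^sup>+r. (if norm (z :: 'a) < R \<and> norm z < r then h r else 0) \<partial>lborel) \<partial>lborel)"
      by (rule nn_integral_cmult) measurable
    also have "(\<integral>\<^sup>+z. (\<integral>\<^sup>+r. (if norm (z :: 'a) < R \<and> norm z < r then h r else 0) \<partial>lborel) \<partial>lborel) =
       (\<integral>\<^sup>+r. (\<integral>\<^sup>+z. (if norm (z :: 'a) < R \<and> norm z < r then h r else 0) \<partial>lborel) \<partial>lborel)"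
      by (rule nn_integral_swap) (auto simp: borel_prod[symmetric])
    \<comment> \<open>The layer at r is a ball of radius min r R. Layers below R leave the power
      r^(n - c - 1), integrable at 0 because c < n; layers above R all have the volume of the full
      ball.\<close>
    also have "\<dots> \<le> (\<integral>\<^sup>+r. ennreal V * (if 0 < r \<and> r < R then ennreal (r powr (?n - c - 1)) else 0)
        + ennreal (V * R powr ?n) * (if R < r then ennreal (r powr (- c - 1)) else 0) \<partial>lborel)"
    proof (rule nn_integral_mono_AE)
      show "AE r in lborel. (\<integral>\<^sup>+z. (if norm (z :: 'a) < R \<and> norm z < r then h r else 0) \<partial>lborel) \<le>
        ennreal V * (if 0 < r \<and> r < R then ennreal (r powr (?n - c - 1)) else 0)
        + ennreal (V * R powr ?n) * (if R < r then ennreal (r powr (- c - 1)) else 0)"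
        using AE_lborel_singleton[of R]
      proof eventually_elim
        case (elim r)
        consider "r \<le> 0" | "0 < r" "r < R" | "R < r" using elim by linarith
        then show ?case
        proof cases
          case 1
          then show ?thesis by (simp add: h_def cong: if_cong)
        next
          case 2
          have "(\<integral>\<^sup>+z. (if norm (z :: 'a) < R \<and> norm z < r then h r else 0) \<partial>lborel) \<le>
            (\<integral>\<^sup>+z. (if norm ((z :: 'a) - 0) < r then h r else 0) \<partial>lborel)"
            by (intro nn_integral_mono) auto
          also have "\<dots> = ennreal (r powr (- c - 1)) * ennreal (V * r powr ?n)"
            using 2 by (subst nn_integral_ball_indicator) (auto simp: h_def V_def)
          also have "\<dots> = ennreal V * ennreal (r powr (?n - c - 1))"
            using V by (simp add: ennreal_mult[symmetric] powr_add[symmetric] mult.left_commute algebra_simps)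
          finally show ?thesis using 2 by simp
        next
          case 3
          have "(\<integral>\<^sup>+z. (if norm (z :: 'a) < R \<and> norm z < r then h r else 0) \<partial>lborel) \<le>
            (\<integral>\<^sup>+z. (if norm ((z :: 'a) - 0) < R then h r else 0) \<partial>lborel)"
            by (intro nn_integral_mono) auto
          also have "\<dots> = ennreal (r powr (- c - 1)) * ennreal (V * R powr ?n)"
            using 3 R by (subst nn_integral_ball_indicator) (auto simp: h_def V_def)
          finally show ?thesis using 3 by (simp add: mult.commute)
        qed
      qed
    qed
    also have "\<dots> = ennreal V * ennreal (R powr (?n - c) / (?n - c)) + ennreal (V * R powr ?n) * ennreal (R powr (- c) / c)"
      using c R by (simp add: nn_integral_add nn_integral_cmult nn_integral_powr_below nn_integral_powr_above)
    also have "\<dots> = ennreal (R powr (?n - c) * (V / (?n - c) + V / c))"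
    proof -
      have "R powr ?n * R powr (- c) = R powr (?n - c)"
        by (simp add: powr_add[symmetric])
      then have "V * (R powr (?n - c) / (?n - c)) + V * R powr ?n * (R powr (- c) / c) = R powr (?n - c) * (V / (?n - c) + V / c)"
        by (simp add: field_simps)
      then show ?thesis
        using V c by (subst (1 2) ennreal_mult[symmetric]) (auto simp: ennreal_plus[symmetric] simp del: ennreal_plus)
    qed
    also have "ennreal (R powr (c - b) * c) * \<dots> = ennreal (C * R powr (?n - b))"
    proof -
      have "R powr (c - b) * R powr (?n - c) = R powr (?n - b)"
        by (simp add: powr_add[symmetric])
      then show ?thesis using V c
        by (subst ennreal_mult[symmetric]) (auto simp: C_def intro!: arg_cong[where f=ennreal] add_nonneg_nonneg)
    qed
    finally show "(\<integral>\<^sup>+z. (if norm (z :: 'a) < R then ennreal (norm z powr (- b)) else 0) \<partial>lborel) \<le> ennreal (C * R powr (?n - b))"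
      by (simp add: mult_left_mono)
  qed
qed

text \<open>The cone is enlarged to a cylinder, which separates t from x. The singular weight
  |x|^(-b), with b = n (1 - \<gamma>), is split by the position of x relative to the origin and not
  to y: inside the ball of radius r about 0 it is integrated, outside it is at most r^(-b). This
  makes the bound uniform in the centre y.\<close>

lemma nn_integral_weight_ball:
  assumes "0 < \<gamma>" "\<gamma> \<le> 1" "0 < \<zeta>"
  obtains A where "0 < A" "\<And>r (y :: 'a). 0 < r \<Longrightarrow>
    (\<integral>\<^sup>+(t, x). (if 0 < t \<and> t + norm (x - y) < r
        then ennreal (t powr (\<zeta> - 1) * norm x powr (real DIM('a::euclidean_space) * (\<gamma> - 1))) else 0) \<partial>lborel)
      \<le> ennreal (A * r powr (\<zeta> + real DIM('a) * \<gamma>))"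
proof -
  let ?n = "real DIM('a)"
  define b where "b = ?n * (1 - \<gamma>)"
  have b: "0 \<le> b" "b < ?n" "?n * (\<gamma> - 1) = - b" "?n - b = ?n * \<gamma>"
    using assms DIM_positive[where 'a='a] by (auto simp: b_def algebra_simps)
  obtain C where C: "0 < C" "\<And>R. 0 < R \<Longrightarrow>
    (\<integral>\<^sup>+z. (if norm (z :: 'a) < R then ennreal (norm z powr (- b)) else 0) \<partial>lborel) \<le> ennreal (C * R powr (?n - b))"
    by (rule nn_integral_norm_powr_ball[OF b(1,2)]) (rule that)
  define V where "V = unit_ball_vol ?n"
  have V: "0 < V" by (simp add: V_def)
  show thesis
  proof
    show "0 < (C + V) / \<zeta>" using C V assms by simp
    fix r :: real and y :: 'a assume r: "0 < r"
    have "(\<integral>\<^sup>+(t, x). (if 0 < t \<and> t + norm (x - y) < r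
        then ennreal (t powr (\<zeta> - 1) * norm x powr (?n * (\<gamma> - 1))) else 0) \<partial>lborel) =
      (\<integral>\<^sup>+t. \<integral>\<^sup>+x. (if 0 < t \<and> t + norm (x - y) < r
        then ennreal (t powr (\<zeta> - 1) * norm x powr (- b)) else 0) \<partial>lborel \<partial>lborel)"
      unfolding b(3) by (subst nn_integral_lborel_pair) (auto simp: borel_prod[symmetric])
    also have "\<dots> \<le> (\<integral>\<^sup>+t. (if 0 < t \<and> t < r then ennreal (t powr (\<zeta> - 1)) else 0) *
        (\<integral>\<^sup>+x. (if norm x < r then ennreal (norm x powr (- b)) else 0) +
          (if norm (x - y) < r then ennreal (r powr (- b)) else 0) \<partial>lborel) \<partial>lborel)"
    proof (rule nn_integral_mono, subst nn_integral_cmult[symmetric], measurable, rule nn_integral_mono)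
      fix t :: real and x :: 'a
      show "(if 0 < t \<and> t + norm (x - y) < r then ennreal (t powr (\<zeta> - 1) * norm x powr (- b)) else 0) \<le>
        (if 0 < t \<and> t < r then ennreal (t powr (\<zeta> - 1)) else 0) *
        ((if norm x < r then ennreal (norm x powr (- b)) else 0) +
          (if norm (x - y) < r then ennreal (r powr (- b)) else 0))"
      proof (cases "0 < t \<and> t + norm (x - y) < r")
        case True
        then have *: "0 < t" "t < r" "norm (x - y) < r" 
          using norm_ge_zero[of "x - y"] by linarith+
        have "ennreal (norm x powr (- b)) \<le> (if norm x < r then ennreal (norm x powr (- b)) else 0) + ennreal (r powr (- b))"
          using r b by (auto intro!: ennreal_leI powr_mono2')
        with * True show ?thesis by (simp add: ennreal_mult mult_left_mono)
      qed (auto simp: zero_le)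
    qed
    also have "\<dots> \<le> (\<integral>\<^sup>+t. (if 0 < t \<and> t < r then ennreal (t powr (\<zeta> - 1)) else 0) * ennreal ((C + V) * r powr (?n * \<gamma>)) \<partial>lborel)"
    proof (intro nn_integral_mono mult_left_mono)
      have "(\<integral>\<^sup>+x. (if norm x < r then ennreal (norm x powr (- b)) else 0) +
          (if norm (x - y) < r then ennreal (r powr (- b)) else 0) \<partial>lborel) \<le>
          ennreal (C * r powr (?n - b)) + ennreal (r powr (- b)) * ennreal (V * r powr ?n)"
        using r C(2)[OF r] by (subst nn_integral_add) (auto simp: nn_integral_ball_indicator V_def add_right_mono)
      also have "\<dots> = ennreal ((C + V) * r powr (?n * \<gamma>))"
      proof -
        have "r powr (- b) * r powr ?n = r powr (?n * \<gamma>)"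
          using b(4) by (simp add: powr_add[symmetric])
        then have "C * r powr (?n - b) + r powr (- b) * (V * r powr ?n) = (C + V) * r powr (?n * \<gamma>)"
          unfolding b(4) by (simp add: algebra_simps)
        then show ?thesis
          using C(1) V by (simp add: ennreal_mult[symmetric] flip: ennreal_plus)
      qed
      finally show "(\<integral>\<^sup>+x. (if norm x < r then ennreal (norm x powr (- b)) else 0) +
          (if norm (x - y) < r then ennreal (r powr (- b)) else 0) \<partial>lborel) \<le> ennreal ((C + V) * r powr (?n * \<gamma>))" .
    qed auto
    also have "\<dots> = ennreal ((C + V) / \<zeta> * r powr (\<zeta> + ?n * \<gamma>))"
    proof -
      have "r powr \<zeta> / \<zeta> * ((C + V) * r powr (?n * \<gamma>)) = (C + V) / \<zeta> * r powr (\<zeta> + ?n * \<gamma>)"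
        by (simp add: powr_add)
      then show ?thesis
        using r assms C(1) V by (subst nn_integral_multc)
          (simp_all add: nn_integral_powr_below ennreal_mult[symmetric])
    qed
    finally show "(\<integral>\<^sup>+(t, x). (if 0 < t \<and> t + norm (x - y) < r
        then ennreal (t powr (\<zeta> - 1) * norm x powr (?n * (\<gamma> - 1))) else 0) \<partial>lborel)
      \<le> ennreal ((C + V) / \<zeta> * r powr (\<zeta> + ?n * \<gamma>))" .
  qed
qed

text \<open>Let D = t + |w|. For |z| < D / 4 the majorant is evaluated where it has size D^(-n), and
  the Riesz kernel is integrated over a ball; elsewhere the Riesz kernel is at most (D / 4)^(\<beta>
  - n) and the mass of the majorant is bounded. Smoothing at height t thus only removes the
  singularity at distances below t.\<close>

lemma majorant_conv_riesz:
  assumes "0 < e" "0 < \<beta>" "\<beta> < real DIM('a::euclidean_space)"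
  obtains C where "0 < C" "\<And>t w. 0 < t \<Longrightarrow>
    (\<integral>\<^sup>+z. ennreal (majorant e t (w - z)) * ennreal (norm z powr (\<beta> - real DIM('a))) \<partial>lborel)
      \<le> ennreal (C * (t + norm (w :: 'a)) powr (\<beta> - real DIM('a)))"
proof -
  let ?n = "real DIM('a)"
  define K where "K = (?n + e) * unit_ball_vol ?n / e"
  have K: "0 < K" using assms by (auto simp: K_def intro!: divide_pos_pos mult_pos_pos add_pos_pos)
  obtain C where C: "0 < C" "\<And>R. 0 < R \<Longrightarrow>
    (\<integral>\<^sup>+z. (if norm (z :: 'a) < R then ennreal (norm z powr (- (?n - \<beta>))) else 0) \<partial>lborel) \<le> ennreal (C * R powr (?n - (?n - \<beta>)))"
    using nn_integral_norm_powr_ball[of "?n - \<beta>", where 'a='a] assms by auto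
  define c where "c = K * (1 / 4) powr (\<beta> - ?n) + 2 powr e * (1 / 2) powr (- ?n) * C * (1 / 4) powr \<beta>"
  show thesis
  proof
    show "0 < c" using K C by (simp add: c_def add_pos_nonneg)
    fix t :: real and w :: 'a assume t: "0 < t"
    define D where "D = t + norm w"
    have D: "0 < D" using t by (simp add: D_def add_pos_nonneg)
    have "(\<integral>\<^sup>+z. ennreal (majorant e t (w - z)) * ennreal (norm z powr (\<beta> - ?n)) \<partial>lborel) \<le>
      (\<integral>\<^sup>+z. ennreal ((D / 4) powr (\<beta> - ?n)) * ennreal (majorant e t (w - z)) +
        ennreal (2 powr e * (D / 2) powr (- ?n)) * (if norm z < D / 4 then ennreal (norm z powr (- (?n - \<beta>))) else 0) \<partial>lborel)"
    proof (rule nn_integral_mono)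
      fix z :: 'a
      show "ennreal (majorant e t (w - z)) * ennreal (norm z powr (\<beta> - ?n)) \<le>
        ennreal ((D / 4) powr (\<beta> - ?n)) * ennreal (majorant e t (w - z)) +
        ennreal (2 powr e * (D / 2) powr (- ?n)) * (if norm z < D / 4 then ennreal (norm z powr (- (?n - \<beta>))) else 0)"
      proof (cases "norm z < D / 4")
        case True
        have "norm w \<le> norm (w - z) + norm z"
          by norm
        \<comment> \<open>\<open>majorant_le\<close> with R = D / 2 and c = 2, since t \<le>
          D.\<close>
        then have "majorant e t (w - z) \<le> 2 powr e * (D / 2) powr (- ?n)"
          using t D assms True by (intro majorant_le) (auto simp: D_def)
        then show ?thesis
          using True by (auto intro!: add_increasing mult_right_mono ennreal_leI)
      next
        case False
        then have "norm z powr (\<beta> - ?n) \<le> (D / 4) powr (\<beta> - ?n)"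
          using D assms by (intro powr_mono2') auto
        then show ?thesis
          using False by (simp add: mult.commute mult_left_mono ennreal_leI)
      qed
    qed
    also have "\<dots> \<le> ennreal ((D / 4) powr (\<beta> - ?n)) * ennreal K +
        ennreal (2 powr e * (D / 2) powr (- ?n)) * ennreal (C * (D / 4) powr \<beta>)"
      using D C(2)[of "D / 4"] nn_integral_majorant_diff[OF assms(1) t, of w]
      by (subst nn_integral_add) (auto simp: nn_integral_cmult K_def intro!: add_mono mult_left_mono)
    also have "\<dots> = ennreal ((D / 4) powr (\<beta> - ?n) * K + 2 powr e * (D / 2) powr (- ?n) * (C * (D / 4) powr \<beta>))"
      using K C by (simp add: ennreal_mult)
    also have "(D / 4) powr (\<beta> - ?n) * K + 2 powr e * (D / 2) powr (- ?n) * (C * (D / 4) powr \<beta>) = c * D powr (\<beta> - ?n)"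
    proof -
      have 1: "(D / 4) powr s = (1 / 4) powr s * D powr s" "(D / 2) powr s = (1 / 2) powr s * D powr s" for s
        using powr_mult[of "1 / 4" D s] powr_mult[of "1 / 2" D s] D by (simp_all add: field_simps)
      have 2: "D powr (\<beta> - ?n) = D powr (- ?n) * D powr \<beta>"
        by (simp add: powr_add[symmetric])
      show ?thesis
        unfolding c_def 1 2 by (simp add: algebra_simps)
    qed
    finally show "(\<integral>\<^sup>+z. ennreal (majorant e t (w - z)) * ennreal (norm z powr (\<beta> - ?n)) \<partial>lborel)
      \<le> ennreal (c * (t + norm w) powr (\<beta> - ?n))"
      by (simp add: D_def)
  qed
qed

text \<open>Here D = t + |w| + r, and the radius decides. If r \<ge> D / 4, the normalised indicator
  is itself at most (D / 4)^(-n). Otherwise D - r - |z| > D / 2 on the ball, so there the majorant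
  is of size D^(-n).\<close>

lemma majorant_conv_ball:
  assumes "0 < e"
  obtains C where "0 < C" "\<And>t r w. 0 < t \<Longrightarrow> 0 < r \<Longrightarrow>
    (\<integral>\<^sup>+z. ennreal (majorant e t (w - z)) * (if norm z < r then ennreal (r powr (- real DIM('a))) else 0) \<partial>lborel)
      \<le> ennreal (C * (t + norm (w :: 'a::euclidean_space) + r) powr (- real DIM('a)))"
proof -
  let ?n = "real DIM('a)"
  define K where "K = (?n + e) * unit_ball_vol ?n / e"
  have K: "0 < K" using assms by (auto simp: K_def intro!: divide_pos_pos mult_pos_pos add_pos_pos)
  define V where "V = unit_ball_vol ?n"
  have V: "0 < V" by (simp add: V_def)
  define c where "c = K * (1 / 4) powr (- ?n) + 2 powr e * (1 / 2) powr (- ?n) * V"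
  show thesis
  proof
    show "0 < c" using K V by (simp add: c_def add_pos_nonneg)
    fix t r :: real and w :: 'a assume t: "0 < t" and r: "0 < r"
    define D where "D = t + norm w + r"
    have D: "0 < D" using t r by (simp add: D_def add_pos_nonneg)
    have "(\<integral>\<^sup>+z. ennreal (majorant e t (w - z)) * (if norm z < r then ennreal (r powr (- ?n)) else 0) \<partial>lborel) \<le>
      (\<integral>\<^sup>+z. ennreal ((D / 4) powr (- ?n)) * ennreal (majorant e t (w - z)) +
        ennreal (2 powr e * (D / 2) powr (- ?n)) * (if norm (z - 0) < r then ennreal (r powr (- ?n)) else 0) \<partial>lborel)"
    proof (rule nn_integral_mono)
      fix z :: 'a
      show "ennreal (majorant e t (w - z)) * (if norm z < r then ennreal (r powr (- ?n)) else 0) \<le>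
        ennreal ((D / 4) powr (- ?n)) * ennreal (majorant e t (w - z)) +
        ennreal (2 powr e * (D / 2) powr (- ?n)) * (if norm (z - 0) < r then ennreal (r powr (- ?n)) else 0)"
      proof (cases "norm z < r")
        case True
        show ?thesis
        proof (cases "r < D / 4")
          case True
          have "norm w \<le> norm (w - z) + norm z"
            by norm
          then have "majorant e t (w - z) \<le> 2 powr e * (D / 2) powr (- ?n)"
            using t r D assms True \<open>norm z < r\<close> by (intro majorant_le) (auto simp: D_def)
          then show ?thesis
            using \<open>norm z < r\<close> by (auto intro!: add_increasing mult_right_mono ennreal_leI)
        next
          case False
          then have "r powr (- ?n) \<le> (D / 4) powr (- ?n)"
            using D assms by (intro powr_mono2') auto
          then show ?thesis
            using \<open>norm z < r\<close> by (auto simp: mult.commute intro!: add_increasing2 mult_left_mono ennreal_leI)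
        qed
      qed auto
    qed
    also have "\<dots> \<le> ennreal ((D / 4) powr (- ?n)) * ennreal K +
        ennreal (2 powr e * (D / 2) powr (- ?n)) * (ennreal (r powr (- ?n)) * ennreal (V * r powr ?n))"
      using r nn_integral_majorant_diff[OF assms(1) t, of w]
      by (subst nn_integral_add) (auto simp: nn_integral_cmult nn_integral_ball_indicator[where 'a='a and y=0, simplified] K_def V_def intro!: add_mono mult_left_mono)
    also have "\<dots> = ennreal ((D / 4) powr (- ?n) * K + 2 powr e * (D / 2) powr (- ?n) * V)"
      using K V r by (simp add: ennreal_mult[symmetric] powr_minus flip: ennreal_plus)
    also have "(D / 4) powr (- ?n) * K + 2 powr e * (D / 2) powr (- ?n) * V = c * D powr (- ?n)"
    proof -
      have 1: "(D / 4) powr s = (1 / 4) powr s * D powr s" "(D / 2) powr s = (1 / 2) powr s * D powr s" for s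
        using powr_mult[of "1 / 4" D s] powr_mult[of "1 / 2" D s] D by (simp_all add: field_simps)
      show ?thesis
        unfolding c_def 1 by (simp add: algebra_simps)
    qed
    finally show "(\<integral>\<^sup>+z. ennreal (majorant e t (w - z)) * (if norm z < r then ennreal (r powr (- ?n)) else 0) \<partial>lborel)
      \<le> ennreal (c * (t + norm w + r) powr (- ?n))"
      by (simp add: D_def)
  qed
qed

section \<open>Potentials over cones\<close>

text \<open>Multiplied by n - \<beta> this is the convolution of g with the regularised Riesz kernel
  (t + |x|)^(\<beta> - n), whose power is unfolded into an integral over r. Keeping r as a variable
  lets a truncation of g depend on it, and (t, x) enters only through membership in a cone.\<close>

definition cone_potential :: "real \<Rightarrow> ('a::euclidean_space \<Rightarrow> real) \<Rightarrow> real \<times> 'a \<Rightarrow> ennreal" where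
  "cone_potential \<beta> g = (\<lambda>(t, x). \<integral>\<^sup>+(r, y). (if 0 < t \<and> t + norm (x - y) < r
     then ennreal (r powr (\<beta> - real DIM('a) - 1) * g y) else 0) \<partial>lborel)"

lemma borel_measurable_cone_potential [measurable]:
  fixes g :: "'a::euclidean_space \<Rightarrow> real"
  assumes [measurable]: "g \<in> borel_measurable borel"
  shows "cone_potential \<beta> g \<in> borel_measurable borel"
proof -
  have [measurable]: "g \<in> borel_measurable (borel :: 'a measure)" by fact
  show ?thesis
    unfolding cone_potential_def lborel_prod[symmetric] borel_prod[symmetric] by measurable
qed

text \<open>
  At \<open>\<rho> = \<beta>\<close> the last expression is \<open>a + \<beta> q - n > 0\<close>, so any \<open>\<rho>\<close> slightly below \<open>\<beta>\<close> works.
\<close>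

lemma exists_threshold_exponent:
  fixes a \<beta> n p q :: real
  assumes "0 < \<beta>" "1 < p" "p * \<beta> < n" "n - p * \<beta> < a" "q = p * a / (n - p * \<beta>)"
  obtains \<rho> where "0 < \<rho>" "\<rho> < \<beta>" "0 < a + \<beta> - n + \<rho> * ((n / p - \<beta>) * (q - 1) / (n / p - \<rho>))"
proof -
  define L where "L = n / p"
  have L: "\<beta> < L" using assms by (simp add: L_def field_simps)
  have "1 < a / (n - p * \<beta>)" using assms by simp
  then have qp: "p < q" using assms mult_strict_left_mono[of 1 "a / (n - p * \<beta>)" p] by simp
  have qe: "q * (L - \<beta>) = a"
    using assms by (simp add: L_def field_simps)
  have "a + \<beta> - n + \<beta> * ((L - \<beta>) * (q - 1) / (L - \<beta>)) = a + \<beta> * q - n"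
  proof -
    have "(L - \<beta>) * (q - 1) / (L - \<beta>) = q - 1"
      by (rule nonzero_mult_div_cancel_left) (use L in simp)
    then show ?thesis by (simp only:) (simp add: algebra_simps)
  qed
  also have "\<dots> = q * L - n" using qe by (simp add: algebra_simps)
  \<comment> \<open>The value is n (q / p - 1).\<close>
  also have "\<dots> > 0"
  proof -
    have "0 < n" using assms mult_pos_pos[of p \<beta>] by linarith
    then have "p * n < q * n" using qp by simp
    then show ?thesis using \<open>1 < p\<close> by (simp add: L_def field_simps)
  qed
  finally have pos: "0 < a + \<beta> - n + \<beta> * ((L - \<beta>) * (q - 1) / (L - \<beta>))" .
  have "((\<lambda>\<rho>. a + \<beta> - n + \<rho> * ((L - \<beta>) * (q - 1) / (L - \<rho>))) \<longlongrightarrow>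
      a + \<beta> - n + \<beta> * ((L - \<beta>) * (q - 1) / (L - \<beta>))) (at_left \<beta>)"
    by (intro tendsto_intros) (use L in auto)
  from order_tendstoD(1)[OF this pos]
  have "\<forall>\<^sub>F \<rho> in at_left \<beta>. 0 < a + \<beta> - n + \<rho> * ((L - \<beta>) * (q - 1) / (L - \<rho>))" .
  moreover have "\<forall>\<^sub>F \<rho> in at_left \<beta>. \<rho> \<in> {0<..<\<beta>}"
    by (rule eventually_at_left_real) (use assms in auto)
  ultimately have "\<forall>\<^sub>F \<rho> in at_left \<beta>. 0 < \<rho> \<and> \<rho> < \<beta> \<and> 0 < a + \<beta> - n + \<rho> * ((L - \<beta>) * (q - 1) / (L - \<rho>))"
    by eventually_elim auto
  then obtain \<rho> where "0 < \<rho>" "\<rho> < \<beta>" "0 < a + \<beta> - n + \<rho> * ((L - \<beta>) * (q - 1) / (L - \<rho>))"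
    using eventually_happens'[OF trivial_limit_at_left_real] by blast
  then show thesis using that by (simp add: L_def)
qed

text \<open>For g > c write g = g^p g^(1 - p). The level c is free, so it may depend on the radius
  or on the very value that is being bounded.\<close>

lemma le_powr_add_powr:
  fixes g c p :: real
  assumes "0 \<le> g" "0 < c" "1 < p"
  shows "g \<le> c + g powr p * c powr (1 - p)"
proof (cases "g \<le> c")
  case True
  have "0 \<le> g powr p * c powr (1 - p)" by simp
  with True show ?thesis by linarith
next
  case False
  then have "g powr (1 - p) \<le> c powr (1 - p)"
    using assms by (intro powr_mono2') auto
  then have "g powr p * g powr (1 - p) \<le> g powr p * c powr (1 - p)"
    by (intro mult_left_mono) auto
  also have "g powr p * g powr (1 - p) = g"
    using False assms by (simp add: powr_add[symmetric])
  finally show ?thesis using assms by simp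
qed

text \<open>
  The first term bounds the part \<open>r \<ge> R\<close>, using \<open>g \<le> \<lambda> + g\<^sup>p \<lambda>\<^sup>1\<^sup>-\<^sup>p\<close> with \<open>\<lambda> = r\<^sup>-\<^sup>n\<^sup>/\<^sup>p\<close>, and the part where \<open>g\<close> is below the
  threshold \<open>R\<^sup>\<rho>\<^sup>-\<^sup>n\<^sup>/\<^sup>p r\<^sup>-\<^sup>\<rho>\<close>.
\<close>

lemma cone_potential_split:
  fixes g :: "'a::euclidean_space \<Rightarrow> real"
  assumes [measurable]: "g \<in> borel_measurable borel" and g0: "\<And>y. 0 \<le> g y"
    and p: "1 < p" and gp: "(\<integral>\<^sup>+y. ennreal (g y powr p) \<partial>lborel) \<le> 1"
    and \<rho>: "\<rho> < \<beta>" and \<eta>: "\<eta> = real DIM('a) / p - \<beta>" "0 < \<eta>" and R: "0 < R" and t: "0 < t"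
  shows "cone_potential \<beta> g (t, x) \<le>
    ennreal (((unit_ball_vol (real DIM('a)) + 1) / \<eta> + unit_ball_vol (real DIM('a)) / (\<beta> - \<rho>)) * R powr (- \<eta>)) +
    (\<integral>\<^sup>+(r, y). (if t + norm (x - y) < r \<and> r < R \<and> R powr (\<rho> - real DIM('a) / p) * r powr (- \<rho>) < g y
       then ennreal (r powr (\<beta> - real DIM('a) - 1) * g y) else 0) \<partial>lborel)"
proof -
  let ?n = "real DIM('a)"
  define V where "V = unit_ball_vol ?n"
  have V: "0 < V" by (simp add: V_def)
  let ?F = "\<lambda>r y. (if t + norm (x - y) < r \<and> r < R \<and> R powr (\<rho> - ?n / p) * r powr (- \<rho>) < g y
       then ennreal (r powr (\<beta> - ?n - 1) * g y) else 0)"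
  have "cone_potential \<beta> g (t, x) = (\<integral>\<^sup>+r. \<integral>\<^sup>+y. (if t + norm (x - y) < r
     then ennreal (r powr (\<beta> - ?n - 1) * g y) else 0) \<partial>lborel \<partial>lborel)"
    using t unfolding cone_potential_def
    by (subst nn_integral_lborel_pair) (auto simp: borel_prod[symmetric])
  also have "\<dots> \<le> (\<integral>\<^sup>+r. ennreal (V + 1) * (if R < r then ennreal (r powr (- \<eta> - 1)) else 0)
       + ennreal (V * R powr (\<rho> - ?n / p)) * (if 0 < r \<and> r < R then ennreal (r powr (\<beta> - \<rho> - 1)) else 0)
       + (\<integral>\<^sup>+y. ?F r y \<partial>lborel) \<partial>lborel)"
  proof (rule nn_integral_mono_AE)
    show "AE r in lborel. (\<integral>\<^sup>+y. (if t + norm (x - y) < r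
     then ennreal (r powr (\<beta> - ?n - 1) * g y) else 0) \<partial>lborel) \<le>
      ennreal (V + 1) * (if R < r then ennreal (r powr (- \<eta> - 1)) else 0)
       + ennreal (V * R powr (\<rho> - ?n / p)) * (if 0 < r \<and> r < R then ennreal (r powr (\<beta> - \<rho> - 1)) else 0)
       + (\<integral>\<^sup>+y. ?F r y \<partial>lborel)"
      using AE_lborel_singleton[of R]
    proof eventually_elim
      case (elim r)
      have pos: "0 < r" "norm (x - y) < r" if "t + norm (x - y) < r" for y
        using that t norm_ge_zero[of "x - y"] by linarith+
      consider "r \<le> 0" | "0 < r" "r < R" | "R < r" using elim by linarith
      then show ?case
      proof cases
        case 1
        have "(\<integral>\<^sup>+y. (if t + norm (x - y) < r then ennreal (r powr (\<beta> - ?n - 1) * g y) else 0) \<partial>lborel) = (\<integral>\<^sup>+y. 0 \<partial>(lborel :: 'a measure))"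
          using pos 1 by (intro nn_integral_cong) (auto simp: not_le[symmetric])
        then show ?thesis by simp
      next
        case 2
        have "(\<integral>\<^sup>+y. (if t + norm (x - y) < r then ennreal (r powr (\<beta> - ?n - 1) * g y) else 0) \<partial>lborel) \<le>
          (\<integral>\<^sup>+y. (if norm (x - y) < r then ennreal (r powr (\<beta> - ?n - 1) * (R powr (\<rho> - ?n / p) * r powr (- \<rho>))) else 0) + ?F r y \<partial>lborel)"
          using 2 pos by (intro nn_integral_mono) (auto intro!: ennreal_leI mult_left_mono simp: not_less)
        also have "\<dots> = ennreal (r powr (\<beta> - ?n - 1) * (R powr (\<rho> - ?n / p) * r powr (- \<rho>))) * ennreal (V * r powr ?n) + (\<integral>\<^sup>+y. ?F r y \<partial>lborel)"
          using 2 by (subst nn_integral_add) (auto simp: nn_integral_ball_indicator V_def)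
        also have "ennreal (r powr (\<beta> - ?n - 1) * (R powr (\<rho> - ?n / p) * r powr (- \<rho>))) * ennreal (V * r powr ?n) =
          ennreal (V * R powr (\<rho> - ?n / p)) * ennreal (r powr (\<beta> - \<rho> - 1))"
        proof -
          have "r powr (\<beta> - ?n - 1) * r powr (- \<rho>) * r powr ?n = r powr (\<beta> - \<rho> - 1)"
            by (simp add: powr_add[symmetric] algebra_simps)
          then show ?thesis
            using V by (simp add: ennreal_mult[symmetric] mult_ac)
        qed
        finally show ?thesis using 2 by simp
      next
        case 3
        then have r: "0 < r" using R by simp
        have "(\<integral>\<^sup>+y. (if t + norm (x - y) < r then ennreal (r powr (\<beta> - ?n - 1) * g y) else 0) \<partial>lborel) \<le>
          (\<integral>\<^sup>+y. (if norm (x - y) < r then ennreal (r powr (\<beta> - ?n - 1) * r powr (- ?n / p)) else 0) +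
             ennreal (r powr (\<beta> - ?n - 1) * r powr (?n / p * (p - 1))) * ennreal (g y powr p) \<partial>lborel)"
        proof (rule nn_integral_mono)
          fix y
          have "g y \<le> r powr (- ?n / p) + g y powr p * (r powr (- ?n / p)) powr (1 - p)"
            using p r g0 by (intro le_powr_add_powr) auto
          also have "(r powr (- ?n / p)) powr (1 - p) = r powr (?n / p * (p - 1))"
            using r p by (simp add: powr_powr algebra_simps diff_divide_distrib)
          finally have "r powr (\<beta> - ?n - 1) * g y \<le> r powr (\<beta> - ?n - 1) * (r powr (- ?n / p) + g y powr p * r powr (?n / p * (p - 1)))"
            by (intro mult_left_mono) auto
          also have "\<dots> = r powr (\<beta> - ?n - 1) * r powr (- ?n / p) + r powr (\<beta> - ?n - 1) * r powr (?n / p * (p - 1)) * g y powr p"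
            by (simp add: algebra_simps)
          finally show "(if t + norm (x - y) < r then ennreal (r powr (\<beta> - ?n - 1) * g y) else 0) \<le>
            (if norm (x - y) < r then ennreal (r powr (\<beta> - ?n - 1) * r powr (- ?n / p)) else 0) +
             ennreal (r powr (\<beta> - ?n - 1) * r powr (?n / p * (p - 1))) * ennreal (g y powr p)"
            using pos by (auto simp: ennreal_mult[symmetric] ennreal_leI simp flip: ennreal_plus)
        qed
        also have "\<dots> = ennreal (r powr (\<beta> - ?n - 1) * r powr (- ?n / p)) * ennreal (V * r powr ?n) +
            ennreal (r powr (\<beta> - ?n - 1) * r powr (?n / p * (p - 1))) * (\<integral>\<^sup>+y. ennreal (g y powr p) \<partial>lborel)"
          using r by (subst nn_integral_add) (auto simp: nn_integral_ball_indicator V_def nn_integral_cmult)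
        also have "\<dots> \<le> ennreal (r powr (\<beta> - ?n - 1) * r powr (- ?n / p)) * ennreal (V * r powr ?n) +
            ennreal (r powr (\<beta> - ?n - 1) * r powr (?n / p * (p - 1))) * 1"
          using gp by (intro add_left_mono mult_left_mono) auto
        also have "\<dots> = ennreal (V + 1) * ennreal (r powr (- \<eta> - 1))"
        proof -
          have 1: "r powr (\<beta> - ?n - 1) * r powr (- ?n / p) * r powr ?n = r powr (- \<eta> - 1)"
            using p by (simp add: powr_add[symmetric] \<eta> algebra_simps)
          have 2: "r powr (\<beta> - ?n - 1) * r powr (?n / p * (p - 1)) = r powr (- \<eta> - 1)"
            using p by (simp add: powr_add[symmetric] \<eta> field_simps)
          have "r powr (\<beta> - ?n - 1) * r powr (- ?n / p) * (V * r powr ?n) + r powr (\<beta> - ?n - 1) * r powr (?n / p * (p - 1)) = (V + 1) * r powr (- \<eta> - 1)"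
            unfolding 2 using 1 by (simp add: algebra_simps)
          then show ?thesis
            using V by (subst (1 2) ennreal_mult[symmetric]) (auto simp flip: ennreal_plus)
        qed
        finally show ?thesis using 3 by (simp add: add_increasing2)
      qed
    qed
  qed
  also have "\<dots> = ennreal (V + 1) * ennreal (R powr (- \<eta>) / \<eta>) + ennreal (V * R powr (\<rho> - ?n / p)) * ennreal (R powr (\<beta> - \<rho>) / (\<beta> - \<rho>))
      + (\<integral>\<^sup>+r. \<integral>\<^sup>+y. ?F r y \<partial>lborel \<partial>lborel)"
    using \<rho> \<eta>(2) R by (simp add: nn_integral_add nn_integral_cmult nn_integral_powr_above nn_integral_powr_below)
  also have "ennreal (V + 1) * ennreal (R powr (- \<eta>) / \<eta>) + ennreal (V * R powr (\<rho> - ?n / p)) * ennreal (R powr (\<beta> - \<rho>) / (\<beta> - \<rho>)) =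
    ennreal (((V + 1) / \<eta> + V / (\<beta> - \<rho>)) * R powr (- \<eta>))"
  proof -
    have "R powr (\<rho> - ?n / p) * R powr (\<beta> - \<rho>) = R powr (- \<eta>)"
      by (simp add: powr_add[symmetric] \<eta>)
    then have "(V + 1) * (R powr (- \<eta>) / \<eta>) + V * R powr (\<rho> - ?n / p) * (R powr (\<beta> - \<rho>) / (\<beta> - \<rho>)) = ((V + 1) / \<eta> + V / (\<beta> - \<rho>)) * R powr (- \<eta>)"
      by (simp add: algebra_simps)
    then show ?thesis
      using V \<rho> \<eta>(2) by (subst (1 2) ennreal_mult[symmetric]) (auto simp flip: ennreal_plus)
  qed
  also have "(\<integral>\<^sup>+r. \<integral>\<^sup>+y. ?F r y \<partial>lborel \<partial>lborel) = (\<integral>\<^sup>+(r, y). ?F r y \<partial>lborel)"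
    by (subst nn_integral_lborel_pair) (auto simp: borel_prod[symmetric])
  finally show ?thesis by (simp add: V_def)
qed

text \<open>Absorption: x is a finite real, so half of it can be subtracted.\<close>

lemma ennreal_half_le:
  assumes "ennreal x \<le> ennreal (x / 2) + y" "0 \<le> x"
  shows "ennreal (x / 2) \<le> y"
proof (cases y)
  case (real r)
  then have "ennreal x \<le> ennreal (x / 2 + r)" using assms by simp
  then have "x \<le> x / 2 + r" using real assms by (subst (asm) ennreal_le_iff) auto
  then show ?thesis using real by (auto intro: ennreal_leI)
qed simp

text \<open>Absorption needs finite values, so a potential S is bounded through the real levels x
  below it. If S is infinite the levels are unbounded, which forces B = top.\<close>

lemma ennpowr_le_of_real_bounds:
  assumes q: "0 < q" and le: "\<And>x. 0 < x \<Longrightarrow> ennreal x \<le> S \<Longrightarrow> ennreal (x powr q) \<le> B"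
  shows "ennpowr S q \<le> B"
proof (cases S)
  case (real s)
  then show ?thesis using le[of s] q by (cases "s = 0") (auto simp: ennpowr_ennreal)
next
  case top
  have "B = top"
  proof (rule ccontr)
    assume "B \<noteq> top"
    then obtain m where m: "B = ennreal m" "0 \<le> m" by (cases B) auto
    have "ennreal (((m + 1) powr (1 / q)) powr q) \<le> B"
      using m top by (intro le) auto
    then show False using m q by (simp add: powr_powr)
  qed
  then show ?thesis by simp
qed

text \<open>
  To bound a level \<open>z\<close> below the potential, split at the radius \<open>R\<close> that makes the first term equal to \<open>z / 2\<close>.
\<close>

lemma cone_potential_powr_le:
  fixes g :: "'a::euclidean_space \<Rightarrow> real"
  assumes [measurable]: "g \<in> borel_measurable borel" and g0: "\<And>y. 0 \<le> g y"
    and p: "1 < p" and gp: "(\<integral>\<^sup>+y. ennreal (g y powr p) \<partial>lborel) \<le> 1"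
    and \<rho>: "\<rho> < \<beta>" and \<eta>: "\<eta> = real DIM('a) / p - \<beta>" "0 < \<eta>" and t: "0 < t" and q: "1 < q"
    and \<theta>: "\<theta> = \<eta> * (q - 1) / (real DIM('a) / p - \<rho>)"
    and c: "c = (unit_ball_vol (real DIM('a)) + 1) / \<eta> + unit_ball_vol (real DIM('a)) / (\<beta> - \<rho>)"
  shows "ennpowr (cone_potential \<beta> g (t, x)) q \<le> ennreal (2 * (2 * c) powr (q - 1)) *
    (\<integral>\<^sup>+(r, y). (if t + norm (x - y) < r
       then ennreal (r powr (\<beta> - real DIM('a) - 1) * (g y * min (r powr (- \<eta> * (q - 1))) ((g y * r powr \<rho>) powr \<theta>))) else 0) \<partial>lborel)"
proof (rule ennpowr_le_of_real_bounds)
  let ?n = "real DIM('a)"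
  have c0: "0 < c"
    using \<rho> \<eta> by (auto simp: c intro!: add_pos_nonneg divide_pos_pos add_nonneg_pos)
  have L: "0 < ?n / p - \<rho>" using \<rho> \<eta> by linarith
  fix z assume z: "0 < z" "ennreal z \<le> cone_potential \<beta> g (t, x)"
  define R where "R = (z / (2 * c)) powr (- 1 / \<eta>)"
  have R: "0 < R" using z c0 by (simp add: R_def)
  have R\<eta>: "R powr (- \<eta>) = z / (2 * c)"
    using z c0 \<eta>(2) by (simp add: R_def powr_powr)
  let ?P = "\<lambda>r y. t + norm (x - y) < r \<and> r < R \<and> R powr (\<rho> - ?n / p) * r powr (- \<rho>) < g y"
  let ?I = "\<integral>\<^sup>+(r, y). (if ?P r y then ennreal (r powr (\<beta> - ?n - 1) * g y) else 0) \<partial>lborel"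
  have "ennreal z \<le> ennreal (c * R powr (- \<eta>)) + ?I"
    using z(2) cone_potential_split[OF assms(1) g0 p gp \<rho> \<eta> R t, of x] unfolding c by (rule order_trans)
  also have "c * R powr (- \<eta>) = z / 2"
    using c0 by (simp add: R\<eta>)
  finally have half: "ennreal (z / 2) \<le> ?I"
    using z by (intro ennreal_half_le) auto
  \<comment> \<open>One factor z / 2 is estimated by the integral; the other q - 1 powers of z are
    expressed through R and moved under it.\<close>
  have zq: "z powr q = 2 * z powr (q - 1) * (z / 2)"
    using z by (simp add: powr_diff)
  have zq1: "z powr (q - 1) = (2 * c) powr (q - 1) * R powr (- \<eta> * (q - 1))"
  proof -
    have "z = 2 * c * R powr (- \<eta>)" using c0 by (simp add: R\<eta>)
    then have "z powr (q - 1) = (2 * c * R powr (- \<eta>)) powr (q - 1)" by simp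
    also have "\<dots> = (2 * c) powr (q - 1) * R powr (- \<eta> * (q - 1))"
      using c0 by (simp add: powr_mult powr_powr)
    finally show ?thesis .
  qed
  have "ennreal (z powr q) = ennreal (2 * z powr (q - 1)) * ennreal (z / 2)"
    using z zq by (simp add: ennreal_mult[symmetric])
  also have "\<dots> \<le> ennreal (2 * z powr (q - 1)) * ?I"
    using half by (intro mult_left_mono) auto
  also have "\<dots> = ennreal (2 * (2 * c) powr (q - 1)) * (ennreal (R powr (- \<eta> * (q - 1))) * ?I)"
    using c0 by (simp add: zq1 ennreal_mult mult_ac)
  also have "ennreal (R powr (- \<eta> * (q - 1))) * ?I = (\<integral>\<^sup>+u. ennreal (R powr (- \<eta> * (q - 1))) *
      (case u of (r, y) \<Rightarrow> if ?P r y then ennreal (r powr (\<beta> - ?n - 1) * g y) else 0) \<partial>lborel)"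
    by (rule nn_integral_cmult[symmetric]) (auto simp: borel_prod[symmetric])
  \<comment> \<open>R depends on the level z and has to disappear. From r < R follows R^(-\<eta> (q
    - 1)) \<le> r^(-\<eta> (q - 1)). The threshold gives R^(\<rho> - n/p) \<le> g r^\<rho>, and
    \<theta> is the exponent that turns the left side of this into the same power of R.\<close>
  also have "\<dots> \<le> (\<integral>\<^sup>+(r, y). (if t + norm (x - y) < r
       then ennreal (r powr (\<beta> - ?n - 1) * (g y * min (r powr (- \<eta> * (q - 1))) ((g y * r powr \<rho>) powr \<theta>))) else 0) \<partial>lborel)"
  proof (rule nn_integral_mono, clarsimp)
    fix r y
    assume P: "t + norm (x - y) < r" "r < R" "R powr (\<rho> - ?n / p) * r powr (- \<rho>) < g y"
    have r: "0 < r" using P(1) t norm_ge_zero[of "x - y"] by linarith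
    have 1: "R powr (- \<eta> * (q - 1)) \<le> r powr (- \<eta> * (q - 1))"
      using P r q \<eta>(2) by (intro powr_mono2') (auto simp: mult_nonneg_nonpos)
    have "R powr (\<rho> - ?n / p) * r powr (- \<rho>) * r powr \<rho> \<le> g y * r powr \<rho>"
      using P by (intro mult_right_mono) auto
    then have "R powr (\<rho> - ?n / p) \<le> g y * r powr \<rho>"
      using r by (simp add: mult.assoc powr_add[symmetric])
    then have "(R powr (\<rho> - ?n / p)) powr \<theta> \<le> (g y * r powr \<rho>) powr \<theta>"
      using L q \<eta>(2) by (intro powr_mono2) (auto simp: \<theta>)
    also have "(R powr (\<rho> - ?n / p)) powr \<theta> = R powr (- \<eta> * (q - 1))"
    proof -
      have "(?n / p - \<rho>) * \<theta> = \<eta> * (q - 1)"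
        using L by (simp add: \<theta>)
      then have "(\<rho> - ?n / p) * \<theta> = - \<eta> * (q - 1)"
        by (simp add: algebra_simps)
      then show ?thesis by (simp add: powr_powr)
    qed
    finally have 2: "R powr (- \<eta> * (q - 1)) \<le> (g y * r powr \<rho>) powr \<theta>" .
    have "R powr (- \<eta> * (q - 1)) * (r powr (\<beta> - ?n - 1) * g y) \<le>
       r powr (\<beta> - ?n - 1) * (g y * min (r powr (- \<eta> * (q - 1))) ((g y * r powr \<rho>) powr \<theta>))"
    proof -
      have "R powr (- \<eta> * (q - 1)) * (r powr (\<beta> - ?n - 1) * g y) = r powr (\<beta> - ?n - 1) * (g y * R powr (- \<eta> * (q - 1)))"
        by simp
      also have "\<dots> \<le> r powr (\<beta> - ?n - 1) * (g y * min (r powr (- \<eta> * (q - 1))) ((g y * r powr \<rho>) powr \<theta>))"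
        using 1 2 g0 by (intro mult_left_mono) auto
      finally show ?thesis .
    qed
    then show "ennreal (R powr (- (\<eta> * (q - 1)))) * ennreal (r powr (\<beta> - ?n - 1) * g y) \<le>
       ennreal (r powr (\<beta> - ?n - 1) * (g y * min (r powr (- (\<eta> * (q - 1)))) ((g y * r powr \<rho>) powr \<theta>)))"
      using g0 by (subst ennreal_mult[symmetric]) (auto intro!: ennreal_leI)
  qed
  finally show "ennreal (z powr q) \<le> ennreal (2 * (2 * c) powr (q - 1)) *
    (\<integral>\<^sup>+(r, y). (if t + norm (x - y) < r
       then ennreal (r powr (\<beta> - ?n - 1) * (g y * min (r powr (- \<eta> * (q - 1))) ((g y * r powr \<rho>) powr \<theta>))) else 0) \<partial>lborel)"
    by (simp add: mult_left_mono)
qed (use q in simp)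

text \<open>The second entry of the minimum makes the integral converge at 0, where the exponent of
  r becomes \<kappa> - 1; the first one does so at infinity, where it becomes -(n - n/p) - 1 and p >
  1 enters. Both pieces turn out to be multiples of G^p.\<close>

lemma nn_integral_min_powr:
  fixes a \<beta> n p q \<rho> \<eta> \<theta> \<kappa> G :: real
  assumes p: "1 < p" and n: "0 < n" and \<eta>: "\<eta> = n / p - \<beta>" "0 < \<eta>" and a: "a = q * \<eta>"
    and \<rho>: "\<rho> < \<beta>" and \<theta>: "\<theta> = \<eta> * (q - 1) / (n / p - \<rho>)"
    and \<kappa>: "\<kappa> = a + \<beta> - n + \<rho> * \<theta>" "0 < \<kappa>" and G: "0 \<le> G"
  shows "(\<integral>\<^sup>+r. (if 0 < r then ennreal (r powr a * (r powr (\<beta> - n - 1) *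
      (G * min (r powr (- \<eta> * (q - 1))) ((G * r powr \<rho>) powr \<theta>)))) else 0) \<partial>lborel)
    \<le> ennreal ((1 / \<kappa> + 1 / (n - n / p)) * G powr p)"
proof (cases "G = 0")
  case False
  with G have G: "0 < G" by simp
  \<comment> \<open>The radius at which the two entries of the minimum agree.\<close>
  define r0 where "r0 = G powr (- p / n)"
  have r0: "0 < r0" using G by (simp add: r0_def)
  have np: "0 < n - n / p" using p n by (simp add: field_simps)
  have L: "0 < n / p - \<rho>" using \<rho> \<eta> by linarith
  have \<theta>L: "(n / p - \<rho>) * \<theta> = \<eta> * (q - 1)"
    using L by (simp add: \<theta>)
  have "(\<integral>\<^sup>+r. (if 0 < r then ennreal (r powr a * (r powr (\<beta> - n - 1) *
      (G * min (r powr (- \<eta> * (q - 1))) ((G * r powr \<rho>) powr \<theta>)))) else 0) \<partial>lborel) \<le>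
    (\<integral>\<^sup>+r. ennreal (G powr (1 + \<theta>)) * (if 0 < r \<and> r < r0 then ennreal (r powr (\<kappa> - 1)) else 0) +
       ennreal G * (if r0 < r then ennreal (r powr (- (n - n / p) - 1)) else 0) \<partial>lborel)"
  proof (rule nn_integral_mono_AE)
    show "AE r in lborel. (if 0 < r then ennreal (r powr a * (r powr (\<beta> - n - 1) *
      (G * min (r powr (- \<eta> * (q - 1))) ((G * r powr \<rho>) powr \<theta>)))) else 0) \<le>
      ennreal (G powr (1 + \<theta>)) * (if 0 < r \<and> r < r0 then ennreal (r powr (\<kappa> - 1)) else 0) +
       ennreal G * (if r0 < r then ennreal (r powr (- (n - n / p) - 1)) else 0)"
      using AE_lborel_singleton[of r0]
    proof eventually_elim
      case (elim r)
      consider "r \<le> 0" | "0 < r" "r < r0" | "r0 < r" using elim by linarith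
      then show ?case
      proof cases
        case 2
        have "r powr a * (r powr (\<beta> - n - 1) * (G * min (r powr (- \<eta> * (q - 1))) ((G * r powr \<rho>) powr \<theta>))) \<le>
          r powr a * (r powr (\<beta> - n - 1) * (G * ((G * r powr \<rho>) powr \<theta>)))"
          using G by (intro mult_left_mono) auto
        also have "\<dots> = (G powr 1 * G powr \<theta>) * (r powr a * r powr (\<beta> - n - 1) * r powr (\<rho> * \<theta>))"
          using G by (simp add: powr_mult powr_powr)
        also have "\<dots> = G powr (1 + \<theta>) * r powr (\<kappa> - 1)"
          unfolding powr_add[symmetric] by (simp add: \<kappa> algebra_simps)
        finally show ?thesis using 2 by (simp add: ennreal_mult[symmetric] ennreal_leI)
      next
        case 3
        then have r: "0 < r" using r0 by simp
        have "r powr a * (r powr (\<beta> - n - 1) * (G * min (r powr (- \<eta> * (q - 1))) ((G * r powr \<rho>) powr \<theta>))) \<le>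
          r powr a * (r powr (\<beta> - n - 1) * (G * r powr (- \<eta> * (q - 1))))"
          using G by (intro mult_left_mono) auto
        also have "\<dots> = G * (r powr a * r powr (\<beta> - n - 1) * r powr (- \<eta> * (q - 1)))"
          by simp
        also have "r powr a * r powr (\<beta> - n - 1) * r powr (- \<eta> * (q - 1)) = r powr (- (n - n / p) - 1)"
          unfolding powr_add[symmetric] by (rule arg_cong2[where f="(powr)"]) (simp_all add: a \<eta> algebra_simps diff_divide_distrib)
        finally show ?thesis using 3 r G by (simp add: ennreal_mult[symmetric] ennreal_leI)
      qed simp
    qed
  qed
  also have "\<dots> = ennreal (G powr (1 + \<theta>)) * ennreal (r0 powr \<kappa> / \<kappa>) + ennreal G * ennreal (r0 powr (- (n - n / p)) / (n - n / p))"
    using r0 \<kappa>(2) np nn_integral_powr_above[OF np r0] 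
    by (simp add: nn_integral_add nn_integral_cmult nn_integral_powr_below)
  also have "\<dots> = ennreal ((1 / \<kappa> + 1 / (n - n / p)) * G powr p)"
  proof -
    have "r0 powr \<kappa> = G powr (p - (1 + \<theta>))"
    proof -
      have "\<theta> * n = p * ((n / p - \<rho>) * \<theta>) + p * \<rho> * \<theta>" using p by (simp add: algebra_simps)
      also have "\<dots> = p * \<eta> * (q - 1) + p * \<rho> * \<theta>" by (simp add: \<theta>L)
      finally have "- p * \<kappa> = n * (p - (1 + \<theta>))"
        using p by (simp add: \<kappa> a \<eta> algebra_simps)
      then have "- p / n * \<kappa> = p - (1 + \<theta>)" using n by (simp add: field_simps)
      then show ?thesis by (simp add: r0_def powr_powr)
    qed
    then have 1: "G powr (1 + \<theta>) * r0 powr \<kappa> = G powr p"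
      by (simp add: powr_add[symmetric])
    have "- p / n * (- (n - n / p)) = p - 1"
      using n p by (simp add: field_simps)
    then have "r0 powr (- (n - n / p)) = G powr (p - 1)"
      unfolding r0_def powr_powr by simp
    then have 2: "G * r0 powr (- (n - n / p)) = G powr p"
      using G by (simp add: powr_diff)
    have "G powr (1 + \<theta>) * (r0 powr \<kappa> / \<kappa>) + G * (r0 powr (- (n - n / p)) / (n - n / p)) = (1 / \<kappa> + 1 / (n - n / p)) * G powr p"
      using 1 2 by (simp add: algebra_simps)
    then show ?thesis
      using G \<kappa>(2) np by (subst (1 2) ennreal_mult[symmetric]) (auto simp flip: ennreal_plus)
  qed
  finally show ?thesis .
qed (simp cong: if_cong)

text \<open>The pointwise bound of \<open>cone_potential_powr_le\<close> is integrated against w and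
  the order exchanged. The points (t, x) whose cone contains (r, y) have weight at most A r^a, and
  the integral in r then leaves g(y)^p by \<open>nn_integral_min_powr\<close>. The truncation levels
  are not homogeneous in g, hence the normalisation.\<close>

lemma cone_potential_strong_type_normalized:
  fixes w :: "real \<times> 'a::euclidean_space \<Rightarrow> ennreal"
  assumes [measurable]: "w \<in> borel_measurable borel"
    and w: "\<And>r (y :: 'a). 0 < r \<Longrightarrow>
      (\<integral>\<^sup>+(t, x). (if 0 < t \<and> t + norm (x - y) < r then w (t, x) else 0) \<partial>lborel) \<le> ennreal (A * r powr a)"
    and A: "0 < A" and \<beta>: "0 < \<beta>" and p: "1 < p" "p * \<beta> < real DIM('a)" and a: "real DIM('a) - p * \<beta> < a"
    and q: "q = p * a / (real DIM('a) - p * \<beta>)"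
  obtains C where "0 < C" "\<And>g. g \<in> borel_measurable borel \<Longrightarrow> (\<And>y. 0 \<le> g y) \<Longrightarrow>
    (\<integral>\<^sup>+y. ennreal (g y powr p) \<partial>lborel) \<le> 1 \<Longrightarrow>
    (\<integral>\<^sup>+z. w z * ennpowr (cone_potential \<beta> g z) q \<partial>lborel) \<le> ennreal C"
proof -
  let ?n = "real DIM('a)"
  obtain \<rho> where \<rho>: "0 < \<rho>" "\<rho> < \<beta>" and \<kappa>: "0 < a + \<beta> - ?n + \<rho> * ((?n / p - \<beta>) * (q - 1) / (?n / p - \<rho>))"
    using exists_threshold_exponent[OF \<beta> p a q] by metis
  define \<eta> where "\<eta> = ?n / p - \<beta>"
  have \<eta>: "0 < \<eta>" using p by (simp add: \<eta>_def field_simps)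
  define \<theta> where "\<theta> = \<eta> * (q - 1) / (?n / p - \<rho>)"
  define \<kappa> where "\<kappa> = a + \<beta> - ?n + \<rho> * \<theta>"
  have \<kappa>0: "0 < \<kappa>" using \<kappa> by (simp add: \<kappa>_def \<theta>_def \<eta>_def)
  have q1: "1 < q"
  proof -
    have "1 < a / (?n - p * \<beta>)" using a p by simp
    then have "p < q" using p mult_strict_left_mono[of 1 "a / (?n - p * \<beta>)" p] by (simp add: q)
    then show ?thesis using p by simp
  qed
  have aq: "a = q * \<eta>" using p by (simp add: q \<eta>_def field_simps)
  have np: "0 < ?n - ?n / p" using p by (simp add: field_simps)
  define c where "c = (unit_ball_vol ?n + 1) / \<eta> + unit_ball_vol ?n / (\<beta> - \<rho>)"
  have c: "0 < c" using \<rho> \<eta> by (auto simp: c_def intro!: add_pos_nonneg divide_pos_pos add_nonneg_pos)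
  define C2 where "C2 = 2 * (2 * c) powr (q - 1)"
  have C2: "0 < C2" using c by (simp add: C2_def)
  define C3 where "C3 = 1 / \<kappa> + 1 / (?n - ?n / p)"
  have C3: "0 < C3" using \<kappa>0 np by (simp add: C3_def add_pos_pos)
  show thesis
  proof
    show "0 < C2 * (A * C3)" using C2 A C3 by simp
    fix g :: "'a \<Rightarrow> real"
    assume g[measurable]: "g \<in> borel_measurable borel" and g0: "\<And>y. 0 \<le> g y"
      and gp: "(\<integral>\<^sup>+y. ennreal (g y powr p) \<partial>lborel) \<le> 1"
    define F where "F = (\<lambda>(r, y). r powr (\<beta> - ?n - 1) * (g y * min (r powr (- \<eta> * (q - 1))) ((g y * r powr \<rho>) powr \<theta>)))"
    have [measurable]: "F \<in> borel_measurable borel"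
      unfolding F_def borel_prod[symmetric] by measurable
    have F0: "0 \<le> F u" for u
      using g0 by (auto simp: F_def split: prod.split)
    \<comment> \<open>One integrand on pairs of points, zero unless u lies in the cone over z, so
      that Fubini applies to the two half spaces.\<close>
    define H where "H = (\<lambda>z u. if 0 < fst z \<and> fst z + norm (snd z - snd u) < fst u then w z * ennreal (F u) else 0)"
    have [measurable]: "w \<in> borel_measurable (borel \<Otimes>\<^sub>M borel)" "F \<in> borel_measurable (borel \<Otimes>\<^sub>M borel)"
      by (simp_all add: borel_prod)
    have H[measurable]: "(\<lambda>(z, u). H z u) \<in> borel_measurable (borel \<Otimes>\<^sub>M borel)"
      unfolding H_def by (simp add: borel_prod[symmetric])
    have "(\<integral>\<^sup>+z. w z * ennpowr (cone_potential \<beta> g z) q \<partial>lborel) \<le> (\<integral>\<^sup>+z. ennreal C2 * (\<integral>\<^sup>+u. H z u \<partial>lborel) \<partial>lborel)"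
    proof (rule nn_integral_mono)
      fix z :: "real \<times> 'a"
      obtain t x where z: "z = (t, x)" by (cases z)
      show "w z * ennpowr (cone_potential \<beta> g z) q \<le> ennreal C2 * (\<integral>\<^sup>+u. H z u \<partial>lborel)"
      proof (cases "0 < t")
        case True
        have "w z * ennpowr (cone_potential \<beta> g z) q \<le> w z * (ennreal C2 * (\<integral>\<^sup>+(r, y). (if t + norm (x - y) < r then ennreal (F (r, y)) else 0) \<partial>lborel))"
          unfolding z F_def C2_def prod.case
          by (intro mult_left_mono cone_potential_powr_le[OF g g0 p(1) gp \<rho>(2) \<eta>_def \<eta> True q1 \<theta>_def c_def]) auto
        also have "\<dots> = ennreal C2 * (w z * (\<integral>\<^sup>+(r, y). (if t + norm (x - y) < r then ennreal (F (r, y)) else 0) \<partial>lborel))"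
          by (simp add: mult_ac)
        also have "w z * (\<integral>\<^sup>+(r, y). (if t + norm (x - y) < r then ennreal (F (r, y)) else 0) \<partial>lborel) = (\<integral>\<^sup>+u. H z u \<partial>lborel)"
          using True by (subst nn_integral_cmult[symmetric])
            (auto simp: borel_prod[symmetric] H_def z intro!: nn_integral_cong)
        finally show ?thesis .
      next
        case False
        then have "cone_potential \<beta> g z = 0" by (simp add: cone_potential_def z case_prod_beta')
        then show ?thesis by simp
      qed
    qed
    also have "\<dots> = ennreal C2 * (\<integral>\<^sup>+z. \<integral>\<^sup>+u. H z u \<partial>lborel \<partial>lborel)"
      by (rule nn_integral_cmult) simp
    also have "(\<integral>\<^sup>+z. \<integral>\<^sup>+u. H z u \<partial>lborel \<partial>lborel) = (\<integral>\<^sup>+u. \<integral>\<^sup>+z. H z u \<partial>lborel \<partial>lborel)"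
      by (rule nn_integral_swap) (use H in \<open>simp add: borel_prod\<close>)
    also have "\<dots> \<le> (\<integral>\<^sup>+u. ennreal A * (if 0 < fst u then ennreal (fst u powr a * F u) else 0) \<partial>lborel)"
    proof (rule nn_integral_mono)
      fix u :: "real \<times> 'a"
      obtain r y where u: "u = (r, y)" by (cases u)
      show "(\<integral>\<^sup>+z. H z u \<partial>lborel) \<le> ennreal A * (if 0 < fst u then ennreal (fst u powr a * F u) else 0)"
      proof (cases "0 < r")
        case True
        have "(\<integral>\<^sup>+z. H z u \<partial>lborel) = (\<integral>\<^sup>+z. ennreal (F u) * (case z of (t, x) \<Rightarrow> if 0 < t \<and> t + norm (x - y) < r then w (t, x) else 0) \<partial>lborel)"
          by (intro nn_integral_cong) (auto simp: H_def u mult.commute)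
        also have "\<dots> = ennreal (F u) * (\<integral>\<^sup>+(t, x). (if 0 < t \<and> t + norm (x - y) < r then w (t, x) else 0) \<partial>lborel)"
          by (rule nn_integral_cmult) (simp add: borel_prod[symmetric])
        also have "\<dots> \<le> ennreal (F u) * ennreal (A * r powr a)"
          by (intro mult_left_mono w True) auto
        also have "\<dots> = ennreal A * ennreal (fst u powr a * F u)"
          using A F0[of u] by (simp add: u ennreal_mult mult_ac)
        finally show ?thesis using True by (simp add: u)
      next
        case False
        have "H z u = 0" for z
          using False norm_ge_zero[of "snd z - y"] by (auto simp: H_def u simp del: norm_ge_zero)
        then show ?thesis by simp
      qed
    qed
    also have "\<dots> = ennreal A * (\<integral>\<^sup>+u. (if 0 < fst u then ennreal (fst u powr a * F u) else 0) \<partial>lborel)"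
      by (rule nn_integral_cmult) (simp add: borel_prod[symmetric])
    also have "(\<integral>\<^sup>+u. (if 0 < fst u then ennreal (fst u powr a * F u) else 0) \<partial>lborel) =
      (\<integral>\<^sup>+r. \<integral>\<^sup>+y. (if 0 < r then ennreal (r powr a * F (r, y)) else 0) \<partial>lborel \<partial>lborel)"
    proof -
      have "(\<lambda>u. if 0 < fst u then ennreal (fst u powr a * F u) else 0) \<in> borel_measurable borel"
        by (simp add: borel_prod[symmetric])
      from nn_integral_lborel_pair[OF this] show ?thesis by (simp only: fst_conv)
    qed
    also have "\<dots> = (\<integral>\<^sup>+y. \<integral>\<^sup>+r. (if 0 < r then ennreal (r powr a * F (r, y)) else 0) \<partial>lborel \<partial>lborel)"
      by (rule nn_integral_swap) (simp add: borel_prod[symmetric])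
    also have "\<dots> \<le> (\<integral>\<^sup>+y. ennreal (C3 * g y powr p) \<partial>lborel)"
      unfolding F_def prod.case C3_def
      by (intro nn_integral_mono nn_integral_min_powr[OF p(1) _ \<eta>_def \<eta> aq \<rho>(2) \<theta>_def \<kappa>_def \<kappa>0 g0]) simp
    also have "\<dots> = ennreal C3 * (\<integral>\<^sup>+y. ennreal (g y powr p) \<partial>lborel)"
      using C3 by (simp add: ennreal_mult nn_integral_cmult)
    also have "\<dots> \<le> ennreal C3 * 1"
      using gp by (intro mult_left_mono) auto
    finally have "(\<integral>\<^sup>+z. w z * ennpowr (cone_potential \<beta> g z) q \<partial>lborel) \<le> ennreal C2 * (ennreal A * (ennreal C3 * 1))"
      by (simp add: mult_left_mono)
    also have "\<dots> = ennreal (C2 * (A * C3))"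
      using C2 C3 A by (simp add: ennreal_mult)
    finally show "(\<integral>\<^sup>+z. w z * ennpowr (cone_potential \<beta> g z) q \<partial>lborel) \<le> ennreal (C2 * (A * C3))" .
  qed
qed

lemma cone_potential_cmult:
  fixes g :: "'a::euclidean_space \<Rightarrow> real"
  assumes [measurable]: "g \<in> borel_measurable borel" and "0 \<le> k"
  shows "cone_potential \<beta> (\<lambda>y. k * g y) z = ennreal k * cone_potential \<beta> g z"
  using assms(2) unfolding cone_potential_def case_prod_beta
  by (subst nn_integral_cmult[symmetric])
    (auto simp: borel_prod[symmetric] ennreal_mult'[symmetric] mult_ac intro!: nn_integral_cong)

text \<open>Both sides scale with the power q of g, so g is divided by its L^p norm. A norm that is
  0 or infinite cannot be divided out; in the former case g vanishes almost everywhere and so does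
  its potential.\<close>

lemma cone_potential_strong_type:
  fixes w :: "real \<times> 'a::euclidean_space \<Rightarrow> ennreal"
  assumes [measurable]: "w \<in> borel_measurable borel"
    and w: "\<And>r (y :: 'a). 0 < r \<Longrightarrow>
      (\<integral>\<^sup>+(t, x). (if 0 < t \<and> t + norm (x - y) < r then w (t, x) else 0) \<partial>lborel) \<le> ennreal (A * r powr a)"
    and A: "0 < A" and \<beta>: "0 < \<beta>" and p: "1 < p" "p * \<beta> < real DIM('a)" and a: "real DIM('a) - p * \<beta> < a"
    and q: "q = p * a / (real DIM('a) - p * \<beta>)"
  obtains C where "0 < C" "\<And>g. g \<in> borel_measurable borel \<Longrightarrow> (\<And>y. 0 \<le> g y) \<Longrightarrow>
    (\<integral>\<^sup>+z. w z * ennpowr (cone_potential \<beta> g z) q \<partial>lborel) \<le> ennreal C * ennpowr (\<integral>\<^sup>+y. ennreal (g y powr p) \<partial>lborel) (q / p)"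
proof (rule cone_potential_strong_type_normalized[OF assms], assumption)
  fix C assume C: "0 < C" "\<And>g. g \<in> borel_measurable borel \<Longrightarrow> (\<And>y. 0 \<le> g y) \<Longrightarrow>
    (\<integral>\<^sup>+y. ennreal (g y powr p) \<partial>lborel) \<le> 1 \<Longrightarrow>
    (\<integral>\<^sup>+z. w z * ennpowr (cone_potential \<beta> g z) q \<partial>lborel) \<le> ennreal C"
  show thesis
  proof (rule that[OF C(1)])
    fix g :: "'a \<Rightarrow> real"
    assume g[measurable]: "g \<in> borel_measurable borel" and g0: "\<And>y. 0 \<le> g y"
    let ?G = "\<integral>\<^sup>+y. ennreal (g y powr p) \<partial>lborel"
    consider "?G = top" | "?G = 0" | G where "?G = ennreal G" "0 < G"
      by (cases ?G) (auto simp: less_le)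
    then show "(\<integral>\<^sup>+z. w z * ennpowr (cone_potential \<beta> g z) q \<partial>lborel) \<le> ennreal C * ennpowr ?G (q / p)"
    proof cases
      case 1
      then show ?thesis using C(1) by (simp add: ennreal_mult_top)
    next
      case 2
      then have "AE y in lborel. ennreal (g y powr p) = 0"
        by (subst (asm) nn_integral_0_iff_AE) auto
      then have AE: "AE y in lborel. g y = 0"
        using g0 by (auto simp: ennreal_eq_0_iff)
      have "cone_potential \<beta> g z = 0" for z
      proof -
        obtain t x where z: "z = (t, x)" by (cases z)
        have "cone_potential \<beta> g z = (\<integral>\<^sup>+r. \<integral>\<^sup>+y. (if 0 < t \<and> t + norm (x - y) < r
          then ennreal (r powr (\<beta> - real DIM('a) - 1) * g y) else 0) \<partial>lborel \<partial>lborel)"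
          unfolding cone_potential_def z prod.case by (subst nn_integral_lborel_pair) (auto simp: borel_prod[symmetric])
        also have "\<dots> = (\<integral>\<^sup>+r. \<integral>\<^sup>+y. 0 \<partial>(lborel :: 'a measure) \<partial>(lborel :: real measure))"
          by (intro nn_integral_cong nn_integral_cong_AE) (use AE in auto)
        finally show ?thesis by simp
      qed
      then show ?thesis by simp
    next
      case 3
      define k where "k = G powr (- 1 / p)"
      have k: "0 < k" using 3 by (simp add: k_def)
      have kp: "k powr p * G = 1"
      proof -
        have "k powr p = G powr (- 1)"
          using p unfolding k_def powr_powr by simp
        then show ?thesis using 3 by (simp add: powr_minus)
      qed
      have "(\<integral>\<^sup>+y. ennreal ((k * g y) powr p) \<partial>lborel) = ennreal (k powr p) * ?G"
        using k g0 by (simp add: powr_mult ennreal_mult nn_integral_cmult)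
      also have "\<dots> = 1" using 3 kp by (simp add: ennreal_mult[symmetric])
      finally have "(\<integral>\<^sup>+z. w z * ennpowr (cone_potential \<beta> (\<lambda>y. k * g y) z) q \<partial>lborel) \<le> ennreal C"
        using k g0 by (intro C(2)) auto
      also have "(\<integral>\<^sup>+z. w z * ennpowr (cone_potential \<beta> (\<lambda>y. k * g y) z) q \<partial>lborel) =
        ennreal (k powr q) * (\<integral>\<^sup>+z. w z * ennpowr (cone_potential \<beta> g z) q \<partial>lborel)"
        using k by (subst nn_integral_cmult[symmetric])
          (auto simp: cone_potential_cmult ennpowr_mult mult_ac intro!: nn_integral_cong)
      finally have le: "ennreal (k powr q) * (\<integral>\<^sup>+z. w z * ennpowr (cone_potential \<beta> g z) q \<partial>lborel) \<le> ennreal C" .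
      have kq: "G powr (q / p) * k powr q = 1"
      proof -
        have "k powr q = G powr (- (q / p))"
          unfolding k_def powr_powr by simp
        then show ?thesis using 3 by (simp add: powr_minus)
      qed
      have "(\<integral>\<^sup>+z. w z * ennpowr (cone_potential \<beta> g z) q \<partial>lborel) =
        ennreal (G powr (q / p) * k powr q) * (\<integral>\<^sup>+z. w z * ennpowr (cone_potential \<beta> g z) q \<partial>lborel)"
        by (simp add: kq)
      also have "\<dots> = ennreal (G powr (q / p)) * (ennreal (k powr q) * (\<integral>\<^sup>+z. w z * ennpowr (cone_potential \<beta> g z) q \<partial>lborel))"
        by (simp add: ennreal_mult mult.assoc)
      also have "\<dots> \<le> ennreal (G powr (q / p)) * ennreal C"
        by (intro mult_left_mono le) auto
      finally show ?thesis
        using 3 by (simp add: ennpowr_ennreal mult.commute)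
    qed
  qed
qed

section \<open>Potentials summed over dyadic scales\<close>

text \<open>The integers are enumerated by \<open>int_decode\<close>; the integral over j is then a
  series and can be exchanged term by term.\<close>

lemma nn_integral_swap_count_space_int:
  fixes f :: "int \<Rightarrow> 'b \<Rightarrow> ennreal"
  assumes [measurable]: "\<And>j. f j \<in> borel_measurable M"
  shows "(\<integral>\<^sup>+x. \<integral>\<^sup>+j. f j x \<partial>count_space UNIV \<partial>M) = (\<integral>\<^sup>+j. \<integral>\<^sup>+x. f j x \<partial>M \<partial>count_space UNIV)"
proof -
  have eq: "(\<integral>\<^sup>+j. h j \<partial>count_space UNIV) = (\<Sum>i. h (int_decode i))" for h :: "int \<Rightarrow> ennreal"
    by (subst nn_integral_bij_count_space[OF bij_int_decode, symmetric]) (rule nn_integral_count_space_nat)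
  show ?thesis
    unfolding eq by (rule nn_integral_suminf) simp
qed

lemma borel_measurable_nn_integral_count_space_int [measurable (raw)]:
  fixes f :: "'b \<Rightarrow> int \<Rightarrow> ennreal"
  assumes [measurable]: "\<And>j. (\<lambda>x. f x j) \<in> borel_measurable M"
  shows "(\<lambda>x. \<integral>\<^sup>+j. f x j \<partial>count_space UNIV) \<in> borel_measurable M"
proof -
  have eq: "(\<integral>\<^sup>+j. h j \<partial>count_space UNIV) = (\<Sum>i. h (int_decode i))" for h :: "int \<Rightarrow> ennreal"
    by (subst nn_integral_bij_count_space[OF bij_int_decode, symmetric]) (rule nn_integral_count_space_nat)
  show ?thesis
    unfolding eq by measurable
qed

text \<open>Layer cake over s > r: the cone bound A s^a at each s is integrated against s^(-b - 1),
  which converges because a < b.\<close>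

lemma nn_integral_weight_tail:
  fixes w :: "real \<times> 'a::euclidean_space \<Rightarrow> ennreal" and y :: 'a
  assumes [measurable]: "w \<in> borel_measurable borel"
    and w: "\<And>r (y :: 'a). 0 < r \<Longrightarrow>
      (\<integral>\<^sup>+(t, x). (if 0 < t \<and> t + norm (x - y) < r then w (t, x) else 0) \<partial>lborel) \<le> ennreal (A * r powr a)"
    and A: "0 < A" and b: "a < b" "0 < b" and r: "0 < r"
  shows "(\<integral>\<^sup>+(t, x). (if 0 < t then w (t, x) * ennreal ((t + norm (x - y) + r) powr (- b)) else 0) \<partial>lborel)
    \<le> ennreal (b * A / (b - a) * r powr (a - b))"
proof -
  have [measurable]: "w \<in> borel_measurable (borel \<Otimes>\<^sub>M borel)"
    by (simp add: borel_prod)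
  let ?d = "\<lambda>z :: real \<times> 'a. fst z + norm (snd z - y)"
  have "(\<integral>\<^sup>+(t, x). (if 0 < t then w (t, x) * ennreal ((t + norm (x - y) + r) powr (- b)) else 0) \<partial>lborel) \<le>
    (\<integral>\<^sup>+z. ennreal b * (\<integral>\<^sup>+s. (if r < s \<and> 0 < fst z \<and> ?d z < s then w z * ennreal (s powr (- b - 1)) else 0) \<partial>lborel) \<partial>lborel)"
  proof (rule nn_integral_mono, clarify)
    fix t :: real and x :: 'a
    show "(if 0 < t then w (t, x) * ennreal ((t + norm (x - y) + r) powr (- b)) else 0) \<le>
      ennreal b * (\<integral>\<^sup>+s. (if r < s \<and> 0 < fst (t, x) \<and> ?d (t, x) < s then w (t, x) * ennreal (s powr (- b - 1)) else 0) \<partial>lborel)"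
    proof (cases "0 < t")
      case True
      have "w (t, x) * ennreal ((t + norm (x - y) + r) powr (- b)) =
        w (t, x) * (ennreal b * (\<integral>\<^sup>+s. (if t + norm (x - y) + r < s then ennreal (s powr (- b - 1)) else 0) \<partial>lborel))"
        using True r b by (subst powr_eq_nn_integral[of b]) (auto intro!: add_nonneg_pos)
      also have "\<dots> = ennreal b * (\<integral>\<^sup>+s. w (t, x) * (if t + norm (x - y) + r < s then ennreal (s powr (- b - 1)) else 0) \<partial>lborel)"
        by (subst nn_integral_cmult) (auto simp: mult_ac)
      also have "\<dots> \<le> ennreal b * (\<integral>\<^sup>+s. (if r < s \<and> 0 < fst (t, x) \<and> ?d (t, x) < s then w (t, x) * ennreal (s powr (- b - 1)) else 0) \<partial>lborel)"
      proof (intro mult_left_mono nn_integral_mono)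
        fix s
        have "r < s \<and> t + norm (x - y) < s" if "t + norm (x - y) + r < s"
          using that True r norm_ge_zero[of "x - y"] by linarith
        then show "w (t, x) * (if t + norm (x - y) + r < s then ennreal (s powr (- b - 1)) else 0) \<le>
          (if r < s \<and> 0 < fst (t, x) \<and> ?d (t, x) < s then w (t, x) * ennreal (s powr (- b - 1)) else 0)"
          using True by auto
      qed simp
      finally show ?thesis using True by simp
    qed simp
  qed
  also have "\<dots> = ennreal b * (\<integral>\<^sup>+z. \<integral>\<^sup>+s. (if r < s \<and> 0 < fst z \<and> ?d z < s then w z * ennreal (s powr (- b - 1)) else 0) \<partial>lborel \<partial>lborel)"
    by (rule nn_integral_cmult) (simp add: borel_prod[symmetric])
  also have "(\<integral>\<^sup>+z. \<integral>\<^sup>+s. (if r < s \<and> 0 < fst z \<and> ?d z < s then w z * ennreal (s powr (- b - 1)) else 0) \<partial>lborel \<partial>lborel) =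
    (\<integral>\<^sup>+s. \<integral>\<^sup>+z. (if r < s \<and> 0 < fst z \<and> ?d z < s then w z * ennreal (s powr (- b - 1)) else 0) \<partial>lborel \<partial>lborel)"
    by (rule nn_integral_swap) (simp add: borel_prod[symmetric])
  also have "\<dots> \<le> (\<integral>\<^sup>+s. ennreal A * (if r < s then ennreal (s powr (- (b - a) - 1)) else 0) \<partial>lborel)"
  proof (rule nn_integral_mono)
    fix s :: real
    show "(\<integral>\<^sup>+z. (if r < s \<and> 0 < fst z \<and> ?d z < s then w z * ennreal (s powr (- b - 1)) else 0) \<partial>lborel) \<le>
      ennreal A * (if r < s then ennreal (s powr (- (b - a) - 1)) else 0)"
    proof (cases "r < s")
      case True
      have "(\<integral>\<^sup>+z. (if r < s \<and> 0 < fst z \<and> ?d z < s then w z * ennreal (s powr (- b - 1)) else 0) \<partial>lborel) =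
         (\<integral>\<^sup>+z. ennreal (s powr (- b - 1)) * (case z of (t, x) \<Rightarrow> if 0 < t \<and> t + norm (x - y) < s then w (t, x) else 0) \<partial>lborel)"
        using True by (intro nn_integral_cong) (auto simp: mult.commute)
      also have "\<dots> = ennreal (s powr (- b - 1)) * (\<integral>\<^sup>+(t, x). (if 0 < t \<and> t + norm (x - y) < s then w (t, x) else 0) \<partial>lborel)"
        by (rule nn_integral_cmult) (simp add: borel_prod[symmetric])
      also have "\<dots> \<le> ennreal (s powr (- b - 1)) * ennreal (A * s powr a)"
        using True r by (intro mult_left_mono w) auto
      also have "\<dots> = ennreal A * ennreal (s powr (- (b - a) - 1))"
      proof -
        have "s powr (- b - 1) * s powr a = s powr (- (b - a) - 1)"
          unfolding powr_add[symmetric] by (simp add: algebra_simps)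
        then show ?thesis using A by (simp add: ennreal_mult[symmetric] mult_ac)
      qed
      finally show ?thesis using True by simp
    qed simp
  qed
  also have "\<dots> = ennreal A * ennreal (r powr (- (b - a)) / (b - a))"
    using b r nn_integral_powr_above[of "b - a" r] by (simp add: nn_integral_cmult)
  also have "ennreal b * \<dots> = ennreal (b * A / (b - a) * r powr (a - b))"
    using b A by (simp add: ennreal_mult[symmetric])
  finally show ?thesis by (simp add: mult_left_mono)
qed

text \<open>What the majorant makes of a superposition of averages of G j over balls of radius
  2^(-j). The sum over j is an integral for the counting measure, so that (j, y) can be treated as
  one variable of integration.\<close>

definition scale_potential :: "(int \<Rightarrow> 'a::euclidean_space \<Rightarrow> real) \<Rightarrow> real \<times> 'a \<Rightarrow> ennreal" where
  "scale_potential G = (\<lambda>(t, x). if 0 < t then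
     (\<integral>\<^sup>+j. \<integral>\<^sup>+y. ennreal ((t + norm (x - y) + 2 powr (- of_int j)) powr (- real DIM('a)) * G j y) \<partial>lborel \<partial>count_space UNIV) else 0)"

lemma borel_measurable_scale_potential [measurable]:
  fixes G :: "int \<Rightarrow> 'a::euclidean_space \<Rightarrow> real"
  assumes [measurable]: "\<And>j. G j \<in> borel_measurable borel"
  shows "scale_potential G \<in> borel_measurable borel"
  unfolding scale_potential_def borel_prod[symmetric] by measurable

text \<open>Jensen's inequality up to a constant, for the measure with density 2^(\<beta> j) G j y,
  whose mass is at most 1. For a level z below the potential the integrand F is bounded by z / 2 +
  F^q (z / 2)^(1 - q), and the first term is absorbed.\<close>

lemma scale_potential_powr_le:
  fixes G :: "int \<Rightarrow> 'a::euclidean_space \<Rightarrow> real"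
  assumes [measurable]: "\<And>j. G j \<in> borel_measurable borel" and G0: "\<And>j y. 0 \<le> G j y"
    and m: "(\<integral>\<^sup>+j. \<integral>\<^sup>+y. ennreal (2 powr (\<beta> * of_int j) * G j y) \<partial>lborel \<partial>count_space UNIV) \<le> 1"
    and q: "1 < q" and t: "0 < t"
  shows "ennpowr (scale_potential G (t, x)) q \<le> ennreal (2 powr q) *
    (\<integral>\<^sup>+j. \<integral>\<^sup>+y. ennreal (2 powr (\<beta> * of_int j) * G j y) *
        ennreal (2 powr (- \<beta> * q * of_int j) * (t + norm (x - y) + 2 powr (- of_int j)) powr (- real DIM('a) * q)) \<partial>lborel \<partial>count_space UNIV)"
    (is "_ \<le> _ * ?I")
proof (rule ennpowr_le_of_real_bounds)
  let ?n = "real DIM('a)"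
  fix z assume z: "0 < z" "ennreal z \<le> scale_potential G (t, x)"
  have "ennreal z \<le> (\<integral>\<^sup>+j. \<integral>\<^sup>+y. ennreal ((t + norm (x - y) + 2 powr (- of_int j)) powr (- ?n) * G j y) \<partial>lborel \<partial>count_space UNIV)"
    using z t by (simp add: scale_potential_def)
  also have "\<dots> \<le> (\<integral>\<^sup>+j. \<integral>\<^sup>+y. ennreal (z / 2) * ennreal (2 powr (\<beta> * of_int j) * G j y) + ennreal ((z / 2) powr (1 - q)) *
      (ennreal (2 powr (\<beta> * of_int j) * G j y) *
        ennreal (2 powr (- \<beta> * q * of_int j) * (t + norm (x - y) + 2 powr (- of_int j)) powr (- ?n * q))) \<partial>lborel \<partial>count_space UNIV)"
  proof (intro nn_integral_mono)
    fix j y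
    define D where "D = t + norm (x - y) + 2 powr (- real_of_int j)"
    define r where "r = 2 powr (\<beta> * real_of_int j)"
    have r: "0 < r" by (simp add: r_def)
    have "D powr (- ?n) / r \<le> z / 2 + (D powr (- ?n) / r) powr q * (z / 2) powr (1 - q)"
      using z q r by (intro le_powr_add_powr) auto
    then have "r * G j y * (D powr (- ?n) / r) \<le> r * G j y * (z / 2 + (D powr (- ?n) / r) powr q * (z / 2) powr (1 - q))"
      using r G0 by (intro mult_left_mono) auto
    also have "r * G j y * (D powr (- ?n) / r) = D powr (- ?n) * G j y" using r by simp
    also have "(D powr (- ?n) / r) powr q = 2 powr (- \<beta> * q * of_int j) * D powr (- ?n * q)"
      by (simp add: powr_divide powr_powr r_def powr_minus powr_mult field_simps)
    finally have "D powr (- ?n) * G j y \<le> z / 2 * (r * G j y) + (z / 2) powr (1 - q) * (r * G j y * (2 powr (- \<beta> * q * of_int j) * D powr (- ?n * q)))"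
      by (simp add: algebra_simps)
    then show "ennreal ((t + norm (x - y) + 2 powr (- of_int j)) powr (- ?n) * G j y) \<le>
      ennreal (z / 2) * ennreal (2 powr (\<beta> * of_int j) * G j y) + ennreal ((z / 2) powr (1 - q)) *
      (ennreal (2 powr (\<beta> * of_int j) * G j y) *
        ennreal (2 powr (- \<beta> * q * of_int j) * (t + norm (x - y) + 2 powr (- of_int j)) powr (- ?n * q)))"
      unfolding D_def[symmetric] r_def[symmetric] using z r G0
      by (simp add: ennreal_mult[symmetric] ennreal_leI flip: ennreal_plus)
  qed
  also have "\<dots> = ennreal (z / 2) * (\<integral>\<^sup>+j. \<integral>\<^sup>+y. ennreal (2 powr (\<beta> * of_int j) * G j y) \<partial>lborel \<partial>count_space UNIV) + ennreal ((z / 2) powr (1 - q)) * ?I"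
    by (simp add: nn_integral_add nn_integral_cmult)
  also have "\<dots> \<le> ennreal (z / 2) * 1 + ennreal ((z / 2) powr (1 - q)) * ?I"
    by (intro add_right_mono mult_left_mono m) auto
  finally have half: "ennreal (z / 2) \<le> ennreal ((z / 2) powr (1 - q)) * ?I"
    using z by (intro ennreal_half_le) auto
  have "ennreal (z powr q) = ennreal (2 powr q * (z / 2) powr (q - 1)) * ennreal (z / 2)"
  proof -
    have "z powr q = 2 powr q * (z / 2) powr q" using z by (simp add: powr_divide)
    also have "(z / 2) powr q = (z / 2) powr (q - 1) * (z / 2)" using z by (simp add: powr_diff)
    finally show ?thesis using z by (simp add: ennreal_mult[symmetric])
  qed
  also have "\<dots> \<le> ennreal (2 powr q * (z / 2) powr (q - 1)) * (ennreal ((z / 2) powr (1 - q)) * ?I)"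
    by (intro mult_left_mono half) auto
  also have "\<dots> = ennreal (2 powr q) * (ennreal ((z / 2) powr (q - 1) * (z / 2) powr (1 - q)) * ?I)"
    by (simp add: ennreal_mult mult.assoc)
  also have "(z / 2) powr (q - 1) * (z / 2) powr (1 - q) = 1"
    using z by (simp add: powr_add[symmetric])
  finally show "ennreal (z powr q) \<le> ennreal (2 powr q) * ?I" by simp
qed (use q in simp)

lemma scale_potential_cmult:
  fixes G :: "int \<Rightarrow> 'a::euclidean_space \<Rightarrow> real"
  assumes [measurable]: "\<And>j. G j \<in> borel_measurable borel" and "0 \<le> k"
  shows "scale_potential (\<lambda>j y. k * G j y) z = ennreal k * scale_potential G z"
proof -
  have "ennreal (D * (k * g)) = ennreal k * ennreal (D * g)" for D g
    using assms(2) by (simp add: ennreal_mult'[symmetric] mult_ac)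
  then show ?thesis
    by (simp add: scale_potential_def case_prod_beta nn_integral_cmult)
qed

text \<open>After the exchange of order each pair (j, y) meets the weight only through
  \<open>nn_integral_weight_tail\<close> with r = 2^(-j). That tail is a multiple of 2^(\<beta> q
  j), which the factor 2^(-\<beta> q j) of the previous inequality cancels exactly, so that just the
  mass remains.\<close>

lemma scale_potential_strong_type:
  fixes w :: "real \<times> 'a::euclidean_space \<Rightarrow> ennreal"
  assumes [measurable]: "w \<in> borel_measurable borel"
    and w: "\<And>r (y :: 'a). 0 < r \<Longrightarrow>
      (\<integral>\<^sup>+(t, x). (if 0 < t \<and> t + norm (x - y) < r then w (t, x) else 0) \<partial>lborel) \<le> ennreal (A * r powr a)"
    and A: "0 < A" and \<beta>: "0 < \<beta>" "\<beta> < real DIM('a)" and q: "1 < q" "q = a / (real DIM('a) - \<beta>)"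
  obtains C where "0 < C" "\<And>G. (\<And>j. G j \<in> borel_measurable borel) \<Longrightarrow> (\<And>j y. 0 \<le> G j y) \<Longrightarrow>
    (\<integral>\<^sup>+z. w z * ennpowr (scale_potential G z) q \<partial>lborel) \<le>
       ennreal C * ennpowr (\<integral>\<^sup>+j. \<integral>\<^sup>+y. ennreal (2 powr (\<beta> * of_int j) * G j y) \<partial>lborel \<partial>count_space UNIV) q"
proof -
  let ?n = "real DIM('a)"
  \<comment> \<open>The q-th power of a kernel of order -n has order -n q; the relation a = q (n -
    \<beta>) then gives a - b = - \<beta> q.\<close>
  define b where "b = ?n * q"
  have aq: "a = q * (?n - \<beta>)" using \<beta> q by simp
  have b: "0 < b" "a < b" "a - b = - \<beta> * q" using q(1) \<beta> mult_pos_pos[of \<beta> q] by (auto simp: b_def aq algebra_simps)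
  define C where "C = 2 powr q * (b * A / (b - a))"
  have C: "0 < C" using A b by (simp add: C_def)
  have norm: "(\<integral>\<^sup>+z. w z * ennpowr (scale_potential G z) q \<partial>lborel) \<le> ennreal C"
    if [measurable]: "\<And>j. G j \<in> borel_measurable borel" and G0: "\<And>j y. 0 \<le> G j y"
    and m: "(\<integral>\<^sup>+j. \<integral>\<^sup>+y. ennreal (2 powr (\<beta> * of_int j) * G j y) \<partial>lborel \<partial>count_space UNIV) \<le> 1"
    for G :: "int \<Rightarrow> 'a \<Rightarrow> real"
  proof -
    define m where "m j y = ennreal (2 powr (\<beta> * of_int j) * G j y)" for j y
    have [measurable]: "m j \<in> borel_measurable borel" for j unfolding m_def by measurable
    define H where "H j y z = (if 0 < fst z then w z * ennreal ((fst z + norm (snd z - y) + 2 powr (- of_int j)) powr (- b)) else 0)" for j :: int and y and z :: "real \<times> 'a"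
    have [measurable]: "w \<in> borel_measurable (borel \<Otimes>\<^sub>M borel)"
      by (simp add: borel_prod)
    have [measurable]: "(\<lambda>(y, z). H j y z) \<in> borel_measurable (borel \<Otimes>\<^sub>M borel)" for j
      unfolding H_def by (simp add: borel_prod[symmetric])
    have [measurable]: "(\<lambda>(z, y). H j y z) \<in> borel_measurable (borel \<Otimes>\<^sub>M borel)" for j
      unfolding H_def by (simp add: borel_prod[symmetric])
    have "(\<integral>\<^sup>+z. w z * ennpowr (scale_potential G z) q \<partial>lborel) \<le>
      (\<integral>\<^sup>+z. ennreal (2 powr q) * (\<integral>\<^sup>+j. \<integral>\<^sup>+y. m j y * (ennreal (2 powr (- \<beta> * q * of_int j)) * H j y z) \<partial>lborel \<partial>count_space UNIV) \<partial>lborel)"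
    proof (rule nn_integral_mono, clarify)
      fix t :: real and x :: 'a
      show "w (t, x) * ennpowr (scale_potential G (t, x)) q \<le>
        ennreal (2 powr q) * (\<integral>\<^sup>+j. \<integral>\<^sup>+y. m j y * (ennreal (2 powr (- \<beta> * q * of_int j)) * H j y (t, x)) \<partial>lborel \<partial>count_space UNIV)"
      proof (cases "0 < t")
        case True
        have "w (t, x) * ennpowr (scale_potential G (t, x)) q \<le> w (t, x) * (ennreal (2 powr q) *
          (\<integral>\<^sup>+j. \<integral>\<^sup>+y. ennreal (2 powr (\<beta> * of_int j) * G j y) *
            ennreal (2 powr (- \<beta> * q * of_int j) * (t + norm (x - y) + 2 powr (- of_int j)) powr (- ?n * q)) \<partial>lborel \<partial>count_space UNIV))"
          using True q(1) G0 m \<open>\<And>j. G j \<in> borel_measurable borel\<close> by (intro mult_left_mono scale_potential_powr_le) auto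
        also have "\<dots> = ennreal (2 powr q) * (\<integral>\<^sup>+j. \<integral>\<^sup>+y. w (t, x) * (ennreal (2 powr (\<beta> * of_int j) * G j y) *
            ennreal (2 powr (- \<beta> * q * of_int j) * (t + norm (x - y) + 2 powr (- of_int j)) powr (- ?n * q))) \<partial>lborel \<partial>count_space UNIV)"
          by (subst nn_integral_cmult, simp, subst nn_integral_cmult, simp) (simp add: mult.left_commute)
        also have "\<dots> = ennreal (2 powr q) * (\<integral>\<^sup>+j. \<integral>\<^sup>+y. m j y * (ennreal (2 powr (- \<beta> * q * of_int j)) * H j y (t, x)) \<partial>lborel \<partial>count_space UNIV)"
        proof -
          have "w (t, x) * (ennreal (2 powr (\<beta> * of_int j) * G j y) *
              ennreal (2 powr (- \<beta> * q * of_int j) * (t + norm (x - y) + 2 powr (- of_int j)) powr (- ?n * q))) =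
            m j y * (ennreal (2 powr (- \<beta> * q * of_int j)) * H j y (t, x))" for j y
            using True by (simp add: m_def H_def b_def ennreal_mult mult_ac)
          then show ?thesis by (simp only:)
        qed
        finally show ?thesis .
      next
        case False
        then show ?thesis by (simp add: scale_potential_def)
      qed
    qed
    also have "\<dots> = ennreal (2 powr q) * (\<integral>\<^sup>+z. \<integral>\<^sup>+j. \<integral>\<^sup>+y. m j y * (ennreal (2 powr (- \<beta> * q * of_int j)) * H j y z) \<partial>lborel \<partial>count_space UNIV \<partial>lborel)"
      by (rule nn_integral_cmult) simp
    also have "(\<integral>\<^sup>+z. \<integral>\<^sup>+j. \<integral>\<^sup>+y. m j y * (ennreal (2 powr (- \<beta> * q * of_int j)) * H j y z) \<partial>lborel \<partial>count_space UNIV \<partial>lborel) =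
       (\<integral>\<^sup>+j. \<integral>\<^sup>+z. \<integral>\<^sup>+y. m j y * (ennreal (2 powr (- \<beta> * q * of_int j)) * H j y z) \<partial>lborel \<partial>lborel \<partial>count_space UNIV)"
      by (rule nn_integral_swap_count_space_int) simp
    also have "\<dots> = (\<integral>\<^sup>+j. \<integral>\<^sup>+y. \<integral>\<^sup>+z. m j y * (ennreal (2 powr (- \<beta> * q * of_int j)) * H j y z) \<partial>lborel \<partial>lborel \<partial>count_space UNIV)"
    proof (rule nn_integral_cong, rule nn_integral_swap)
      fix j
      have "(\<lambda>(z, y). m j y * (ennreal (2 powr (- \<beta> * q * of_int j)) * H j y z)) \<in> borel_measurable (borel \<Otimes>\<^sub>M borel)"
        by measurable
      then show "(\<lambda>(z, y). m j y * (ennreal (2 powr (- \<beta> * q * of_int j)) * H j y z)) \<in> borel_measurable borel"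
        by (simp only: borel_prod)
    qed
    also have "\<dots> \<le> (\<integral>\<^sup>+j. \<integral>\<^sup>+y. m j y * ennreal (b * A / (b - a)) \<partial>lborel \<partial>count_space UNIV)"
    proof (intro nn_integral_mono)
      fix j y
      have "(\<integral>\<^sup>+z. m j y * (ennreal (2 powr (- \<beta> * q * of_int j)) * H j y z) \<partial>lborel) = m j y * (ennreal (2 powr (- \<beta> * q * of_int j)) * (\<integral>\<^sup>+z. H j y z \<partial>lborel))"
        by (subst nn_integral_cmult, simp, subst nn_integral_cmult) simp_all
      also have "(\<integral>\<^sup>+z. H j y z \<partial>lborel) = (\<integral>\<^sup>+(t, x). (if 0 < t then w (t, x) * ennreal ((t + norm (x - y) + 2 powr (- of_int j)) powr (- b)) else 0) \<partial>lborel)"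
        by (intro nn_integral_cong) (auto simp: H_def)
      also have "\<dots> \<le> ennreal (b * A / (b - a) * (2 powr (- of_int j)) powr (a - b))"
        by (intro nn_integral_weight_tail[OF assms(1) w A b(2,1)]) auto
      also have "ennreal (2 powr (- \<beta> * q * of_int j)) * \<dots> = ennreal (b * A / (b - a))"
      proof -
        have "2 powr (- \<beta> * q * of_int j) * (2 powr (- of_int j)) powr (a - b) = 1"
          by (simp add: powr_powr powr_add[symmetric] b(3))
        then show ?thesis using A b by (simp add: ennreal_mult[symmetric] mult_ac)
      qed
      finally show "(\<integral>\<^sup>+z. m j y * (ennreal (2 powr (- \<beta> * q * of_int j)) * H j y z) \<partial>lborel) \<le> m j y * ennreal (b * A / (b - a))"
        by (simp add: mult_left_mono)
    qed
    also have "\<dots> = (\<integral>\<^sup>+j. \<integral>\<^sup>+y. m j y \<partial>lborel \<partial>count_space UNIV) * ennreal (b * A / (b - a))"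
      by (simp add: nn_integral_multc)
    also have "\<dots> \<le> 1 * ennreal (b * A / (b - a))"
      using m unfolding m_def by (rule mult_right_mono) simp
    finally have "(\<integral>\<^sup>+z. w z * ennpowr (scale_potential G z) q \<partial>lborel) \<le> ennreal (2 powr q) * (1 * ennreal (b * A / (b - a)))"
      by (simp add: mult_left_mono)
    also have "\<dots> = ennreal C" using A b by (simp add: C_def ennreal_mult[symmetric])
    finally show ?thesis .
  qed
  show thesis
  proof (rule that[OF C])
    fix G :: "int \<Rightarrow> 'a \<Rightarrow> real"
    assume G[measurable]: "\<And>j. G j \<in> borel_measurable borel" and G0: "\<And>j y. 0 \<le> G j y"
    let ?m = "\<lambda>G. \<integral>\<^sup>+j. \<integral>\<^sup>+y. ennreal (2 powr (\<beta> * of_int j) * G j y) \<partial>lborel \<partial>count_space UNIV"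
    \<comment> \<open>Stated for every admissible factor k and not just for the inverse of the mass,
      so that it also covers mass 0.\<close>
    have le: "ennreal (k powr q) * (\<integral>\<^sup>+z. w z * ennpowr (scale_potential G z) q \<partial>lborel) \<le> ennreal C"
      if k: "0 < k" "ennreal k * ?m G \<le> 1" for k
    proof -
      have "ennreal (D * (k * g)) = ennreal k * ennreal (D * g)" for D g
        using k(1) by (simp add: ennreal_mult'[symmetric] mult_ac)
      then have "?m (\<lambda>j y. k * G j y) = ennreal k * ?m G"
        by (simp add: nn_integral_cmult)
      then have "(\<integral>\<^sup>+z. w z * ennpowr (scale_potential (\<lambda>j y. k * G j y) z) q \<partial>lborel) \<le> ennreal C"
        using k G0 by (intro norm) auto
      also have "(\<integral>\<^sup>+z. w z * ennpowr (scale_potential (\<lambda>j y. k * G j y) z) q \<partial>lborel) =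
        (\<integral>\<^sup>+z. ennreal (k powr q) * (w z * ennpowr (scale_potential G z) q) \<partial>lborel)"
        using k(1) by (intro nn_integral_cong) (simp add: scale_potential_cmult ennpowr_mult mult.left_commute)
      also have "\<dots> = ennreal (k powr q) * (\<integral>\<^sup>+z. w z * ennpowr (scale_potential G z) q \<partial>lborel)"
        by (rule nn_integral_cmult) simp
      finally show ?thesis .
    qed
    consider "?m G = top" | "?m G = 0" | M where "?m G = ennreal M" "0 < M"
      by (cases "?m G") (auto simp: less_le)
    then show "(\<integral>\<^sup>+z. w z * ennpowr (scale_potential G z) q \<partial>lborel) \<le> ennreal C * ennpowr (?m G) q"
    proof cases
      case 1
      then show ?thesis using C by (simp add: ennreal_mult_top)
    next
      case 2
      have "(\<integral>\<^sup>+z. w z * ennpowr (scale_potential G z) q \<partial>lborel) = 0" (is "?X = 0")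
      proof (rule ccontr)
        assume "?X \<noteq> 0"
        have "?X \<le> ennreal C" using le[of 1] 2 by simp
        then obtain X where X: "?X = ennreal X" "0 \<le> X" by (cases ?X) (auto simp: top_unique)
        with \<open>?X \<noteq> 0\<close> have "0 < X" by (auto simp: less_le)
        \<comment> \<open>With mass 0 every k > 0 is admissible; this one makes k^q X equal to C +
          1, against the bound C.\<close>
        define k where "k = ((C + 1) / X) powr (1 / q)"
        have k: "0 < k" "k powr q = (C + 1) / X"
          using \<open>0 < X\<close> C q(1) by (auto simp: k_def powr_powr)
        have "ennreal (k powr q * X) \<le> ennreal C"
          using le[OF k(1)] 2 X by (simp add: ennreal_mult)
        then show False using k \<open>0 < X\<close> C by simp
      qed
      then show ?thesis by simp
    next
      case 3
      have "ennreal (inverse M) * ?m G \<le> 1" using 3 by (simp add: ennreal_mult[symmetric])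
      then have "ennreal (inverse M powr q) * (\<integral>\<^sup>+z. w z * ennpowr (scale_potential G z) q \<partial>lborel) \<le> ennreal C"
        using 3 by (intro le) auto
      then have "ennreal (M powr q) * (ennreal (inverse M powr q) * (\<integral>\<^sup>+z. w z * ennpowr (scale_potential G z) q \<partial>lborel)) \<le> ennreal (M powr q) * ennreal C"
        by (rule mult_left_mono) simp
      moreover have "M powr q * inverse M powr q = 1"
        using 3 by (simp add: powr_mult[symmetric])
      then have "ennreal (M powr q) * (ennreal (inverse M powr q) * (\<integral>\<^sup>+z. w z * ennpowr (scale_potential G z) q \<partial>lborel)) =
          (\<integral>\<^sup>+z. w z * ennpowr (scale_potential G z) q \<partial>lborel)"
        by (simp add: mult.assoc[symmetric] ennreal_mult[symmetric])
      ultimately show ?thesis using 3 by (simp add: ennpowr_ennreal mult.commute)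
    qed
  qed
qed

section \<open>Averages of test functions over dyadic scales\<close>

lemma test_function_continuous: "test_function f \<Longrightarrow> continuous_on UNIV f"
  unfolding test_function_def by (metis Ck.simps(1))

lemma test_function_borel: "test_function f \<Longrightarrow> f \<in> borel_measurable borel"
  by (intro borel_measurable_continuous_onI test_function_continuous)

lemma test_function_support:
  fixes f :: "'a::euclidean_space \<Rightarrow> real"
  assumes "test_function f"
  obtains R where "0 < R" "\<And>x. R \<le> norm x \<Longrightarrow> f x = 0"
proof -
  have "bounded (closure {x. f x \<noteq> 0})"
    using assms compact_imp_bounded by (auto simp: test_function_def)
  then obtain R where R: "\<And>x. x \<in> closure {x. f x \<noteq> 0} \<Longrightarrow> norm x \<le> R"
    by (auto simp: bounded_iff)
  show thesis
  proof (rule that[of "\<bar>R\<bar> + 1"])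
    fix x :: 'a assume x: "\<bar>R\<bar> + 1 \<le> norm x"
    show "f x = 0"
    proof (rule ccontr)
      assume "f x \<noteq> 0"
      then have "x \<in> closure {x. f x \<noteq> 0}" by (intro closure_subset[THEN subsetD]) auto
      then show False using R x by fastforce
    qed
  qed simp
qed

lemma test_function_bounded:
  fixes f :: "'a::euclidean_space \<Rightarrow> real"
  assumes "test_function f"
  obtains B where "0 < B" "\<And>x. \<bar>f x\<bar> \<le> B"
proof -
  obtain R where R: "0 < R" "\<And>x. R \<le> norm x \<Longrightarrow> f x = 0"
    using test_function_support[OF assms] by auto
  have "compact (f ` cball 0 R)"
    by (intro compact_continuous_image continuous_on_subset[OF test_function_continuous[OF assms]]) auto
  then obtain B where B: "\<And>x. x \<in> cball 0 R \<Longrightarrow> norm (f x) \<le> B"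
    using compact_imp_bounded bounded_iff by (metis imageI)
  show thesis
  proof (rule that[of "\<bar>B\<bar> + 1"])
    fix x :: 'a
    show "\<bar>f x\<bar> \<le> \<bar>B\<bar> + 1"
      using B[of x] R(2)[of x] by (cases "norm x \<le> R") auto
  qed simp
qed

lemma test_function_integrable:
  fixes f :: "'a::euclidean_space \<Rightarrow> real"
  assumes "test_function f"
  shows "integrable lborel f"
proof -
  obtain R where R: "0 < R" "\<And>x. R \<le> norm x \<Longrightarrow> f x = 0"
    using test_function_support[OF assms] by auto
  have "integrable lborel (\<lambda>x. indicator (cball 0 R) x *\<^sub>R f x)"
    by (intro borel_integrable_compact continuous_on_subset[OF test_function_continuous[OF assms]]) auto
  also have "(\<lambda>x. indicator (cball 0 R) x *\<^sub>R f x) = f"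
    using R(2) by (auto simp: fun_eq_iff split: split_indicator)
  finally show ?thesis .
qed

section \<open>Averages against a dilated kernel and their limits\<close>

lemma integral_lborel_scale:
  fixes g :: "'a::euclidean_space \<Rightarrow> 'b::{banach, second_countable_topology}"
  assumes [measurable]: "g \<in> borel_measurable borel" and "0 < c"
  shows "(LINT y|lborel. g y) = c ^ DIM('a) *\<^sub>R (LINT y|lborel. g (c *\<^sub>R y))"
  using assms(2) by (subst lborel_affine[of c 0]) (simp_all add: integral_density integral_distr)

lemma nn_integral_lborel_scale:
  fixes g :: "'a::euclidean_space \<Rightarrow> ennreal"
  assumes [measurable]: "g \<in> borel_measurable borel" and "0 < c"
  shows "(\<integral>\<^sup>+y. g (x + c *\<^sub>R y) \<partial>lborel) = ennreal (c powr (- real DIM('a))) * (\<integral>\<^sup>+y. g y \<partial>lborel)"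
proof -
  have "(\<integral>\<^sup>+y. g y \<partial>lborel) = ennreal (c ^ DIM('a)) * (\<integral>\<^sup>+y. g (x + c *\<^sub>R y) \<partial>lborel)"
    using assms(2) by (subst lborel_affine[of c x]) (simp_all add: nn_integral_density nn_integral_distr nn_integral_cmult)
  moreover have "c powr (- real DIM('a)) * c ^ DIM('a) = 1"
    using assms(2) by (simp add: powr_realpow[symmetric] powr_add[symmetric])
  ultimately show ?thesis
    by (simp add: mult.assoc[symmetric] ennreal_mult[symmetric] assms(2) less_imp_le)
qed

text \<open>The kernel will be signed, so this is no average against a probability density. In this
  substituted form the scale occurs only in the argument of f, and r = 0 is meaningful.\<close>

definition avg :: "('a::euclidean_space \<Rightarrow> real) \<Rightarrow> real \<Rightarrow> ('a \<Rightarrow> real) \<Rightarrow> 'a \<Rightarrow> real" where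
  "avg a r f x = (LINT y|lborel. a y * f (x + r *\<^sub>R y))"

context
  fixes a :: "'a::euclidean_space \<Rightarrow> real" and K M :: real
  assumes a[measurable]: "a \<in> borel_measurable borel"
    and a_le: "\<And>y. \<bar>a y\<bar> \<le> (if norm y < K then M else 0)" and K: "0 < K" and M: "0 < M"
begin

lemma avg_integrable:
  assumes [measurable]: "g \<in> borel_measurable borel" and "\<And>x. \<bar>g x\<bar> \<le> B"
  shows "integrable lborel (\<lambda>y. a y * g (x + r *\<^sub>R y))"
proof (rule integrableI_bounded_set[where A="ball 0 K" and B="M * B"])
  show "AE y\<in>ball 0 K in lborel. norm (a y * g (x + r *\<^sub>R y)) \<le> M * B"
    using a_le assms(2) M by (intro AE_I2 impI) (auto simp: abs_mult intro!: mult_mono, metis)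
  show "AE y in lborel. y \<notin> ball 0 K \<longrightarrow> a y * g (x + r *\<^sub>R y) = 0"
  proof (intro AE_I2 impI)
    fix y :: 'a assume "y \<notin> ball 0 K"
    then show "a y * g (x + r *\<^sub>R y) = 0" using a_le[of y] by auto
  qed
  show "emeasure lborel (ball (0::'a) K) < \<infinity>" by (intro emeasure_bounded_finite) auto
qed auto

lemma avg_kernel_integrable: "integrable lborel a"
  using avg_integrable[of "\<lambda>_. 1" 1] by simp

lemma avg_bound:
  assumes "g \<in> borel_measurable borel" "\<And>x. \<bar>g x\<bar> \<le> B"
  shows "\<bar>avg a r g x\<bar> \<le> (LINT y|lborel. \<bar>a y\<bar>) * B"
proof -
  have "\<bar>avg a r g x\<bar> \<le> (LINT y|lborel. \<bar>a y * g (x + r *\<^sub>R y)\<bar>)"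
    unfolding avg_def by (rule integral_abs_bound)
  also have "\<dots> \<le> (LINT y|lborel. \<bar>a y\<bar> * B)"
    using avg_kernel_integrable assms(2) by (intro integral_mono avg_integrable[OF assms, THEN integrable_abs])
      (auto simp: abs_mult intro!: mult_left_mono)
  finally show ?thesis by simp
qed

lemma avg_measurable [measurable]:
  assumes [measurable]: "g \<in> borel_measurable borel"
  shows "avg a r g \<in> borel_measurable borel"
  unfolding avg_def[abs_def] by measurable

lemma avg_diff:
  assumes "g \<in> borel_measurable borel" "\<And>x. \<bar>g x\<bar> \<le> B" "h \<in> borel_measurable borel" "\<And>x. \<bar>h x\<bar> \<le> B'"
  shows "avg a r (\<lambda>x. g x - h x) x = avg a r g x - avg a r h x"
  unfolding avg_def right_diff_distrib
  by (intro Bochner_Integration.integral_diff avg_integrable[OF assms(1,2)] avg_integrable[OF assms(3,4)])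

text \<open>Fubini, as both kernels are bounded with bounded support. Commutation is what lets a
  difference of squares of averaging operators factor.\<close>

lemma avg_commute:
  assumes [measurable]: "f \<in> borel_measurable borel" and "\<And>x. \<bar>f x\<bar> \<le> B"
  shows "avg a s (avg a r f) x = avg a r (avg a s f) x"
proof -
  have int: "integrable (lborel \<Otimes>\<^sub>M lborel) (\<lambda>(y, z). a y * (a z * f (x + s *\<^sub>R y + r *\<^sub>R z)))"
  proof (rule integrableI_bounded_set[where A="ball 0 K \<times> ball 0 K" and B="M * (M * B)"])
    show "AE u\<in>ball 0 K \<times> ball 0 K in lborel \<Otimes>\<^sub>M lborel. norm (case u of (y, z) \<Rightarrow> a y * (a z * f (x + s *\<^sub>R y + r *\<^sub>R z))) \<le> M * (M * B)"
    proof (intro AE_I2 impI, clarify)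
      fix y z :: 'a
      have 1: "\<bar>a y\<bar> \<le> M" for y using a_le[of y] M by (auto split: if_splits)
      have B: "0 \<le> B" using assms(2)[of 0] by linarith
      show "norm (a y * (a z * f (x + s *\<^sub>R y + r *\<^sub>R z))) \<le> M * (M * B)"
        unfolding real_norm_def abs_mult using M B by (intro mult_mono 1 assms(2)) auto
    qed
    show "AE u in lborel \<Otimes>\<^sub>M lborel. u \<notin> ball 0 K \<times> ball 0 K \<longrightarrow> (case u of (y, z) \<Rightarrow> a y * (a z * f (x + s *\<^sub>R y + r *\<^sub>R z))) = 0"
    proof (intro AE_I2 impI)
      fix u :: "'a \<times> 'a" assume u: "u \<notin> ball 0 K \<times> ball 0 K"
      obtain y z where yz: "u = (y, z)" by (cases u)
      have "a y = 0 \<or> a z = 0" using u a_le[of y] a_le[of z] by (auto simp: yz)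
      then show "(case u of (y, z) \<Rightarrow> a y * (a z * f (x + s *\<^sub>R y + r *\<^sub>R z))) = 0" by (auto simp: yz)
    qed
    show "emeasure (lborel \<Otimes>\<^sub>M lborel) (ball (0::'a) K \<times> ball (0::'a) K) < \<infinity>"
      unfolding lborel_prod by (intro emeasure_bounded_finite bounded_Times) auto
  qed auto
  have "avg a s (avg a r f) x = (LINT y|lborel. LINT z|lborel. a y * (a z * f (x + s *\<^sub>R y + r *\<^sub>R z)))"
    by (simp add: avg_def)
  also have "\<dots> = (LINT z|lborel. LINT y|lborel. a y * (a z * f (x + s *\<^sub>R y + r *\<^sub>R z)))"
    using lborel_pair.Fubini_integral[OF int] by simp
  also have "\<dots> = (LINT z|lborel. a z * (LINT y|lborel. a y * f (x + s *\<^sub>R y + r *\<^sub>R z)))"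
    by (subst integral_mult_right_zero[symmetric]) (simp add: mult.left_commute)
  also have "\<dots> = avg a r (avg a s f) x"
    by (simp add: avg_def add_ac)
  finally show ?thesis .
qed

lemma avg_le_nn_integral:
  assumes [measurable]: "g \<in> borel_measurable borel" and r: "0 < r"
  shows "ennreal \<bar>avg a r g x\<bar> \<le> (\<integral>\<^sup>+y. (if norm (x - y) < K * r then ennreal (M * r powr (- real DIM('a)) * \<bar>g y\<bar>) else 0) \<partial>lborel)"
proof -
  define h where "h u = (if norm (x - u) < K * r then ennreal (M * \<bar>g u\<bar>) else 0)" for u
  have [measurable]: "h \<in> borel_measurable borel" unfolding h_def by measurable
  have "ennreal \<bar>avg a r g x\<bar> \<le> (\<integral>\<^sup>+y. ennreal \<bar>a y * g (x + r *\<^sub>R y)\<bar> \<partial>lborel)"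
  proof (cases "integrable lborel (\<lambda>y. a y * g (x + r *\<^sub>R y))")
    case True
    then show ?thesis
      unfolding avg_def using integral_norm_bound_ennreal[OF True] by simp
  qed (simp add: avg_def not_integrable_integral_eq)
  also have "\<dots> \<le> (\<integral>\<^sup>+y. h (x + r *\<^sub>R y) \<partial>lborel)"
  proof (rule nn_integral_mono)
    fix y :: 'a
    have "norm y < K \<longleftrightarrow> norm y * r < K * r" using r by simp
    then show "ennreal \<bar>a y * g (x + r *\<^sub>R y)\<bar> \<le> h (x + r *\<^sub>R y)"
      using a_le[of y] r by (auto simp: h_def abs_mult mult.commute intro!: ennreal_leI mult_right_mono split: if_splits)
  qed
  also have "\<dots> = ennreal (r powr (- real DIM('a))) * (\<integral>\<^sup>+y. h y \<partial>lborel)"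
    using r by (intro nn_integral_lborel_scale) auto
  also have "\<dots> = (\<integral>\<^sup>+y. (if norm (x - y) < K * r then ennreal (M * r powr (- real DIM('a)) * \<bar>g y\<bar>) else 0) \<partial>lborel)"
    using M by (subst nn_integral_cmult[symmetric]) (auto simp: h_def ennreal_mult[symmetric] mult_ac intro!: nn_integral_cong)
  finally show ?thesis .
qed

text \<open>Dominated convergence twice: by continuity of f the inner average tends to its limit
  also when it is taken at the moving point x + r y.\<close>

lemma avg_avg_tendsto_small:
  assumes cont: "continuous_on UNIV f" and B: "\<And>x. \<bar>f x\<bar> \<le> B" and r: "r \<longlonglongrightarrow> 0"
  shows "(\<lambda>m. avg a (r m) (avg a (r m) f) x) \<longlonglongrightarrow> (LINT y|lborel. a y) * ((LINT y|lborel. a y) * f x)"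
proof -
  have [measurable]: "f \<in> borel_measurable borel" by (intro borel_measurable_continuous_onI cont)
  have *: "(\<lambda>m. avg a (r m) f (x + r m *\<^sub>R y)) \<longlonglongrightarrow> (LINT z|lborel. a z * f x)" for y
    unfolding avg_def
  proof (rule integral_dominated_convergence[where w="\<lambda>z. \<bar>a z\<bar> * B"])
    show "AE z in lborel. (\<lambda>m. a z * f (x + r m *\<^sub>R y + r m *\<^sub>R z)) \<longlonglongrightarrow> a z * f x"
    proof (rule AE_I2)
      fix z
      have "(\<lambda>m. x + r m *\<^sub>R y + r m *\<^sub>R z) \<longlonglongrightarrow> x + 0 *\<^sub>R y + 0 *\<^sub>R z"
        by (intro tendsto_intros r)
      then have "(\<lambda>m. f (x + r m *\<^sub>R y + r m *\<^sub>R z)) \<longlonglongrightarrow> f x"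
        using cont continuous_on_tendsto_compose[of UNIV f _ x] by auto
      then show "(\<lambda>m. a z * f (x + r m *\<^sub>R y + r m *\<^sub>R z)) \<longlonglongrightarrow> a z * f x"
        by (intro tendsto_intros)
    qed
    show "integrable lborel (\<lambda>z. \<bar>a z\<bar> * B)" using avg_kernel_integrable by auto
    show "AE z in lborel. norm (a z * f (x + r m *\<^sub>R y + r m *\<^sub>R z)) \<le> \<bar>a z\<bar> * B" for m
      using B by (auto simp: abs_mult intro!: mult_left_mono)
  qed auto
  have "(\<lambda>m. avg a (r m) (avg a (r m) f) x) \<longlonglongrightarrow> (LINT y|lborel. a y * (LINT z|lborel. a z * f x))"
    unfolding avg_def[of _ _ "avg a (r m) f" for m]
  proof (rule integral_dominated_convergence[where w="\<lambda>y. \<bar>a y\<bar> * ((LINT y|lborel. \<bar>a y\<bar>) * B)"])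
    show "AE y in lborel. (\<lambda>m. a y * avg a (r m) f (x + r m *\<^sub>R y)) \<longlonglongrightarrow> a y * (LINT z|lborel. a z * f x)"
      by (intro AE_I2 tendsto_intros *)
    show "integrable lborel (\<lambda>y. \<bar>a y\<bar> * ((LINT y|lborel. \<bar>a y\<bar>) * B))" using avg_kernel_integrable by auto
    show "AE y in lborel. norm (a y * avg a (r m) f (x + r m *\<^sub>R y)) \<le> \<bar>a y\<bar> * ((LINT y|lborel. \<bar>a y\<bar>) * B)" for m
      unfolding real_norm_def abs_mult by (intro AE_I2 mult_left_mono avg_bound B) auto
  qed auto
  then show ?thesis by simp
qed

text \<open>The average of an integrable function at scale r is at most M r^(-n) times its L^1 norm,
  uniformly in the point; the outer average keeps this up to the L^1 norm of the kernel.\<close>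

lemma avg_avg_tendsto_large:
  assumes [measurable]: "f \<in> borel_measurable borel" and B: "\<And>x. \<bar>f x\<bar> \<le> B" and int: "integrable lborel f"
    and r: "filterlim r at_top sequentially" "\<And>m. 0 < r m"
  shows "(\<lambda>m. avg a (r m) (avg a (r m) f) x) \<longlonglongrightarrow> 0"
proof -
  define F where "F = (LINT y|lborel. \<bar>f y\<bar>)"
  have F0: "0 \<le> F" by (simp add: F_def)
  have 1: "\<bar>avg a (r m) f u\<bar> \<le> M * r m powr (- real DIM('a)) * F" for m u
  proof -
    have "ennreal \<bar>avg a (r m) f u\<bar> \<le> (\<integral>\<^sup>+y. (if norm (u - y) < K * r m then ennreal (M * r m powr (- real DIM('a)) * \<bar>f y\<bar>) else 0) \<partial>lborel)"
      by (intro avg_le_nn_integral r) auto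
    also have "\<dots> \<le> (\<integral>\<^sup>+y. ennreal (M * r m powr (- real DIM('a)) * \<bar>f y\<bar>) \<partial>lborel)"
      by (intro nn_integral_mono) auto
    also have "\<dots> = ennreal (M * r m powr (- real DIM('a)) * F)"
      using int M by (subst nn_integral_eq_integral) (auto simp: F_def)
    finally show ?thesis using M F0 by (subst (asm) ennreal_le_iff) auto
  qed
  have 2: "\<bar>avg a (r m) (avg a (r m) f) x\<bar> \<le> (LINT y|lborel. \<bar>a y\<bar>) * (M * r m powr (- real DIM('a)) * F)" for m
    by (intro avg_bound 1) auto
  have "(\<lambda>m. r m powr (- real DIM('a))) \<longlonglongrightarrow> 0"
    using r(1) by (intro tendsto_neg_powr) auto
  then have "(\<lambda>m. (LINT y|lborel. \<bar>a y\<bar>) * (M * r m powr (- real DIM('a)) * F)) \<longlonglongrightarrow> (LINT y|lborel. \<bar>a y\<bar>) * (M * 0 * F)"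
    by (intro tendsto_intros)
  then have lim: "(\<lambda>m. (LINT y|lborel. \<bar>a y\<bar>) * (M * r m powr (- real DIM('a)) * F)) \<longlonglongrightarrow> 0"
    by simp
  show ?thesis
  proof (rule Lim_null_comparison[OF _ lim])
    show "\<forall>\<^sub>F m in sequentially. norm (avg a (r m) (avg a (r m) f) x) \<le> (LINT y|lborel. \<bar>a y\<bar>) * (M * r m powr (- real DIM('a)) * F)"
      using 2 by (intro always_eventually allI) simp
  qed
qed

lemma telescope_int: "(\<Sum>j\<in>{- int m..<int m}. Q (j + 1) - Q j) = Q (int m) - Q (- int m)" for Q :: "int \<Rightarrow> real"
proof (induction m)
  case (Suc m)
  have *: "int (Suc m) = int m + 1" "- (int m + 1) = - int m - 1"
    by auto
  have **: "{- int m - 1..<int m + 1} = insert (- int m - 1) (insert (int m) {- int m..<int m})"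
    by auto
  show ?case unfolding * ** by (simp add: Suc)
qed simp

text \<open>Write A r for the average at scale r. With s = r / 2 and g = A s f - A r f, commutation
  gives A s (A s f) - A r (A r f) = A s g + A r g. Here g is controlled by the deviations D at the
  two scales, and the outer averages replace its value at x by integrals over balls, as a bound by
  L^1 norms requires. With a single average the increment would be g itself, at the point x.\<close>

lemma scale_decomposition:
  fixes f :: "'a \<Rightarrow> real"
  assumes cont: "continuous_on UNIV f" and B: "\<And>x. \<bar>f x\<bar> \<le> B" and int: "integrable lborel f"
    and a1: "(LINT y|lborel. a y) = 1"
  defines "r \<equiv> (\<lambda>j::int. 2 powr (- real_of_int j))"
  defines "D \<equiv> (\<lambda>j y. \<bar>f y - avg a (r j) f y\<bar>)"
  shows "ennreal \<bar>f x\<bar> \<le> (\<integral>\<^sup>+j. \<integral>\<^sup>+y. (if norm (x - y) < K * r j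
     then ennreal ((M * 2 powr real DIM('a) + M) * r j powr (- real DIM('a)) * (D j y + D (j + 1) y)) else 0) \<partial>lborel \<partial>count_space UNIV)"
proof -
  let ?n = "real DIM('a)"
  have [measurable]: "f \<in> borel_measurable borel" by (intro borel_measurable_continuous_onI cont)
  have r: "0 < r j" for j by (simp add: r_def)
  have rs: "r (j + 1) = r j / 2" for j by (simp add: r_def powr_diff powr_minus field_simps powr_add)
  define T where "T j = (\<integral>\<^sup>+y. (if norm (x - y) < K * r j
     then ennreal ((M * 2 powr ?n + M) * r j powr (- ?n) * (D j y + D (j + 1) y)) else 0) \<partial>lborel)" for j
  define Q where "Q j = avg a (r j) (avg a (r j) f) x" for j
  let ?I = "LINT y|lborel. \<bar>a y\<bar>"
  have QT: "ennreal \<bar>Q (j + 1) - Q j\<bar> \<le> T j" for j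
  proof -
    define s where "s = r (j + 1)"
    define g where "g y = avg a s f y - avg a (r j) f y" for y
    have [measurable]: "g \<in> borel_measurable borel" unfolding g_def by measurable
    have s: "0 < s" "s \<le> r j" using r[of j] by (auto simp: s_def rs)
    have g: "\<bar>g y\<bar> \<le> D j y + D (j + 1) y" for y
      unfolding g_def D_def s_def by linarith
    have bnd: "\<bar>avg a t f y\<bar> \<le> ?I * B" for t y by (intro avg_bound B) auto
    have "Q (j + 1) - Q j = avg a s g x + avg a (r j) g x"
      unfolding g_def[abs_def] Q_def s_def[symmetric]
      using avg_commute[of f B s "r j" x] B
      by (subst (1 2) avg_diff[OF _ bnd _ bnd]) auto
    then have "ennreal \<bar>Q (j + 1) - Q j\<bar> \<le> ennreal \<bar>avg a s g x\<bar> + ennreal \<bar>avg a (r j) g x\<bar>"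
      by (auto simp flip: ennreal_plus intro!: ennreal_leI)
    also have "\<dots> \<le> (\<integral>\<^sup>+y. (if norm (x - y) < K * s then ennreal (M * s powr (- ?n) * \<bar>g y\<bar>) else 0) \<partial>lborel) +
        (\<integral>\<^sup>+y. (if norm (x - y) < K * r j then ennreal (M * r j powr (- ?n) * \<bar>g y\<bar>) else 0) \<partial>lborel)"
      by (intro add_mono avg_le_nn_integral s r) auto
    also have "\<dots> = (\<integral>\<^sup>+y. (if norm (x - y) < K * s then ennreal (M * s powr (- ?n) * \<bar>g y\<bar>) else 0) +
        (if norm (x - y) < K * r j then ennreal (M * r j powr (- ?n) * \<bar>g y\<bar>) else 0) \<partial>lborel)"
      by (subst nn_integral_add) auto
    also have "\<dots> \<le> T j"
      unfolding T_def
    proof (rule nn_integral_mono)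
      fix y
      \<comment> \<open>Halving the radius costs 2^n in the normalisation, whence M 2^n + M for the
        two outer averages together.\<close>
      have sn: "s powr (- ?n) = 2 powr ?n * r j powr (- ?n)"
        unfolding s_def rs using r[of j] by (simp add: powr_divide powr_minus field_simps)
      have "M * s powr (- ?n) * \<bar>g y\<bar> + M * r j powr (- ?n) * \<bar>g y\<bar> = (M * 2 powr ?n + M) * r j powr (- ?n) * \<bar>g y\<bar>"
        by (simp add: sn algebra_simps)
      also have "\<dots> \<le> (M * 2 powr ?n + M) * r j powr (- ?n) * (D j y + D (j + 1) y)"
        using M g by (intro mult_left_mono) auto
      finally have le: "M * s powr (- ?n) * \<bar>g y\<bar> + M * r j powr (- ?n) * \<bar>g y\<bar> \<le> (M * 2 powr ?n + M) * r j powr (- ?n) * (D j y + D (j + 1) y)" .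
      show "(if norm (x - y) < K * s then ennreal (M * s powr (- ?n) * \<bar>g y\<bar>) else 0) +
        (if norm (x - y) < K * r j then ennreal (M * r j powr (- ?n) * \<bar>g y\<bar>) else 0) \<le>
        (if norm (x - y) < K * r j then ennreal ((M * 2 powr ?n + M) * r j powr (- ?n) * (D j y + D (j + 1) y)) else 0)"
      proof (cases "norm (x - y) < K * r j")
        case True
        have "(if norm (x - y) < K * s then ennreal (M * s powr (- ?n) * \<bar>g y\<bar>) else 0) \<le> ennreal (M * s powr (- ?n) * \<bar>g y\<bar>)"
          by simp
        then have "(if norm (x - y) < K * s then ennreal (M * s powr (- ?n) * \<bar>g y\<bar>) else 0) + ennreal (M * r j powr (- ?n) * \<bar>g y\<bar>) \<le>
          ennreal (M * s powr (- ?n) * \<bar>g y\<bar>) + ennreal (M * r j powr (- ?n) * \<bar>g y\<bar>)"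
          by (rule add_right_mono)
        also have "\<dots> \<le> ennreal ((M * 2 powr ?n + M) * r j powr (- ?n) * (D j y + D (j + 1) y))"
          using M le by (simp flip: ennreal_plus add: ennreal_leI)
        finally show ?thesis using True by simp
      next
        case False
        moreover have "K * s \<le> K * r j" using s K by simp
        ultimately show ?thesis by simp
      qed
    qed
    finally show ?thesis .
  qed
  have le: "ennreal \<bar>Q (int m) - Q (- int m)\<bar> \<le> (\<integral>\<^sup>+j. T j \<partial>count_space UNIV)" for m
  proof -
    have "ennreal \<bar>Q (int m) - Q (- int m)\<bar> = ennreal \<bar>\<Sum>j\<in>{- int m..<int m}. Q (j + 1) - Q j\<bar>"
      by (simp add: telescope_int)
    also have "\<dots> \<le> ennreal (\<Sum>j\<in>{- int m..<int m}. \<bar>Q (j + 1) - Q j\<bar>)"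
      by (intro ennreal_leI sum_abs)
    also have "\<dots> = (\<Sum>j\<in>{- int m..<int m}. ennreal \<bar>Q (j + 1) - Q j\<bar>)"
      by (rule sum_ennreal[symmetric]) auto
    also have "\<dots> \<le> (\<Sum>j\<in>{- int m..<int m}. T j)"
      by (intro sum_mono QT)
    also have "\<dots> = (\<integral>\<^sup>+j. T j \<partial>count_space {- int m..<int m})"
      by (simp add: nn_integral_count_space_finite)
    also have "\<dots> \<le> (\<integral>\<^sup>+j. T j \<partial>count_space UNIV)"
      by (subst nn_integral_count_space_indicator) (auto intro!: nn_integral_mono split: split_indicator)
    finally show ?thesis .
  qed
  have "(\<lambda>m. Q (int m)) \<longlonglongrightarrow> (LINT y|lborel. a y) * ((LINT y|lborel. a y) * f x)"
    unfolding Q_def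
  proof (rule avg_avg_tendsto_small[OF cont B])
    have "(\<lambda>m. (1 / 2) ^ m) \<longlonglongrightarrow> (0::real)" by (rule LIMSEQ_realpow_zero) auto
    also have "(\<lambda>m. (1 / 2) ^ m) = (\<lambda>m. r (int m))"
      by (simp add: r_def fun_eq_iff powr_minus powr_realpow power_one_over inverse_eq_divide)
    finally show "(\<lambda>m. r (int m)) \<longlonglongrightarrow> 0" .
  qed
  then have 1: "(\<lambda>m. Q (int m)) \<longlonglongrightarrow> f x" by (simp add: a1)
  have 2: "(\<lambda>m. Q (- int m)) \<longlonglongrightarrow> 0"
    unfolding Q_def
  proof (rule avg_avg_tendsto_large[OF _ B int])
    have "filterlim (\<lambda>m. 2 ^ m :: real) at_top sequentially"
      by (rule filterlim_at_infinity_imp_filterlim_at_top[OF filterlim_realpow_sequentially_gt1]) auto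
    also have "(\<lambda>m. 2 ^ m :: real) = (\<lambda>m. r (- int m))"
      by (simp add: r_def fun_eq_iff powr_realpow)
    finally show "filterlim (\<lambda>m. r (- int m)) at_top sequentially" .
  qed (auto simp: r)
  have "(\<lambda>m. ennreal \<bar>Q (int m) - Q (- int m)\<bar>) \<longlonglongrightarrow> ennreal \<bar>f x - 0\<bar>"
    by (intro tendsto_ennrealI tendsto_rabs tendsto_diff 1 2)
  then have "ennreal \<bar>f x - 0\<bar> \<le> (\<integral>\<^sup>+j. T j \<partial>count_space UNIV)"
    by (rule LIMSEQ_le_const2) (use le in auto)
  then show ?thesis by (simp add: T_def)
qed

end

section \<open>Averages and higher order differences\<close>

text \<open>The coefficient of f x is recorded because it isolates f x from the shifts by i h with i
  \<ge> 1, out of which the averaging kernel is built.\<close>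

lemma fwd_diff_funpow_expand:
  "\<exists>c :: nat \<Rightarrow> real. c 0 = (- 1) ^ k \<and>
     (\<forall>h (f :: 'a::euclidean_space \<Rightarrow> real) x. (fwd_diff h ^^ k) f x = (\<Sum>i\<le>k. c i * f (x + real i *\<^sub>R h)))"
proof (induction k)
  case 0
  show ?case by (intro exI[of _ "\<lambda>_. 1"]) simp
next
  case (Suc k)
  then obtain c :: "nat \<Rightarrow> real" where c: "c 0 = (- 1) ^ k"
    "\<And>h (f :: 'a \<Rightarrow> real) x. (fwd_diff h ^^ k) f x = (\<Sum>i\<le>k. c i * f (x + real i *\<^sub>R h))"
    by blast
  define c' where "c' i = (if i = 0 then 0 else c (i - 1)) - (if i \<le> k then c i else 0)" for i
  have "(fwd_diff h ^^ Suc k) f x = (\<Sum>i\<le>Suc k. c' i * f (x + real i *\<^sub>R h))" for h and f :: "'a \<Rightarrow> real" and x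
  proof -
    have "(fwd_diff h ^^ Suc k) f x = (\<Sum>i\<le>k. c i * f (x + h + real i *\<^sub>R h)) - (\<Sum>i\<le>k. c i * f (x + real i *\<^sub>R h))"
      by (simp add: fwd_diff_def c(2))
    also have "(\<Sum>i\<le>k. c i * f (x + h + real i *\<^sub>R h)) = (\<Sum>i\<le>Suc k. (if i = 0 then 0 else c (i - 1)) * f (x + real i *\<^sub>R h))"
      by (subst sum.atMost_Suc_shift) (simp add: algebra_simps)
    also have "(\<Sum>i\<le>k. c i * f (x + real i *\<^sub>R h)) = (\<Sum>i\<le>Suc k. (if i \<le> k then c i else 0) * f (x + real i *\<^sub>R h))"
      by simp
    also have "(\<Sum>i\<le>Suc k. (if i = 0 then 0 else c (i - 1)) * f (x + real i *\<^sub>R h)) - \<dots> = (\<Sum>i\<le>Suc k. c' i * f (x + real i *\<^sub>R h))"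
      by (simp only: sum_subtractf[symmetric] c'_def left_diff_distrib)
    finally show ?thesis .
  qed
  moreover have "c' 0 = (- 1) ^ Suc k" by (simp add: c'_def c(1))
  ultimately show ?case by blast
qed

text \<open>
  The averaging kernel is \<open>a\<close> with \<open>f x - (a * f)(x)\<close> equal, up to sign, to the mean of the
  \<open>k\<close>-th differences over the unit ball.
\<close>

lemma exists_difference_kernel:
  assumes "0 < k"
  obtains a :: "'a::euclidean_space \<Rightarrow> real" and M :: real where
    "a \<in> borel_measurable borel" "0 < M" "\<And>y. \<bar>a y\<bar> \<le> (if norm y < real k then M else 0)" "(LINT y|lborel. a y) = 1"
    "\<And>f B r x. f \<in> borel_measurable borel \<Longrightarrow> (\<And>x. \<bar>f x\<bar> \<le> B) \<Longrightarrow>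
       ennreal \<bar>f x - avg a r f x\<bar> \<le> (\<integral>\<^sup>+h. (if norm h < 1 then ennreal (1 / unit_ball_vol (real DIM('a)) * \<bar>(fwd_diff (r *\<^sub>R h) ^^ k) f x\<bar>) else 0) \<partial>(lborel :: 'a measure))"
proof -
  let ?n = "real DIM('a)"
  define V where "V = unit_ball_vol ?n"
  have V: "0 < V" by (simp add: V_def)
  obtain c :: "nat \<Rightarrow> real" where c: "c 0 = (- 1) ^ k"
    "\<And>h (f :: 'a \<Rightarrow> real) x. (fwd_diff h ^^ k) f x = (\<Sum>i\<le>k. c i * f (x + real i *\<^sub>R h))"
    using fwd_diff_funpow_expand[of k, where 'a='a] by blast
  \<comment> \<open>The sign is chosen so that the weighted shifts sum to f x minus a signed k-th
    difference.\<close>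
  define \<kappa> where "\<kappa> i = - ((- 1) ^ k * c i)" for i
  have diff: "(\<Sum>i\<in>{1..k}. \<kappa> i * f (x + real i *\<^sub>R h)) = f x - (- 1) ^ k * (fwd_diff h ^^ k) f x" for f :: "'a \<Rightarrow> real" and x h
  proof -
    have "(fwd_diff h ^^ k) f x = c 0 * f x + (\<Sum>i\<in>{1..k}. c i * f (x + real i *\<^sub>R h))"
      by (simp add: c(2) atMost_atLeast0 sum.atLeast_Suc_atMost)
    then have "(- 1) ^ k * (fwd_diff h ^^ k) f x = f x - (\<Sum>i\<in>{1..k}. \<kappa> i * f (x + real i *\<^sub>R h))"
      by (simp add: c(1) distrib_left \<kappa>_def sum_distrib_left sum_negf mult.assoc power_mult_distrib[symmetric] flip: mult.assoc)
    then show ?thesis by simp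
  qed
  \<comment> \<open>A difference of positive order kills constants, so these weights sum to 1, which
    will be the integral of the kernel.\<close>
  have \<kappa>1: "(\<Sum>i\<in>{1..k}. \<kappa> i) = 1"
  proof -
    have "(fwd_diff h ^^ k) (\<lambda>_. 1) x = 0" for h x :: 'a
    proof -
      have "(fwd_diff h ^^ m) (\<lambda>_. 0) x = 0" for m and x :: 'a
        by (induction m arbitrary: x) (simp_all add: fwd_diff_def)
      moreover have "fwd_diff h (\<lambda>_. 1) = (\<lambda>_. 0)"
        by (simp add: fwd_diff_def)
      ultimately show ?thesis
        using assms by (cases k) (simp_all add: funpow_Suc_right del: funpow.simps(2))
    qed
    then show ?thesis using diff[of "\<lambda>_. 1" 0 0] by simp
  qed
  \<comment> \<open>A shift by i h with h in the unit ball becomes, under y = i h, a normalised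
    indicator of the ball of radius i. The largest of these radii is k, which bounds the
    support.\<close>
  define a where "a y = (\<Sum>i\<in>{1..k}. \<kappa> i / V * (if norm y < real i then real i powr (- ?n) else 0))" for y :: 'a
  have a[measurable]: "a \<in> borel_measurable borel" unfolding a_def by measurable
  define M where "M = (\<Sum>i\<in>{1..k}. \<bar>\<kappa> i / V\<bar>) + 1"
  have M: "0 < M" by (simp add: M_def add_nonneg_pos sum_nonneg)
  have aM: "\<bar>a y\<bar> \<le> (if norm y < real k then M else 0)" for y
  proof (cases "norm y < real k")
    case True
    have "\<bar>a y\<bar> \<le> (\<Sum>i\<in>{1..k}. \<bar>\<kappa> i / V * (if norm y < real i then real i powr (- ?n) else 0)\<bar>)"
      unfolding a_def by (rule sum_abs)
    also have "\<dots> \<le> (\<Sum>i\<in>{1..k}. \<bar>\<kappa> i / V\<bar> * 1)"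
    proof (rule sum_mono)
      fix i assume i: "i \<in> {1..k}"
      then have "real i powr (- ?n) \<le> 1 powr (- ?n)" by (intro powr_mono2') auto
      then show "\<bar>\<kappa> i / V * (if norm y < real i then real i powr (- ?n) else 0)\<bar> \<le> \<bar>\<kappa> i / V\<bar> * 1"
        unfolding abs_mult by (intro mult_left_mono) auto
    qed
    finally show ?thesis using True by (simp add: M_def)
  next
    case False
    then have "a y = 0" unfolding a_def by (intro sum.neutral) auto
    with False show ?thesis by simp
  qed
  have ball: "integrable lborel (\<lambda>h. if norm h < 1 then g h else 0 :: real)"
    if [measurable]: "g \<in> borel_measurable borel" and "\<And>h. \<bar>g h\<bar> \<le> B" for g :: "'a \<Rightarrow> real" and B
  proof (rule integrableI_bounded_set[where A="ball 0 1" and B=B])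
    show "emeasure lborel (ball (0::'a) 1) < \<infinity>" by (intro emeasure_bounded_finite) auto
    show "AE x\<in>ball 0 1 in lborel. norm (if norm x < 1 then g x else 0) \<le> B"
      using that(2) by auto
  qed auto
  have avg: "avg a r f x = (LINT h|lborel. (if norm h < 1 then 1 / V * (f x - (- 1) ^ k * (fwd_diff (r *\<^sub>R h) ^^ k) f x) else 0))"
    if [measurable]: "f \<in> borel_measurable borel" and B: "\<And>x. \<bar>f x\<bar> \<le> B" for f :: "'a \<Rightarrow> real" and B r x
  proof -
    have int: "integrable lborel (\<lambda>h. if norm h < 1 then \<kappa> i / V * f (x + real i *\<^sub>R r *\<^sub>R h) else 0)" for i
    proof (rule ball)
      show "\<bar>\<kappa> i / V * f (x + real i *\<^sub>R r *\<^sub>R h)\<bar> \<le> \<bar>\<kappa> i / V\<bar> * B" for h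
        unfolding abs_mult by (intro mult_left_mono B) auto
    qed measurable
    have scale: "(LINT y|lborel. \<kappa> i / V * (if norm y < real i then real i powr (- ?n) else 0) * f (x + r *\<^sub>R y)) =
      (LINT h|lborel. (if norm h < 1 then \<kappa> i / V * f (x + real i *\<^sub>R r *\<^sub>R h) else 0))" if "i \<in> {1..k}" for i
    proof -
      have i: "0 < real i" using that by simp
      have "(LINT y|lborel. \<kappa> i / V * (if norm y < real i then real i powr (- ?n) else 0) * f (x + r *\<^sub>R y)) =
        real i ^ DIM('a) *\<^sub>R (LINT h|lborel. \<kappa> i / V * (if norm (real i *\<^sub>R h) < real i then real i powr (- ?n) else 0) * f (x + r *\<^sub>R real i *\<^sub>R h))"
        by (rule integral_lborel_scale) (use i in auto)
      also have "\<dots> = (LINT h|lborel. real i ^ DIM('a) * (\<kappa> i / V * (if norm (real i *\<^sub>R h) < real i then real i powr (- ?n) else 0) * f (x + r *\<^sub>R real i *\<^sub>R h)))"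
        by simp
      also have "\<dots> = (LINT h|lborel. (if norm h < 1 then \<kappa> i / V * f (x + real i *\<^sub>R r *\<^sub>R h) else 0))"
        using i by (intro Bochner_Integration.integral_cong) (auto simp: powr_minus powr_realpow mult.commute)
      finally show ?thesis .
    qed
    have int': "integrable lborel (\<lambda>y. \<kappa> i / V * (if norm y < real i then real i powr (- ?n) else 0) * f (x + r *\<^sub>R y))" for i
    proof (rule integrableI_bounded_set[where A="ball 0 (real i)" and B="\<bar>\<kappa> i / V\<bar> * (real i powr (- ?n)) * B"])
      show "AE y\<in>ball 0 (real i) in lborel. norm (\<kappa> i / V * (if norm y < real i then real i powr (- ?n) else 0) * f (x + r *\<^sub>R y)) \<le> \<bar>\<kappa> i / V\<bar> * (real i powr (- ?n)) * B"
        using V B by (intro AE_I2 impI) (auto simp: abs_mult intro!: mult_left_mono divide_right_mono)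
      show "emeasure lborel (ball (0::'a) (real i)) < \<infinity>" by (intro emeasure_bounded_finite) auto
    qed auto
    have "avg a r f x = (LINT y|lborel. (\<Sum>i\<in>{1..k}. \<kappa> i / V * (if norm y < real i then real i powr (- ?n) else 0) * f (x + r *\<^sub>R y)))"
      by (simp add: avg_def a_def sum_distrib_right)
    also have "\<dots> = (\<Sum>i\<in>{1..k}. (LINT h|lborel. (if norm h < 1 then \<kappa> i / V * f (x + real i *\<^sub>R r *\<^sub>R h) else 0)))"
      using int' scale by (subst Bochner_Integration.integral_sum) (auto intro: sum.cong)
    also have "\<dots> = (LINT h|lborel. (\<Sum>i\<in>{1..k}. (if norm h < 1 then \<kappa> i / V * f (x + real i *\<^sub>R r *\<^sub>R h) else 0)))"
      using int by (subst Bochner_Integration.integral_sum) auto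
    also have "\<dots> = (LINT h|lborel. (if norm h < 1 then 1 / V * (f x - (- 1) ^ k * (fwd_diff (r *\<^sub>R h) ^^ k) f x) else 0))"
      unfolding diff[symmetric] by (intro Bochner_Integration.integral_cong) (auto simp: sum_distrib_left intro!: sum.cong)
    finally show ?thesis .
  qed
  have Vint: "(LINT h|(lborel :: 'a measure). (if norm h < 1 then 1 / V * s else 0)) = s" for s
  proof -
    have "(LINT h|(lborel :: 'a measure). (if norm h < 1 then 1 / V * s else 0)) = (LINT h|(lborel :: 'a measure). (1 / V * s) * indicator (ball 0 1) h)"
      by (intro Bochner_Integration.integral_cong) (auto split: split_indicator)
    also have "\<dots> = 1 / V * s * measure lborel (ball (0::'a) 1)" by simp
    also have "measure lborel (ball (0::'a) 1) = V" by (simp add: content_ball V_def)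
    also have "1 / V * s * V = s" using V by simp
    finally show ?thesis .
  qed
  show thesis
  proof (rule that[OF a M aM])
    \<comment> \<open>The integral of a is read off from the formula for \<open>avg\<close> applied
      to the constant 1 at scale 0.\<close>
    have d: "1 - (- 1) ^ k * (fwd_diff h ^^ k) (\<lambda>_. 1) 0 = (\<Sum>i\<in>{1..k}. \<kappa> i)" for h :: 'a
      using diff[of "\<lambda>_. 1" 0 h] by simp
    have "avg a 0 (\<lambda>_. 1) 0 = (LINT h|(lborel :: 'a measure). (if norm h < 1 then 1 / V * (1 - (- 1) ^ k * (fwd_diff (0 *\<^sub>R h) ^^ k) (\<lambda>_. 1) 0) else 0))"
      by (rule avg[where B=1]) auto
    then show "(LINT y|lborel. a y) = 1"
      unfolding d Vint \<kappa>1 by (simp add: avg_def)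
  next
    fix f and B r :: real and x :: 'a
    assume f[measurable]: "f \<in> borel_measurable borel" and B: "\<And>x :: 'a. \<bar>f x\<bar> \<le> B"
    let ?d = "\<lambda>h. if norm h < 1 then 1 / V * ((- 1) ^ k * (fwd_diff (r *\<^sub>R h) ^^ k) f x) else 0"
    have m: "(\<lambda>h. (fwd_diff (r *\<^sub>R h) ^^ k) f x) \<in> borel_measurable borel"
      unfolding c(2) by measurable
    note [measurable] = m
    have bd: "\<bar>1 / V * ((- 1) ^ k * (fwd_diff (r *\<^sub>R h) ^^ k) f x)\<bar> \<le> 1 / V * ((\<Sum>i\<le>k. \<bar>c i\<bar>) * B)" for h
    proof -
      have "\<bar>(fwd_diff (r *\<^sub>R h) ^^ k) f x\<bar> \<le> (\<Sum>i\<le>k. \<bar>c i * f (x + real i *\<^sub>R r *\<^sub>R h)\<bar>)"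
        unfolding c(2) by (rule sum_abs)
      also have "\<dots> \<le> (\<Sum>i\<le>k. \<bar>c i\<bar> * B)"
        unfolding abs_mult by (intro sum_mono mult_left_mono B) auto
      also have "\<dots> = (\<Sum>i\<le>k. \<bar>c i\<bar>) * B" by (rule sum_distrib_right[symmetric])
      finally show ?thesis using V by (simp add: abs_mult power_abs divide_right_mono)
    qed
    have int: "integrable lborel ?d"
      by (rule ball[OF _ bd]) measurable
    have "f x - avg a r f x = (LINT h|(lborel :: 'a measure). (if norm h < 1 then 1 / V * f x else 0)) - (LINT h|lborel. (if norm h < 1 then 1 / V * (f x - (- 1) ^ k * (fwd_diff (r *\<^sub>R h) ^^ k) f x) else 0))"
      unfolding Vint avg[OF f B] ..
    also have "\<dots> = (LINT h|(lborel :: 'a measure). ?d h)"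
    proof (subst Bochner_Integration.integral_diff[symmetric])
      show "integrable lborel (\<lambda>h :: 'a. if norm h < 1 then 1 / V * f x else 0)"
        by (rule ball[of _ "\<bar>1 / V * f x\<bar>"]) auto
      then have "integrable lborel (\<lambda>h. (if norm h < 1 then 1 / V * f x else 0) - ?d h)"
        using int by (rule Bochner_Integration.integrable_diff)
      also have "(\<lambda>h. (if norm h < 1 then 1 / V * f x else 0) - ?d h) = (\<lambda>h. if norm h < 1 then 1 / V * (f x - (- 1) ^ k * (fwd_diff (r *\<^sub>R h) ^^ k) f x) else 0)"
        by (auto simp: fun_eq_iff right_diff_distrib)
      finally show "integrable lborel (\<lambda>h. if norm h < 1 then 1 / V * (f x - (- 1) ^ k * (fwd_diff (r *\<^sub>R h) ^^ k) f x) else 0)" .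
    qed (auto intro!: Bochner_Integration.integral_cong simp: right_diff_distrib)
    finally have "\<bar>f x - avg a r f x\<bar> = norm (LINT h|(lborel :: 'a measure). ?d h)" by simp
    then have "ennreal \<bar>f x - avg a r f x\<bar> \<le> (\<integral>\<^sup>+h. ennreal (norm (?d h)) \<partial>lborel)"
      using integral_norm_bound_ennreal[OF int] by simp
    also have "\<dots> = (\<integral>\<^sup>+h. (if norm h < 1 then ennreal (1 / V * \<bar>(fwd_diff (r *\<^sub>R h) ^^ k) f x\<bar>) else 0) \<partial>lborel)"
      using V by (intro nn_integral_cong) (auto simp: abs_mult power_abs)
    finally show "ennreal \<bar>f x - avg a r f x\<bar> \<le> (\<integral>\<^sup>+h. (if norm h < 1 then ennreal (1 / unit_ball_vol ?n * \<bar>(fwd_diff (r *\<^sub>R h) ^^ k) f x\<bar>) else 0) \<partial>(lborel :: 'a measure))"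
      unfolding V_def .
  qed
qed

text \<open>The condition selects all j up to some \<open>j0\<close>, so the series is geometric and
  dominated by its largest term, which is at most \<rho>^(-s).\<close>

lemma nn_integral_geometric_scales:
  assumes s: "0 < s" and \<rho>: "0 < \<rho>"
  shows "(\<integral>\<^sup>+j. (if \<rho> < 2 powr (- of_int j) then ennreal (2 powr (s * of_int j)) else 0) \<partial>count_space (UNIV :: int set))
    \<le> ennreal (1 / (1 - 2 powr (- s)) * \<rho> powr (- s))"
proof -
  \<comment> \<open>The largest j with \<rho> < 2^(-j); the inequality is strict, hence the ceiling
    minus 1.\<close>
  define j0 :: int where "j0 = \<lceil>- log 2 \<rho>\<rceil> - 1"
  have iff: "\<rho> < 2 powr (- of_int j) \<longleftrightarrow> j \<le> j0" for j :: int
  proof -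
    have "\<rho> < 2 powr (- of_int j) \<longleftrightarrow> log 2 \<rho> < - of_int j"
      using \<rho> by (subst less_powr_iff) auto
    also have "\<dots> \<longleftrightarrow> of_int j < - log 2 \<rho>" by linarith
    also have "\<dots> \<longleftrightarrow> j \<le> j0" by (simp add: j0_def less_ceiling_iff[symmetric] zle_diff1_eq)
    finally show ?thesis .
  qed
  have bij: "bij_betw (\<lambda>i. j0 - int i) UNIV {..j0}"
    by (rule bij_betwI[where g="\<lambda>j. nat (j0 - j)"]) auto
  have geo: "2 powr (- s) < (1 :: real)" using s powr_less_mono[of "- s" 0 "2 :: real"] by simp
  have j0: "2 powr (s * of_int j0) \<le> \<rho> powr (- s)"
  proof -
    have "\<rho> < 2 powr (- of_int j0)" by (simp add: iff)
    then have "(2 powr (- of_int j0)) powr (- s) \<le> \<rho> powr (- s)"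
      using \<rho> s by (intro powr_mono2') auto
    then show ?thesis by (simp add: powr_powr mult.commute)
  qed
  have "(\<integral>\<^sup>+j. (if \<rho> < 2 powr (- of_int j) then ennreal (2 powr (s * of_int j)) else 0) \<partial>count_space (UNIV :: int set)) =
    (\<integral>\<^sup>+j. ennreal (2 powr (s * of_int j)) \<partial>count_space {..j0})"
    by (subst nn_integral_count_space_indicator) (auto simp: iff intro!: nn_integral_cong split: split_indicator)
  also have "\<dots> = (\<integral>\<^sup>+i. ennreal (2 powr (s * of_int (j0 - int i))) \<partial>count_space UNIV)"
    by (rule nn_integral_bij_count_space[OF bij, symmetric])
  also have "\<dots> = (\<Sum>i. ennreal (2 powr (s * of_int j0) * (2 powr (- s)) ^ i))"
    by (subst nn_integral_count_space_nat) (simp add: powr_realpow[symmetric] powr_powr powr_add[symmetric] algebra_simps)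
  also have "\<dots> = ennreal (2 powr (s * of_int j0) * (1 / (1 - 2 powr (- s))))"
    using geo by (subst suminf_ennreal2) (auto intro!: summable_mult summable_geometric simp: suminf_mult suminf_geometric)
  also have "\<dots> \<le> ennreal (1 / (1 - 2 powr (- s)) * \<rho> powr (- s))"
    using j0 geo by (intro ennreal_leI) (simp add: divide_right_mono)
  finally show ?thesis .
qed

lemma test_norm_1:
  fixes f :: "'a::euclidean_space \<Rightarrow> real"
  shows "test_norm \<beta> 1 f = (\<integral>\<^sup>+h. (\<integral>\<^sup>+y. ennreal \<bar>(fwd_diff h ^^ (1 + nat \<lfloor>\<beta>\<rfloor>)) f y\<bar> \<partial>lborel) / ennreal (norm h powr (real DIM('a) + \<beta>)) \<partial>lborel)"
  by (simp add: test_norm_def Lp_norm_def)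

text \<open>The L^1 norm of D at scale j is at most a constant times the mean over |h| < 2^(-j) of
  the L^1 norms of the differences with step h. Weighted by 2^(\<beta> j) and summed, a fixed h
  collects the scales with 2^(-j) > |h|, a geometric series of size |h|^(-n - \<beta>), which is the
  kernel of the difference norm.\<close>

lemma difference_scale_sum:
  fixes f :: "'a::euclidean_space \<Rightarrow> real" and D :: "int \<Rightarrow> 'a \<Rightarrow> real"
  assumes \<beta>: "0 < \<beta>" and f[measurable]: "f \<in> borel_measurable borel"
    and D: "\<And>j y. ennreal (D j y) \<le> (\<integral>\<^sup>+h. (if norm h < 1 then ennreal (c * \<bar>(fwd_diff (2 powr (- of_int j) *\<^sub>R h) ^^ (1 + nat \<lfloor>\<beta>\<rfloor>)) f y\<bar>) else 0) \<partial>(lborel :: 'a measure))"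
    and c: "0 < c"
  shows "(\<integral>\<^sup>+j. ennreal (2 powr (\<beta> * of_int j)) * (\<integral>\<^sup>+y. ennreal (D j y) \<partial>lborel) \<partial>count_space UNIV)
    \<le> ennreal (c / (1 - 2 powr (- (\<beta> + real DIM('a))))) * test_norm \<beta> 1 f"
proof -
  let ?n = "real DIM('a)" and ?k = "1 + nat \<lfloor>\<beta>\<rfloor>"
  obtain co :: "nat \<Rightarrow> real" where co:
    "\<And>h (f :: 'a \<Rightarrow> real) x. (fwd_diff h ^^ ?k) f x = (\<Sum>i\<le>?k. co i * f (x + real i *\<^sub>R h))"
    using fwd_diff_funpow_expand[of ?k, where 'a='a] by blast
  define \<Delta> where "\<Delta> = (\<lambda>h y. \<bar>(fwd_diff h ^^ ?k) f y\<bar>)"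
  have \<Delta>[measurable]: "(\<lambda>(h, y). \<Delta> h y) \<in> borel_measurable (borel \<Otimes>\<^sub>M borel)"
    unfolding \<Delta>_def co by measurable
  have \<Delta>2[measurable]: "(\<lambda>(y, h). \<Delta> h y) \<in> borel_measurable (borel \<Otimes>\<^sub>M borel)"
    unfolding \<Delta>_def co by measurable
  define N where "N h = (\<integral>\<^sup>+y. ennreal (\<Delta> h y) \<partial>lborel)" for h
  have [measurable]: "N \<in> borel_measurable borel" unfolding N_def by measurable
  have geo: "2 powr (- (\<beta> + ?n)) < (1 :: real)" using \<beta> powr_less_mono[of "- (\<beta> + ?n)" 0 "2 :: real"] by simp
  have DN: "(\<integral>\<^sup>+y. ennreal (D j y) \<partial>lborel) \<le> ennreal (c * 2 powr (?n * of_int j)) * (\<integral>\<^sup>+h. (if norm h < 2 powr (- of_int j) then N h else 0) \<partial>lborel)" for j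
  proof -
    define r where "r = 2 powr (- real_of_int j)"
    have r: "0 < r" by (simp add: r_def)
    define g where "g u = (if norm u < r then ennreal c * N u else 0)" for u
    have [measurable]: "g \<in> borel_measurable borel" unfolding g_def by measurable
    have "(\<integral>\<^sup>+y. ennreal (D j y) \<partial>lborel) \<le> (\<integral>\<^sup>+y. \<integral>\<^sup>+h. (if norm h < 1 then ennreal c * ennreal (\<Delta> (r *\<^sub>R h) y) else 0) \<partial>lborel \<partial>lborel)"
    proof (rule nn_integral_mono)
      fix y
      have eq: "(if norm h < 1 then ennreal (c * \<bar>(fwd_diff (r *\<^sub>R h) ^^ ?k) f y\<bar>) else 0) =
        (if norm h < 1 then ennreal c * ennreal (\<Delta> (r *\<^sub>R h) y) else 0)" for h
        using c by (simp add: \<Delta>_def ennreal_mult)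
      show "ennreal (D j y) \<le> (\<integral>\<^sup>+h. (if norm h < 1 then ennreal c * ennreal (\<Delta> (r *\<^sub>R h) y) else 0) \<partial>lborel)"
        using D[of j y] unfolding r_def[symmetric] eq .
    qed
    also have "\<dots> = (\<integral>\<^sup>+h. \<integral>\<^sup>+y. (if norm h < 1 then ennreal c * ennreal (\<Delta> (r *\<^sub>R h) y) else 0) \<partial>lborel \<partial>lborel)"
    proof (rule nn_integral_swap)
      have "(\<lambda>(y, h). if norm h < 1 then ennreal c * ennreal (\<Delta> (r *\<^sub>R h) y) else 0) \<in> borel_measurable (borel \<Otimes>\<^sub>M borel)"
        by measurable
      then show "(\<lambda>(y, h). if norm h < 1 then ennreal c * ennreal (\<Delta> (r *\<^sub>R h) y) else 0) \<in> borel_measurable borel"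
        by (simp only: borel_prod)
    qed
    also have "\<dots> = (\<integral>\<^sup>+h. g (0 + r *\<^sub>R h) \<partial>lborel)"
      using r by (intro nn_integral_cong) (auto simp: g_def N_def nn_integral_cmult)
    also have "\<dots> = ennreal (r powr (- ?n)) * (\<integral>\<^sup>+h. g h \<partial>lborel)"
      by (rule nn_integral_lborel_scale) (use r in auto)
    also have "(\<integral>\<^sup>+h. g h \<partial>lborel) = ennreal c * (\<integral>\<^sup>+h. (if norm h < r then N h else 0) \<partial>lborel)"
      by (subst nn_integral_cmult[symmetric]) (auto simp: g_def intro!: nn_integral_cong)
    also have "ennreal (r powr (- ?n)) * \<dots> = ennreal (c * 2 powr (?n * of_int j)) * (\<integral>\<^sup>+h. (if norm h < r then N h else 0) \<partial>lborel)"
      using c by (simp add: r_def powr_powr ennreal_mult mult_ac)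
    finally show ?thesis by (simp add: r_def)
  qed
  have "(\<integral>\<^sup>+j. ennreal (2 powr (\<beta> * of_int j)) * (\<integral>\<^sup>+y. ennreal (D j y) \<partial>lborel) \<partial>count_space UNIV) \<le>
    (\<integral>\<^sup>+j. \<integral>\<^sup>+h. ennreal c * (N h * (if norm h < 2 powr (- of_int j) then ennreal (2 powr ((\<beta> + ?n) * of_int j)) else 0)) \<partial>lborel \<partial>count_space UNIV)"
  proof (rule nn_integral_mono)
    fix j :: int
    have "ennreal (2 powr (\<beta> * of_int j)) * (\<integral>\<^sup>+y. ennreal (D j y) \<partial>lborel) \<le>
      ennreal (2 powr (\<beta> * of_int j)) * (ennreal (c * 2 powr (?n * of_int j)) * (\<integral>\<^sup>+h. (if norm h < 2 powr (- of_int j) then N h else 0) \<partial>lborel))"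
      by (intro mult_left_mono DN) auto
    also have "\<dots> = ennreal (c * 2 powr ((\<beta> + ?n) * of_int j)) * (\<integral>\<^sup>+h. (if norm h < 2 powr (- of_int j) then N h else 0) \<partial>lborel)"
    proof -
      have "ennreal (2 powr (\<beta> * of_int j)) * ennreal (c * 2 powr (?n * of_int j)) = ennreal (c * 2 powr ((\<beta> + ?n) * of_int j))"
        using c by (subst ennreal_mult[symmetric]) (auto simp: powr_add distrib_right)
      then show ?thesis by (simp only: mult.assoc[symmetric])
    qed
    also have "\<dots> = (\<integral>\<^sup>+h. ennreal c * (N h * (if norm h < 2 powr (- of_int j) then ennreal (2 powr ((\<beta> + ?n) * of_int j)) else 0)) \<partial>lborel)"
      using c by (subst nn_integral_cmult[symmetric]) (auto simp: ennreal_mult mult_ac intro!: nn_integral_cong)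
    finally show "ennreal (2 powr (\<beta> * of_int j)) * (\<integral>\<^sup>+y. ennreal (D j y) \<partial>lborel) \<le> \<dots>" .
  qed
  also have "\<dots> = (\<integral>\<^sup>+h. \<integral>\<^sup>+j. ennreal c * (N h * (if norm h < 2 powr (- of_int j) then ennreal (2 powr ((\<beta> + ?n) * of_int j)) else 0)) \<partial>count_space UNIV \<partial>lborel)"
    by (rule nn_integral_swap_count_space_int[symmetric]) measurable
  also have "\<dots> = (\<integral>\<^sup>+h. ennreal c * (N h * (\<integral>\<^sup>+j. (if norm h < 2 powr (- of_int j) then ennreal (2 powr ((\<beta> + ?n) * of_int j)) else 0) \<partial>count_space UNIV)) \<partial>lborel)"
    by (simp add: nn_integral_cmult)
  also have "\<dots> \<le> (\<integral>\<^sup>+h. ennreal (c / (1 - 2 powr (- (\<beta> + ?n)))) * (N h / ennreal (norm h powr (?n + \<beta>))) \<partial>lborel)"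
  proof (rule nn_integral_mono_AE)
    show "AE h in lborel. ennreal c * (N h * (\<integral>\<^sup>+j. (if norm h < 2 powr (- of_int j) then ennreal (2 powr ((\<beta> + ?n) * of_int j)) else 0) \<partial>count_space UNIV)) \<le>
      ennreal (c / (1 - 2 powr (- (\<beta> + ?n)))) * (N h / ennreal (norm h powr (?n + \<beta>)))"
      using AE_lborel_singleton[of 0]
    proof eventually_elim
      case (elim h)
      then have h: "0 < norm h" by simp
      have "ennreal c * (N h * (\<integral>\<^sup>+j. (if norm h < 2 powr (- of_int j) then ennreal (2 powr ((\<beta> + ?n) * of_int j)) else 0) \<partial>count_space UNIV)) \<le>
        ennreal c * (N h * ennreal (1 / (1 - 2 powr (- (\<beta> + ?n))) * norm h powr (- (\<beta> + ?n))))"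
        using \<beta> h by (intro mult_left_mono nn_integral_geometric_scales) auto
      also have "1 / (1 - 2 powr (- (\<beta> + ?n))) * norm h powr (- (\<beta> + ?n)) = 1 / (1 - 2 powr (- (\<beta> + ?n))) * inverse (norm h powr (?n + \<beta>))"
        unfolding powr_minus[symmetric] by (simp only: add.commute)
      also have "ennreal c * (N h * ennreal (1 / (1 - 2 powr (- (\<beta> + ?n))) * inverse (norm h powr (?n + \<beta>)))) =
        ennreal (c / (1 - 2 powr (- (\<beta> + ?n)))) * (N h / ennreal (norm h powr (?n + \<beta>)))"
      proof -
        have "ennreal (1 / (1 - 2 powr (- (\<beta> + ?n))) * inverse (norm h powr (?n + \<beta>))) =
          ennreal (1 / (1 - 2 powr (- (\<beta> + ?n)))) * inverse (ennreal (norm h powr (?n + \<beta>)))"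
          using geo h by (subst inverse_ennreal) (auto simp: ennreal_mult[symmetric])
        moreover have "ennreal (c / (1 - 2 powr (- (\<beta> + ?n)))) = ennreal c * ennreal (1 / (1 - 2 powr (- (\<beta> + ?n))))"
          using geo c by (simp add: ennreal_mult[symmetric])
        ultimately show ?thesis by (simp add: divide_ennreal_def mult_ac)
      qed
      finally show ?case .
    qed
  qed
  also have "\<dots> = ennreal (c / (1 - 2 powr (- (\<beta> + ?n)))) * test_norm \<beta> 1 f"
  proof -
    have "test_norm \<beta> 1 f = (\<integral>\<^sup>+h. N h / ennreal (norm h powr (?n + \<beta>)) \<partial>lborel)"
      unfolding test_norm_1 N_def \<Delta>_def ..
    then show ?thesis by (simp add: nn_integral_cmult)
  qed
  finally show ?thesis .
qed

text \<open>G j adds the deviations of f from its averages at the scales 2^(-j) and 2^(-j - 1). The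
  constants are fixed before f, because the passage to the completion needs them uniform.\<close>

lemma test_function_scale_decomposition:
  assumes \<beta>: "0 < \<beta>"
  shows "\<exists>M>0. \<exists>C>0. \<forall>f :: 'a::euclidean_space \<Rightarrow> real. test_function f \<longrightarrow> (\<exists>G.
    (\<forall>j. G j \<in> borel_measurable borel) \<and> (\<forall>j y. 0 \<le> G j y) \<and>
    (\<forall>x. ennreal \<bar>f x\<bar> \<le> (\<integral>\<^sup>+j. \<integral>\<^sup>+y. (if norm (x - y) < real (1 + nat \<lfloor>\<beta>\<rfloor>) * 2 powr (- of_int j)
        then ennreal (M * (2 powr (- of_int j)) powr (- real DIM('a)) * G j y) else 0) \<partial>lborel \<partial>count_space UNIV)) \<and>
    (\<integral>\<^sup>+j. \<integral>\<^sup>+y. ennreal (2 powr (\<beta> * of_int j) * G j y) \<partial>lborel \<partial>count_space UNIV) \<le> ennreal C * test_norm \<beta> 1 f)"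
proof -
  let ?n = "real DIM('a)" and ?k = "1 + nat \<lfloor>\<beta>\<rfloor>"
  obtain a :: "'a \<Rightarrow> real" and M :: real where a: "a \<in> borel_measurable borel" and M: "0 < M"
    and aM: "\<And>y. \<bar>a y\<bar> \<le> (if norm y < real ?k then M else 0)" and a1: "(LINT y|lborel. a y) = 1"
    and diff: "\<And>f B r x. f \<in> borel_measurable borel \<Longrightarrow> (\<And>x. \<bar>f x\<bar> \<le> B) \<Longrightarrow>
       ennreal \<bar>f x - avg a r f x\<bar> \<le> (\<integral>\<^sup>+h. (if norm h < 1 then ennreal (1 / unit_ball_vol ?n * \<bar>(fwd_diff (r *\<^sub>R h) ^^ ?k) f x\<bar>) else 0) \<partial>(lborel :: 'a measure))"
    by (rule exists_difference_kernel[of ?k, where 'a='a]) auto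
  define c where "c = 1 / unit_ball_vol ?n / (1 - 2 powr (- (\<beta> + ?n)))"
  have geo: "2 powr (- (\<beta> + ?n)) < (1 :: real)" using \<beta> powr_less_mono[of "- (\<beta> + ?n)" 0 "2 :: real"] by simp
  have c: "0 < c" using geo by (simp add: c_def)
  have [measurable]: "a \<in> borel_measurable borel" by (rule a)
  show ?thesis
  proof (rule exI[where x="M * 2 powr ?n + M"], rule conjI[rotated], rule exI[where x="c + c"], intro conjI allI impI)
    show "0 < M * 2 powr ?n + M" "0 < c + c" using M c by (auto intro!: add_pos_pos)
    fix f :: "'a \<Rightarrow> real" assume f: "test_function f"
    obtain B where B: "\<And>x. \<bar>f x\<bar> \<le> B" using test_function_bounded[OF f] by auto
    have fm[measurable]: "f \<in> borel_measurable borel" by (rule test_function_borel[OF f])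
    define D where "D j y = \<bar>f y - avg a (2 powr (- real_of_int j)) f y\<bar>" for j y
    have Dm[measurable]: "D j \<in> borel_measurable borel" for j
      unfolding D_def avg_def by measurable
    define S where "S = (\<integral>\<^sup>+j. ennreal (2 powr (\<beta> * of_int j)) * (\<integral>\<^sup>+y. ennreal (D j y) \<partial>lborel) \<partial>count_space UNIV)"
    have S: "S \<le> ennreal c * test_norm \<beta> 1 f"
      unfolding S_def c_def
      by (rule difference_scale_sum[OF \<beta> fm]) (use diff[OF fm B] in \<open>auto simp: D_def\<close>)
    have dec: "ennreal \<bar>f x\<bar> \<le> (\<integral>\<^sup>+j. \<integral>\<^sup>+y. (if norm (x - y) < real ?k * 2 powr (- of_int j)
        then ennreal ((M * 2 powr ?n + M) * (2 powr (- of_int j)) powr (- ?n) * (D j y + D (j + 1) y)) else 0) \<partial>lborel \<partial>count_space UNIV)" for x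
      unfolding D_def
      by (rule scale_decomposition[OF a aM _ M test_function_continuous[OF f] B test_function_integrable[OF f] a1]) simp
    have "(\<integral>\<^sup>+j. \<integral>\<^sup>+y. ennreal (2 powr (\<beta> * of_int j) * (D j y + D (j + 1) y)) \<partial>lborel \<partial>count_space UNIV) \<le>
      (\<integral>\<^sup>+j. ennreal (2 powr (\<beta> * of_int j)) * (\<integral>\<^sup>+y. ennreal (D j y) \<partial>lborel) +
        ennreal (2 powr (\<beta> * of_int (j + 1))) * (\<integral>\<^sup>+y. ennreal (D (j + 1) y) \<partial>lborel) \<partial>count_space UNIV)"
    proof (rule nn_integral_mono)
      fix j :: int
      have "(\<integral>\<^sup>+y. ennreal (2 powr (\<beta> * of_int j) * (D j y + D (j + 1) y)) \<partial>lborel) =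
        ennreal (2 powr (\<beta> * of_int j)) * (\<integral>\<^sup>+y. ennreal (D j y) \<partial>lborel) + ennreal (2 powr (\<beta> * of_int j)) * (\<integral>\<^sup>+y. ennreal (D (j + 1) y) \<partial>lborel)"
      proof -
        have "ennreal (2 powr (\<beta> * of_int j) * (D j y + D (j + 1) y)) = ennreal (2 powr (\<beta> * of_int j)) * ennreal (D j y) + ennreal (2 powr (\<beta> * of_int j)) * ennreal (D (j + 1) y)" for y
          by (simp add: D_def ennreal_mult[symmetric] distrib_left flip: ennreal_plus)
        then show ?thesis by (simp add: nn_integral_add nn_integral_cmult)
      qed
      \<comment> \<open>Raising the second weight to 2^(\<beta> (j + 1)) makes the second sum an
        index shift of the first.\<close>
      also have "\<dots> \<le> ennreal (2 powr (\<beta> * of_int j)) * (\<integral>\<^sup>+y. ennreal (D j y) \<partial>lborel) +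
        ennreal (2 powr (\<beta> * of_int (j + 1))) * (\<integral>\<^sup>+y. ennreal (D (j + 1) y) \<partial>lborel)"
        using \<beta> by (intro add_left_mono mult_right_mono ennreal_leI powr_mono) auto
      finally show "(\<integral>\<^sup>+y. ennreal (2 powr (\<beta> * of_int j) * (D j y + D (j + 1) y)) \<partial>lborel) \<le> \<dots>" .
    qed
    also have "\<dots> = S + (\<integral>\<^sup>+j. ennreal (2 powr (\<beta> * of_int (j + 1))) * (\<integral>\<^sup>+y. ennreal (D (j + 1) y) \<partial>lborel) \<partial>count_space UNIV)"
      unfolding S_def by (rule nn_integral_add) auto
    also have "(\<integral>\<^sup>+j. ennreal (2 powr (\<beta> * of_int (j + 1))) * (\<integral>\<^sup>+y. ennreal (D (j + 1) y) \<partial>lborel) \<partial>count_space UNIV) = S"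
    proof -
      have "bij_betw (\<lambda>j::int. j + 1) UNIV UNIV"
        by (rule bij_betwI[where g="\<lambda>j. j - 1"]) auto
      from nn_integral_bij_count_space[OF this, of "\<lambda>j. ennreal (2 powr (\<beta> * of_int j)) * (\<integral>\<^sup>+y. ennreal (D j y) \<partial>lborel)"]
      show ?thesis by (simp add: S_def)
    qed
    also have "S + S \<le> ennreal c * test_norm \<beta> 1 f + ennreal c * test_norm \<beta> 1 f"
      by (intro add_mono S)
    also have "\<dots> = ennreal (c + c) * test_norm \<beta> 1 f"
      using c by (subst ennreal_plus) (auto simp: distrib_right)
    finally have sum: "(\<integral>\<^sup>+j. \<integral>\<^sup>+y. ennreal (2 powr (\<beta> * of_int j) * (D j y + D (j + 1) y)) \<partial>lborel \<partial>count_space UNIV) \<le> ennreal (c + c) * test_norm \<beta> 1 f" .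
    show "\<exists>G. (\<forall>j. G j \<in> borel_measurable borel) \<and> (\<forall>j y. 0 \<le> G j y) \<and>
    (\<forall>x. ennreal \<bar>f x\<bar> \<le> (\<integral>\<^sup>+j. \<integral>\<^sup>+y. (if norm (x - y) < real ?k * 2 powr (- of_int j)
        then ennreal ((M * 2 powr ?n + M) * (2 powr (- of_int j)) powr (- ?n) * G j y) else 0) \<partial>lborel \<partial>count_space UNIV)) \<and>
    (\<integral>\<^sup>+j. \<integral>\<^sup>+y. ennreal (2 powr (\<beta> * of_int j) * G j y) \<partial>lborel \<partial>count_space UNIV) \<le> ennreal (c + c) * test_norm \<beta> 1 f"
    proof (intro exI[of _ "\<lambda>j y. D j y + D (j + 1) y"] conjI allI)
      show "(\<lambda>y. D j y + D (j + 1) y) \<in> borel_measurable borel" for j by measurable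
      show "0 \<le> D j y + D (j + 1) y" for j y by (simp add: D_def)
    qed (rule dec sum)+
  qed
qed

section \<open>Smoothing by the majorant\<close>

text \<open>Integrates |f| with values in \<open>ennreal\<close>, so no integrability of f is
  involved. The completed measure is used because elements of the Sobolev space are Lebesgue
  measurable functions.\<close>

definition smoothed :: "real \<Rightarrow> ('a::euclidean_space \<Rightarrow> real) \<Rightarrow> real \<times> 'a \<Rightarrow> ennreal" where
  "smoothed e f = (\<lambda>(t, x). \<integral>\<^sup>+y. ennreal (majorant e t (x - y)) * ennreal \<bar>f y\<bar> \<partial>lebesgue)"

lemma smoothed_eq: "smoothed e f (t, x) = (\<integral>\<^sup>+y. ennreal (majorant e t (x - y)) * ennreal \<bar>f y\<bar> \<partial>lborel)"
  by (simp add: smoothed_def nn_integral_completion)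

lemma borel_measurable_smoothed [measurable]:
  fixes f :: "'a::euclidean_space \<Rightarrow> real"
  assumes [measurable]: "f \<in> borel_measurable borel"
  shows "smoothed e f \<in> borel_measurable borel"
  unfolding smoothed_def nn_integral_completion borel_prod[symmetric] majorant_def by measurable

text \<open>Once the decomposition is inserted and the order exchanged, the majorant meets the
  indicator of a ball of radius k 2^(-j), which is the situation of
  \<open>majorant_conv_ball\<close>.\<close>

lemma smoothed_le_scale_potential:
  fixes f :: "'a::euclidean_space \<Rightarrow> real" and G :: "int \<Rightarrow> 'a \<Rightarrow> real"
  assumes e: "0 < e" and [measurable]: "f \<in> borel_measurable borel" "\<And>j. G j \<in> borel_measurable borel"
    and G0: "\<And>j y. 0 \<le> G j y" and M: "0 < M" and k: "1 \<le> k"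
    and C: "0 < C" "\<And>t r w. 0 < t \<Longrightarrow> 0 < r \<Longrightarrow>
      (\<integral>\<^sup>+z. ennreal (majorant e t (w - z)) * (if norm z < r then ennreal (r powr (- real DIM('a))) else 0) \<partial>lborel)
      \<le> ennreal (C * (t + norm (w :: 'a) + r) powr (- real DIM('a)))"
    and f: "\<And>x. ennreal \<bar>f x\<bar> \<le> (\<integral>\<^sup>+j. \<integral>\<^sup>+y. (if norm (x - y) < k * 2 powr (- of_int j)
        then ennreal (M * (2 powr (- of_int j)) powr (- real DIM('a)) * G j y) else 0) \<partial>lborel \<partial>count_space UNIV)"
    and t: "0 < t"
  shows "smoothed e f (t, x) \<le> ennreal (M * k powr real DIM('a) * C) * scale_potential G (t, x)"
proof -
  let ?n = "real DIM('a)"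
  define m where "m y = ennreal (majorant e t (x - y))" for y
  have [measurable]: "m \<in> borel_measurable borel" unfolding m_def by measurable
  define r where "r = (\<lambda>j::int. 2 powr (- real_of_int j))"
  have r: "0 < r j" for j by (simp add: r_def)
  define T where "T j u y = (if norm (u - y) < k * r j then ennreal (M * r j powr (- ?n) * G j y) else 0)" for j u y
  have [measurable]: "(\<lambda>(u, y). T j u y) \<in> borel_measurable (borel \<Otimes>\<^sub>M borel)" for j
    unfolding T_def by measurable
  have "smoothed e f (t, x) \<le> (\<integral>\<^sup>+u. m u * (\<integral>\<^sup>+j. \<integral>\<^sup>+y. T j u y \<partial>lborel \<partial>count_space UNIV) \<partial>lborel)"
    unfolding smoothed_eq m_def T_def r_def by (intro nn_integral_mono mult_left_mono f) auto
  also have "\<dots> = (\<integral>\<^sup>+u. \<integral>\<^sup>+j. \<integral>\<^sup>+y. m u * T j u y \<partial>lborel \<partial>count_space UNIV \<partial>lborel)"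
    by (simp add: nn_integral_cmult)
  also have "\<dots> = (\<integral>\<^sup>+j. \<integral>\<^sup>+u. \<integral>\<^sup>+y. m u * T j u y \<partial>lborel \<partial>lborel \<partial>count_space UNIV)"
    by (rule nn_integral_swap_count_space_int) measurable
  also have "\<dots> = (\<integral>\<^sup>+j. \<integral>\<^sup>+y. \<integral>\<^sup>+u. m u * T j u y \<partial>lborel \<partial>lborel \<partial>count_space UNIV)"
  proof (rule nn_integral_cong, rule nn_integral_swap)
    fix j
    have "(\<lambda>(u, y). m u * T j u y) \<in> borel_measurable (borel \<Otimes>\<^sub>M borel)" by measurable
    then show "(\<lambda>(u, y). m u * T j u y) \<in> borel_measurable borel" by (simp only: borel_prod)
  qed
  also have "\<dots> \<le> (\<integral>\<^sup>+j. \<integral>\<^sup>+y. ennreal (M * k powr ?n * C) * ennreal ((t + norm (x - y) + r j) powr (- ?n) * G j y) \<partial>lborel \<partial>count_space UNIV)"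
  proof (intro nn_integral_mono)
    fix j y
    have "(\<integral>\<^sup>+u. m u * T j u y \<partial>lborel) = (\<integral>\<^sup>+z. m (y + z) * T j (y + z) y \<partial>lborel)"
      by (rule nn_integral_lborel_translate[symmetric]) measurable
    also have "\<dots> = (\<integral>\<^sup>+z. ennreal (M * k powr ?n * G j y) * (ennreal (majorant e t (x - y - z)) * (if norm z < k * r j then ennreal ((k * r j) powr (- ?n)) else 0)) \<partial>lborel)"
    proof (rule nn_integral_cong)
      fix z
      \<comment> \<open>Normalises the indicator by its own radius k r, the form required by the
        convolution bound; this is the source of k^n in the constant.\<close>
      have "k powr ?n * (k * r j) powr (- ?n) = r j powr (- ?n)"
        using k r[of j] by (simp add: powr_mult powr_minus)
      then have "ennreal (M * r j powr (- ?n) * G j y) = ennreal (M * k powr ?n * G j y) * ennreal ((k * r j) powr (- ?n))"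
        using M k G0[of j y] by (simp add: ennreal_mult[symmetric] mult_ac)
      then show "m (y + z) * T j (y + z) y = ennreal (M * k powr ?n * G j y) * (ennreal (majorant e t (x - y - z)) * (if norm z < k * r j then ennreal ((k * r j) powr (- ?n)) else 0))"
        by (simp add: m_def T_def diff_diff_add mult_ac)
    qed
    also have "\<dots> = ennreal (M * k powr ?n * G j y) * (\<integral>\<^sup>+z. ennreal (majorant e t (x - y - z)) * (if norm z < k * r j then ennreal ((k * r j) powr (- ?n)) else 0) \<partial>lborel)"
      by (rule nn_integral_cmult) measurable
    also have "\<dots> \<le> ennreal (M * k powr ?n * G j y) * ennreal (C * (t + norm (x - y) + k * r j) powr (- ?n))"
      using k r[of j] by (intro mult_left_mono C(2) t) auto
    \<comment> \<open>As k \<ge> 1, k r may be replaced by r in the decreasing power.\<close>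
    also have "\<dots> \<le> ennreal (M * k powr ?n * G j y) * ennreal (C * (t + norm (x - y) + r j) powr (- ?n))"
      using k r[of j] t C(1) by (intro mult_left_mono ennreal_leI powr_mono2' add_left_mono) (auto intro: add_pos_nonneg add_nonneg_pos)
    also have "\<dots> = ennreal (M * k powr ?n * C) * ennreal ((t + norm (x - y) + r j) powr (- ?n) * G j y)"
      using M C(1) k G0[of j y] by (simp add: ennreal_mult[symmetric] mult_ac)
    finally show "(\<integral>\<^sup>+u. m u * T j u y \<partial>lborel) \<le> \<dots>" .
  qed
  also have "\<dots> = ennreal (M * k powr ?n * C) * scale_potential G (t, x)"
    using t by (simp add: scale_potential_def r_def nn_integral_cmult)
  finally show ?thesis .
qed

text \<open>By \<open>majorant_conv_riesz\<close> the smoothed Riesz kernel is at most a multiple of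
  (t + |x - y|)^(\<beta> - n). Unfolding this power over r > t + |x - y| produces the cone and the
  factor n - \<beta>.\<close>

lemma smoothed_le_cone_potential:
  fixes f g :: "'a::euclidean_space \<Rightarrow> real"
  assumes e: "0 < e" and [measurable]: "f \<in> borel_measurable borel" "g \<in> borel_measurable borel"
    and g0: "\<And>y. 0 \<le> g y" and M: "0 < M" and \<beta>: "\<beta> < real DIM('a)"
    and C: "0 < C" "\<And>t w. 0 < t \<Longrightarrow>
      (\<integral>\<^sup>+z. ennreal (majorant e t (w - z)) * ennreal (norm z powr (\<beta> - real DIM('a))) \<partial>lborel)
      \<le> ennreal (C * (t + norm (w :: 'a)) powr (\<beta> - real DIM('a)))"
    and f: "\<And>x. ennreal \<bar>f x\<bar> \<le> ennreal M * (\<integral>\<^sup>+y. ennreal (norm (x - y) powr (\<beta> - real DIM('a)) * g y) \<partial>lborel)"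
    and t: "0 < t"
  shows "smoothed e f (t, x) \<le> ennreal (M * C * (real DIM('a) - \<beta>)) * cone_potential \<beta> g (t, x)"
proof -
  let ?n = "real DIM('a)"
  define m where "m y = ennreal (majorant e t (x - y))" for y
  have [measurable]: "m \<in> borel_measurable borel" unfolding m_def by measurable
  define T where "T u y = ennreal (norm (u - y) powr (\<beta> - ?n) * g y)" for u y
  have [measurable]: "(\<lambda>(u, y). T u y) \<in> borel_measurable (borel \<Otimes>\<^sub>M borel)"
    unfolding T_def by measurable
  have "smoothed e f (t, x) \<le> (\<integral>\<^sup>+u. m u * (ennreal M * (\<integral>\<^sup>+y. T u y \<partial>lborel)) \<partial>lborel)"
    unfolding smoothed_eq m_def T_def by (intro nn_integral_mono mult_left_mono f) auto
  also have "\<dots> = ennreal M * (\<integral>\<^sup>+u. \<integral>\<^sup>+y. m u * T u y \<partial>lborel \<partial>lborel)"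
    by (simp add: nn_integral_cmult[symmetric] mult_ac)
  also have "(\<integral>\<^sup>+u. \<integral>\<^sup>+y. m u * T u y \<partial>lborel \<partial>lborel) = (\<integral>\<^sup>+y. \<integral>\<^sup>+u. m u * T u y \<partial>lborel \<partial>lborel)"
  proof (rule nn_integral_swap)
    have "(\<lambda>(u, y). m u * T u y) \<in> borel_measurable (borel \<Otimes>\<^sub>M borel)" by measurable
    then show "(\<lambda>(u, y). m u * T u y) \<in> borel_measurable borel" by (simp only: borel_prod)
  qed
  also have "\<dots> \<le> (\<integral>\<^sup>+y. ennreal (C * (?n - \<beta>)) * (\<integral>\<^sup>+r. (if t + norm (x - y) < r then ennreal (r powr (\<beta> - ?n - 1) * g y) else 0) \<partial>lborel) \<partial>lborel)"
  proof (intro nn_integral_mono)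
    fix y
    have d: "0 < t + norm (x - y)" using t by (simp add: add_pos_nonneg)
    have "(\<integral>\<^sup>+u. m u * T u y \<partial>lborel) = (\<integral>\<^sup>+z. m (y + z) * T (y + z) y \<partial>lborel)"
      by (rule nn_integral_lborel_translate[symmetric]) measurable
    also have "\<dots> = (\<integral>\<^sup>+z. ennreal (g y) * (ennreal (majorant e t (x - y - z)) * ennreal (norm z powr (\<beta> - ?n))) \<partial>lborel)"
      using g0[of y] by (intro nn_integral_cong) (simp add: m_def T_def diff_diff_add ennreal_mult mult_ac)
    also have "\<dots> = ennreal (g y) * (\<integral>\<^sup>+z. ennreal (majorant e t (x - y - z)) * ennreal (norm z powr (\<beta> - ?n)) \<partial>lborel)"
      by (rule nn_integral_cmult) measurable
    also have "\<dots> \<le> ennreal (g y) * ennreal (C * (t + norm (x - y)) powr (\<beta> - ?n))"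
      by (intro mult_left_mono C(2) t) auto
    also have "\<dots> = ennreal (g y) * (ennreal C * ennreal ((t + norm (x - y)) powr (- (?n - \<beta>))))"
      using C(1) by (simp add: ennreal_mult)
    also have "\<dots> = ennreal (g y) * (ennreal C * (ennreal (?n - \<beta>) * (\<integral>\<^sup>+r. (if t + norm (x - y) < r then ennreal (r powr (- (?n - \<beta>) - 1)) else 0) \<partial>lborel)))"
      using \<beta> d by (subst powr_eq_nn_integral[of "?n - \<beta>"]) auto
    also have "\<dots> = ennreal (C * (?n - \<beta>)) * (ennreal (g y) * (\<integral>\<^sup>+r. (if t + norm (x - y) < r then ennreal (r powr (- (?n - \<beta>) - 1)) else 0) \<partial>lborel))"
      using C(1) \<beta> by (simp add: ennreal_mult mult_ac)
    also have "ennreal (g y) * (\<integral>\<^sup>+r. (if t + norm (x - y) < r then ennreal (r powr (- (?n - \<beta>) - 1)) else 0) \<partial>lborel) =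
      (\<integral>\<^sup>+r. (if t + norm (x - y) < r then ennreal (r powr (\<beta> - ?n - 1) * g y) else 0) \<partial>lborel)"
      using g0[of y] by (subst nn_integral_cmult[symmetric]) (auto simp: ennreal_mult mult.commute intro!: nn_integral_cong)
    finally show "(\<integral>\<^sup>+u. m u * T u y \<partial>lborel) \<le> ennreal (C * (?n - \<beta>)) * \<dots>" .
  qed
  also have "\<dots> = ennreal (C * (?n - \<beta>)) * cone_potential \<beta> g (t, x)"
  proof -
    have m: "(\<lambda>(r, y). if t + norm (x - y) < r then ennreal (r powr (\<beta> - ?n - 1) * g y) else 0) \<in> borel_measurable (borel \<Otimes>\<^sub>M borel)"
      by measurable
    have "cone_potential \<beta> g (t, x) = (\<integral>\<^sup>+r. \<integral>\<^sup>+y. (if t + norm (x - y) < r then ennreal (r powr (\<beta> - ?n - 1) * g y) else 0) \<partial>lborel \<partial>lborel)"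
      using t nn_integral_lborel_pair[OF m[unfolded borel_prod]] by (simp add: cone_potential_def)
    also have "\<dots> = (\<integral>\<^sup>+y. \<integral>\<^sup>+r. (if t + norm (x - y) < r then ennreal (r powr (\<beta> - ?n - 1) * g y) else 0) \<partial>lborel \<partial>lborel)"
      by (rule nn_integral_swap[OF m[unfolded borel_prod]])
    finally show ?thesis by (simp add: nn_integral_cmult)
  qed
  finally show ?thesis
    using M C(1) \<beta> by (simp add: ennreal_mult mult.assoc mult_left_mono)
qed

section \<open>Decay of the heat kernel\<close>

text \<open>Unit step in a complex variable. If G takes at each natural number i the value of a
  function at \<xi> + i h, then the iterates of \<open>cdiff\<close> at natural numbers are the
  iterated differences of that function with step h.\<close>

definition cdiff :: "(complex \<Rightarrow> complex) \<Rightarrow> complex \<Rightarrow> complex" where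
  "cdiff G = (\<lambda>z. G (z + 1) - G z)"

text \<open>Cauchy's inequality on discs of radius \<sigma> bounds the derivative by B / \<sigma>
  along the segment from z to z + 1. The radius of the domain shrinks by 2 \<sigma> \<ge> 1 +
  \<sigma>, enough for the step and the disc.\<close>

lemma cdiff_holomorphic_bound:
  assumes hol: "G holomorphic_on ball 0 R" and B: "\<And>z. z \<in> ball 0 R \<Longrightarrow> cmod (G z) \<le> B" and \<sigma>: "1 \<le> \<sigma>"
  shows "cdiff G holomorphic_on ball 0 (R - 2 * \<sigma>)"
    and "z \<in> ball 0 (R - 2 * \<sigma>) \<Longrightarrow> cmod (cdiff G z) \<le> B / \<sigma>"
proof -
  have sub': "u \<in> ball 0 R" if z: "z \<in> ball 0 (R - 2 * \<sigma>)" and w: "w \<in> closed_segment z (z + 1)" and u: "cmod (u - w) \<le> \<sigma>" for z w u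
  proof -
    obtain s where s: "0 \<le> s" "s \<le> 1" "w = (1 - s) *\<^sub>R z + s *\<^sub>R (z + 1)"
      using w by (auto simp: closed_segment_def)
    have "w = z + of_real s" using s(3) by (simp add: scaleR_conv_of_real algebra_simps)
    then have "cmod w \<le> cmod z + s" using s(1) norm_triangle_ineq[of z "of_real s"] by simp
    moreover have "cmod u \<le> cmod w + cmod (u - w)" using norm_triangle_ineq[of w "u - w"] by simp
    ultimately show ?thesis using z u s \<sigma> by simp
  qed
  show "cdiff G holomorphic_on ball 0 (R - 2 * \<sigma>)"
    unfolding cdiff_def
  proof (intro holomorphic_on_diff)
    show "G holomorphic_on ball 0 (R - 2 * \<sigma>)"
      by (rule holomorphic_on_subset[OF hol]) (use \<sigma> in \<open>auto intro!: subset_ball\<close>)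
    have "(G \<circ> (\<lambda>z. z + 1)) holomorphic_on ball 0 (R - 2 * \<sigma>)"
    proof (rule holomorphic_on_compose_gen[OF _ hol])
      show "(\<lambda>z::complex. z + 1) ` ball 0 (R - 2 * \<sigma>) \<subseteq> ball 0 R"
      proof (rule image_subsetI)
        fix z :: complex assume z: "z \<in> ball 0 (R - 2 * \<sigma>)"
        show "z + 1 \<in> ball 0 R" by (rule sub'[OF z, of "z + 1"]) (use \<sigma> in auto)
      qed
    qed (intro holomorphic_intros)
    then show "(\<lambda>z. G (z + 1)) holomorphic_on ball 0 (R - 2 * \<sigma>)" by (simp add: o_def)
  qed
  assume z: "z \<in> ball 0 (R - 2 * \<sigma>)"
  have "cmod (G (z + 1) - G z) \<le> B / \<sigma> * cmod (z + 1 - z)"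
  proof (rule field_differentiable_bound[of "closed_segment z (z + 1)" G "deriv G"])
    fix w assume w: "w \<in> closed_segment z (z + 1)"
    have cb: "cball w \<sigma> \<subseteq> ball 0 R"
      using sub'[OF z w] by (auto simp: dist_norm norm_minus_commute)
    have "w \<in> ball 0 R" by (rule subsetD[OF cb]) (use \<sigma> in auto)
    then show "(G has_field_derivative deriv G w) (at w within closed_segment z (z + 1))"
      using hol by (meson DERIV_subset holomorphic_derivI open_ball subset_UNIV has_field_derivative_at_within)
    show "cmod (deriv G w) \<le> B / \<sigma>"
    proof -
      have "cmod ((deriv ^^ 1) G w) \<le> fact 1 * B / \<sigma> ^ 1"
      proof (rule Cauchy_inequality)
        show "G holomorphic_on ball w \<sigma>" using hol cb ball_subset_cball holomorphic_on_subset by blast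
        show "continuous_on (cball w \<sigma>) G" using hol cb holomorphic_on_imp_continuous_on continuous_on_subset by blast
        show "cmod (G u) \<le> B" if "cmod (w - u) = \<sigma>" for u
          by (rule B, rule subsetD[OF cb]) (use that in \<open>simp add: dist_norm\<close>)
      qed (use \<sigma> in simp)
      then show ?thesis by simp
    qed
  qed auto
  then show "cmod (cdiff G z) \<le> B / \<sigma>" by (simp add: cdiff_def)
qed

lemma cdiff_funpow_bound:
  assumes "G holomorphic_on ball 0 R" "\<And>z. z \<in> ball 0 R \<Longrightarrow> cmod (G z) \<le> B" and \<sigma>: "1 \<le> \<sigma>"
  shows "(cdiff ^^ k) G holomorphic_on ball 0 (R - 2 * \<sigma> * real k) \<and>
    (\<forall>z \<in> ball 0 (R - 2 * \<sigma> * real k). cmod ((cdiff ^^ k) G z) \<le> B / \<sigma> ^ k)"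
proof (induction k)
  case 0
  then show ?case using assms by simp
next
  case (Suc k)
  let ?R = "R - 2 * \<sigma> * real k"
  have R: "?R - 2 * \<sigma> = R - 2 * \<sigma> * real (Suc k)" by (simp add: algebra_simps)
  show ?case
    using cdiff_holomorphic_bound[of "(cdiff ^^ k) G" ?R "B / \<sigma> ^ k" \<sigma>] Suc.IH \<sigma>
    unfolding R by (auto simp: field_simps)
qed

lemma cdiff_funpow_of_nat:
  fixes g :: "'a::euclidean_space \<Rightarrow> real"
  assumes "\<And>i. G (of_nat i) = of_real (g (x + real i *\<^sub>R h))"
  shows "(cdiff ^^ k) G (of_nat i) = of_real ((fwd_diff h ^^ k) g (x + real i *\<^sub>R h))"
proof (induction k arbitrary: i)
  case (Suc k)
  have "(cdiff ^^ Suc k) G (of_nat i) = (cdiff ^^ k) G (of_nat (Suc i)) - (cdiff ^^ k) G (of_nat i)"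
    by (simp add: cdiff_def add.commute)
  moreover have "(fwd_diff h ^^ Suc k) g (x + real i *\<^sub>R h) =
      (fwd_diff h ^^ k) g (x + real (Suc i) *\<^sub>R h) - (fwd_diff h ^^ k) g (x + real i *\<^sub>R h)"
    by (simp add: fwd_diff_def[of h "(fwd_diff h ^^ k) g"] algebra_simps)
  ultimately show ?case
    unfolding Suc.IH by (simp only: of_real_diff)
qed (use assms in simp)

text \<open>The derivative of exp (- z) has modulus at most 1 on the right half plane, which is
  convex.\<close>

lemma norm_exp_minus_1_le:
  assumes "0 \<le> Re u"
  shows "cmod (exp (- u) - 1) \<le> cmod u"
proof -
  have "cmod (exp (- u) - exp (- 0)) \<le> 1 * cmod (u - 0)"
  proof (rule field_differentiable_bound[of "{z. 0 \<le> Re z}" "\<lambda>z. exp (- z)" "\<lambda>z. - exp (- z)"])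
    show "convex {z. 0 \<le> Re z}" by (rule convex_halfspace_Re_ge)
    show "((\<lambda>z. exp (- z)) has_field_derivative - exp (- z)) (at z within {z. 0 \<le> Re z})" for z
      by (auto intro!: derivative_eq_intros)
    show "cmod (- exp (- z)) \<le> 1" if "z \<in> {z. 0 \<le> Re z}" for z
      using that by (simp add: norm_exp_eq_Re)
  qed (use assms in auto)
  then show ?thesis by simp
qed

text \<open>The argument of w is below \<pi>/2 in modulus, and \<alpha> \<le> 1 keeps the argument
  of the power in the range where the cosine is nonnegative.\<close>

lemma Re_powr_nonneg:
  assumes "0 < Re w" "0 < \<alpha>" "\<alpha> \<le> 1"
  shows "0 \<le> Re (w powr of_real \<alpha>)"
proof -
  have w: "w \<noteq> 0" using assms by auto
  have "\<bar>Im (Ln w)\<bar> < pi / 2" using assms by (intro Re_Ln_pos_lt_imp)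
  then have "\<bar>\<alpha> * Im (Ln w)\<bar> \<le> pi / 2"
    using assms mult_mono[of \<alpha> 1 "\<bar>Im (Ln w)\<bar>" "pi / 2"] by (simp add: abs_mult)
  then have "0 \<le> cos (\<alpha> * Im (Ln w))"
    by (intro cos_ge_zero) (auto simp: abs_le_iff)
  then show ?thesis using w by (simp add: powr_def Re_exp)
qed

text \<open>
  Along the line \<open>z \<mapsto> \<xi> + z h\<close> the symbol extends holomorphically to a disc of radius comparable to
  \<open>|\<xi>| / |h|\<close>, so Cauchy estimates bound its differences.
\<close>

lemma fwd_diff_exp_far:
  fixes h \<xi> :: "'a::euclidean_space"
  assumes \<alpha>: "0 < \<alpha>" "\<alpha> \<le> 1" and M: "0 < M" and h: "h \<noteq> 0" and far: "16 * real M * norm h \<le> norm \<xi>"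
  shows "\<bar>(fwd_diff h ^^ M) (\<lambda>\<xi>. exp (- (norm \<xi> powr (2 * \<alpha>))) - 1) \<xi>\<bar> \<le> 2 * norm \<xi> powr (2 * \<alpha>) * (16 * real M * norm h / norm \<xi>) ^ M"
proof -
  have h0: "0 < norm h" using h by simp
  have \<xi>0: "0 < norm \<xi>" using far h0 M by (intro less_le_trans[OF _ far]) simp
  \<comment> \<open>Polynomial extension of |\<xi> + z h|^2 from real to complex z.\<close>
  define W where "W z = of_real ((norm \<xi>)\<^sup>2) + of_real (2 * (\<xi> \<bullet> h)) * z + of_real ((norm h)\<^sup>2) * z\<^sup>2" for z :: complex
  \<comment> \<open>Subtracting 1 changes no difference of positive order and brings G down to size
    |\<xi>|^(2 \<alpha>), which matters near the origin, where the exponential itself is close to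
    1.\<close>
  define G where "G z = exp (- (W z powr of_real \<alpha>)) - 1" for z
  \<comment> \<open>On this disc W differs from |\<xi>|^2 by at most (2/4 + 1/16) |\<xi>|^2, so it
    stays in the right half plane, where the power is holomorphic.\<close>
  define R where "R = norm \<xi> / (4 * norm h)"
  have W: "cmod (W z - of_real ((norm \<xi>)\<^sup>2)) \<le> 9 / 16 * (norm \<xi>)\<^sup>2" if "z \<in> ball 0 R" for z
  proof -
    have z: "cmod z * norm h \<le> norm \<xi> / 4" using that h0 by (simp add: R_def field_simps)
    have "cmod (W z - of_real ((norm \<xi>)\<^sup>2)) \<le> cmod (of_real (2 * (\<xi> \<bullet> h)) * z) + cmod (of_real ((norm h)\<^sup>2) * z\<^sup>2)"
    proof -
      have "W z - of_real ((norm \<xi>)\<^sup>2) = of_real (2 * (\<xi> \<bullet> h)) * z + of_real ((norm h)\<^sup>2) * z\<^sup>2"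
        by (simp add: W_def)
      then show ?thesis by (simp only: norm_triangle_ineq)
    qed
    also have "\<dots> = 2 * \<bar>\<xi> \<bullet> h\<bar> * cmod z + (cmod z * norm h)\<^sup>2"
      by (simp add: norm_mult norm_power power_mult_distrib)
    also have "\<dots> \<le> 2 * (norm \<xi> * norm h) * cmod z + (norm \<xi> / 4)\<^sup>2"
      using z by (intro add_mono mult_right_mono mult_left_mono Cauchy_Schwarz_ineq2 power_mono) auto
    also have "2 * (norm \<xi> * norm h) * cmod z = 2 * norm \<xi> * (cmod z * norm h)" by simp
    also have "\<dots> \<le> 2 * norm \<xi> * (norm \<xi> / 4)" using z by (intro mult_left_mono) auto
    finally show ?thesis by (simp add: power2_eq_square field_simps)
  qed
  have ReW: "0 < Re (W z)" if "z \<in> ball 0 R" for z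
  proof -
    have "\<bar>Re (W z) - (norm \<xi>)\<^sup>2\<bar> \<le> 9 / 16 * (norm \<xi>)\<^sup>2"
      using W[OF that] abs_Re_le_cmod[of "W z - of_real ((norm \<xi>)\<^sup>2)"] by simp
    moreover have "0 < (norm \<xi>)\<^sup>2" using \<xi>0 by simp
    ultimately show ?thesis unfolding abs_le_iff by linarith
  qed
  have hol: "G holomorphic_on ball 0 R"
    unfolding G_def
    by (intro holomorphic_intros) (use ReW in \<open>auto simp: W_def complex_nonpos_Reals_iff intro!: holomorphic_intros, fastforce\<close>)
  have bnd: "cmod (G z) \<le> 2 * norm \<xi> powr (2 * \<alpha>)" if z: "z \<in> ball 0 R" for z
  proof -
    have "cmod (G z) \<le> cmod (W z powr of_real \<alpha>)"
      unfolding G_def by (intro norm_exp_minus_1_le Re_powr_nonneg ReW z \<alpha>)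
    also have "\<dots> = cmod (W z) powr \<alpha>" by (subst norm_powr_real_powr') auto
    also have "\<dots> \<le> (2 * (norm \<xi>)\<^sup>2) powr \<alpha>"
    proof (rule powr_mono2)
      show "cmod (W z) \<le> 2 * (norm \<xi>)\<^sup>2"
      proof -
        have "cmod (W z) - cmod (of_real ((norm \<xi>)\<^sup>2)) \<le> 9 / 16 * (norm \<xi>)\<^sup>2"
          using W[OF z] norm_triangle_ineq2[of "W z" "of_real ((norm \<xi>)\<^sup>2)"] by (rule order_trans[rotated])
        moreover have "cmod (of_real ((norm \<xi>)\<^sup>2)) = (norm \<xi>)\<^sup>2" "0 \<le> (norm \<xi>)\<^sup>2"
          by (simp_all add: norm_power)
        ultimately show ?thesis by linarith
      qed
    qed (use \<alpha> in auto)
    also have "\<dots> = 2 powr \<alpha> * norm \<xi> powr (2 * \<alpha>)"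
    proof -
      have "(norm \<xi>)\<^sup>2 = norm \<xi> powr 2" using \<xi>0 by simp
      then show ?thesis by (simp only: powr_mult powr_powr)
    qed
    also have "\<dots> \<le> 2 * norm \<xi> powr (2 * \<alpha>)"
      using \<alpha> powr_mono[of \<alpha> 1 2] by (intro mult_right_mono) auto
    finally show ?thesis .
  qed
  \<comment> \<open>M differences use up the radius 2 \<sigma> M = R / 2, and \<sigma> \<ge> 1 is
    precisely the hypothesis \<open>far\<close>.\<close>
  define \<sigma> where "\<sigma> = R / (4 * real M)"
  have \<sigma>: "1 \<le> \<sigma>" using far h0 M by (simp add: \<sigma>_def R_def field_simps)
  have Rpos: "0 < R - 2 * \<sigma> * real M"
    using M \<xi>0 h0 by (simp add: \<sigma>_def R_def)
  have Gi: "G (of_nat i) = of_real (exp (- (norm (\<xi> + real i *\<^sub>R h) powr (2 * \<alpha>))) - 1)" for i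
  proof -
    have n2: "(norm (\<xi> + real i *\<^sub>R h))\<^sup>2 = (norm \<xi>)\<^sup>2 + 2 * (\<xi> \<bullet> h) * real i + (norm h)\<^sup>2 * (real i)\<^sup>2"
      unfolding power2_norm_eq_inner by (simp add: inner_add_left inner_add_right inner_commute[of h \<xi>] algebra_simps power2_eq_square)
    have "W (of_nat i) = of_real ((norm (\<xi> + real i *\<^sub>R h))\<^sup>2)"
      unfolding W_def n2 by simp
    then have "W (of_nat i) powr of_real \<alpha> = of_real (((norm (\<xi> + real i *\<^sub>R h))\<^sup>2) powr \<alpha>)"
      by (simp add: powr_of_real del: of_real_power)
    also have "((norm (\<xi> + real i *\<^sub>R h))\<^sup>2) powr \<alpha> = norm (\<xi> + real i *\<^sub>R h) powr (2 * \<alpha>)"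
    proof -
      have "(norm (\<xi> + real i *\<^sub>R h))\<^sup>2 = norm (\<xi> + real i *\<^sub>R h) powr 2"
        by (cases "norm (\<xi> + real i *\<^sub>R h) = 0") (simp_all del: norm_eq_zero)
      then show ?thesis by (simp only: powr_powr)
    qed
    finally show ?thesis
      unfolding G_def by (simp add: exp_of_real[symmetric])
  qed
  have "\<bar>(fwd_diff h ^^ M) (\<lambda>\<xi>. exp (- (norm \<xi> powr (2 * \<alpha>))) - 1) \<xi>\<bar> = cmod ((cdiff ^^ M) G 0)"
    using cdiff_funpow_of_nat[of G "\<lambda>\<xi>. exp (- (norm \<xi> powr (2 * \<alpha>))) - 1" \<xi> h M 0, OF Gi] by simp
  also have "\<dots> \<le> 2 * norm \<xi> powr (2 * \<alpha>) / \<sigma> ^ M"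
    using cdiff_funpow_bound[OF hol bnd \<sigma>, of M] Rpos by auto
  also have "\<dots> = 2 * norm \<xi> powr (2 * \<alpha>) * (16 * real M * norm h / norm \<xi>) ^ M"
  proof -
    have "16 * real M * norm h / norm \<xi> = inverse \<sigma>"
      by (simp add: \<sigma>_def R_def)
    then show ?thesis by (simp only: power_inverse divide_inverse)
  qed
  finally show ?thesis .
qed

text \<open>No cancellation is exploited: each point \<xi> + i h has norm at most (16 M + M) |h|,
  and 1 - exp (- u) \<le> u.\<close>

lemma fwd_diff_exp_near:
  fixes h \<xi> :: "'a::euclidean_space"
  assumes \<alpha>: "0 < \<alpha>" and c: "\<And>h (f :: 'a \<Rightarrow> real) x. (fwd_diff h ^^ M) f x = (\<Sum>i\<le>M. c i * f (x + real i *\<^sub>R h))"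
    and M: "0 < M" and near: "norm \<xi> \<le> 16 * real M * norm h"
  shows "\<bar>(fwd_diff h ^^ M) (\<lambda>\<xi>. exp (- (norm \<xi> powr (2 * \<alpha>))) - 1) \<xi>\<bar> \<le> (\<Sum>i\<le>M. \<bar>c i\<bar>) * (17 * real M * norm h) powr (2 * \<alpha>)"
proof -
  have "\<bar>(fwd_diff h ^^ M) (\<lambda>\<xi>. exp (- (norm \<xi> powr (2 * \<alpha>))) - 1) \<xi>\<bar> \<le>
    (\<Sum>i\<le>M. \<bar>c i * (exp (- (norm (\<xi> + real i *\<^sub>R h) powr (2 * \<alpha>))) - 1)\<bar>)"
    unfolding c by (rule sum_abs)
  also have "\<dots> \<le> (\<Sum>i\<le>M. \<bar>c i\<bar> * (17 * real M * norm h) powr (2 * \<alpha>))"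
    unfolding abs_mult
  proof (intro sum_mono mult_left_mono)
    fix i assume i: "i \<in> {..M}"
    have "\<bar>exp (- (norm (\<xi> + real i *\<^sub>R h) powr (2 * \<alpha>))) - 1\<bar> \<le> norm (\<xi> + real i *\<^sub>R h) powr (2 * \<alpha>)"
      using exp_ge_add_one_self[of "- (norm (\<xi> + real i *\<^sub>R h) powr (2 * \<alpha>))"] by simp
    also have "\<dots> \<le> (17 * real M * norm h) powr (2 * \<alpha>)"
    proof (rule powr_mono2)
      have "norm (\<xi> + real i *\<^sub>R h) \<le> norm \<xi> + real i * norm h"
        using norm_triangle_ineq[of \<xi> "real i *\<^sub>R h"] by simp
      also have "real i * norm h \<le> real M * norm h" using i by (intro mult_right_mono) auto
      finally show "norm (\<xi> + real i *\<^sub>R h) \<le> 17 * real M * norm h" using near by linarith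
    qed (use \<alpha> in auto)
    finally show "\<bar>exp (- (norm (\<xi> + real i *\<^sub>R h) powr (2 * \<alpha>))) - 1\<bar> \<le> (17 * real M * norm h) powr (2 * \<alpha>)" .
  qed auto
  also have "\<dots> = (\<Sum>i\<le>M. \<bar>c i\<bar>) * (17 * real M * norm h) powr (2 * \<alpha>)"
    by (rule sum_distrib_right[symmetric])
  finally show ?thesis .
qed

text \<open>Away from the origin the Cauchy estimates give |h|^M |\<xi>|^(2 \<alpha> - M), near it
  the crude bound is |h|^(2 \<alpha>), both up to constants. Since 2 \<alpha> < M, one decreasing
  power of |h| + |\<xi>| covers the two cases.\<close>

lemma fwd_diff_exp_bound:
  fixes M :: nat
  assumes \<alpha>: "0 < \<alpha>" "\<alpha> \<le> 1" and M: "0 < M" "2 * \<alpha> < real M"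
  shows "\<exists>C>0. \<forall>h \<xi> :: 'a::euclidean_space. h \<noteq> 0 \<longrightarrow>
    \<bar>(fwd_diff h ^^ M) (\<lambda>\<xi>. exp (- (norm \<xi> powr (2 * \<alpha>)))) \<xi>\<bar> \<le> C * norm h ^ M * (norm h + norm \<xi>) powr (2 * \<alpha> - real M)"
proof -
  obtain c :: "nat \<Rightarrow> real" where c: "\<And>h (f :: 'a \<Rightarrow> real) x. (fwd_diff h ^^ M) f x = (\<Sum>i\<le>M. c i * f (x + real i *\<^sub>R h))"
    using fwd_diff_funpow_expand[of M, where 'a='a] by blast
  define S where "S = (\<Sum>i\<le>M. \<bar>c i\<bar>)"
  have S: "0 \<le> S" by (simp add: S_def sum_nonneg)
  \<comment> \<open>In the far case |\<xi>| is replaced by (|h| + |\<xi>|) / 2, which doubles 16 to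
    32; the 17 of the near case is smaller.\<close>
  define C where "C = (S + 2) * (32 * real M) ^ M"
  show ?thesis
  proof (intro exI[of _ C] conjI allI impI)
    show "0 < C" using S M by (simp add: C_def)
    fix h \<xi> :: 'a assume h: "h \<noteq> 0"
    define s where "s = norm h + norm \<xi>"
    have h0: "0 < norm h" using h by simp
    have s: "0 < s" using h0 by (simp add: s_def add_pos_nonneg)
    have eq: "(fwd_diff h ^^ M) (\<lambda>\<xi>. exp (- (norm \<xi> powr (2 * \<alpha>)))) \<xi> = (fwd_diff h ^^ M) (\<lambda>\<xi>. exp (- (norm \<xi> powr (2 * \<alpha>))) - 1) \<xi>"
      using M(1) by (cases M) (simp_all add: funpow_Suc_right fwd_diff_def del: funpow.simps(2))
    have "\<bar>(fwd_diff h ^^ M) (\<lambda>\<xi>. exp (- (norm \<xi> powr (2 * \<alpha>))) - 1) \<xi>\<bar> \<le> C * norm h ^ M * s powr (2 * \<alpha> - real M)"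
    proof (cases "norm \<xi> \<le> 16 * real M * norm h")
      case True
      have sle: "s \<le> 17 * real M * norm h"
      proof -
        have "1 * norm h \<le> real M * norm h" using M by (intro mult_right_mono) auto
        then show ?thesis using True unfolding s_def by linarith
      qed
      have "\<bar>(fwd_diff h ^^ M) (\<lambda>\<xi>. exp (- (norm \<xi> powr (2 * \<alpha>))) - 1) \<xi>\<bar> \<le> S * (17 * real M * norm h) powr (2 * \<alpha>)"
        unfolding S_def by (rule fwd_diff_exp_near[OF \<alpha>(1) c M(1) True])
      also have "\<dots> = S * ((17 * real M * norm h) ^ M * (17 * real M * norm h) powr (2 * \<alpha> - real M))"
        using h0 M(1) by (simp add: powr_realpow[symmetric] powr_add[symmetric])
      also have "\<dots> \<le> S * ((17 * real M * norm h) ^ M * s powr (2 * \<alpha> - real M))"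
        using sle s M S by (intro mult_left_mono powr_mono2') auto
      also have "\<dots> = S * (17 * real M) ^ M * norm h ^ M * s powr (2 * \<alpha> - real M)"
        by (simp add: power_mult_distrib)
      also have "\<dots> \<le> C * norm h ^ M * s powr (2 * \<alpha> - real M)"
      proof (intro mult_right_mono)
        show "S * (17 * real M) ^ M \<le> C"
          unfolding C_def using S M by (intro mult_mono power_mono) auto
      qed auto
      finally show ?thesis .
    next
      case False
      then have far: "16 * real M * norm h \<le> norm \<xi>" by simp
      have \<xi>0: "0 < norm \<xi>" using far h0 M by (intro less_le_trans[OF _ far]) simp
      have hx: "norm h \<le> norm \<xi>"
      proof -
        have "1 * norm h \<le> 16 * real M * norm h" using M by (intro mult_right_mono) auto
        then show ?thesis using far by linarith
      qed
      have "\<bar>(fwd_diff h ^^ M) (\<lambda>\<xi>. exp (- (norm \<xi> powr (2 * \<alpha>))) - 1) \<xi>\<bar> \<le> 2 * norm \<xi> powr (2 * \<alpha>) * (16 * real M * norm h / norm \<xi>) ^ M"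
        by (rule fwd_diff_exp_far[OF \<alpha> M(1) h far])
      also have "\<dots> = 2 * (16 * real M) ^ M * norm h ^ M * (norm \<xi> powr (2 * \<alpha>) / norm \<xi> ^ M)"
        by (simp add: power_mult_distrib power_divide)
      also have "norm \<xi> powr (2 * \<alpha>) / norm \<xi> ^ M = norm \<xi> powr (2 * \<alpha> - real M)"
        using \<xi>0 by (simp add: powr_diff powr_realpow)
      also have "norm \<xi> powr (2 * \<alpha> - real M) \<le> (s / 2) powr (2 * \<alpha> - real M)"
        using hx s M by (intro powr_mono2') (auto simp: s_def)
      also have "(s / 2) powr (2 * \<alpha> - real M) = 2 powr (real M - 2 * \<alpha>) * s powr (2 * \<alpha> - real M)"
        using s by (simp add: powr_divide powr_minus powr_diff field_simps)
      also have "2 * (16 * real M) ^ M * norm h ^ M * (2 powr (real M - 2 * \<alpha>) * s powr (2 * \<alpha> - real M)) \<le> C * norm h ^ M * s powr (2 * \<alpha> - real M)"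
      proof -
        have "2 powr (real M - 2 * \<alpha>) \<le> 2 ^ M"
          using \<alpha> by (simp add: powr_realpow[symmetric])
        then have "2 * (16 * real M) ^ M * 2 powr (real M - 2 * \<alpha>) \<le> 2 * (16 * real M) ^ M * 2 ^ M"
          by (intro mult_left_mono) auto
        also have "\<dots> = 2 * (32 * real M) ^ M"
        proof -
          have "(16 * real M) ^ M * 2 ^ M = (16 * real M * 2) ^ M" by (rule power_mult_distrib[symmetric])
          then show ?thesis by simp
        qed
        also have "\<dots> \<le> C" unfolding C_def using S by (intro mult_right_mono) auto
        finally have "2 * (16 * real M) ^ M * 2 powr (real M - 2 * \<alpha>) * (norm h ^ M * s powr (2 * \<alpha> - real M)) \<le> C * (norm h ^ M * s powr (2 * \<alpha> - real M))"
          by (intro mult_right_mono) auto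
        then show ?thesis by (simp add: mult_ac)
      qed
      finally show ?thesis by (simp add: mult_left_mono)
    qed
    then show "\<bar>(fwd_diff h ^^ M) (\<lambda>\<xi>. exp (- (norm \<xi> powr (2 * \<alpha>)))) \<xi>\<bar> \<le> C * norm h ^ M * (norm h + norm \<xi>) powr (2 * \<alpha> - real M)"
      by (simp add: eq s_def)
  qed
qed

section \<open>From differences of the symbol to decay of its Fourier integral\<close>

lemma integral_lborel_translate:
  fixes g :: "'a::euclidean_space \<Rightarrow> 'b::{banach, second_countable_topology}"
  assumes "integrable lborel g"
  shows "integrable lborel (\<lambda>y. g (c + y))" "(LINT y|lborel. g (c + y)) = (LINT y|lborel. g y)"
proof -
  have [measurable]: "g \<in> borel_measurable borel" using assms by auto
  have "integrable (distr lborel borel ((+) c)) g" using assms by (simp add: lborel_distr_plus)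
  then show "integrable lborel (\<lambda>y. g (c + y))" by (subst (asm) integrable_distr_eq) auto
  have "(LINT y|lborel. g y) = (LINT y|distr lborel borel ((+) c). g y)" by (simp add: lborel_distr_plus)
  also have "\<dots> = (LINT y|lborel. g (c + y))" by (rule integral_distr) auto
  finally show "(LINT y|lborel. g (c + y)) = (LINT y|lborel. g y)" ..
qed

lemma borel_measurable_cis [measurable]: "cis \<in> borel_measurable borel"
  by (rule borel_measurable_continuous_onI) (auto intro!: continuous_intros simp: cis_conv_exp[abs_def])

lemma integrable_cis_mult:
  fixes f :: "'b \<Rightarrow> complex"
  assumes "integrable M f" "\<theta> \<in> borel_measurable M"
  shows "integrable M (\<lambda>x. cis (\<theta> x) * f x)"
proof (rule Bochner_Integration.integrable_bound[OF assms(1)])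
  have [measurable]: "f \<in> borel_measurable M" using assms(1) by auto
  show "(\<lambda>x. cis (\<theta> x) * f x) \<in> borel_measurable M" using assms(2) by measurable
qed (auto simp: norm_mult)

text \<open>Because x . h = \<pi>, translation by h multiplies the Fourier integral by -1, so each
  difference contributes a factor -2. This takes the place of integration by parts, for which the
  symbol is in general not smooth enough at the origin.\<close>

lemma fourier_fwd_diff:
  fixes g :: "'a::euclidean_space \<Rightarrow> real"
  assumes g: "integrable lborel g" and h: "x \<bullet> h = pi"
  shows "integrable lborel ((fwd_diff h ^^ k) g) \<and>
    (LINT \<xi>|lborel. cis (x \<bullet> \<xi>) * of_real ((fwd_diff h ^^ k) g \<xi>)) = (-2) ^ k * (LINT \<xi>|lborel. cis (x \<bullet> \<xi>) * of_real (g \<xi>))"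
proof (induction k)
  case (Suc k)
  define f where "f = (fwd_diff h ^^ k) g"
  have f: "integrable lborel f" using Suc by (simp add: f_def)
  have f': "integrable lborel (\<lambda>\<xi>. f (h + \<xi>))" by (rule integral_lborel_translate(1)[OF f])
  have I: "integrable lborel (\<lambda>\<xi>. cis (x \<bullet> \<xi>) * of_real (f \<xi>))"
    by (rule integrable_cis_mult) (use f in auto)
  have I': "integrable lborel (\<lambda>\<xi>. cis (x \<bullet> \<xi>) * of_real (f (h + \<xi>)))"
    by (rule integrable_cis_mult) (use f' in auto)
  have eq: "fwd_diff h f = (\<lambda>\<xi>. f (h + \<xi>) - f \<xi>)" by (simp add: fwd_diff_def add.commute)
  have "(LINT \<xi>|lborel. cis (x \<bullet> \<xi>) * of_real (f \<xi>)) = (LINT \<xi>|lborel. cis (x \<bullet> (h + \<xi>)) * of_real (f (h + \<xi>)))"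
    by (rule integral_lborel_translate(2)[OF I, symmetric])
  also have "\<dots> = (LINT \<xi>|lborel. - (cis (x \<bullet> \<xi>) * of_real (f (h + \<xi>))))"
    by (simp add: inner_add_right h cis_mult[symmetric] cis_pi)
  also have "\<dots> = - (LINT \<xi>|lborel. cis (x \<bullet> \<xi>) * of_real (f (h + \<xi>)))"
    by simp
  finally have sh: "(LINT \<xi>|lborel. cis (x \<bullet> \<xi>) * of_real (f (h + \<xi>))) = - (LINT \<xi>|lborel. cis (x \<bullet> \<xi>) * of_real (f \<xi>))" by simp
  have "(LINT \<xi>|lborel. cis (x \<bullet> \<xi>) * of_real (fwd_diff h f \<xi>)) =
    (LINT \<xi>|lborel. cis (x \<bullet> \<xi>) * of_real (f (h + \<xi>))) - (LINT \<xi>|lborel. cis (x \<bullet> \<xi>) * of_real (f \<xi>))"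
    unfolding eq of_real_diff right_diff_distrib by (rule Bochner_Integration.integral_diff[OF I' I])
  also have "\<dots> = (-2) * (LINT \<xi>|lborel. cis (x \<bullet> \<xi>) * of_real (f \<xi>))" unfolding sh by simp
  finally have 2: "(LINT \<xi>|lborel. cis (x \<bullet> \<xi>) * of_real (fwd_diff h f \<xi>)) = (-2) * (LINT \<xi>|lborel. cis (x \<bullet> \<xi>) * of_real (f \<xi>))" .
  have 1: "integrable lborel (fwd_diff h f)" unfolding eq using f f' by auto
  from 1 2 Suc show ?case by (simp add: f_def)
qed (use g in simp)

text \<open>For u > 1 a single term of the exponential series, the k-th power of u^a with a k > b,
  already beats u^b.\<close>

lemma exp_powr_le_powr:
  fixes a b :: real
  assumes "0 < a" "0 \<le> b"
  obtains C where "0 < C" "\<And>u. 0 \<le> u \<Longrightarrow> exp (- (u powr a)) \<le> C * (1 + u) powr (- b)"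
proof -
  obtain k :: nat where k: "b / a < real k" using reals_Archimedean2 by blast
  then have kb: "b \<le> a * real k" using assms by (simp add: field_simps)
  have fact: "v ^ k / fact k \<le> exp v" if "0 \<le> v" for v :: real
  proof -
    have "(\<Sum>i\<in>{k}. v ^ i /\<^sub>R fact i) \<le> (\<Sum>i. v ^ i /\<^sub>R fact i)"
      by (rule sum_le_suminf[OF summable_exp_generic]) (use that in auto)
    then show ?thesis by (simp add: exp_def divide_inverse mult.commute)
  qed
  show thesis
  proof (rule that[of "(fact k + 1) * 2 powr b"])
    fix u :: real assume u: "0 \<le> u"
    show "exp (- (u powr a)) \<le> (fact k + 1) * 2 powr b * (1 + u) powr (- b)"
    proof (cases "u \<le> 1")
      case True
      have "exp (- (u powr a)) \<le> 1" by simp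
      also have "1 \<le> 2 powr b * (1 + u) powr (- b)"
      proof -
        have "2 powr (- b) \<le> (1 + u) powr (- b)"
          using True u assms by (intro powr_mono2') auto
        then have "2 powr b * 2 powr (- b) \<le> 2 powr b * (1 + u) powr (- b)"
          by (intro mult_left_mono) auto
        then show ?thesis by (simp add: powr_add[symmetric])
      qed
      also have "\<dots> \<le> (fact k + 1) * (2 powr b * (1 + u) powr (- b))"
        using mult_right_mono[of 1 "fact k + 1 :: real" "2 powr b * (1 + u) powr (- b)"] by simp
      finally show ?thesis by (simp add: mult.assoc)
    next
      case False
      then have u1: "1 \<le> u" by simp
      have "u powr b \<le> u powr (a * real k)" using u1 kb by (rule powr_mono[rotated])
      also have "\<dots> = (u powr a) ^ k" using u1 by (simp add: powr_powr[symmetric] powr_realpow)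
      finally have "u powr b / fact k \<le> exp (u powr a)"
        using fact[of "u powr a"] divide_right_mono[of "u powr b" "(u powr a) ^ k" "fact k"] by simp
      then have "exp (- (u powr a)) \<le> fact k * u powr (- b)"
        using u1 by (simp add: exp_minus powr_minus field_simps)
      also have "u powr (- b) \<le> ((1 + u) / 2) powr (- b)"
        using u1 assms by (intro powr_mono2') auto
      also have "((1 + u) / 2) powr (- b) = 2 powr b * (1 + u) powr (- b)"
        using u1 by (simp add: powr_divide powr_minus field_simps)
      also have "fact k * (2 powr b * (1 + u) powr (- b)) \<le> (fact k + 1) * (2 powr b * (1 + u) powr (- b))"
        by (intro mult_right_mono) auto
      finally show ?thesis by (simp add: mult.assoc mult_left_mono)
    qed
  qed (simp add: add_pos_nonneg)
qed

lemma integrable_exp_powr: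
  assumes "0 < a"
  shows "integrable lborel (\<lambda>\<xi> :: 'a::euclidean_space. exp (- (norm \<xi> powr a)))"
proof -
  obtain C where C: "0 < C" "\<And>u. 0 \<le> u \<Longrightarrow> exp (- (u powr a)) \<le> C * (1 + u) powr (- (real DIM('a) + 1))"
    using exp_powr_le_powr[OF assms, of "real DIM('a) + 1"] by auto
  have "(\<integral>\<^sup>+\<xi>. ennreal (norm (exp (- (norm \<xi> powr a)))) \<partial>(lborel :: 'a measure)) \<le> (\<integral>\<^sup>+\<xi>. ennreal C * ennreal (majorant 1 1 \<xi>) \<partial>(lborel :: 'a measure))"
    using C by (intro nn_integral_mono) (simp add: majorant_def ennreal_mult[symmetric] ennreal_leI)
  also have "\<dots> = ennreal C * (\<integral>\<^sup>+\<xi>. ennreal (majorant 1 1 \<xi>) \<partial>(lborel :: 'a measure))"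
    by (rule nn_integral_cmult) measurable
  also have "\<dots> < \<infinity>"
    using nn_integral_majorant[of 1 1, where 'a='a] by (simp add: ennreal_mult_less_top le_less_trans)
  finally show ?thesis by (intro integrableI_bounded) auto
qed

text \<open>For h = \<pi> x / |x|^2 the M-th difference of the symbol has L^1 norm of order |h|^(n +
  2 \<alpha>), that is, |x|^(-n - 2 \<alpha>), and this norm bounds 2^M times the Fourier integral.
  For |x| \<le> 1 the L^1 norm of the symbol suffices.\<close>

lemma fourier_exp_powr_bound:
  assumes \<alpha>: "0 < \<alpha>" "\<alpha> \<le> 1"
  shows "\<exists>C>0. \<forall>x :: 'a::euclidean_space.
    cmod (LINT \<xi>|lborel. cis (x \<bullet> \<xi>) * of_real (exp (- (norm \<xi> powr (2 * \<alpha>))))) \<le> C * majorant (2 * \<alpha>) 1 x"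
proof -
  let ?n = "real DIM('a)"
  define m :: "'a \<Rightarrow> real" where "m \<xi> = exp (- (norm \<xi> powr (2 * \<alpha>)))" for \<xi>
  have m: "integrable lborel m" unfolding m_def using \<alpha> by (intro integrable_exp_powr) auto
  \<comment> \<open>Enough differences to make |h|^M (|h| + |\<xi>|)^(2 \<alpha> - M) integrable in
    \<xi>.\<close>
  obtain M :: nat where M: "?n + 2 * \<alpha> < real M" using reals_Archimedean2 by blast
  have M0: "0 < M" "2 * \<alpha> < real M"
  proof -
    show "2 * \<alpha> < real M" using M by linarith
    then have "0 < real M" using \<alpha> by linarith
    then show "0 < M" by simp
  qed
  obtain C1 where C1: "0 < C1" "\<And>h \<xi> :: 'a. h \<noteq> 0 \<Longrightarrow> \<bar>(fwd_diff h ^^ M) m \<xi>\<bar> \<le> C1 * norm h ^ M * (norm h + norm \<xi>) powr (2 * \<alpha> - real M)"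
    using fwd_diff_exp_bound[OF \<alpha> M0, where 'a='a] unfolding m_def by blast
  \<comment> \<open>With this e that bound is |h|^(n + 2 \<alpha>) times the majorant at height |h|,
    whose mass has been estimated.\<close>
  define e where "e = real M - 2 * \<alpha> - ?n"
  have e: "0 < e" using M by (simp add: e_def)
  define K0 where "K0 = (?n + e) * unit_ball_vol ?n / e"
  have K0: "0 < K0" using e by (auto simp: K0_def intro!: divide_pos_pos mult_pos_pos add_pos_pos)
  define I where "I = (LINT \<xi>|(lborel :: 'a measure). m \<xi>)"
  have I: "0 \<le> I" by (simp add: I_def m_def)
  define C where "C = (I + C1 * K0 * pi powr (?n + 2 * \<alpha>)) * 2 powr (?n + 2 * \<alpha>)"
  have C: "0 < C" using I C1 K0 by (auto simp: C_def intro!: mult_pos_pos add_nonneg_pos)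
  define K where "K x = (LINT \<xi>|lborel. cis (x \<bullet> \<xi>) * of_real (m \<xi>))" for x
  have K1: "cmod (K x) \<le> I" for x
  proof -
    have "cmod (K x) \<le> (LINT \<xi>|lborel. cmod (cis (x \<bullet> \<xi>) * of_real (m \<xi>)))"
      unfolding K_def by (rule integral_norm_bound)
    also have "\<dots> = I" by (simp add: I_def norm_mult m_def)
    finally show ?thesis .
  qed
  have K2: "cmod (K x) \<le> C1 * K0 * pi powr (?n + 2 * \<alpha>) * norm x powr (- ?n - 2 * \<alpha>)" if x: "x \<noteq> 0" for x
  proof -
    define h where "h = (pi / (norm x)\<^sup>2) *\<^sub>R x"
    have xh: "x \<bullet> h = pi" using x by (simp add: h_def power2_norm_eq_inner)
    have nh: "norm h = pi / norm x" using x by (simp add: h_def power2_eq_square)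
    have h: "h \<noteq> 0" using x by (simp add: h_def)
    have h0: "0 < norm h" using h by simp
    have F: "integrable lborel ((fwd_diff h ^^ M) m)" "(LINT \<xi>|lborel. cis (x \<bullet> \<xi>) * of_real ((fwd_diff h ^^ M) m \<xi>)) = (-2) ^ M * K x"
      using fourier_fwd_diff[OF m xh, of M] by (auto simp: K_def)
    have "1 * cmod (K x) \<le> 2 ^ M * cmod (K x)" by (intro mult_right_mono) auto
    also have "\<dots> = cmod ((-2) ^ M * K x)" by (simp add: norm_mult norm_power)
    also have "\<dots> \<le> (LINT \<xi>|lborel. cmod (cis (x \<bullet> \<xi>) * of_real ((fwd_diff h ^^ M) m \<xi>)))"
      unfolding F(2)[symmetric] by (rule integral_norm_bound)
    also have "\<dots> = (LINT \<xi>|lborel. \<bar>(fwd_diff h ^^ M) m \<xi>\<bar>)" by (simp add: norm_mult)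
    finally have 1: "cmod (K x) \<le> (LINT \<xi>|lborel. \<bar>(fwd_diff h ^^ M) m \<xi>\<bar>)" by simp
    have "ennreal (LINT \<xi>|lborel. \<bar>(fwd_diff h ^^ M) m \<xi>\<bar>) = (\<integral>\<^sup>+\<xi>. ennreal \<bar>(fwd_diff h ^^ M) m \<xi>\<bar> \<partial>lborel)"
      using F(1) by (intro nn_integral_eq_integral[symmetric]) auto
    also have "\<dots> \<le> (\<integral>\<^sup>+\<xi>. ennreal (C1 * norm h powr (?n + 2 * \<alpha>)) * ennreal (majorant e (norm h) \<xi>) \<partial>(lborel :: 'a measure))"
    proof (rule nn_integral_mono)
      fix \<xi> :: 'a
      have "C1 * norm h ^ M * (norm h + norm \<xi>) powr (2 * \<alpha> - real M) = C1 * norm h powr (?n + 2 * \<alpha>) * majorant e (norm h) \<xi>"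
      proof -
        have "norm h powr (?n + 2 * \<alpha>) * norm h powr e = norm h ^ M"
          using h0 by (simp add: powr_add[symmetric] e_def powr_realpow)
        moreover have "2 * \<alpha> - real M = - ?n - e" by (simp add: e_def)
        ultimately show ?thesis by (simp add: majorant_def mult.assoc[symmetric])
      qed
      then have "\<bar>(fwd_diff h ^^ M) m \<xi>\<bar> \<le> C1 * norm h powr (?n + 2 * \<alpha>) * majorant e (norm h) \<xi>"
        using C1(2)[OF h, of \<xi>] by (simp only:)
      then show "ennreal \<bar>(fwd_diff h ^^ M) m \<xi>\<bar> \<le> ennreal (C1 * norm h powr (?n + 2 * \<alpha>)) * ennreal (majorant e (norm h) \<xi>)"
        using C1(1) C1(2)[OF h, of \<xi>] by (simp add: ennreal_mult[symmetric] ennreal_leI)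
    qed
    also have "\<dots> = ennreal (C1 * norm h powr (?n + 2 * \<alpha>)) * (\<integral>\<^sup>+\<xi>. ennreal (majorant e (norm h) (\<xi> :: 'a)) \<partial>lborel)"
      by (rule nn_integral_cmult) measurable
    also have "\<dots> \<le> ennreal (C1 * norm h powr (?n + 2 * \<alpha>)) * ennreal K0"
      unfolding K0_def by (intro mult_left_mono nn_integral_majorant e h0) auto
    also have "\<dots> = ennreal (C1 * norm h powr (?n + 2 * \<alpha>) * K0)"
      using C1(1) K0 by (simp add: ennreal_mult)
    finally have "(LINT \<xi>|lborel. \<bar>(fwd_diff h ^^ M) m \<xi>\<bar>) \<le> C1 * norm h powr (?n + 2 * \<alpha>) * K0"
      using C1(1) K0 by (subst (asm) ennreal_le_iff) auto
    also have "norm h powr (?n + 2 * \<alpha>) = pi powr (?n + 2 * \<alpha>) * norm x powr (- ?n - 2 * \<alpha>)"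
    proof -
      have "- ?n - 2 * \<alpha> = - (?n + 2 * \<alpha>)" by simp
      moreover have "(pi / norm x) powr (?n + 2 * \<alpha>) = pi powr (?n + 2 * \<alpha>) / norm x powr (?n + 2 * \<alpha>)"
        by (simp add: powr_divide)
      ultimately show ?thesis unfolding nh by (simp only: powr_minus divide_inverse)
    qed
    finally show ?thesis using 1 by (simp add: mult_ac)
  qed
  show ?thesis
  proof (intro exI[of _ C] conjI allI C)
    fix x :: 'a
    have "cmod (K x) \<le> C * (1 + norm x) powr (- ?n - 2 * \<alpha>)"
    proof (cases "norm x \<le> 1")
      case True
      have "1 = 2 powr (?n + 2 * \<alpha>) * 2 powr (- ?n - 2 * \<alpha>)" by (simp add: powr_add[symmetric])
      also have "\<dots> \<le> 2 powr (?n + 2 * \<alpha>) * (1 + norm x) powr (- ?n - 2 * \<alpha>)"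
        using True \<alpha> by (intro mult_left_mono powr_mono2') (auto intro: add_pos_nonneg)
      finally have "I * 1 \<le> I * (2 powr (?n + 2 * \<alpha>) * (1 + norm x) powr (- ?n - 2 * \<alpha>))"
        using I by (rule mult_left_mono)
      also have "\<dots> \<le> C * (1 + norm x) powr (- ?n - 2 * \<alpha>)"
        unfolding C_def using C1 K0 by (simp add: distrib_right mult.assoc)
      finally show ?thesis using K1[of x] by simp
    next
      case False
      then have x: "x \<noteq> 0" "1 < norm x" by auto
      have "norm x powr (- ?n - 2 * \<alpha>) \<le> ((1 + norm x) / 2) powr (- ?n - 2 * \<alpha>)"
        using x \<alpha> by (intro powr_mono2') auto
      also have "\<dots> = 2 powr (?n + 2 * \<alpha>) * (1 + norm x) powr (- ?n - 2 * \<alpha>)"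
      proof -
        have "- ?n - 2 * \<alpha> = - (?n + 2 * \<alpha>)" by simp
        then show ?thesis using x by (simp only: powr_divide powr_minus) (simp add: divide_inverse)
      qed
      finally have "cmod (K x) \<le> C1 * K0 * pi powr (?n + 2 * \<alpha>) * (2 powr (?n + 2 * \<alpha>) * (1 + norm x) powr (- ?n - 2 * \<alpha>))"
        using C1(1) K0 by (intro order_trans[OF K2[OF x(1)]] mult_left_mono) auto
      also have "\<dots> \<le> C * (1 + norm x) powr (- ?n - 2 * \<alpha>)"
        unfolding C_def using I by (simp add: distrib_right mult.assoc)
      finally show ?thesis .
    qed
    then show "cmod (LINT \<xi>|lborel. cis (x \<bullet> \<xi>) * of_real (exp (- (norm \<xi> powr (2 * \<alpha>))))) \<le> C * majorant (2 * \<alpha>) 1 x"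
      by (simp add: K_def m_def majorant_def)
  qed
qed

text \<open>Substituting t \<xi> for \<xi> reduces time t^(2 \<alpha>) to time 1. Kernel and
  majorant obey the same law: each is t^(-n) times its value for t = 1 at the point x / t.\<close>

lemma heat_kernel_bound:
  assumes \<alpha>: "0 < \<alpha>" "\<alpha> \<le> 1"
  shows "\<exists>C>0. \<forall>t>0. \<forall>x :: 'a::euclidean_space. cmod (heat_kernel \<alpha> (t powr (2 * \<alpha>)) x) \<le> C * majorant (2 * \<alpha>) t x"
proof -
  let ?n = "real DIM('a)"
  obtain C where C: "0 < C" "\<And>x :: 'a. cmod (LINT \<xi>|lborel. cis (x \<bullet> \<xi>) * of_real (exp (- (norm \<xi> powr (2 * \<alpha>))))) \<le> C * majorant (2 * \<alpha>) 1 x"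
    using fourier_exp_powr_bound[OF \<alpha>, where 'a='a] by blast
  define c where "c = (2 * pi) powr (- ?n / 2)"
  have c: "0 < c" by (simp add: c_def)
  show ?thesis
  proof (intro exI[of _ "c * C"] conjI allI impI)
    show "0 < c * C" using c C by simp
    fix t :: real and x :: 'a assume t: "0 < t"
    define y where "y = inverse t *\<^sub>R x"
    define L where "L = (LINT \<xi>|(lborel :: 'a measure). cis (x \<bullet> \<xi>) * of_real (exp (- (t powr (2 * \<alpha>)) * norm \<xi> powr (2 * \<alpha>))))"
    have "(LINT \<xi>|(lborel :: 'a measure). cis (y \<bullet> \<xi>) * of_real (exp (- (norm \<xi> powr (2 * \<alpha>))))) =
      t ^ DIM('a) *\<^sub>R (LINT \<xi>|lborel. cis (y \<bullet> (t *\<^sub>R \<xi>)) * of_real (exp (- (norm (t *\<^sub>R \<xi>) powr (2 * \<alpha>)))))"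
      by (rule integral_lborel_scale) (use t in auto)
    also have "(LINT \<xi>|(lborel :: 'a measure). cis (y \<bullet> (t *\<^sub>R \<xi>)) * of_real (exp (- (norm (t *\<^sub>R \<xi>) powr (2 * \<alpha>))))) = L"
    proof -
      have "y \<bullet> (t *\<^sub>R \<xi>) = x \<bullet> \<xi>" for \<xi>
        using t by (simp add: y_def mult.assoc[symmetric])
      then show ?thesis unfolding L_def using t by (simp add: powr_mult)
    qed
    finally have "t ^ DIM('a) * cmod L \<le> C * majorant (2 * \<alpha>) 1 y"
      using C(2)[of y] t by simp
    moreover have "majorant (2 * \<alpha>) 1 y = t ^ DIM('a) * majorant (2 * \<alpha>) t x"
    proof -
      have "1 + norm y = (t + norm x) / t" using t by (simp add: y_def field_simps)
      then have "(1 + norm y) powr (- ?n - 2 * \<alpha>) = (t + norm x) powr (- ?n - 2 * \<alpha>) / t powr (- ?n - 2 * \<alpha>)"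
        using t by (simp add: powr_divide)
      also have "\<dots> = (t + norm x) powr (- ?n - 2 * \<alpha>) * t powr (?n + 2 * \<alpha>)"
      proof -
        have "- ?n - 2 * \<alpha> = - (?n + 2 * \<alpha>)" by simp
        then show ?thesis by (simp only: powr_minus divide_inverse inverse_inverse_eq)
      qed
      also have "t powr (?n + 2 * \<alpha>) = t ^ DIM('a) * t powr (2 * \<alpha>)" using t by (simp add: powr_add powr_realpow)
      finally show ?thesis by (simp add: majorant_def)
    qed
    ultimately have "t ^ DIM('a) * cmod L \<le> t ^ DIM('a) * (C * majorant (2 * \<alpha>) t x)"
      by (simp add: mult.left_commute)
    then have "cmod L \<le> C * majorant (2 * \<alpha>) t x" using t by simp
    then have "c * cmod L \<le> c * (C * majorant (2 * \<alpha>) t x)" using c by (intro mult_left_mono) auto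
    then show "cmod (heat_kernel \<alpha> (t powr (2 * \<alpha>)) x) \<le> c * C * majorant (2 * \<alpha>) t x"
      by (simp add: heat_kernel_def L_def c_def norm_mult mult.assoc)
  qed
qed

text \<open>If the convolution integral does not exist, the Bochner integral is 0 by convention and
  the bound is trivial; otherwise the norm is taken inside.\<close>

lemma heat_ext_le_smoothed:
  fixes f :: "'a::euclidean_space \<Rightarrow> real"
  assumes C: "\<And>x :: 'a. cmod (heat_kernel \<alpha> s x) \<le> C * majorant e t x" "0 < C"
    and [measurable]: "f \<in> borel_measurable lebesgue"
  shows "ennreal (cmod (heat_ext \<alpha> s f x)) \<le> ennreal C * smoothed e f (t, x)"
proof (cases "integrable lebesgue (\<lambda>y. heat_kernel \<alpha> s (x - y) * of_real (f y))")
  case True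
  have "ennreal (cmod (heat_ext \<alpha> s f x)) \<le> (\<integral>\<^sup>+y. ennreal (cmod (heat_kernel \<alpha> s (x - y) * of_real (f y))) \<partial>lebesgue)"
    unfolding heat_ext_def by (rule integral_norm_bound_ennreal[OF True])
  also have "\<dots> \<le> (\<integral>\<^sup>+y. ennreal C * (ennreal (majorant e t (x - y)) * ennreal \<bar>f y\<bar>) \<partial>lebesgue)"
  proof (rule nn_integral_mono)
    fix y
    have "cmod (heat_kernel \<alpha> s (x - y) * of_real (f y)) \<le> C * majorant e t (x - y) * \<bar>f y\<bar>"
      unfolding norm_mult using C by (intro mult_mono) auto
    then show "ennreal (cmod (heat_kernel \<alpha> s (x - y) * of_real (f y))) \<le> ennreal C * (ennreal (majorant e t (x - y)) * ennreal \<bar>f y\<bar>)"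
      using C(2) by (simp add: ennreal_mult[symmetric] ennreal_leI mult.assoc)
  qed
  also have "\<dots> = ennreal C * smoothed e f (t, x)"
    unfolding smoothed_def prod.case
  proof (rule nn_integral_cmult)
    have "(\<lambda>y. ennreal (majorant e t (x - y))) \<in> borel_measurable lborel" by measurable
    then have [measurable]: "(\<lambda>y. ennreal (majorant e t (x - y))) \<in> borel_measurable lebesgue" by (rule measurable_completion)
    show "(\<lambda>y. ennreal (majorant e t (x - y)) * ennreal \<bar>f y\<bar>) \<in> borel_measurable lebesgue" by measurable
  qed
  finally show ?thesis .
qed (simp add: heat_ext_def not_integrable_integral_eq)

section \<open>Fourier transforms of Gaussians and of test functions\<close>

lemma
  fixes f :: "'a::euclidean_space \<Rightarrow> real \<Rightarrow> complex"
  assumes f: "\<And>b. b \<in> Basis \<Longrightarrow> integrable lborel (f b)"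
  shows integrable_lborel_prod: "integrable lborel (\<lambda>x. \<Prod>b\<in>Basis. f b (x \<bullet> b))"
    and integral_lborel_prod: "(LINT x|lborel. (\<Prod>b\<in>Basis. f b (x \<bullet> b))) = (\<Prod>b\<in>Basis. (LINT u|lborel. f b u))"
proof -
  interpret product_sigma_finite "\<lambda>_ :: 'a. lborel :: real measure" ..
  have m: "(\<lambda>x. \<Prod>b\<in>Basis. f b (x \<bullet> b)) \<in> borel_measurable borel"
  proof (rule borel_measurable_prod)
    fix b :: 'a assume "b \<in> Basis"
    then have [measurable]: "f b \<in> borel_measurable borel" using f[of b] by auto
    show "(\<lambda>x. f b (x \<bullet> b)) \<in> borel_measurable borel" by measurable
  qed
  have eq: "(\<Prod>b\<in>Basis. f b ((\<Sum>c\<in>Basis. x c *\<^sub>R c) \<bullet> b)) = (\<Prod>b\<in>Basis. f b (x b))" for x :: "'a \<Rightarrow> real"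
    by (intro prod.cong) auto
  show "integrable lborel (\<lambda>x. \<Prod>b\<in>Basis. f b (x \<bullet> b))"
    using product_integrable_prod[OF finite_Basis f] m
    by (subst lborel_eq, subst integrable_distr_eq) (simp_all only: eq, simp_all)
  show "(LINT x|lborel. (\<Prod>b\<in>Basis. f b (x \<bullet> b))) = (\<Prod>b\<in>Basis. (LINT u|lborel. f b u))"
    using product_integral_prod[OF finite_Basis f] m
    by (subst lborel_eq, subst integral_distr) (simp_all only: eq, simp_all)
qed

text \<open>Taken from the characteristic function of the standard normal distribution.\<close>

lemma fourier_gauss_real:
  "integrable lborel (\<lambda>x. cis (x * u) * of_real (exp (- x\<^sup>2 / 2)))"
  "(LINT x|lborel. cis (x * u) * of_real (exp (- x\<^sup>2 / 2))) = of_real (sqrt (2 * pi) * exp (- u\<^sup>2 / 2))"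
proof -
  have eq: "cis (x * u) * of_real (exp (- x\<^sup>2 / 2)) = of_real (sqrt (2 * pi)) * (std_normal_density x *\<^sub>R iexp (u * x))" for x
    by (simp add: std_normal_density_def cis_conv_exp scaleR_conv_of_real mult_ac)
  have sq: "integrable lborel std_normal_density" by (rule integrable_normal_density) simp
  have int: "integrable lborel (\<lambda>x. std_normal_density x *\<^sub>R iexp (u * x))"
    by (rule Bochner_Integration.integrable_bound[OF sq]) auto
  then show "integrable lborel (\<lambda>x. cis (x * u) * of_real (exp (- x\<^sup>2 / 2)))"
    unfolding eq by (rule integrable_mult_right)
  have "(LINT x|lborel. std_normal_density x *\<^sub>R iexp (u * x)) = char std_normal_distribution u"
    unfolding char_def by (subst integral_density) auto
  then have "(LINT x|lborel. std_normal_density x *\<^sub>R iexp (u * x)) = of_real (exp (- u\<^sup>2 / 2))"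
    by (simp add: char_std_normal_distribution)
  then show "(LINT x|lborel. cis (x * u) * of_real (exp (- x\<^sup>2 / 2))) = of_real (sqrt (2 * pi) * exp (- u\<^sup>2 / 2))"
    unfolding eq integral_mult_right_zero by simp
qed

text \<open>Scaled to be its own Fourier transform in the normalisation with (2
  \<pi>)^(-n/2).\<close>

definition gauss :: "'a::euclidean_space \<Rightarrow> real" where
  "gauss x = exp (- (norm x)\<^sup>2 / 2)"

lemma gauss_pos: "0 < gauss x" "gauss x \<le> 1"
  by (simp_all add: gauss_def)

lemma borel_measurable_gauss [measurable]: "gauss \<in> borel_measurable borel"
  unfolding gauss_def[abs_def] by measurable

lemma gauss_minus: "gauss (- x) = gauss x"
  by (simp add: gauss_def)

lemma gauss_prod: "gauss x = (\<Prod>b\<in>Basis. exp (- (x \<bullet> b)\<^sup>2 / 2))"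
proof -
  have "(norm x)\<^sup>2 = (\<Sum>b\<in>Basis. (x \<bullet> b)\<^sup>2)"
    unfolding power2_norm_eq_inner by (subst euclidean_inner) (simp add: power2_eq_square)
  then have "- (norm x)\<^sup>2 / 2 = (\<Sum>b\<in>Basis. - (x \<bullet> b)\<^sup>2 / 2)"
    by (simp add: sum_divide_distrib sum_negf)
  then show ?thesis unfolding gauss_def by (simp only: exp_sum finite_Basis)
qed

lemma cis_sum: "finite A \<Longrightarrow> cis (\<Sum>b\<in>A. f b) = (\<Prod>b\<in>A. cis (f b))"
  by (induction A rule: finite_induct) (auto simp: cis_mult[symmetric])

lemma fourier_gauss:
  fixes \<xi> :: "'a::euclidean_space"
  shows "integrable lborel (\<lambda>x. cis (x \<bullet> \<xi>) * of_real (gauss x))"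
    and "(LINT x|lborel. cis (x \<bullet> \<xi>) * of_real (gauss x)) = of_real ((2 * pi) powr (real DIM('a) / 2) * gauss \<xi>)"
proof -
  have eq: "cis (x \<bullet> \<xi>) * of_real (gauss x) = (\<Prod>b\<in>Basis. cis ((x \<bullet> b) * (\<xi> \<bullet> b)) * of_real (exp (- (x \<bullet> b)\<^sup>2 / 2)))" for x
    by (subst euclidean_inner, subst cis_sum) (simp_all add: gauss_prod prod.distrib)
  show "integrable lborel (\<lambda>x. cis (x \<bullet> \<xi>) * of_real (gauss x))"
    unfolding eq by (rule integrable_lborel_prod) (rule fourier_gauss_real)
  have "(LINT x|lborel. cis (x \<bullet> \<xi>) * of_real (gauss x)) = (\<Prod>b\<in>Basis. of_real (sqrt (2 * pi) * exp (- (\<xi> \<bullet> b)\<^sup>2 / 2)))"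
    unfolding eq by (subst integral_lborel_prod, rule fourier_gauss_real) (simp only: fourier_gauss_real(2))
  also have "\<dots> = of_real (\<Prod>b\<in>(Basis :: 'a set). sqrt (2 * pi) * exp (- (\<xi> \<bullet> b)\<^sup>2 / 2))"
    by (rule of_real_prod[symmetric])
  also have "(\<Prod>b\<in>(Basis :: 'a set). sqrt (2 * pi) * exp (- (\<xi> \<bullet> b)\<^sup>2 / 2)) = sqrt (2 * pi) ^ DIM('a) * gauss \<xi>"
    by (simp add: prod.distrib gauss_prod)
  also have "sqrt (2 * pi) ^ DIM('a) = (2 * pi) powr (real DIM('a) / 2)"
    by (simp add: powr_half_sqrt[symmetric] powr_realpow[symmetric] powr_powr)
  finally show "(LINT x|lborel. cis (x \<bullet> \<xi>) * of_real (gauss x)) = of_real ((2 * pi) powr (real DIM('a) / 2) * gauss \<xi>)" .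
qed

lemma gauss_integrable: "integrable lborel (gauss :: 'a::euclidean_space \<Rightarrow> real)"
proof -
  have "integrable lborel (\<lambda>x :: 'a. norm (cis (x \<bullet> 0) * of_real (gauss x)))"
    by (intro integrable_norm fourier_gauss)
  then show ?thesis by (simp add: norm_mult abs_of_pos[OF gauss_pos(1)])
qed

lemma fourier_gauss_scaled:
  fixes w :: "'a::euclidean_space"
  assumes e: "0 < e"
  shows "integrable lborel (\<lambda>x. cis (x \<bullet> w) * of_real (gauss (e *\<^sub>R x)))"
    and "of_real (e ^ DIM('a)) * (LINT x|lborel. cis (x \<bullet> w) * of_real (gauss (e *\<^sub>R x))) = of_real ((2 * pi) powr (real DIM('a) / 2) * gauss ((1 / e) *\<^sub>R w))"
proof -
  let ?g = "\<lambda>x :: 'a. cis (x \<bullet> ((1 / e) *\<^sub>R w)) * of_real (gauss x)"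
  have eq: "cis (x \<bullet> w) * of_real (gauss (e *\<^sub>R x)) = ?g (0 + e *\<^sub>R x)" for x
    using e by simp
  have "integrable (density (distr lborel borel (\<lambda>x. 0 + e *\<^sub>R x)) (\<lambda>_. \<bar>e\<bar> ^ DIM('a))) ?g"
    using fourier_gauss(1)[of "(1 / e) *\<^sub>R w"] e by (subst lborel_affine[symmetric]) auto
  then have i: "integrable lborel (\<lambda>x. e ^ DIM('a) *\<^sub>R (cis (x \<bullet> w) * of_real (gauss (e *\<^sub>R x))))"
    unfolding eq using e by (subst (asm) integrable_density) (auto simp: integrable_distr_eq)
  show "integrable lborel (\<lambda>x. cis (x \<bullet> w) * of_real (gauss (e *\<^sub>R x)))"
    using integrable_scaleR_right[of "inverse (e ^ DIM('a))", OF i] e by simp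
  have "(LINT x|lborel. ?g x) = e ^ DIM('a) *\<^sub>R (LINT x|lborel. ?g (e *\<^sub>R x))"
    by (rule integral_lborel_scale) (use e in auto)
  then show "of_real (e ^ DIM('a)) * (LINT x|lborel. cis (x \<bullet> w) * of_real (gauss (e *\<^sub>R x))) = of_real ((2 * pi) powr (real DIM('a) / 2) * gauss ((1 / e) *\<^sub>R w))"
    unfolding eq fourier_gauss(2) by (simp add: scaleR_conv_of_real)
qed

lemma gauss_le_powr:
  fixes b :: real
  assumes "0 \<le> b"
  obtains C :: real where "0 < C" "\<And>u. 0 \<le> u \<Longrightarrow> exp (- u\<^sup>2 / 2) \<le> C * (1 + u) powr (- b)"
proof -
  obtain C where C: "0 < C" "\<And>u. 0 \<le> u \<Longrightarrow> exp (- (u powr 2)) \<le> C * (1 + u) powr (- b)"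
    using exp_powr_le_powr[of 2 b] assms by auto
  show thesis
  proof (rule that[of "C * 2 powr b"])
    fix u :: real assume u: "0 \<le> u"
    have "exp (- u\<^sup>2 / 2) \<le> exp (- ((u / 2) powr 2))"
      using u by (simp add: power_divide)
    also have "\<dots> \<le> C * (1 + u / 2) powr (- b)" by (rule C) (use u in simp)
    also have "\<dots> \<le> C * ((1 + u) / 2) powr (- b)"
      using C(1) u assms by (intro mult_left_mono powr_mono2') auto
    also have "((1 + u) / 2) powr (- b) = 2 powr b * (1 + u) powr (- b)"
      using u by (simp add: powr_divide powr_minus field_simps)
    finally show "exp (- u\<^sup>2 / 2) \<le> C * 2 powr b * (1 + u) powr (- b)" by simp
  qed (use C in simp)
qed

section \<open>Derivatives and Fourier transforms of test functions\<close>

lemma test_function_partial: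
  assumes "test_function f" "b \<in> Basis"
  shows "test_function (\<lambda>x. frechet_derivative f (at x) b)"
  unfolding test_function_def
proof
  show "\<forall>k. Ck k (\<lambda>x. frechet_derivative f (at x) b)"
  proof
    fix k
    have "Ck (Suc k) f" using assms(1) by (simp add: test_function_def)
    then show "Ck k (\<lambda>x. frechet_derivative f (at x) b)" using assms(2) by simp
  qed
  have sub: "{x. frechet_derivative f (at x) b \<noteq> 0} \<subseteq> closure {x. f x \<noteq> 0}"
  proof
    fix x assume x: "x \<in> {x. frechet_derivative f (at x) b \<noteq> 0}"
    show "x \<in> closure {x. f x \<noteq> 0}"
    proof (rule ccontr)
      assume nx: "x \<notin> closure {x. f x \<noteq> 0}"
      have "((\<lambda>_. 0) has_derivative (\<lambda>_. 0)) (at x)" by (rule has_derivative_const)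
      then have "(f has_derivative (\<lambda>_. 0)) (at x)"
      proof (rule has_derivative_transform_within_open[where s="- closure {x. f x \<noteq> 0}"])
        fix y assume "y \<in> - closure {x. f x \<noteq> 0}"
        then show "0 = f y" using closure_subset[of "{x. f x \<noteq> 0}"] by auto
      qed (use nx in auto)
      then have "frechet_derivative f (at x) = (\<lambda>_. 0)" by (rule frechet_derivative_at[symmetric])
      with x show False by simp
    qed
  qed
  then have "closure {x. frechet_derivative f (at x) b \<noteq> 0} \<subseteq> closure {x. f x \<noteq> 0}"
    by (simp add: closure_minimal)
  moreover have "compact (closure {x. f x \<noteq> 0})" using assms(1) by (simp add: test_function_def)
  ultimately show "compact (closure {x. frechet_derivative f (at x) b \<noteq> 0})"
    by (metis closed_closure compact_Int_closed inf.absorb2)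
qed

lemma test_function_line_derivative:
  fixes f :: "'a::euclidean_space \<Rightarrow> real"
  assumes "test_function f"
  shows "((\<lambda>s. f (x + s *\<^sub>R b)) has_real_derivative frechet_derivative f (at (x + s *\<^sub>R b)) b) (at s)"
proof -
  have "Ck (Suc 0) f" using assms unfolding test_function_def by blast
  then have d: "(f has_derivative frechet_derivative f (at (x + s *\<^sub>R b))) (at (x + s *\<^sub>R b))"
    by (simp add: frechet_derivative_works)
  have g: "((\<lambda>s. x + s *\<^sub>R b) has_derivative (\<lambda>t. t *\<^sub>R b)) (at s)"
    by (auto intro!: derivative_eq_intros)
  have "((\<lambda>s. f (x + s *\<^sub>R b)) has_derivative (\<lambda>t. frechet_derivative f (at (x + s *\<^sub>R b)) (t *\<^sub>R b))) (at s)"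
    using has_derivative_compose[OF g d] .
  also have "(\<lambda>t. frechet_derivative f (at (x + s *\<^sub>R b)) (t *\<^sub>R b)) = (*) (frechet_derivative f (at (x + s *\<^sub>R b)) b)"
    using has_derivative_linear[OF d] by (auto simp: fun_eq_iff linear_cmul mult.commute)
  finally show ?thesis by (simp add: has_field_derivative_def)
qed


lemma norm_fourier_le:
  fixes f :: "'a::euclidean_space \<Rightarrow> real"
  shows "cmod (fourier f \<xi>) \<le> (2 * pi) powr (- real DIM('a) / 2) * (LINT x|lborel. \<bar>f x\<bar>)"
proof -
  have "cmod (LINT x|lborel. cis (- (x \<bullet> \<xi>)) * of_real (f x)) \<le> (LINT x|lborel. cmod (cis (- (x \<bullet> \<xi>)) * of_real (f x)))"
    by (rule integral_norm_bound)
  then show ?thesis by (simp add: fourier_def norm_mult mult_left_mono)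
qed

text \<open>Difference quotients replace integration by parts: translating f by s b multiplies the
  Fourier integral by \<open>cis (s * (\<xi> \<bullet> b))\<close>, and s tends to 0 on both
  sides.\<close>

lemma fourier_partial:
  fixes f :: "'a::euclidean_space \<Rightarrow> real"
  assumes f: "test_function f" and b: "b \<in> Basis"
  shows "fourier (\<lambda>x. frechet_derivative f (at x) b) \<xi> = \<i> * of_real (\<xi> \<bullet> b) * fourier f \<xi>"
proof -
  define D where "D x = frechet_derivative f (at x) b" for x
  have D: "test_function D" unfolding D_def by (rule test_function_partial[OF f b])
  obtain B where B: "0 < B" "\<And>x. \<bar>D x\<bar> \<le> B" using test_function_bounded[OF D] by auto
  obtain R where R: "0 < R" "\<And>x. R \<le> norm x \<Longrightarrow> f x = 0" using test_function_support[OF f] by auto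
  have [measurable]: "f \<in> borel_measurable borel" "D \<in> borel_measurable borel"
    using test_function_borel f D by auto
  define h where "h m = inverse (real (Suc m))" for m
  have h: "0 < h m" "h m \<le> 1" for m by (auto simp: h_def field_simps)
  have h0: "h \<longlonglongrightarrow> 0" unfolding h_def by (rule LIMSEQ_inverse_real_of_nat)
  define I where "I = (LINT x|lborel. cis (- (x \<bullet> \<xi>)) * of_real (f x))"
  have nb: "norm b = 1" using b by simp
  have i: "integrable lborel (\<lambda>x. cis (- (x \<bullet> \<xi>)) * of_real (f x))"
    by (rule integrable_cis_mult) (use test_function_integrable[OF f] in auto)
  have shift: "integrable lborel (\<lambda>x. cis (- (x \<bullet> \<xi>)) * of_real (f (x + s *\<^sub>R b)))"
    "(LINT x|lborel. cis (- (x \<bullet> \<xi>)) * of_real (f (x + s *\<^sub>R b))) = cis (s * (\<xi> \<bullet> b)) * I" for s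
  proof -
    have eq: "cis (- (x \<bullet> \<xi>)) * of_real (f (x + s *\<^sub>R b)) = cis (s * (\<xi> \<bullet> b)) * (cis (- ((s *\<^sub>R b + x) \<bullet> \<xi>)) * of_real (f (s *\<^sub>R b + x)))" for x
      by (simp add: cis_mult inner_add_left inner_commute[of b \<xi>] add.commute mult.assoc[symmetric])
    have j: "integrable lborel (\<lambda>x. cis (- ((s *\<^sub>R b + x) \<bullet> \<xi>)) * of_real (f (s *\<^sub>R b + x)))"
      by (rule integral_lborel_translate(1)[OF i])
    show "integrable lborel (\<lambda>x. cis (- (x \<bullet> \<xi>)) * of_real (f (x + s *\<^sub>R b)))"
      unfolding eq using j by (rule integrable_mult_right)
    show "(LINT x|lborel. cis (- (x \<bullet> \<xi>)) * of_real (f (x + s *\<^sub>R b))) = cis (s * (\<xi> \<bullet> b)) * I"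
      unfolding eq I_def integral_mult_right_zero by (subst integral_lborel_translate(2)[OF i]) rule
  qed
  have q: "(LINT x|lborel. cis (- (x \<bullet> \<xi>)) * of_real ((f (x + h m *\<^sub>R b) - f x) / h m)) = (cis (h m * (\<xi> \<bullet> b)) - 1) / of_real (h m) * I" for m
  proof -
    have "(LINT x|lborel. cis (- (x \<bullet> \<xi>)) * of_real ((f (x + h m *\<^sub>R b) - f x) / h m)) =
      (LINT x|lborel. (cis (- (x \<bullet> \<xi>)) * of_real (f (x + h m *\<^sub>R b)) - cis (- (x \<bullet> \<xi>)) * of_real (f x)) / of_real (h m))"
      by (simp add: right_diff_distrib diff_divide_distrib)
    also have "\<dots> = (LINT x|lborel. cis (- (x \<bullet> \<xi>)) * of_real (f (x + h m *\<^sub>R b)) - cis (- (x \<bullet> \<xi>)) * of_real (f x)) / of_real (h m)"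
      by (rule integral_divide_zero)
    also have "(LINT x|lborel. cis (- (x \<bullet> \<xi>)) * of_real (f (x + h m *\<^sub>R b)) - cis (- (x \<bullet> \<xi>)) * of_real (f x)) = cis (h m * (\<xi> \<bullet> b)) * I - I"
      using shift i by (subst Bochner_Integration.integral_diff) (auto simp: I_def)
    finally show ?thesis by (simp add: left_diff_distrib diff_divide_distrib)
  qed
  have lim1: "(\<lambda>m. LINT x|lborel. cis (- (x \<bullet> \<xi>)) * of_real ((f (x + h m *\<^sub>R b) - f x) / h m)) \<longlonglongrightarrow> (LINT x|lborel. cis (- (x \<bullet> \<xi>)) * of_real (D x))"
  \<comment> \<open>By the mean value theorem the quotients are values of the partial derivative,
    hence at most B, and steps of length at most 1 keep their support in the ball of radius R +
    1.\<close>
  proof (rule integral_dominated_convergence[where w="\<lambda>x. B * indicator (cball 0 (R + 1)) x"])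
    show "integrable lborel (\<lambda>x :: 'a. B * indicator (cball 0 (R + 1)) x)"
      using emeasure_bounded_finite[of "cball (0 :: 'a) (R + 1)"]
      by (intro integrable_mult_right integrable_real_indicator) auto
    show "AE x in lborel. (\<lambda>m. cis (- (x \<bullet> \<xi>)) * of_real ((f (x + h m *\<^sub>R b) - f x) / h m)) \<longlonglongrightarrow> cis (- (x \<bullet> \<xi>)) * of_real (D x)"
    proof (intro AE_I2 tendsto_mult tendsto_const tendsto_of_real)
      fix x
      have "((\<lambda>s. (f (x + s *\<^sub>R b) - f x) / s) \<longlongrightarrow> D x) (at 0)"
        using test_function_line_derivative[OF f, of x b 0] by (simp add: has_field_derivative_iff D_def)
      moreover have "filterlim h (at 0) sequentially"
        using h0 h(1) by (intro filterlim_atI) (auto intro!: always_eventually simp: less_imp_neq[THEN not_sym])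
      ultimately show "(\<lambda>m. (f (x + h m *\<^sub>R b) - f x) / h m) \<longlonglongrightarrow> D x"
        by (rule filterlim_compose)
    qed
    show "AE x in lborel. cmod (cis (- (x \<bullet> \<xi>)) * of_real ((f (x + h m *\<^sub>R b) - f x) / h m)) \<le> B * indicator (cball 0 (R + 1)) x" for m
    proof (rule AE_I2)
      fix x :: 'a
      show "cmod (cis (- (x \<bullet> \<xi>)) * of_real ((f (x + h m *\<^sub>R b) - f x) / h m)) \<le> B * indicator (cball 0 (R + 1)) x"
      proof (cases "x \<in> cball 0 (R + 1)")
        case True
        obtain z where z: "f (x + h m *\<^sub>R b) - f (x + 0 *\<^sub>R b) = (h m - 0) * D (x + z *\<^sub>R b)"
          using MVT2[OF h(1)[of m], of "\<lambda>s. f (x + s *\<^sub>R b)" "\<lambda>s. D (x + s *\<^sub>R b)"] test_function_line_derivative[OF f, of x b]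
          unfolding D_def by blast
        then have "(f (x + h m *\<^sub>R b) - f x) / h m = D (x + z *\<^sub>R b)" using h(1)[of m] by simp
        then show ?thesis using True B(2) by (simp add: norm_mult)
      next
        case False
        then have "R + 1 < norm x" by simp
        moreover have "norm x \<le> norm (x + h m *\<^sub>R b) + h m"
          using norm_triangle_ineq4[of "x + h m *\<^sub>R b" "h m *\<^sub>R b"] h(1)[of m] nb by simp
        ultimately have "R \<le> norm (x + h m *\<^sub>R b)" "R \<le> norm x" using h(2)[of m] by linarith+
        then show ?thesis using R(2) False by simp
      qed
    qed
  qed measurable
  have lim2: "(\<lambda>m. (cis (h m * (\<xi> \<bullet> b)) - 1) / of_real (h m) * I) \<longlonglongrightarrow> \<i> * of_real (\<xi> \<bullet> b) * I"
  proof (intro tendsto_mult tendsto_const)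
    define a where "a = \<i> * complex_of_real (\<xi> \<bullet> b)"
    have "((\<lambda>z. exp (z * a)) has_field_derivative a) (at 0)"
      by (auto intro!: derivative_eq_intros)
    then have "((\<lambda>z. (exp (z * a) - 1) / z) \<longlongrightarrow> a) (at 0)"
      by (simp add: has_field_derivative_iff)
    moreover have "filterlim (\<lambda>m. complex_of_real (h m)) (at 0) sequentially"
      using tendsto_of_real[OF h0, where 'a=complex] h(1)
      by (intro filterlim_atI) (auto intro!: always_eventually simp: less_imp_neq[THEN not_sym])
    ultimately have "(\<lambda>m. (exp (of_real (h m) * a) - 1) / of_real (h m)) \<longlonglongrightarrow> a"
      by (rule filterlim_compose)
    moreover have "cis (h m * (\<xi> \<bullet> b)) = exp (of_real (h m) * a)" for m
      by (simp add: cis_conv_exp a_def mult_ac)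
    ultimately show "(\<lambda>m. (cis (h m * (\<xi> \<bullet> b)) - 1) / of_real (h m)) \<longlonglongrightarrow> \<i> * of_real (\<xi> \<bullet> b)"
      by (simp add: a_def)
  qed
  have "(LINT x|lborel. cis (- (x \<bullet> \<xi>)) * of_real (D x)) = \<i> * of_real (\<xi> \<bullet> b) * I"
    using LIMSEQ_unique[OF lim1[unfolded q] lim2] .
  then show ?thesis
    by (simp add: fourier_def D_def[symmetric] I_def)
qed

section \<open>Regularised fractional Laplacian\<close>

lemma fourier_partial_power:
  fixes f :: "'a::euclidean_space \<Rightarrow> real"
  assumes "test_function f" "b \<in> Basis"
  shows "\<exists>C. \<forall>\<xi>. \<bar>\<xi> \<bullet> b\<bar> ^ m * cmod (fourier f \<xi>) \<le> C"
  using assms(1)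
proof (induction m arbitrary: f)
  case 0
  show ?case
    by (rule exI[of _ "(2 * pi) powr (- real DIM('a) / 2) * (LINT x|lborel. \<bar>f x\<bar>)"]) (use norm_fourier_le[of f] in simp)
next
  case (Suc m)
  have "\<bar>\<xi> \<bullet> b\<bar> ^ m * cmod (fourier (\<lambda>x. frechet_derivative f (at x) b) \<xi>) = \<bar>\<xi> \<bullet> b\<bar> ^ Suc m * cmod (fourier f \<xi>)" for \<xi>
    by (simp add: fourier_partial[OF Suc.prems assms(2)] norm_mult)
  with Suc.IH[OF test_function_partial[OF Suc.prems assms(2)]] show ?case by simp
qed

text \<open>Each derivative in direction b gains a factor \<xi> . b. For given \<xi> some coordinate
  satisfies |\<xi>| \<le> n |\<xi> . b|, since the Euclidean norm is at most the sum of the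
  coordinates in modulus; summing the constants over b makes the choice harmless.\<close>

lemma fourier_decay:
  fixes f :: "'a::euclidean_space \<Rightarrow> real"
  assumes f: "test_function f"
  obtains C where "0 < C" "\<And>\<xi>. cmod (fourier f \<xi>) \<le> C * (1 + norm \<xi>) powr (- real m)"
proof -
  let ?n = "real DIM('a)"
  have "\<forall>b\<in>Basis. \<exists>C. \<forall>\<xi>. \<bar>\<xi> \<bullet> b\<bar> ^ m * cmod (fourier f \<xi>) \<le> C"
    using fourier_partial_power[OF f] by blast
  then obtain C where C: "\<And>b \<xi>. b \<in> Basis \<Longrightarrow> \<bar>\<xi> \<bullet> b\<bar> ^ m * cmod (fourier f \<xi>) \<le> C b"
    by metis
  define C0 where "C0 = (2 * pi) powr (- ?n / 2) * (LINT x|lborel. \<bar>f x\<bar>)"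
  have C0: "cmod (fourier f \<xi>) \<le> C0" for \<xi>
    unfolding C0_def by (rule norm_fourier_le)
  have Cb: "0 \<le> C b" if "b \<in> Basis" for b
    using C[OF that, of 0] by (rule order_trans[rotated]) simp
  define S where "S = ?n ^ m * (\<Sum>b\<in>Basis. C b)"
  have S: "norm \<xi> ^ m * cmod (fourier f \<xi>) \<le> S" for \<xi>
  proof -
    obtain b where b: "b \<in> Basis" "norm \<xi> \<le> ?n * \<bar>\<xi> \<bullet> b\<bar>"
    proof (rule ccontr)
      assume no: "\<not> thesis"
      have "norm \<xi> \<le> (\<Sum>b\<in>Basis. \<bar>\<xi> \<bullet> b\<bar>)" by (rule norm_le_l1)
      also have "\<dots> < (\<Sum>b\<in>(Basis :: 'a set). norm \<xi> / ?n)"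
      proof (rule sum_strict_mono)
        fix b :: 'a assume "b \<in> Basis"
        then have "\<not> norm \<xi> \<le> ?n * \<bar>\<xi> \<bullet> b\<bar>" using no that by blast
        then show "\<bar>\<xi> \<bullet> b\<bar> < norm \<xi> / ?n" by (simp add: field_simps)
      qed auto
      also have "\<dots> = norm \<xi>" by simp
      finally show False by simp
    qed
    have "norm \<xi> ^ m * cmod (fourier f \<xi>) \<le> (?n * \<bar>\<xi> \<bullet> b\<bar>) ^ m * cmod (fourier f \<xi>)"
      using b by (intro mult_right_mono power_mono) auto
    also have "\<dots> = ?n ^ m * (\<bar>\<xi> \<bullet> b\<bar> ^ m * cmod (fourier f \<xi>))" by (simp add: power_mult_distrib)
    also have "\<dots> \<le> ?n ^ m * C b" using C b by (intro mult_left_mono) auto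
    also have "\<dots> \<le> S" unfolding S_def using b Cb by (intro mult_left_mono member_le_sum) auto
    finally show ?thesis .
  qed
  have C0p: "0 \<le> C0" using C0[of 0] norm_ge_zero order_trans by blast
  have Sp: "0 \<le> S" unfolding S_def using Cb by (intro mult_nonneg_nonneg sum_nonneg) auto
  show thesis
  proof (rule that[of "2 ^ m * (C0 + S) + 1"])
    show "0 < 2 ^ m * (C0 + S) + 1" using C0p Sp by (simp add: add_nonneg_pos)
    fix \<xi> :: 'a
    have "(1 + norm \<xi>) ^ m * cmod (fourier f \<xi>) \<le> 2 ^ m * (C0 + S)"
    proof (cases "norm \<xi> \<le> 1")
      case True
      have "(1 + norm \<xi>) ^ m * cmod (fourier f \<xi>) \<le> 2 ^ m * C0"
        using True C0 by (intro mult_mono power_mono) auto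
      also have "\<dots> \<le> 2 ^ m * (C0 + S)" using Sp by simp
      finally show ?thesis .
    next
      case False
      have "(1 + norm \<xi>) ^ m * cmod (fourier f \<xi>) \<le> (2 * norm \<xi>) ^ m * cmod (fourier f \<xi>)"
        using False by (intro mult_right_mono power_mono) auto
      also have "\<dots> = 2 ^ m * (norm \<xi> ^ m * cmod (fourier f \<xi>))" by (simp add: power_mult_distrib)
      also have "\<dots> \<le> 2 ^ m * (C0 + S)" using S[of \<xi>] C0p by (intro mult_left_mono) auto
      finally show ?thesis .
    qed
    then have "(1 + norm \<xi>) ^ m * cmod (fourier f \<xi>) \<le> 2 ^ m * (C0 + S) + 1" by simp
    moreover have "0 < 1 + norm \<xi>" by (simp add: add_pos_nonneg)
    ultimately show "cmod (fourier f \<xi>) \<le> (2 ^ m * (C0 + S) + 1) * (1 + norm \<xi>) powr (- real m)"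
      by (simp add: powr_minus powr_realpow field_simps)
  qed
qed

lemma fourier_measurable [measurable]:
  fixes f :: "'a::euclidean_space \<Rightarrow> real"
  assumes [measurable]: "f \<in> borel_measurable borel"
  shows "fourier f \<in> borel_measurable borel"
  unfolding fourier_def[abs_def] by measurable

lemma fourier_powr_integrable:
  fixes f :: "'a::euclidean_space \<Rightarrow> real"
  assumes f: "test_function f" and s: "0 \<le> s"
  shows "integrable lborel (\<lambda>\<xi>. of_real (norm \<xi> powr s) * fourier f \<xi>)"
proof -
  have [measurable]: "f \<in> borel_measurable borel" by (rule test_function_borel[OF f])
  \<comment> \<open>Decay of order above n + 1 + s leaves, after multiplication by |\<xi>|^s, the
    integrable majorant with e = 1.\<close>
  obtain m :: nat where m: "real DIM('a) + 1 + s < real m" using reals_Archimedean2 by blast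
  obtain C where C: "0 < C" "\<And>\<xi>. cmod (fourier f \<xi>) \<le> C * (1 + norm \<xi>) powr (- real m)"
    using fourier_decay[OF f] by auto
  have "(\<integral>\<^sup>+\<xi>. ennreal (norm (of_real (norm \<xi> powr s) * fourier f \<xi>)) \<partial>lborel) \<le> (\<integral>\<^sup>+\<xi>. ennreal C * ennreal (majorant 1 1 (\<xi> :: 'a)) \<partial>lborel)"
  proof (rule nn_integral_mono)
    fix \<xi> :: 'a
    have "norm \<xi> powr s * cmod (fourier f \<xi>) \<le> (1 + norm \<xi>) powr s * (C * (1 + norm \<xi>) powr (- real m))"
      using C s by (intro mult_mono powr_mono2) auto
    also have "\<dots> = C * (1 + norm \<xi>) powr (s - real m)"
      by (simp add: powr_add[symmetric] mult.left_commute)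
    also have "\<dots> \<le> C * (1 + norm \<xi>) powr (- real DIM('a) - 1)"
      using C m by (intro mult_left_mono powr_mono) auto
    finally show "ennreal (norm (of_real (norm \<xi> powr s) * fourier f \<xi>)) \<le> ennreal C * ennreal (majorant 1 1 \<xi>)"
      using C(1) by (simp add: norm_mult majorant_def ennreal_mult[symmetric] ennreal_leI)
  qed
  also have "\<dots> = ennreal C * (\<integral>\<^sup>+\<xi>. ennreal (majorant 1 1 (\<xi> :: 'a)) \<partial>lborel)"
    by (rule nn_integral_cmult) measurable
  also have "\<dots> < \<infinity>"
    using nn_integral_majorant[of 1 1, where 'a='a] by (simp add: ennreal_mult_less_top le_less_trans)
  finally show ?thesis by (intro integrableI_bounded) auto
qed

lemma fourier_integrable:
  fixes f :: "'a::euclidean_space \<Rightarrow> real"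
  assumes f: "test_function f"
  shows "integrable lborel (fourier f)"
proof -
  have "integrable lborel (\<lambda>\<xi>. of_real (norm \<xi> powr 0) * fourier f \<xi>)"
    by (rule fourier_powr_integrable[OF f]) simp
  \<comment> \<open>At \<xi> = 0 the factor \<open>norm \<xi> powr 0\<close> is 0 and not 1, so the
    two functions are compared off the origin.\<close>
  moreover have "AE \<xi> in lborel. of_real (norm \<xi> powr 0) * fourier f \<xi> = fourier f \<xi>"
    using AE_lborel_singleton[of 0] by eventually_elim simp
  ultimately show ?thesis
    using test_function_borel[OF f] by (subst (asm) integrable_cong_AE) auto
qed

lemma integrable_pair_mult:
  fixes g :: "'a::euclidean_space \<Rightarrow> complex" and h :: "'b::euclidean_space \<Rightarrow> complex"
  assumes g: "integrable lborel g" and h: "integrable lborel h"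
  shows "integrable (lborel \<Otimes>\<^sub>M lborel) (\<lambda>(x, y). g x * h y)"
proof (rule integrableI_bounded)
  have [measurable]: "g \<in> borel_measurable borel" "h \<in> borel_measurable borel" using g h by auto
  show "(\<lambda>(x, y). g x * h y) \<in> borel_measurable (lborel \<Otimes>\<^sub>M lborel)" by measurable
  have "(\<integral>\<^sup>+u. ennreal (norm (case u of (x, y) \<Rightarrow> g x * h y)) \<partial>(lborel \<Otimes>\<^sub>M lborel)) =
    (\<integral>\<^sup>+x. \<integral>\<^sup>+y. ennreal (norm (g x)) * ennreal (norm (h y)) \<partial>lborel \<partial>lborel)"
    by (subst lborel.nn_integral_fst[symmetric]) (auto simp: norm_mult ennreal_mult)
  also have "\<dots> = (\<integral>\<^sup>+x. ennreal (norm (g x)) \<partial>lborel) * (\<integral>\<^sup>+y. ennreal (norm (h y)) \<partial>lborel)"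
    by (simp add: nn_integral_cmult nn_integral_multc)
  also have "\<dots> < \<infinity>"
    using g h unfolding integrable_iff_bounded by (auto simp: ennreal_mult_less_top)
  finally show "(\<integral>\<^sup>+u. ennreal (norm (case u of (x, y) \<Rightarrow> g x * h y)) \<partial>(lborel \<Otimes>\<^sub>M lborel)) < \<infinity>" .
qed

lemma integral_lborel_reflect_scale:
  fixes g :: "'a::euclidean_space \<Rightarrow> 'b::{banach, second_countable_topology}"
  assumes [measurable]: "g \<in> borel_measurable borel" and e: "0 < e"
  shows "(LINT y|lborel. g y) = e ^ DIM('a) *\<^sub>R (LINT u|lborel. g (x - e *\<^sub>R u))"
  using e by (subst lborel_affine[of "- e" x]) (simp_all add: integral_density integral_distr)

lemma gauss_scaled_integrable:
  fixes x :: "'a::euclidean_space"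
  assumes e: "0 < e"
  shows "integrable lborel (\<lambda>y. gauss ((1 / e) *\<^sub>R (x - y)))"
proof -
  have "integrable lborel (\<lambda>y :: 'a. norm (cis (y \<bullet> 0) * of_real (gauss ((1 / e) *\<^sub>R y))))"
    by (intro integrable_norm fourier_gauss_scaled) (use e in simp)
  then have "integrable lborel (\<lambda>y :: 'a. gauss ((1 / e) *\<^sub>R y))"
    by (simp add: norm_mult abs_of_pos[OF gauss_pos(1)])
  from integral_lborel_translate(1)[OF this, of "- x"]
  have "integrable lborel (\<lambda>y :: 'a. gauss (- ((1 / e) *\<^sub>R (- x + y))))" unfolding gauss_minus .
  then show ?thesis by (simp add: algebra_simps)
qed

lemma two_pi_powr_cancel: "(2 * pi) powr (- s / 2) * (2 * pi) powr (s / 2) = 1" for s :: real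
  by (simp add: powr_add[symmetric])

text \<open>Gaussian summability. With the factor \<open>gauss (e *\<^sub>R \<xi>)\<close> inserted
  the double integral converges absolutely, and Fubini turns it into a mean of f against a Gaussian
  of width e. Letting e tend to 0 in both expressions gives the two sides.\<close>

lemma fourier_inversion:
  fixes f :: "'a::euclidean_space \<Rightarrow> real"
  assumes f: "test_function f"
  shows "(LINT \<xi>|lborel. cis (x \<bullet> \<xi>) * fourier f \<xi>) = of_real ((2 * pi) powr (real DIM('a) / 2) * f x)"
proof -
  let ?n = "real DIM('a)"
  define c where "c = (2 * pi) powr (- ?n / 2)"
  define c' where "c' = (2 * pi) powr (?n / 2)"
  have cc: "c * c' = 1" unfolding c_def c'_def by (rule two_pi_powr_cancel)
  have fm[measurable]: "f \<in> borel_measurable borel" by (rule test_function_borel[OF f])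
  obtain B where B: "0 < B" "\<And>x. \<bar>f x\<bar> \<le> B" using test_function_bounded[OF f] by auto
  have Fi: "integrable lborel (fourier f)" by (rule fourier_integrable[OF f])
  define e where "e m = inverse (real (Suc m))" for m
  have e: "0 < e m" for m by (simp add: e_def)
  have e0: "e \<longlonglongrightarrow> 0" unfolding e_def by (rule LIMSEQ_inverse_real_of_nat)
  have gc: "continuous_on UNIV (gauss :: 'a \<Rightarrow> real)" unfolding gauss_def[abs_def] by (intro continuous_intros) auto
  define A where "A m = (LINT \<xi>|lborel. of_real (gauss (e m *\<^sub>R \<xi>)) * (cis (x \<bullet> \<xi>) * fourier f \<xi>))" for m
  have lim1: "A \<longlonglongrightarrow> (LINT \<xi>|lborel. cis (x \<bullet> \<xi>) * fourier f \<xi>)"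
    unfolding A_def
  proof (rule integral_dominated_convergence[where w="\<lambda>\<xi>. cmod (fourier f \<xi>)"])
    show "AE \<xi> in lborel. (\<lambda>m. of_real (gauss (e m *\<^sub>R \<xi>)) * (cis (x \<bullet> \<xi>) * fourier f \<xi>)) \<longlonglongrightarrow> cis (x \<bullet> \<xi>) * fourier f \<xi>"
    proof (rule AE_I2)
      fix \<xi> :: 'a
      have "(\<lambda>m. e m *\<^sub>R \<xi>) \<longlonglongrightarrow> 0 *\<^sub>R \<xi>" by (intro tendsto_intros e0)
      then have "(\<lambda>m. gauss (e m *\<^sub>R \<xi>)) \<longlonglongrightarrow> gauss (0 :: 'a)"
        using continuous_on_tendsto_compose[OF gc] by simp
      then have "(\<lambda>m. of_real (gauss (e m *\<^sub>R \<xi>)) * (cis (x \<bullet> \<xi>) * fourier f \<xi>)) \<longlonglongrightarrow> of_real (gauss (0 :: 'a)) * (cis (x \<bullet> \<xi>) * fourier f \<xi>)"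
        by (intro tendsto_intros)
      then show "(\<lambda>m. of_real (gauss (e m *\<^sub>R \<xi>)) * (cis (x \<bullet> \<xi>) * fourier f \<xi>)) \<longlonglongrightarrow> cis (x \<bullet> \<xi>) * fourier f \<xi>"
        by (simp add: gauss_def)
    qed
    show "AE \<xi> in lborel. cmod (of_real (gauss (e m *\<^sub>R \<xi>)) * (cis (x \<bullet> \<xi>) * fourier f \<xi>)) \<le> cmod (fourier f \<xi>)" for m
    proof (rule AE_I2)
      fix \<xi> :: 'a
      have "\<bar>gauss (e m *\<^sub>R \<xi>)\<bar> \<le> 1" using gauss_pos[of "e m *\<^sub>R \<xi>"] by simp
      from mult_right_mono[OF this norm_ge_zero[of "fourier f \<xi>"]]
      show "cmod (of_real (gauss (e m *\<^sub>R \<xi>)) * (cis (x \<bullet> \<xi>) * fourier f \<xi>)) \<le> cmod (fourier f \<xi>)"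
        by (simp add: norm_mult)
    qed
  qed (use Fi in auto)
  have A: "A m = (LINT u|lborel. of_real (gauss u * f (x - e m *\<^sub>R u)))" for m
  proof -
    let ?g = "\<lambda>\<xi> y. cis ((x - y) \<bullet> \<xi>) * (of_real (gauss (e m *\<^sub>R \<xi>)) * of_real (f y))"
    have gi: "integrable lborel (\<lambda>\<xi> :: 'a. complex_of_real (gauss (e m *\<^sub>R \<xi>)))"
      using fourier_gauss_scaled(1)[OF e, of 0 m] by simp
    have int: "integrable (lborel \<Otimes>\<^sub>M lborel) (\<lambda>(\<xi>, y). ?g \<xi> y)"
    proof -
      have "integrable (lborel \<Otimes>\<^sub>M lborel) (\<lambda>u :: 'a \<times> 'a. cis ((x - snd u) \<bullet> fst u) * (case u of (\<xi>, y) \<Rightarrow> of_real (gauss (e m *\<^sub>R \<xi>)) * of_real (f y)))"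
        by (intro integrable_cis_mult integrable_pair_mult gi) (use test_function_integrable[OF f] in auto)
      then show ?thesis by (simp add: case_prod_beta')
    qed
    have "A m = (LINT \<xi>|lborel. of_real c * (LINT y|lborel. ?g \<xi> y))"
      unfolding A_def
    proof (rule Bochner_Integration.integral_cong)
      fix \<xi> :: 'a
      have "of_real (gauss (e m *\<^sub>R \<xi>)) * (cis (x \<bullet> \<xi>) * fourier f \<xi>) = of_real c * ((of_real (gauss (e m *\<^sub>R \<xi>)) * cis (x \<bullet> \<xi>)) * (LINT y|lborel. cis (- (y \<bullet> \<xi>)) * of_real (f y)))"
        by (simp add: fourier_def c_def)
      also have "(of_real (gauss (e m *\<^sub>R \<xi>)) * cis (x \<bullet> \<xi>)) * (LINT y|lborel. cis (- (y \<bullet> \<xi>)) * of_real (f y)) =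
        (LINT y|lborel. (of_real (gauss (e m *\<^sub>R \<xi>)) * cis (x \<bullet> \<xi>)) * (cis (- (y \<bullet> \<xi>)) * of_real (f y)))"
        by (rule integral_mult_right_zero[symmetric])
      also have "\<dots> = (LINT y|lborel. ?g \<xi> y)"
      proof (rule Bochner_Integration.integral_cong)
        fix y
        have "cis (x \<bullet> \<xi>) * cis (- (y \<bullet> \<xi>)) = cis ((x - y) \<bullet> \<xi>)"
          by (simp add: cis_mult inner_diff_left)
        then show "(of_real (gauss (e m *\<^sub>R \<xi>)) * cis (x \<bullet> \<xi>)) * (cis (- (y \<bullet> \<xi>)) * of_real (f y)) = ?g \<xi> y"
          by (metis mult.assoc mult.commute)
      qed simp
      finally show "of_real (gauss (e m *\<^sub>R \<xi>)) * (cis (x \<bullet> \<xi>) * fourier f \<xi>) = of_real c * (LINT y|lborel. ?g \<xi> y)" .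
    qed simp
    also have "\<dots> = of_real c * (LINT \<xi>|lborel. LINT y|lborel. ?g \<xi> y)"
      by (rule integral_mult_right_zero)
    also have "(LINT \<xi>|lborel. LINT y|lborel. ?g \<xi> y) = (LINT y|lborel. LINT \<xi>|lborel. ?g \<xi> y)"
      using lborel_pair.Fubini_integral[OF int] by simp
    also have "\<dots> = (LINT y|lborel. of_real (f y) * (of_real (inverse (e m ^ DIM('a))) * of_real (c' * gauss ((1 / e m) *\<^sub>R (x - y)))))"
    proof (rule Bochner_Integration.integral_cong)
      fix y
      have "(LINT \<xi>|lborel. ?g \<xi> y) = (LINT \<xi>|lborel. of_real (f y) * (cis (\<xi> \<bullet> (x - y)) * of_real (gauss (e m *\<^sub>R \<xi>))))"
        by (simp add: inner_commute mult_ac)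
      also have "\<dots> = of_real (f y) * (LINT \<xi>|lborel. cis (\<xi> \<bullet> (x - y)) * of_real (gauss (e m *\<^sub>R \<xi>)))"
        by (rule integral_mult_right_zero)
      also have "(LINT \<xi>|lborel. cis (\<xi> \<bullet> (x - y)) * of_real (gauss (e m *\<^sub>R \<xi>))) =
        of_real (inverse (e m ^ DIM('a))) * (of_real (e m ^ DIM('a)) * (LINT \<xi>|lborel. cis (\<xi> \<bullet> (x - y)) * of_real (gauss (e m *\<^sub>R \<xi>))))"
        using e[of m] by simp
      also have "of_real (e m ^ DIM('a)) * (LINT \<xi>|lborel. cis (\<xi> \<bullet> (x - y)) * of_real (gauss (e m *\<^sub>R \<xi>))) = of_real (c' * gauss ((1 / e m) *\<^sub>R (x - y)))"
        unfolding c'_def by (rule fourier_gauss_scaled(2)[OF e])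
      finally show "(LINT \<xi>|lborel. ?g \<xi> y) = of_real (f y) * (of_real (inverse (e m ^ DIM('a))) * of_real (c' * gauss ((1 / e m) *\<^sub>R (x - y))))" .
    qed simp
    also have "\<dots> = e m ^ DIM('a) *\<^sub>R (LINT u|lborel. of_real (f (x - e m *\<^sub>R u)) * (of_real (inverse (e m ^ DIM('a))) * of_real (c' * gauss ((1 / e m) *\<^sub>R (x - (x - e m *\<^sub>R u))))))"
      by (rule integral_lborel_reflect_scale) (use e in auto)
    also have "\<dots> = e m ^ DIM('a) *\<^sub>R (LINT u|lborel. of_real (inverse (e m ^ DIM('a)) * c') * of_real (gauss u * f (x - e m *\<^sub>R u)))"
      using e[of m] by (simp add: mult_ac)
    also have "\<dots> = of_real c' * (LINT u|lborel. of_real (gauss u * f (x - e m *\<^sub>R u)))"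
      unfolding integral_mult_right_zero using e[of m] by (simp add: scaleR_conv_of_real)
    also have "of_real c * (of_real c' * (LINT u|lborel. of_real (gauss u * f (x - e m *\<^sub>R u)))) = complex_of_real (c * c') * (LINT u|lborel. of_real (gauss u * f (x - e m *\<^sub>R u)))"
      by simp
    finally have "A m = (LINT u|lborel. complex_of_real (gauss u * f (x - e m *\<^sub>R u)))" by (simp add: cc)
    then show ?thesis .
  qed
  have lim2: "(\<lambda>m. (LINT u|lborel. complex_of_real (gauss u * f (x - e m *\<^sub>R u)))) \<longlonglongrightarrow> (LINT u|(lborel :: 'a measure). complex_of_real (gauss u * f x))"
  proof (rule integral_dominated_convergence[where w="\<lambda>u. gauss u * B"])
    show "AE u in lborel. (\<lambda>m. complex_of_real (gauss u * f (x - e m *\<^sub>R u))) \<longlonglongrightarrow> of_real (gauss u * f x)"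
    proof (intro AE_I2 tendsto_of_real tendsto_mult tendsto_const)
      fix u :: 'a
      have "(\<lambda>m. x - e m *\<^sub>R u) \<longlonglongrightarrow> x - 0 *\<^sub>R u" by (intro tendsto_intros e0)
      then show "(\<lambda>m. f (x - e m *\<^sub>R u)) \<longlonglongrightarrow> f x"
        using continuous_on_tendsto_compose[OF test_function_continuous[OF f], of "\<lambda>m. x - e m *\<^sub>R u" x] by simp
    qed
    show "integrable lborel (\<lambda>u :: 'a. gauss u * B)" by (intro integrable_mult_left gauss_integrable)
    show "AE u in lborel. cmod (complex_of_real (gauss u * f (x - e m *\<^sub>R u))) \<le> gauss u * B" for m
      using mult_left_mono[OF B(2) less_imp_le[OF gauss_pos(1)]]
      by (intro AE_I2) (simp add: norm_mult abs_of_pos[OF gauss_pos(1)])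
  qed auto
  have "(LINT u|(lborel :: 'a measure). complex_of_real (gauss u * f x)) = (LINT u|(lborel :: 'a measure). cis (u \<bullet> 0) * complex_of_real (gauss u)) * of_real (f x)"
    by simp
  also have "\<dots> = of_real (c' * f x)"
    unfolding fourier_gauss(2) c'_def by (simp add: gauss_def)
  finally have lim: "(LINT u|(lborel :: 'a measure). complex_of_real (gauss u * f x)) = of_real (c' * f x)" .
  have "A = (\<lambda>m. LINT u|lborel. complex_of_real (gauss u * f (x - e m *\<^sub>R u)))"
    by (rule ext) (rule A)
  with lim2 lim have lim2': "A \<longlonglongrightarrow> of_real (c' * f x)" by (simp only:)
  show ?thesis
    using LIMSEQ_unique[OF lim1 lim2'] by (simp add: c'_def)
qed


text \<open>
  Integrating this identity in \<open>e\<close> against \<open>e\<^sup>s\<^sup>-\<^sup>1\<^sup>-\<^sup>n\<close> cancels \<open>|\<xi>|\<^sup>s\<close> on the right and turns the Gaussians on the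
  left into the Riesz kernel.
\<close>

lemma frac_laplacian_gauss_mean:
  fixes f :: "'a::euclidean_space \<Rightarrow> real"
  assumes f: "test_function f" and s: "0 < s" and e: "0 < e"
  shows "(LINT y|lborel. of_real (gauss ((1 / e) *\<^sub>R (x - y))) * frac_laplacian (s / 2) f y) =
    of_real (e ^ DIM('a)) * (LINT \<xi>|lborel. of_real (gauss (e *\<^sub>R \<xi>)) * (cis (x \<bullet> \<xi>) * (of_real (norm \<xi> powr s) * fourier f \<xi>)))"
proof -
  let ?n = "real DIM('a)"
  define c where "c = (2 * pi) powr (- ?n / 2)"
  define c' where "c' = (2 * pi) powr (?n / 2)"
  have cc: "c * c' = 1" unfolding c_def c'_def by (rule two_pi_powr_cancel)
  have fm[measurable]: "f \<in> borel_measurable borel" by (rule test_function_borel[OF f])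
  define G where "G \<xi> = of_real (norm \<xi> powr s) * fourier f \<xi>" for \<xi>
  have Gi: "integrable lborel G" unfolding G_def by (rule fourier_powr_integrable[OF f]) (use s in simp)
  have [measurable]: "G \<in> borel_measurable borel" using Gi by auto
  let ?g = "\<lambda>y \<xi>. cis (y \<bullet> \<xi>) * (of_real (gauss ((1 / e) *\<^sub>R (x - y))) * G \<xi>)"
  have gi: "integrable lborel (\<lambda>y :: 'a. complex_of_real (gauss ((1 / e) *\<^sub>R (x - y))))"
    by (intro integrable_of_real gauss_scaled_integrable e)
  have int: "integrable (lborel \<Otimes>\<^sub>M lborel) (\<lambda>(y, \<xi>). ?g y \<xi>)"
  proof -
    have "integrable (lborel \<Otimes>\<^sub>M lborel) (\<lambda>u :: 'a \<times> 'a. cis (fst u \<bullet> snd u) * (case u of (y, \<xi>) \<Rightarrow> of_real (gauss ((1 / e) *\<^sub>R (x - y))) * G \<xi>))"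
      by (intro integrable_cis_mult integrable_pair_mult gi Gi) simp
    then show ?thesis by (simp add: case_prod_beta')
  qed
  have "(LINT y|lborel. of_real (gauss ((1 / e) *\<^sub>R (x - y))) * frac_laplacian (s / 2) f y) =
    (LINT y|lborel. of_real c * (LINT \<xi>|lborel. ?g y \<xi>))"
  proof (rule Bochner_Integration.integral_cong)
    fix y :: 'a
    have "frac_laplacian (s / 2) f y = of_real c * (LINT \<xi>|lborel. cis (y \<bullet> \<xi>) * G \<xi>)"
      by (simp add: frac_laplacian_def c_def G_def mult.assoc)
    moreover have "(LINT \<xi>|lborel. ?g y \<xi>) = of_real (gauss ((1 / e) *\<^sub>R (x - y))) * (LINT \<xi>|lborel. cis (y \<bullet> \<xi>) * G \<xi>)"
      by (subst integral_mult_right_zero[symmetric]) (simp add: mult_ac)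
    ultimately show "of_real (gauss ((1 / e) *\<^sub>R (x - y))) * frac_laplacian (s / 2) f y = of_real c * (LINT \<xi>|lborel. ?g y \<xi>)"
      by simp
  qed simp
  also have "\<dots> = of_real c * (LINT y|lborel. LINT \<xi>|lborel. ?g y \<xi>)"
    by (rule integral_mult_right_zero)
  also have "(LINT y|lborel. LINT \<xi>|lborel. ?g y \<xi>) = (LINT \<xi>|lborel. LINT y|lborel. ?g y \<xi>)"
    using lborel_pair.Fubini_integral[OF int] by simp
  also have "\<dots> = (LINT \<xi>|lborel. of_real (e ^ DIM('a) * c') * (of_real (gauss (e *\<^sub>R \<xi>)) * (cis (x \<bullet> \<xi>) * G \<xi>)))"
  proof (rule Bochner_Integration.integral_cong)
    fix \<xi> :: 'a
    have "(LINT y|lborel. ?g y \<xi>) = (LINT y|lborel. G \<xi> * (cis (y \<bullet> \<xi>) * of_real (gauss ((1 / e) *\<^sub>R (x - y)))))"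
      by (simp add: mult_ac)
    also have "\<dots> = G \<xi> * (LINT y|lborel. cis (y \<bullet> \<xi>) * of_real (gauss ((1 / e) *\<^sub>R (x - y))))"
      by (rule integral_mult_right_zero)
    also have "(LINT y|lborel. cis (y \<bullet> \<xi>) * of_real (gauss ((1 / e) *\<^sub>R (x - y)))) =
      e ^ DIM('a) *\<^sub>R (LINT u|lborel. cis ((x - e *\<^sub>R u) \<bullet> \<xi>) * of_real (gauss ((1 / e) *\<^sub>R (x - (x - e *\<^sub>R u)))))"
      by (rule integral_lborel_reflect_scale) (use e in auto)
    also have "(LINT u|lborel. cis ((x - e *\<^sub>R u) \<bullet> \<xi>) * of_real (gauss ((1 / e) *\<^sub>R (x - (x - e *\<^sub>R u))))) =
      (LINT u|lborel. cis (x \<bullet> \<xi>) * (cis (u \<bullet> (- (e *\<^sub>R \<xi>))) * of_real (gauss u)))"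
      using e by (simp add: inner_diff_left cis_mult mult.assoc[symmetric])
    also have "\<dots> = cis (x \<bullet> \<xi>) * of_real (c' * gauss (- (e *\<^sub>R \<xi>)))"
      unfolding integral_mult_right_zero fourier_gauss(2) c'_def ..
    finally show "(LINT y|lborel. ?g y \<xi>) = of_real (e ^ DIM('a) * c') * (of_real (gauss (e *\<^sub>R \<xi>)) * (cis (x \<bullet> \<xi>) * G \<xi>))"
      by (simp add: gauss_minus scaleR_conv_of_real mult_ac)
  qed simp
  also have "\<dots> = of_real (e ^ DIM('a) * c') * (LINT \<xi>|lborel. of_real (gauss (e *\<^sub>R \<xi>)) * (cis (x \<bullet> \<xi>) * G \<xi>))"
    by (rule integral_mult_right_zero)
  also have "of_real c * \<dots> = of_real (c * c') * (of_real (e ^ DIM('a)) * (LINT \<xi>|lborel. of_real (gauss (e *\<^sub>R \<xi>)) * (cis (x \<bullet> \<xi>) * G \<xi>)))"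
    by (simp add: mult_ac)
  finally show ?thesis by (simp add: cc G_def)
qed

text \<open>Integrand of a Gamma integral: over e > 0 and for \<rho> > 0 it yields \<rho>^(-s)
  2^(s/2 - 1) Gamma(s/2). What matters is the homogeneity in \<rho> and that the constant is finite
  and positive.\<close>

definition gamma_gauss :: "real \<Rightarrow> real \<Rightarrow> real \<Rightarrow> real" where
  "gamma_gauss s \<rho> e = (if 0 < e then e powr (s - 1) * exp (- (e * \<rho>)\<^sup>2 / 2) else 0)"

lemma gamma_gauss_nonneg: "0 \<le> gamma_gauss s \<rho> e"
  by (simp add: gamma_gauss_def)

lemma borel_measurable_gamma_gauss [measurable]:
  "(\<lambda>(\<rho>, e). gamma_gauss s \<rho> e) \<in> borel_measurable (borel \<Otimes>\<^sub>M borel)"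
  "(\<lambda>(e, \<rho>). gamma_gauss s \<rho> e) \<in> borel_measurable (borel \<Otimes>\<^sub>M borel)"
  unfolding gamma_gauss_def by measurable

lemma gamma_gauss_integrable:
  assumes s: "0 < s"
  shows "integrable lborel (gamma_gauss s 1)"
proof -
  \<comment> \<open>Decay of order 2 s turns e^(s - 1) into e^(- s - 1), which is integrable at
    infinity.\<close>
  obtain C where C: "0 < C" "\<And>u. 0 \<le> u \<Longrightarrow> exp (- u\<^sup>2 / 2) \<le> C * (1 + u) powr (- (2 * s))"
    using gauss_le_powr[of "2 * s"] s by auto
  have [measurable]: "gamma_gauss s 1 \<in> borel_measurable borel" unfolding gamma_gauss_def by measurable
  have "(\<integral>\<^sup>+e. ennreal (norm (gamma_gauss s 1 e)) \<partial>lborel) \<le>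
    (\<integral>\<^sup>+e. (if 0 < e \<and> e < 1 then ennreal (e powr (s - 1)) else 0) + ennreal C * (if 1 < e then ennreal (e powr (- s - 1)) else 0) \<partial>lborel)"
  proof (rule nn_integral_mono_AE)
    show "AE e in lborel. ennreal (norm (gamma_gauss s 1 e)) \<le> (if 0 < e \<and> e < 1 then ennreal (e powr (s - 1)) else 0) + ennreal C * (if 1 < e then ennreal (e powr (- s - 1)) else 0)"
      using AE_lborel_singleton[of 1]
    proof eventually_elim
      case (elim e)
      consider "e \<le> 0" | "0 < e" "e < 1" | "1 < e" using elim by linarith
      then show ?case
      proof cases
        case 2
        have "e powr (s - 1) * exp (- e\<^sup>2 / 2) \<le> e powr (s - 1) * 1" by (intro mult_left_mono) auto
        then show ?thesis using 2 by (simp add: gamma_gauss_def ennreal_leI)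
      next
        case 3
        have "e powr (s - 1) * exp (- e\<^sup>2 / 2) \<le> e powr (s - 1) * (C * e powr (- (2 * s)))"
        proof (intro mult_left_mono)
          have "(1 + e) powr (- (2 * s)) \<le> e powr (- (2 * s))" using 3 s by (intro powr_mono2') auto
          then show "exp (- e\<^sup>2 / 2) \<le> C * e powr (- (2 * s))"
            using C(2)[of e] C(1) 3 by (meson less_imp_le less_trans mult_left_mono order_trans zero_less_one)
        qed simp
        also have "\<dots> = C * e powr (- s - 1)"
          by (simp add: powr_add[symmetric] mult.left_commute)
        finally show ?thesis using 3 C(1) by (simp add: gamma_gauss_def ennreal_mult[symmetric] ennreal_leI)
      qed (simp add: gamma_gauss_def)
    qed
  qed
  also have "\<dots> = ennreal (1 powr s / s) + ennreal C * ennreal (1 powr (- s) / s)"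
    using s by (simp add: nn_integral_add nn_integral_cmult nn_integral_powr_below nn_integral_powr_above del: powr_one_eq_one)
  also have "\<dots> < \<infinity>" by (simp add: ennreal_mult_less_top)
  finally show ?thesis by (intro integrableI_bounded) auto
qed

lemma gamma_gauss_scale:
  assumes \<rho>: "0 < \<rho>"
  shows "(\<integral>\<^sup>+e. ennreal (gamma_gauss s \<rho> e) \<partial>lborel) = ennreal (\<rho> powr (- s)) * (\<integral>\<^sup>+e. ennreal (gamma_gauss s 1 e) \<partial>lborel)"
proof -
  have [measurable]: "gamma_gauss s r \<in> borel_measurable borel" for r unfolding gamma_gauss_def by measurable
  have eq: "gamma_gauss s \<rho> e = \<rho> powr (1 - s) * gamma_gauss s 1 (0 + \<rho> *\<^sub>R e)" for e
  proof (cases "0 < e")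
    case True
    have "\<rho> powr (1 - s) * (\<rho> * e) powr (s - 1) = e powr (s - 1)"
      using True \<rho> by (simp add: powr_mult mult.assoc[symmetric] powr_add[symmetric])
    then show ?thesis using True \<rho> by (simp add: gamma_gauss_def mult.commute mult.left_commute mult.assoc[symmetric])
  qed (use \<rho> in \<open>simp add: gamma_gauss_def zero_less_mult_iff\<close>)
  have "(\<integral>\<^sup>+e. ennreal (gamma_gauss s \<rho> e) \<partial>lborel) = ennreal (\<rho> powr (1 - s)) * (\<integral>\<^sup>+e. ennreal (gamma_gauss s 1 (0 + \<rho> *\<^sub>R e)) \<partial>lborel)"
    unfolding eq by (subst nn_integral_cmult[symmetric]) (auto simp: ennreal_mult gamma_gauss_nonneg)
  also have "(\<integral>\<^sup>+e. ennreal (gamma_gauss s 1 (0 + \<rho> *\<^sub>R e)) \<partial>lborel) = ennreal (\<rho> powr (- real DIM(real))) * (\<integral>\<^sup>+e. ennreal (gamma_gauss s 1 e) \<partial>lborel)"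
    by (rule nn_integral_lborel_scale) (use \<rho> in auto)
  also have "ennreal (\<rho> powr (1 - s)) * \<dots> = ennreal (\<rho> powr (1 - s) * \<rho> powr (- 1)) * (\<integral>\<^sup>+e. ennreal (gamma_gauss s 1 e) \<partial>lborel)"
    by (simp only: ennreal_mult[OF powr_ge_zero powr_ge_zero] mult.assoc DIM_real of_nat_1)
  also have "\<rho> powr (1 - s) * \<rho> powr (- 1) = \<rho> powr (- s)" unfolding powr_add[symmetric] by simp
  finally show ?thesis .
qed

section \<open>Riesz potential representation\<close>

text \<open>Covers non-integrable functions too, whose integral is 0 by convention.\<close>

lemma norm_integral_le_nn_integral:
  fixes f :: "'b \<Rightarrow> 'c::{banach, second_countable_topology}"
  shows "ennreal (norm (integral\<^sup>L M f)) \<le> (\<integral>\<^sup>+x. ennreal (norm (f x)) \<partial>M)"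
  by (cases "integrable M f") (auto simp: integral_norm_bound_ennreal not_integrable_integral_eq)

text \<open>Split at e = \<rho>. Below, the Gaussian is at most a multiple of (e / \<rho>)^n, which
  removes the singularity e^(-n) and leaves e^(\<beta> - 1); above, it is at most 1 and \<beta> < n
  gives convergence.\<close>

lemma nn_integral_inverse_gauss:
  assumes \<beta>: "0 < \<beta>" "\<beta> < n"
  shows "\<exists>C>0. \<forall>\<rho>>0. (\<integral>\<^sup>+e. (if 0 < e then ennreal (e powr (\<beta> - 1 - n) * exp (- (\<rho> / e)\<^sup>2 / 2)) else 0) \<partial>lborel) \<le> ennreal (C * \<rho> powr (\<beta> - n))"
proof -
  obtain C where C: "0 < C" "\<And>u. 0 \<le> u \<Longrightarrow> exp (- u\<^sup>2 / 2) \<le> C * (1 + u) powr (- n)"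
    using gauss_le_powr[of n] \<beta> by auto
  show ?thesis
  proof (intro exI[of _ "C / \<beta> + 1 / (n - \<beta>)"] conjI allI impI)
    show "0 < C / \<beta> + 1 / (n - \<beta>)" using C \<beta> by (simp add: add_pos_pos)
    fix \<rho> :: real assume \<rho>: "0 < \<rho>"
    have "(\<integral>\<^sup>+e. (if 0 < e then ennreal (e powr (\<beta> - 1 - n) * exp (- (\<rho> / e)\<^sup>2 / 2)) else 0) \<partial>lborel) \<le>
      (\<integral>\<^sup>+e. ennreal (C * \<rho> powr (- n)) * (if 0 < e \<and> e < \<rho> then ennreal (e powr (\<beta> - 1)) else 0) +
        (if \<rho> < e then ennreal (e powr (- (n - \<beta>) - 1)) else 0) \<partial>lborel)"
    proof (rule nn_integral_mono_AE)
      show "AE e in lborel. (if 0 < e then ennreal (e powr (\<beta> - 1 - n) * exp (- (\<rho> / e)\<^sup>2 / 2)) else 0) \<le>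
        ennreal (C * \<rho> powr (- n)) * (if 0 < e \<and> e < \<rho> then ennreal (e powr (\<beta> - 1)) else 0) +
        (if \<rho> < e then ennreal (e powr (- (n - \<beta>) - 1)) else 0)"
        using AE_lborel_singleton[of \<rho>]
      proof eventually_elim
        case (elim e)
        consider "e \<le> 0" | "0 < e" "e < \<rho>" | "\<rho> < e" using elim by linarith
        then show ?case
        proof cases
          case 2
          have "exp (- (\<rho> / e)\<^sup>2 / 2) \<le> C * (1 + \<rho> / e) powr (- n)"
            by (rule C) (use 2 \<rho> in simp)
          also have "\<dots> \<le> C * (\<rho> / e) powr (- n)"
            using 2 \<rho> C(1) \<beta> by (intro mult_left_mono powr_mono2') auto
          finally have "e powr (\<beta> - 1 - n) * exp (- (\<rho> / e)\<^sup>2 / 2) \<le> e powr (\<beta> - 1 - n) * (C * (\<rho> / e) powr (- n))"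
            by (intro mult_left_mono) auto
          also have "(\<rho> / e) powr (- n) = \<rho> powr (- n) * e powr n"
          proof -
            have "(\<rho> / e) powr (- n) = \<rho> powr (- n) / e powr (- n)" by (rule powr_divide)
            then show ?thesis by (simp only: powr_minus divide_inverse inverse_inverse_eq)
          qed
          also have "e powr (\<beta> - 1 - n) * (C * (\<rho> powr (- n) * e powr n)) = C * \<rho> powr (- n) * e powr (\<beta> - 1)"
          proof -
            have "e powr (\<beta> - 1 - n) * e powr n = e powr (\<beta> - 1)" by (simp add: powr_add[symmetric])
            then show ?thesis by (simp add: mult_ac)
          qed
          finally show ?thesis using 2 C(1) by (simp add: ennreal_mult[symmetric] ennreal_leI)
        next
          case 3
          then have e: "0 < e" using \<rho> by simp
          have "e powr (\<beta> - 1 - n) * exp (- (\<rho> / e)\<^sup>2 / 2) \<le> e powr (\<beta> - 1 - n) * 1"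
            by (intro mult_left_mono) auto
          also have "\<dots> = e powr (- (n - \<beta>) - 1)" by (simp add: algebra_simps)
          finally show ?thesis using 3 e by (simp add: ennreal_leI)
        qed simp
      qed
    qed
    also have "\<dots> = ennreal (C * \<rho> powr (- n)) * ennreal (\<rho> powr \<beta> / \<beta>) + ennreal (\<rho> powr (- (n - \<beta>)) / (n - \<beta>))"
      using \<beta> \<rho> nn_integral_powr_above[of "n - \<beta>" \<rho>] by (simp add: nn_integral_add nn_integral_cmult nn_integral_powr_below)
    also have "\<dots> = ennreal ((C / \<beta> + 1 / (n - \<beta>)) * \<rho> powr (\<beta> - n))"
    proof -
      have "\<rho> powr (- n) * \<rho> powr \<beta> = \<rho> powr (\<beta> - n)" by (simp add: powr_add[symmetric])
      then have "C * \<rho> powr (- n) * (\<rho> powr \<beta> / \<beta>) + \<rho> powr (- (n - \<beta>)) / (n - \<beta>) = (C / \<beta> + 1 / (n - \<beta>)) * \<rho> powr (\<beta> - n)"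
        by (simp add: distrib_right mult.assoc[symmetric])
      then show ?thesis using C(1) \<beta> by (subst ennreal_mult[symmetric]) (auto simp flip: ennreal_plus)
    qed
    finally show "(\<integral>\<^sup>+e. (if 0 < e then ennreal (e powr (\<beta> - 1 - n) * exp (- (\<rho> / e)\<^sup>2 / 2)) else 0) \<partial>lborel) \<le> ennreal ((C / \<beta> + 1 / (n - \<beta>)) * \<rho> powr (\<beta> - n))" .
  qed
qed

text \<open>The range 0 < e < 1 alone gives a positive lower bound, so this constant can later be
  divided out.\<close>

lemma gamma_gauss_pos:
  assumes s: "0 < s"
  shows "0 < (LINT e|lborel. gamma_gauss s 1 e)"
proof -
  have "ennreal (exp (- 1 / 2) / s) = ennreal (exp (- 1 / 2)) * (\<integral>\<^sup>+e. (if 0 < e \<and> e < 1 then ennreal (e powr (s - 1)) else 0) \<partial>lborel)"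
    using s nn_integral_powr_below[of s 1] by (simp add: ennreal_mult[symmetric])
  also have "\<dots> = (\<integral>\<^sup>+e. ennreal (exp (- 1 / 2)) * (if 0 < e \<and> e < 1 then ennreal (e powr (s - 1)) else 0) \<partial>lborel)"
    by (rule nn_integral_cmult[symmetric]) measurable
  also have "\<dots> \<le> (\<integral>\<^sup>+e. ennreal (gamma_gauss s 1 e) \<partial>lborel)"
  proof (rule nn_integral_mono)
    fix e :: real
    show "ennreal (exp (- 1 / 2)) * (if 0 < e \<and> e < 1 then ennreal (e powr (s - 1)) else 0) \<le> ennreal (gamma_gauss s 1 e)"
    proof (cases "0 < e \<and> e < 1")
      case True
      then have "e\<^sup>2 \<le> 1" by (simp add: power_le_one)
      then have "exp (- 1 / 2) * e powr (s - 1) \<le> exp (- e\<^sup>2 / 2) * e powr (s - 1)"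
        by (intro mult_right_mono) auto
      then show ?thesis using True by (simp add: gamma_gauss_def ennreal_mult[symmetric] ennreal_leI mult.commute)
    qed auto
  qed
  also have "\<dots> = ennreal (LINT e|lborel. gamma_gauss s 1 e)"
    by (rule nn_integral_eq_integral[OF gamma_gauss_integrable[OF s]]) (simp add: gamma_gauss_nonneg)
  finally have "ennreal (exp (- 1 / 2) / s) \<le> ennreal (LINT e|lborel. gamma_gauss s 1 e)" .
  moreover have "0 \<le> (LINT e|lborel. gamma_gauss s 1 e)" by (simp add: gamma_gauss_nonneg integral_nonneg_AE)
  ultimately have "exp (- 1 / 2) / s \<le> (LINT e|lborel. gamma_gauss s 1 e)" by (simp add: ennreal_le_iff)
  moreover have "0 < exp (- 1 / 2) / s" using s by simp
  ultimately show ?thesis by linarith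
qed

text \<open>The constant A of the Gamma integral is inserted into the inversion formula as an
  integral over e. The norm enters the inner integral only after that integral has become a Gaussian
  mean of the fractional Laplacian. From there on everything is an inequality in
  \<open>ennreal\<close>, so convergence of the potential is no issue.\<close>

lemma riesz_representation:
  assumes \<beta>: "0 < \<beta>" "\<beta> < real DIM('a::euclidean_space)"
  shows "\<exists>M>0. \<forall>f :: 'a \<Rightarrow> real. test_function f \<longrightarrow> (\<forall>x.
    ennreal \<bar>f x\<bar> \<le> ennreal M * (\<integral>\<^sup>+y. ennreal (norm (x - y) powr (\<beta> - real DIM('a)) * cmod (frac_laplacian (\<beta> / 2) f y)) \<partial>lborel))"
proof -
  let ?n = "real DIM('a)"
  define A where "A = (LINT e|lborel. gamma_gauss \<beta> 1 e)"
  have A: "0 < A" unfolding A_def by (rule gamma_gauss_pos[OF \<beta>(1)])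
  have Ann: "(\<integral>\<^sup>+e. ennreal (gamma_gauss \<beta> 1 e) \<partial>lborel) = ennreal A"
    unfolding A_def by (rule nn_integral_eq_integral[OF gamma_gauss_integrable[OF \<beta>(1)]]) (simp add: gamma_gauss_nonneg)
  define c' where "c' = (2 * pi) powr (?n / 2)"
  have c': "0 < c'" by (simp add: c'_def)
  obtain C where C: "0 < C" "\<And>\<rho>. 0 < \<rho> \<Longrightarrow> (\<integral>\<^sup>+e. (if 0 < e then ennreal (e powr (\<beta> - 1 - ?n) * exp (- (\<rho> / e)\<^sup>2 / 2)) else 0) \<partial>lborel) \<le> ennreal (C * \<rho> powr (\<beta> - ?n))"
    using nn_integral_inverse_gauss[OF \<beta>] by blast
  show ?thesis
  proof (intro exI[of _ "C / (A * c')"] conjI allI impI)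
    show "0 < C / (A * c')" using C A c' by simp
    fix f :: "'a \<Rightarrow> real" and x :: 'a
    assume f: "test_function f"
    have [measurable]: "f \<in> borel_measurable borel" by (rule test_function_borel[OF f])
    define G where "G y = frac_laplacian (\<beta> / 2) f y" for y
    have [measurable]: "G \<in> borel_measurable borel" unfolding G_def frac_laplacian_def by measurable
    define F where "F \<xi> e = of_real (gamma_gauss \<beta> (norm \<xi>) e * norm \<xi> powr \<beta>) * (cis (x \<bullet> \<xi>) * fourier f \<xi>)" for \<xi> e
    have gs: "(\<integral>\<^sup>+e. ennreal (gamma_gauss \<beta> (norm \<xi>) e * norm \<xi> powr \<beta>) \<partial>lborel) = ennreal A" if "\<xi> \<noteq> 0" for \<xi> :: 'a
    proof -
      have [measurable]: "gamma_gauss \<beta> r \<in> borel_measurable borel" for r unfolding gamma_gauss_def by measurable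
      have "(\<integral>\<^sup>+e. ennreal (gamma_gauss \<beta> (norm \<xi>) e * norm \<xi> powr \<beta>) \<partial>lborel) = (\<integral>\<^sup>+e. ennreal (gamma_gauss \<beta> (norm \<xi>) e) \<partial>lborel) * ennreal (norm \<xi> powr \<beta>)"
        by (subst nn_integral_multc[symmetric]) (auto simp: ennreal_mult gamma_gauss_nonneg)
      also have "\<dots> = ennreal (norm \<xi> powr (- \<beta>)) * ennreal A * ennreal (norm \<xi> powr \<beta>)"
        using that by (subst gamma_gauss_scale) (auto simp: Ann)
      also have "\<dots> = ennreal (norm \<xi> powr (- \<beta>) * A * norm \<xi> powr \<beta>)"
        using A by (simp add: ennreal_mult)
      also have "norm \<xi> powr (- \<beta>) * A * norm \<xi> powr \<beta> = A"
        using that by (simp add: powr_minus)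
      finally show ?thesis .
    qed
    \<comment> \<open>Integrating the modulus over e first cancels |\<xi>|^\<beta> and leaves A
      times the modulus of \<open>fourier f\<close>, which is integrable.\<close>
    have int: "integrable (lborel \<Otimes>\<^sub>M lborel) (\<lambda>(\<xi>, e). F \<xi> e)"
    proof (rule integrableI_bounded)
      show "(\<lambda>(\<xi>, e). F \<xi> e) \<in> borel_measurable (lborel \<Otimes>\<^sub>M lborel)"
        unfolding F_def gamma_gauss_def by measurable
      then have m: "(\<lambda>u. ennreal (norm (case u of (\<xi>, e) \<Rightarrow> F \<xi> e))) \<in> borel_measurable (lborel \<Otimes>\<^sub>M lborel)"
        by measurable
      have "(\<integral>\<^sup>+u. ennreal (norm (case u of (\<xi>, e) \<Rightarrow> F \<xi> e)) \<partial>(lborel \<Otimes>\<^sub>M lborel)) = (\<integral>\<^sup>+\<xi>. \<integral>\<^sup>+e. ennreal (norm (F \<xi> e)) \<partial>lborel \<partial>lborel)"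
        using lborel.nn_integral_fst[OF m] by simp
      also have "\<dots> = (\<integral>\<^sup>+\<xi>. ennreal A * ennreal (cmod (fourier f \<xi>)) \<partial>lborel)"
      proof (rule nn_integral_cong_AE)
        show "AE \<xi> in lborel. (\<integral>\<^sup>+e. ennreal (norm (F \<xi> e)) \<partial>lborel) = ennreal A * ennreal (cmod (fourier f \<xi>))"
          using AE_lborel_singleton[of 0]
        proof eventually_elim
          case (elim \<xi>)
          have [measurable]: "gamma_gauss \<beta> r \<in> borel_measurable borel" for r unfolding gamma_gauss_def by measurable
          have "(\<integral>\<^sup>+e. ennreal (norm (F \<xi> e)) \<partial>lborel) = (\<integral>\<^sup>+e. ennreal (gamma_gauss \<beta> (norm \<xi>) e * norm \<xi> powr \<beta>) * ennreal (cmod (fourier f \<xi>)) \<partial>lborel)"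
            by (simp add: F_def norm_mult ennreal_mult gamma_gauss_nonneg)
          then show ?case using gs[OF elim] by (simp add: nn_integral_multc)
        qed
      qed
      also have "\<dots> = ennreal A * (\<integral>\<^sup>+\<xi>. ennreal (cmod (fourier f \<xi>)) \<partial>lborel)"
        by (rule nn_integral_cmult) measurable
      also have "\<dots> < \<infinity>"
        using fourier_integrable[OF f] unfolding integrable_iff_bounded by (simp add: ennreal_mult_less_top)
      finally show "(\<integral>\<^sup>+u. ennreal (norm (case u of (\<xi>, e) \<Rightarrow> F \<xi> e)) \<partial>(lborel \<Otimes>\<^sub>M lborel)) < \<infinity>" .
    qed
    have "of_real (A * c' * f x) = of_real A * (LINT \<xi>|lborel. cis (x \<bullet> \<xi>) * fourier f \<xi>)"
      by (simp add: fourier_inversion[OF f] c'_def)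
    also have "\<dots> = (LINT \<xi>|lborel. of_real A * (cis (x \<bullet> \<xi>) * fourier f \<xi>))"
      by (rule integral_mult_right_zero[symmetric])
    also have "\<dots> = (LINT \<xi>|lborel. LINT e|lborel. F \<xi> e)"
    proof (rule integral_cong_AE)
      show "(\<lambda>\<xi>. LINT e|lborel. F \<xi> e) \<in> borel_measurable lborel"
        unfolding F_def gamma_gauss_def by measurable
      show "AE \<xi> in lborel. of_real A * (cis (x \<bullet> \<xi>) * fourier f \<xi>) = (LINT e|lborel. F \<xi> e)"
        using AE_lborel_singleton[of 0]
      proof eventually_elim
        case (elim \<xi>)
        have [measurable]: "gamma_gauss \<beta> r \<in> borel_measurable borel" for r unfolding gamma_gauss_def by measurable
        have "(LINT e|lborel. gamma_gauss \<beta> (norm \<xi>) e * norm \<xi> powr \<beta>) = A"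
          using gs[OF elim] A by (subst integral_eq_nn_integral) (auto simp: gamma_gauss_nonneg)
        moreover have "(LINT e|lborel. F \<xi> e) = (LINT e|lborel. complex_of_real (gamma_gauss \<beta> (norm \<xi>) e * norm \<xi> powr \<beta>)) * (cis (x \<bullet> \<xi>) * fourier f \<xi>)"
          unfolding F_def by (rule integral_mult_left_zero)
        ultimately show ?case by (simp only: integral_complex_of_real)
      qed
    qed measurable
    also have "\<dots> = (LINT e|lborel. LINT \<xi>|lborel. F \<xi> e)"
      using lborel_pair.Fubini_integral[OF int] by simp
    finally have "A * c' * \<bar>f x\<bar> = norm (LINT e|lborel. LINT \<xi>|lborel. F \<xi> e)"
      using A c' by (metis abs_mult abs_of_pos mult_pos_pos norm_of_real)
    then have "ennreal (A * c' * \<bar>f x\<bar>) \<le> (\<integral>\<^sup>+e. ennreal (norm (LINT \<xi>|lborel. F \<xi> e)) \<partial>lborel)"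
      using norm_integral_le_nn_integral by metis
    also have "\<dots> \<le> (\<integral>\<^sup>+e. \<integral>\<^sup>+y. (if 0 < e then ennreal (e powr (\<beta> - 1 - ?n) * exp (- (norm (x - y) / e)\<^sup>2 / 2)) else 0) * ennreal (cmod (G y)) \<partial>lborel \<partial>lborel)"
    proof (rule nn_integral_mono)
      fix e :: real
      show "ennreal (norm (LINT \<xi>|lborel. F \<xi> e)) \<le> (\<integral>\<^sup>+y. (if 0 < e then ennreal (e powr (\<beta> - 1 - ?n) * exp (- (norm (x - y) / e)\<^sup>2 / 2)) else 0) * ennreal (cmod (G y)) \<partial>lborel)"
      proof (cases "0 < e")
        case True
        have "(LINT \<xi>|lborel. F \<xi> e) = (LINT \<xi>|lborel. of_real (e powr (\<beta> - 1)) * (of_real (gauss (e *\<^sub>R \<xi>)) * (cis (x \<bullet> \<xi>) * (of_real (norm \<xi> powr \<beta>) * fourier f \<xi>))))"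
          using True by (intro Bochner_Integration.integral_cong) (auto simp: F_def gamma_gauss_def gauss_def mult_ac)
        also have "\<dots> = of_real (e powr (\<beta> - 1)) * (LINT \<xi>|lborel. of_real (gauss (e *\<^sub>R \<xi>)) * (cis (x \<bullet> \<xi>) * (of_real (norm \<xi> powr \<beta>) * fourier f \<xi>)))"
          by (rule integral_mult_right_zero)
        \<comment> \<open>The power e^n and its inverse are inserted to match
          \<open>frac_laplacian_gauss_mean\<close>; the inverse lowers the exponent to \<beta> - 1 -
          n.\<close>
        also have "\<dots> = of_real (e powr (\<beta> - 1) * inverse (e ^ DIM('a))) * (of_real (e ^ DIM('a)) * (LINT \<xi>|lborel. of_real (gauss (e *\<^sub>R \<xi>)) * (cis (x \<bullet> \<xi>) * (of_real (norm \<xi> powr \<beta>) * fourier f \<xi>))))"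
          using True by simp
        also have "e powr (\<beta> - 1) * inverse (e ^ DIM('a)) = e powr (\<beta> - 1 - ?n)"
          using True by (simp add: powr_diff powr_realpow divide_inverse)
        also have "of_real (e ^ DIM('a)) * (LINT \<xi>|lborel. of_real (gauss (e *\<^sub>R \<xi>)) * (cis (x \<bullet> \<xi>) * (of_real (norm \<xi> powr \<beta>) * fourier f \<xi>))) =
          (LINT y|lborel. of_real (gauss ((1 / e) *\<^sub>R (x - y))) * G y)"
          unfolding G_def by (rule frac_laplacian_gauss_mean[OF f \<beta>(1) True, symmetric])
        finally have "ennreal (norm (LINT \<xi>|lborel. F \<xi> e)) = ennreal (e powr (\<beta> - 1 - ?n)) * ennreal (norm (LINT y|lborel. of_real (gauss ((1 / e) *\<^sub>R (x - y))) * G y))"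
          by (simp add: norm_mult ennreal_mult)
        also have "\<dots> \<le> ennreal (e powr (\<beta> - 1 - ?n)) * (\<integral>\<^sup>+y. ennreal (norm (of_real (gauss ((1 / e) *\<^sub>R (x - y))) * G y)) \<partial>lborel)"
          by (intro mult_left_mono norm_integral_le_nn_integral) auto
        also have "\<dots> = (\<integral>\<^sup>+y. ennreal (e powr (\<beta> - 1 - ?n)) * ennreal (norm (of_real (gauss ((1 / e) *\<^sub>R (x - y))) * G y)) \<partial>lborel)"
          by (rule nn_integral_cmult[symmetric]) measurable
        also have "\<dots> = (\<integral>\<^sup>+y. (if 0 < e then ennreal (e powr (\<beta> - 1 - ?n) * exp (- (norm (x - y) / e)\<^sup>2 / 2)) else 0) * ennreal (cmod (G y)) \<partial>lborel)"
          using True by (intro nn_integral_cong) (simp add: norm_mult gauss_def ennreal_mult mult.assoc)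
        finally show ?thesis .
      next
        case False
        then have "F \<xi> e = 0" for \<xi> by (simp add: F_def gamma_gauss_def)
        then show ?thesis by simp
      qed
    qed
    also have "\<dots> = (\<integral>\<^sup>+y. \<integral>\<^sup>+e. (if 0 < e then ennreal (e powr (\<beta> - 1 - ?n) * exp (- (norm (x - y) / e)\<^sup>2 / 2)) else 0) * ennreal (cmod (G y)) \<partial>lborel \<partial>lborel)"
    proof (rule nn_integral_swap)
      have "(\<lambda>(e, y). (if 0 < e then ennreal (e powr (\<beta> - 1 - ?n) * exp (- (norm (x - y) / e)\<^sup>2 / 2)) else 0) * ennreal (cmod (G y))) \<in> borel_measurable (borel \<Otimes>\<^sub>M borel)"
        by measurable
      then show "(\<lambda>(e, y). (if 0 < e then ennreal (e powr (\<beta> - 1 - ?n) * exp (- (norm (x - y) / e)\<^sup>2 / 2)) else 0) * ennreal (cmod (G y))) \<in> borel_measurable borel"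
        by (simp only: borel_prod)
    qed
    also have "\<dots> \<le> (\<integral>\<^sup>+y. ennreal C * ennreal (norm (x - y) powr (\<beta> - ?n) * cmod (G y)) \<partial>lborel)"
    proof (rule nn_integral_mono_AE)
      show "AE y in lborel. (\<integral>\<^sup>+e. (if 0 < e then ennreal (e powr (\<beta> - 1 - ?n) * exp (- (norm (x - y) / e)\<^sup>2 / 2)) else 0) * ennreal (cmod (G y)) \<partial>lborel) \<le> ennreal C * ennreal (norm (x - y) powr (\<beta> - ?n) * cmod (G y))"
        using AE_lborel_singleton[of x]
      proof eventually_elim
        case (elim y)
        have "(\<integral>\<^sup>+e. (if 0 < e then ennreal (e powr (\<beta> - 1 - ?n) * exp (- (norm (x - y) / e)\<^sup>2 / 2)) else 0) * ennreal (cmod (G y)) \<partial>lborel) =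
          (\<integral>\<^sup>+e. (if 0 < e then ennreal (e powr (\<beta> - 1 - ?n) * exp (- (norm (x - y) / e)\<^sup>2 / 2)) else 0) \<partial>lborel) * ennreal (cmod (G y))"
          by (rule nn_integral_multc) measurable
        also have "\<dots> \<le> ennreal (C * norm (x - y) powr (\<beta> - ?n)) * ennreal (cmod (G y))"
          using elim by (intro mult_right_mono C(2)) auto
        finally show ?case using C(1) by (simp add: ennreal_mult mult.assoc)
      qed
    qed
    also have "\<dots> = ennreal C * (\<integral>\<^sup>+y. ennreal (norm (x - y) powr (\<beta> - ?n) * cmod (G y)) \<partial>lborel)"
      by (rule nn_integral_cmult) measurable
    finally have "ennreal (1 / (A * c')) * ennreal (A * c' * \<bar>f x\<bar>) \<le> ennreal (1 / (A * c')) * (ennreal C * (\<integral>\<^sup>+y. ennreal (norm (x - y) powr (\<beta> - ?n) * cmod (G y)) \<partial>lborel))"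
      by (rule mult_left_mono) simp
    moreover have "ennreal (1 / (A * c')) * ennreal (A * c' * \<bar>f x\<bar>) = ennreal \<bar>f x\<bar>"
      using A c' by (simp add: ennreal_mult[symmetric])
    moreover have "ennreal (1 / (A * c')) * ennreal C = ennreal (C / (A * c'))"
      using A c' C(1) by (simp add: ennreal_mult[symmetric])
    ultimately show "ennreal \<bar>f x\<bar> \<le> ennreal (C / (A * c')) * (\<integral>\<^sup>+y. ennreal (norm (x - y) powr (\<beta> - ?n) * cmod (frac_laplacian (\<beta> / 2) f y)) \<partial>lborel)"
      by (simp add: mult.assoc[symmetric] G_def)
  qed
qed

section \<open>Weighted estimates on the half space\<close>

lemma tendsto_ennpowr:
  assumes "(u \<longlongrightarrow> l) F" "0 < a" "l \<noteq> top"
  shows "((\<lambda>k. ennpowr (u k) a) \<longlongrightarrow> ennpowr l a) F"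
proof -
  obtain r where r: "l = ennreal r" "0 \<le> r" using assms(3) by (cases l) auto
  have "eventually (\<lambda>k. u k < top) F"
    using order_tendstoD(2)[OF assms(1), of top] assms(3) by (simp add: less_top)
  then have ev: "eventually (\<lambda>k. ennreal (enn2real (u k) powr a) = ennpowr (u k) a) F"
    by eventually_elim (simp add: ennpowr_def less_top)
  have "((\<lambda>k. enn2real (u k)) \<longlongrightarrow> r) F"
    by (rule tendsto_enn2real) (use assms(1) r in auto)
  then have "((\<lambda>k. enn2real (u k) powr a) \<longlongrightarrow> r powr a) F"
    using assms(2) r(2) by (intro tendsto_powr2 tendsto_const) (auto intro!: always_eventually)
  then have "((\<lambda>k. ennreal (enn2real (u k) powr a)) \<longlongrightarrow> ennreal (r powr a)) F"
    by (rule tendsto_ennrealI)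
  from Lim_transform_eventually[OF this ev] show ?thesis
    using r by (simp add: ennpowr_ennreal)
qed

text \<open>The density of the measure, extended by 0 to the whole space so that
  \<open>lborel\<close> and its Fubini rules can be used.\<close>

definition tent_weight :: "real \<Rightarrow> real \<Rightarrow> real \<times> 'a::euclidean_space \<Rightarrow> ennreal" where
  "tent_weight \<gamma> \<zeta> = (\<lambda>(t, x). if 0 < t then ennreal (t powr (\<zeta> - 1) * norm x powr (real DIM('a) * (\<gamma> - 1))) else 0)"

lemma borel_measurable_tent_weight [measurable]: "tent_weight \<gamma> \<zeta> \<in> borel_measurable borel"
  unfolding tent_weight_def borel_prod[symmetric] by measurable

lemma half_space_borel: "{0<..} \<times> UNIV \<in> sets (borel :: (real \<times> 'a::euclidean_space) measure)"
  by (intro borel_open open_Times) auto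

lemma space_mu_weight: "space (mu_weight \<gamma> \<zeta> :: (real \<times> 'a::euclidean_space) measure) = {0<..} \<times> UNIV"
  by (simp add: mu_weight_def space_restrict_space)

lemma measurable_mu_weight:
  fixes f :: "real \<times> 'a::euclidean_space \<Rightarrow> ennreal"
  assumes "f \<in> borel_measurable borel"
  shows "f \<in> borel_measurable (mu_weight \<gamma> \<zeta>)"
  unfolding mu_weight_def using assms by (simp add: measurable_restrict_space1)

lemma nn_integral_mu_weight:
  fixes f :: "real \<times> 'a::euclidean_space \<Rightarrow> ennreal"
  assumes [measurable]: "f \<in> borel_measurable borel"
  shows "(\<integral>\<^sup>+z. f z \<partial>mu_weight \<gamma> \<zeta>) = (\<integral>\<^sup>+z. tent_weight \<gamma> \<zeta> z * f z \<partial>lborel)"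
proof -
  let ?R = "restrict_space lborel ({0<..} \<times> UNIV) :: (real \<times> 'a) measure"
  let ?w = "\<lambda>(t :: real, x :: 'a). ennreal (t powr (\<zeta> - 1) * norm x powr (real DIM('a) * (\<gamma> - 1)))"
  have w: "?w \<in> borel_measurable borel"
    unfolding borel_prod[symmetric] by measurable
  have "(\<integral>\<^sup>+z. f z \<partial>mu_weight \<gamma> \<zeta>) = (\<integral>\<^sup>+z. ?w z * f z \<partial>?R)"
    unfolding mu_weight_def using w assms by (intro nn_integral_density) (auto intro: measurable_restrict_space1)
  also have "\<dots> = (\<integral>\<^sup>+z. (?w z * f z) * indicator ({0<..} \<times> UNIV) z \<partial>lborel)"
    by (rule nn_integral_restrict_space) (use half_space_borel in simp)
  also have "\<dots> = (\<integral>\<^sup>+z. tent_weight \<gamma> \<zeta> z * f z \<partial>lborel)"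
    by (intro nn_integral_cong) (auto simp: tent_weight_def split: split_indicator if_splits)
  finally show ?thesis .
qed

lemma smoothed_test_function_bound:
  assumes e: "0 < e" and \<beta>: "0 < \<beta>" "\<beta> < real DIM('a::euclidean_space)" and \<gamma>: "0 < \<gamma>" "\<gamma> \<le> 1"
    and \<zeta>: "0 < \<zeta>" "real DIM('a) - p * \<beta> < \<zeta> + real DIM('a) * \<gamma>"
    and p: "1 \<le> p" "p * \<beta> < real DIM('a)" and q: "q = p * (\<zeta> + real DIM('a) * \<gamma>) / (real DIM('a) - p * \<beta>)"
  shows "\<exists>C>0. \<forall>f :: 'a \<Rightarrow> real. test_function f \<longrightarrow>
    (\<integral>\<^sup>+z. ennpowr (smoothed e f z) q \<partial>mu_weight \<gamma> \<zeta>) \<le> ennreal C * ennpowr (test_norm \<beta> p f) q"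
proof -
  let ?n = "real DIM('a)"
  define a where "a = \<zeta> + ?n * \<gamma>"
  define w :: "real \<times> 'a \<Rightarrow> ennreal" where "w = tent_weight \<gamma> \<zeta>"
  have wm[measurable]: "w \<in> borel_measurable borel" unfolding w_def by measurable
  have pq: "p < q"
  proof -
    have "1 < a / (?n - p * \<beta>)" using \<zeta>(2) p(2) by (simp add: a_def)
    then have "p * 1 < p * (a / (?n - p * \<beta>))" using p(1) by (intro mult_strict_left_mono) auto
    then show ?thesis by (simp add: q a_def)
  qed
  obtain A where A: "0 < A" "\<And>r (y :: 'a). 0 < r \<Longrightarrow>
    (\<integral>\<^sup>+(t, x). (if 0 < t \<and> t + norm (x - y) < r
        then ennreal (t powr (\<zeta> - 1) * norm x powr (?n * (\<gamma> - 1))) else 0) \<partial>lborel) \<le> ennreal (A * r powr a)"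
    by (rule nn_integral_weight_ball[OF \<gamma> \<zeta>(1), where 'a='a, folded a_def]) (rule that, assumption, blast)
  have wA: "(\<integral>\<^sup>+(t, x). (if 0 < t \<and> t + norm (x - y) < r then w (t, x) else 0) \<partial>lborel) \<le> ennreal (A * r powr a)"
    if "0 < r" for r and y :: 'a
  proof -
    have "(\<integral>\<^sup>+(t, x). (if 0 < t \<and> t + norm (x - y) < r then w (t, x) else 0) \<partial>lborel) =
      (\<integral>\<^sup>+(t, x). (if 0 < t \<and> t + norm (x - y) < r then ennreal (t powr (\<zeta> - 1) * norm x powr (?n * (\<gamma> - 1))) else 0) \<partial>lborel)"
      by (intro nn_integral_cong) (auto simp: w_def tent_weight_def)
    then show ?thesis using A(2)[OF that] by simp
  qed
  \<comment> \<open>Shared by both ranges of p: domination by a potential for t > 0 is enough, as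
    the weight vanishes elsewhere.\<close>
  have reduce: "(\<integral>\<^sup>+z. ennpowr (smoothed e f z) q \<partial>mu_weight \<gamma> \<zeta>) \<le> ennreal (K powr q) * (\<integral>\<^sup>+z. w z * ennpowr (S z) q \<partial>lborel)"
    if f: "test_function f" and K: "0 < K" and [measurable]: "S \<in> borel_measurable borel"
      and S: "\<And>t x. 0 < t \<Longrightarrow> smoothed e f (t, x) \<le> ennreal K * S (t, x)"
    for f and K :: real and S :: "real \<times> 'a \<Rightarrow> ennreal"
  proof -
    have [measurable]: "f \<in> borel_measurable borel" by (rule test_function_borel[OF f])
    have "(\<integral>\<^sup>+z. ennpowr (smoothed e f z) q \<partial>mu_weight \<gamma> \<zeta>) = (\<integral>\<^sup>+z. w z * ennpowr (smoothed e f z) q \<partial>lborel)"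
      unfolding w_def by (rule nn_integral_mu_weight) measurable
    also have "\<dots> \<le> (\<integral>\<^sup>+z. ennreal (K powr q) * (w z * ennpowr (S z) q) \<partial>lborel)"
    proof (rule nn_integral_mono, clarify)
      fix t :: real and x :: 'a
      show "w (t, x) * ennpowr (smoothed e f (t, x)) q \<le> ennreal (K powr q) * (w (t, x) * ennpowr (S (t, x)) q)"
      proof (cases "0 < t")
        case True
        have "ennpowr (smoothed e f (t, x)) q \<le> ennpowr (ennreal K * S (t, x)) q"
          using pq p(1) by (intro ennpowr_mono S True) auto
        also have "\<dots> = ennreal (K powr q) * ennpowr (S (t, x)) q" by (rule ennpowr_mult[OF K])
        finally show ?thesis by (subst mult.left_commute) (rule mult_left_mono, auto)
      qed (simp add: w_def tent_weight_def)
    qed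
    also have "\<dots> = ennreal (K powr q) * (\<integral>\<^sup>+z. w z * ennpowr (S z) q \<partial>lborel)"
      by (rule nn_integral_cmult) measurable
    finally show ?thesis .
  qed
  show ?thesis
  proof (cases "p = 1")
    case True
    have q1: "1 < q" "q = a / (?n - \<beta>)" using pq True by (auto simp: q a_def)
    obtain M C1 where M: "0 < M" and C1: "0 < C1" and dec: "\<And>f :: 'a \<Rightarrow> real. test_function f \<Longrightarrow> (\<exists>G.
      (\<forall>j. G j \<in> borel_measurable borel) \<and> (\<forall>j y. 0 \<le> G j y) \<and>
      (\<forall>x. ennreal \<bar>f x\<bar> \<le> (\<integral>\<^sup>+j. \<integral>\<^sup>+y. (if norm (x - y) < real (1 + nat \<lfloor>\<beta>\<rfloor>) * 2 powr (- of_int j)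
        then ennreal (M * (2 powr (- of_int j)) powr (- ?n) * G j y) else 0) \<partial>lborel \<partial>count_space UNIV)) \<and>
      (\<integral>\<^sup>+j. \<integral>\<^sup>+y. ennreal (2 powr (\<beta> * of_int j) * G j y) \<partial>lborel \<partial>count_space UNIV) \<le> ennreal C1 * test_norm \<beta> 1 f)"
      using test_function_scale_decomposition[OF \<beta>(1), where 'a='a] by blast
    obtain Cb where Cb: "0 < Cb" "\<And>t r (w :: 'a). 0 < t \<Longrightarrow> 0 < r \<Longrightarrow>
      (\<integral>\<^sup>+z. ennreal (majorant e t (w - z)) * (if norm z < r then ennreal (r powr (- ?n)) else 0) \<partial>lborel)
        \<le> ennreal (Cb * (t + norm w + r) powr (- ?n))"
      by (rule majorant_conv_ball[OF e, where 'a='a]) (rule that, assumption, blast)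
    define K where "K = M * real (1 + nat \<lfloor>\<beta>\<rfloor>) powr ?n * Cb"
    have K: "0 < K" using M Cb by (simp add: K_def)
    show ?thesis
    proof (rule scale_potential_strong_type[OF wm wA A(1) \<beta> q1], assumption)
      fix C assume C: "0 < C" and strong: "\<And>G. (\<And>j. G j \<in> borel_measurable borel) \<Longrightarrow> (\<And>j y. 0 \<le> G j y) \<Longrightarrow>
        (\<integral>\<^sup>+z. w z * ennpowr (scale_potential G z) q \<partial>lborel) \<le>
          ennreal C * ennpowr (\<integral>\<^sup>+j. \<integral>\<^sup>+y. ennreal (2 powr (\<beta> * of_int j) * G j y) \<partial>lborel \<partial>count_space UNIV) q"
      show ?thesis
      proof (intro exI[of _ "K powr q * (C * C1 powr q)"] conjI allI impI)
        show "0 < K powr q * (C * C1 powr q)" using K C C1 by simp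
        fix f :: "'a \<Rightarrow> real" assume f: "test_function f"
        obtain G where G: "\<And>j. G j \<in> borel_measurable borel" and G0: "\<And>j y. 0 \<le> G j y"
          and fG: "\<And>x. ennreal \<bar>f x\<bar> \<le> (\<integral>\<^sup>+j. \<integral>\<^sup>+y. (if norm (x - y) < real (1 + nat \<lfloor>\<beta>\<rfloor>) * 2 powr (- of_int j)
            then ennreal (M * (2 powr (- of_int j)) powr (- ?n) * G j y) else 0) \<partial>lborel \<partial>count_space UNIV)"
          and Gn: "(\<integral>\<^sup>+j. \<integral>\<^sup>+y. ennreal (2 powr (\<beta> * of_int j) * G j y) \<partial>lborel \<partial>count_space UNIV) \<le> ennreal C1 * test_norm \<beta> 1 f"
          using dec[OF f] by blast
        have "(\<integral>\<^sup>+z. ennpowr (smoothed e f z) q \<partial>mu_weight \<gamma> \<zeta>) \<le> ennreal (K powr q) * (\<integral>\<^sup>+z. w z * ennpowr (scale_potential G z) q \<partial>lborel)"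
        proof (rule reduce[OF f K])
          show "scale_potential G \<in> borel_measurable borel" using G by measurable
          show "smoothed e f (t, x) \<le> ennreal K * scale_potential G (t, x)" if "0 < t" for t x
            unfolding K_def by (rule smoothed_le_scale_potential[OF e test_function_borel[OF f] G G0 M _ Cb fG that]) simp
        qed
        also have "\<dots> \<le> ennreal (K powr q) * (ennreal C * ennpowr (\<integral>\<^sup>+j. \<integral>\<^sup>+y. ennreal (2 powr (\<beta> * of_int j) * G j y) \<partial>lborel \<partial>count_space UNIV) q)"
          by (intro mult_left_mono strong G G0) auto
        also have "\<dots> \<le> ennreal (K powr q) * (ennreal C * ennpowr (ennreal C1 * test_norm \<beta> 1 f) q)"
          using q1(1) by (intro mult_left_mono ennpowr_mono Gn) auto
        also have "\<dots> = ennreal (K powr q * (C * C1 powr q)) * ennpowr (test_norm \<beta> p f) q"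
          using C by (simp add: ennpowr_mult[OF C1] True ennreal_mult mult.assoc)
        finally show "(\<integral>\<^sup>+z. ennpowr (smoothed e f z) q \<partial>mu_weight \<gamma> \<zeta>) \<le> ennreal (K powr q * (C * C1 powr q)) * ennpowr (test_norm \<beta> p f) q" .
      qed
    qed
  next
    case False
    then have p1: "1 < p" using p(1) by simp
    have qa: "q = p * a / (?n - p * \<beta>)" and an: "?n - p * \<beta> < a" using \<zeta>(2) by (auto simp: q a_def)
    obtain M where M: "0 < M" and riesz: "\<And>f :: 'a \<Rightarrow> real. test_function f \<Longrightarrow> (\<forall>x.
      ennreal \<bar>f x\<bar> \<le> ennreal M * (\<integral>\<^sup>+y. ennreal (norm (x - y) powr (\<beta> - ?n) * cmod (frac_laplacian (\<beta> / 2) f y)) \<partial>lborel))"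
      using riesz_representation[OF \<beta>] by blast
    obtain Cb where Cb: "0 < Cb" "\<And>t (w :: 'a). 0 < t \<Longrightarrow>
      (\<integral>\<^sup>+z. ennreal (majorant e t (w - z)) * ennreal (norm z powr (\<beta> - ?n)) \<partial>lborel)
        \<le> ennreal (Cb * (t + norm w) powr (\<beta> - ?n))"
      by (rule majorant_conv_riesz[OF e \<beta>]) (rule that, assumption, blast)
    define K where "K = M * Cb * (?n - \<beta>)"
    have K: "0 < K" using M Cb \<beta> by (simp add: K_def)
    show ?thesis
    proof (rule cone_potential_strong_type[OF wm wA A(1) \<beta>(1) p1 p(2) an qa], assumption)
      fix C assume C: "0 < C" and strong: "\<And>g. g \<in> borel_measurable borel \<Longrightarrow> (\<And>y. 0 \<le> g y) \<Longrightarrow>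
        (\<integral>\<^sup>+z. w z * ennpowr (cone_potential \<beta> g z) q \<partial>lborel) \<le> ennreal C * ennpowr (\<integral>\<^sup>+y. ennreal (g y powr p) \<partial>lborel) (q / p)"
      show ?thesis
      proof (intro exI[of _ "K powr q * C"] conjI allI impI)
        show "0 < K powr q * C" using K C by simp
        fix f :: "'a \<Rightarrow> real" assume f: "test_function f"
        have [measurable]: "f \<in> borel_measurable borel" by (rule test_function_borel[OF f])
        define g where "g y = cmod (frac_laplacian (\<beta> / 2) f y)" for y
        have g[measurable]: "g \<in> borel_measurable borel" unfolding g_def frac_laplacian_def by measurable
        have g0: "0 \<le> g y" for y by (simp add: g_def)
        have fg: "ennreal \<bar>f x\<bar> \<le> ennreal M * (\<integral>\<^sup>+y. ennreal (norm (x - y) powr (\<beta> - ?n) * g y) \<partial>lborel)" for x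
          using riesz[OF f] by (simp add: g_def)
        have "(\<integral>\<^sup>+z. ennpowr (smoothed e f z) q \<partial>mu_weight \<gamma> \<zeta>) \<le> ennreal (K powr q) * (\<integral>\<^sup>+z. w z * ennpowr (cone_potential \<beta> g z) q \<partial>lborel)"
        proof (rule reduce[OF f K])
          show "smoothed e f (t, x) \<le> ennreal K * cone_potential \<beta> g (t, x)" if "0 < t" for t x
            unfolding K_def by (rule smoothed_le_cone_potential[OF e test_function_borel[OF f] g g0 M \<beta>(2) Cb fg that])
        qed measurable
        also have "\<dots> \<le> ennreal (K powr q) * (ennreal C * ennpowr (\<integral>\<^sup>+y. ennreal (g y powr p) \<partial>lborel) (q / p))"
          by (intro mult_left_mono strong g g0) auto
        also have "ennpowr (\<integral>\<^sup>+y. ennreal (g y powr p) \<partial>lborel) (q / p) = ennpowr (test_norm \<beta> p f) q"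
          using False by (simp add: test_norm_def Lp_norm_def ennpowr_ennpowr g_def)
        also have "ennreal (K powr q) * (ennreal C * ennpowr (test_norm \<beta> p f) q) = ennreal (K powr q * C) * ennpowr (test_norm \<beta> p f) q"
          using C by (simp add: ennreal_mult mult.assoc)
        finally show "(\<integral>\<^sup>+z. ennpowr (smoothed e f z) q \<partial>mu_weight \<gamma> \<zeta>) \<le> ennreal (K powr q * C) * ennpowr (test_norm \<beta> p f) q" .
      qed
    qed
  qed
qed

text \<open>Convergence is given only in L^1 on compact sets. The majorant is at most t^(-n), so
  over a ball the contribution of f exceeds the smoothing of \<open>\<phi> k\<close> by an error
  that tends to 0. The radius of the ball then tends to infinity by monotone convergence.\<close>

lemma smoothed_le_liminf:
  fixes f :: "'a::euclidean_space \<Rightarrow> real"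
  assumes e: "0 < e" and t: "0 < t" and f[measurable]: "f \<in> borel_measurable lebesgue" and \<phi>: "\<And>k. \<phi> k \<in> borel_measurable borel"
    and conv: "\<And>K. compact K \<Longrightarrow> (\<lambda>k. \<integral>\<^sup>+y\<in>K. ennreal \<bar>\<phi> k y - f y\<bar> \<partial>lebesgue) \<longlonglongrightarrow> 0"
  shows "smoothed e f (t, x) \<le> liminf (\<lambda>k. smoothed e (\<phi> k) (t, x))"
proof -
  define P where "P y = ennreal (majorant e t (x - y))" for y
  have "P \<in> borel_measurable lborel" unfolding P_def by measurable
  then have Pm[measurable]: "P \<in> borel_measurable lebesgue" by (rule measurable_completion)
  have \<phi>m[measurable]: "\<phi> k \<in> borel_measurable lebesgue" for k
    using \<phi>[of k] by (intro measurable_completion) simp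
  define B where "B = t powr (- real DIM('a))"
  have PB: "P y \<le> ennreal B" for y
    using majorant_le[OF e t t, of "x - y" 1] by (simp add: P_def B_def ennreal_leI)
  have cb[measurable]: "cball (0 :: 'a) r \<in> sets lebesgue" for r by simp
  have le: "(\<integral>\<^sup>+y. P y * ennreal \<bar>f y\<bar> * indicator (cball 0 r) y \<partial>lebesgue) \<le> liminf (\<lambda>k. smoothed e (\<phi> k) (t, x))" for r
  proof -
    define b where "b k = ennreal B * (\<integral>\<^sup>+y\<in>cball 0 r. ennreal \<bar>\<phi> k y - f y\<bar> \<partial>lebesgue)" for k
    have b0: "b \<longlonglongrightarrow> 0"
      unfolding b_def using ennreal_tendsto_cmult[OF _ conv[of "cball 0 r"], of "ennreal B"] by simp
    have split: "(\<integral>\<^sup>+y. P y * ennreal \<bar>f y\<bar> * indicator (cball 0 r) y \<partial>lebesgue) \<le> smoothed e (\<phi> k) (t, x) + b k" for k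
    proof -
      have "(\<integral>\<^sup>+y. P y * ennreal \<bar>f y\<bar> * indicator (cball 0 r) y \<partial>lebesgue) \<le>
        (\<integral>\<^sup>+y. P y * ennreal \<bar>\<phi> k y\<bar> + ennreal B * (ennreal \<bar>\<phi> k y - f y\<bar> * indicator (cball 0 r) y) \<partial>lebesgue)"
      proof (rule nn_integral_mono)
        fix y
        have "P y * ennreal \<bar>f y\<bar> \<le> P y * (ennreal \<bar>\<phi> k y\<bar> + ennreal \<bar>\<phi> k y - f y\<bar>)"
          by (intro mult_left_mono) (auto simp flip: ennreal_plus intro!: ennreal_leI)
        also have "\<dots> \<le> P y * ennreal \<bar>\<phi> k y\<bar> + ennreal B * ennreal \<bar>\<phi> k y - f y\<bar>"
          unfolding distrib_left by (intro add_left_mono mult_right_mono PB) auto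
        finally show "P y * ennreal \<bar>f y\<bar> * indicator (cball 0 r) y \<le> P y * ennreal \<bar>\<phi> k y\<bar> + ennreal B * (ennreal \<bar>\<phi> k y - f y\<bar> * indicator (cball 0 r) y)"
          by (auto split: split_indicator)
      qed
      also have "\<dots> = smoothed e (\<phi> k) (t, x) + b k"
        unfolding smoothed_def b_def prod.case P_def[symmetric]
        by (subst nn_integral_add) (simp_all add: nn_integral_cmult)
      finally show ?thesis .
    qed
    show ?thesis
    proof (rule ennreal_le_epsilon)
      fix \<epsilon> :: real assume \<epsilon>: "0 < \<epsilon>"
      let ?X = "\<integral>\<^sup>+y. P y * ennreal \<bar>f y\<bar> * indicator (cball 0 r) y \<partial>lebesgue"
      have "eventually (\<lambda>k. b k < ennreal \<epsilon>) sequentially"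
        using order_tendstoD(2)[OF b0, of "ennreal \<epsilon>"] \<epsilon> by simp
      then have "eventually (\<lambda>k. ?X - ennreal \<epsilon> \<le> smoothed e (\<phi> k) (t, x)) sequentially"
      proof eventually_elim
        case (elim k)
        have "?X \<le> smoothed e (\<phi> k) (t, x) + ennreal \<epsilon>"
          using split[of k] add_left_mono[OF less_imp_le[OF elim]] by (rule order_trans)
        then show ?case by (simp add: ennreal_minus_le_iff add.commute)
      qed
      then have "?X - ennreal \<epsilon> \<le> liminf (\<lambda>k. smoothed e (\<phi> k) (t, x))"
        by (rule Liminf_bounded)
      then show "?X \<le> liminf (\<lambda>k. smoothed e (\<phi> k) (t, x)) + ennreal \<epsilon>"
        by (simp add: ennreal_minus_le_iff add.commute)
    qed
  qed
  have sup: "P y * ennreal \<bar>f y\<bar> = (SUP m::nat. P y * ennreal \<bar>f y\<bar> * indicator (cball 0 (real m)) y)" for y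
  proof (rule antisym)
    obtain m :: nat where "norm y \<le> real m" using real_arch_simple by blast
    then have "P y * ennreal \<bar>f y\<bar> = P y * ennreal \<bar>f y\<bar> * indicator (cball 0 (real m)) y" by simp
    also have "\<dots> \<le> (SUP m::nat. P y * ennreal \<bar>f y\<bar> * indicator (cball 0 (real m)) y)" by (rule SUP_upper) simp
    finally show "P y * ennreal \<bar>f y\<bar> \<le> (SUP m::nat. P y * ennreal \<bar>f y\<bar> * indicator (cball 0 (real m)) y)" .
  qed (auto intro!: SUP_least split: split_indicator)
  have "smoothed e f (t, x) = (\<integral>\<^sup>+y. (SUP m::nat. P y * ennreal \<bar>f y\<bar> * indicator (cball 0 (real m)) y) \<partial>lebesgue)"
    unfolding smoothed_def prod.case P_def[symmetric] sup[symmetric] ..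
  also have "\<dots> = (SUP m::nat. \<integral>\<^sup>+y. P y * ennreal \<bar>f y\<bar> * indicator (cball 0 (real m)) y \<partial>lebesgue)"
    by (rule nn_integral_monotone_convergence_SUP)
      (auto simp: incseq_def le_fun_def intro!: mult_left_mono split: split_indicator)
  also have "\<dots> \<le> liminf (\<lambda>k. smoothed e (\<phi> k) (t, x))"
    by (intro SUP_least le)
  finally show ?thesis .
qed

text \<open>H is the lower limit of the smoothings of an approximating sequence. It stands in for
  the smoothing of f, which is built from a merely Lebesgue measurable function: H is Borel, as is
  needed to move constants out of its integrals.\<close>

lemma smoothed_sobolev_bound:
  assumes e: "0 < e" and \<beta>: "0 < \<beta>" "\<beta> < real DIM('a::euclidean_space)" and \<gamma>: "0 < \<gamma>" "\<gamma> \<le> 1"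
    and \<zeta>: "0 < \<zeta>" "real DIM('a) - p * \<beta> < \<zeta> + real DIM('a) * \<gamma>"
    and p: "1 \<le> p" "p * \<beta> < real DIM('a)" and q: "q = p * (\<zeta> + real DIM('a) * \<gamma>) / (real DIM('a) - p * \<beta>)"
  shows "\<exists>C>0. \<forall>(f :: 'a \<Rightarrow> real) N. has_sobolev_norm \<beta> p f N \<longrightarrow>
    (\<exists>H. H \<in> borel_measurable borel \<and> (\<forall>t x. 0 < t \<longrightarrow> smoothed e f (t, x) \<le> H (t, x)) \<and>
      (\<integral>\<^sup>+z. ennpowr (H z) q \<partial>mu_weight \<gamma> \<zeta>) \<le> ennreal C * ennpowr N q)"
proof -
  obtain C where C: "0 < C" "\<And>f :: 'a \<Rightarrow> real. test_function f \<Longrightarrow>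
    (\<integral>\<^sup>+z. ennpowr (smoothed e f z) q \<partial>mu_weight \<gamma> \<zeta>) \<le> ennreal C * ennpowr (test_norm \<beta> p f) q"
    using smoothed_test_function_bound[OF assms] by blast
  have q0: "0 < q"
    using p \<zeta> by (simp add: q)
  show ?thesis
  proof (intro exI[of _ C] conjI allI impI)
    fix f :: "'a \<Rightarrow> real" and N
    assume "has_sobolev_norm \<beta> p f N"
    then obtain \<phi> where fm: "f \<in> borel_measurable lebesgue" and \<phi>: "\<And>k. test_function (\<phi> k)"
      and conv: "\<And>K. compact K \<Longrightarrow> (\<lambda>k. \<integral>\<^sup>+y\<in>K. ennreal \<bar>\<phi> k y - f y\<bar> \<partial>lebesgue) \<longlonglongrightarrow> 0"
      and N: "(\<lambda>k. test_norm \<beta> p (\<phi> k)) \<longlonglongrightarrow> N"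
      unfolding has_sobolev_norm_def by blast
    have \<phi>m[measurable]: "\<phi> k \<in> borel_measurable borel" for k by (rule test_function_borel[OF \<phi>])
    define H where "H z = liminf (\<lambda>k. smoothed e (\<phi> k) z)" for z
    have Hm[measurable]: "H \<in> borel_measurable borel" unfolding H_def by measurable
    have bound: "(\<integral>\<^sup>+z. ennpowr (H z) q \<partial>mu_weight \<gamma> \<zeta>) \<le> ennreal C * ennpowr N q"
    \<comment> \<open>For infinite N the right side is infinite; \<open>tendsto_ennpowr\<close>
      deals with finite limits.\<close>
    proof (cases "N = top")
      case False
      have "(\<integral>\<^sup>+z. ennpowr (H z) q \<partial>mu_weight \<gamma> \<zeta>) \<le> (\<integral>\<^sup>+z. liminf (\<lambda>k. ennpowr (smoothed e (\<phi> k) z) q) \<partial>mu_weight \<gamma> \<zeta>)"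
        by (intro nn_integral_mono ennpowr_liminf_le q0) (simp add: H_def)
      also have "\<dots> \<le> liminf (\<lambda>k. \<integral>\<^sup>+z. ennpowr (smoothed e (\<phi> k) z) q \<partial>mu_weight \<gamma> \<zeta>)"
        by (rule nn_integral_liminf) (rule measurable_mu_weight, measurable)
      also have "\<dots> \<le> liminf (\<lambda>k. ennreal C * ennpowr (test_norm \<beta> p (\<phi> k)) q)"
        by (intro Liminf_mono always_eventually allI C \<phi>)
      also have "\<dots> = ennreal C * ennpowr N q"
        by (intro lim_imp_Liminf ennreal_tendsto_cmult tendsto_ennpowr N q0 False) auto
      finally show ?thesis .
    qed (use C(1) in \<open>simp add: ennreal_mult_top\<close>)
    show "\<exists>H. H \<in> borel_measurable borel \<and> (\<forall>t x. 0 < t \<longrightarrow> smoothed e f (t, x) \<le> H (t, x)) \<and>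
      (\<integral>\<^sup>+z. ennpowr (H z) q \<partial>mu_weight \<gamma> \<zeta>) \<le> ennreal C * ennpowr N q"
      using smoothed_le_liminf[OF e _ fm \<phi>m conv] Hm bound by (intro exI[of _ H]) (auto simp: H_def)
  qed (rule C)
qed

text \<open>On the ball the majorant at height r is at least r^e (2 r)^(-n - e). Multiplied by the
  volume of the ball all powers of r cancel, so the bound is the same for every point of a
  tent.\<close>

lemma smoothed_ge_of_ball:
  fixes f :: "'a::euclidean_space \<Rightarrow> real"
  assumes e: "0 < e" and r: "0 < r" and f: "\<And>y. y \<in> ball x r \<Longrightarrow> 1 \<le> f y"
  shows "ennreal (2 powr (- real DIM('a) - e) * unit_ball_vol (real DIM('a))) \<le> smoothed e f (r, x)"
proof -
  let ?n = "real DIM('a)"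
  define c where "c = r powr e * (2 * r) powr (- ?n - e)"
  have "ennreal c * ennreal (unit_ball_vol ?n * r powr ?n) = (\<integral>\<^sup>+y. ennreal c * indicator (ball x r) y \<partial>lborel)"
    using emeasure_ball_powr[OF r, of x] by (simp add: nn_integral_cmult_indicator)
  also have "\<dots> \<le> smoothed e f (r, x)"
    unfolding smoothed_eq
  proof (rule nn_integral_mono)
    fix y
    show "ennreal c * indicator (ball x r) y \<le> ennreal (majorant e r (x - y)) * ennreal \<bar>f y\<bar>"
    proof (cases "y \<in> ball x r")
      case True
      have "(2 * r) powr (- ?n - e) \<le> (r + norm (x - y)) powr (- ?n - e)"
        using True r e by (intro powr_mono2') (auto simp: dist_norm add_pos_nonneg)
      then have "c \<le> majorant e r (x - y)"
        unfolding c_def majorant_def by (intro mult_left_mono) auto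
      then have "c * 1 \<le> majorant e r (x - y) * \<bar>f y\<bar>"
        using f[OF True] by (intro mult_mono) auto
      then show ?thesis using True by (simp add: ennreal_mult[symmetric] ennreal_leI)
    qed simp
  qed
  also have "ennreal c * ennreal (unit_ball_vol ?n * r powr ?n) = ennreal (2 powr (- ?n - e) * unit_ball_vol ?n)"
  proof -
    have "r powr e * r powr (- ?n - e) * r powr ?n = 1"
      unfolding powr_add[symmetric] using r by simp
    moreover have "c * (unit_ball_vol ?n * r powr ?n) = 2 powr (- ?n - e) * unit_ball_vol ?n * (r powr e * r powr (- ?n - e) * r powr ?n)"
      using r by (simp add: c_def powr_mult mult_ac)
    ultimately have "c * (unit_ball_vol ?n * r powr ?n) = 2 powr (- ?n - e) * unit_ball_vol ?n" by simp
    then show ?thesis by (subst ennreal_mult[symmetric]) (auto simp: c_def)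
  qed
  finally show ?thesis .
qed

text \<open>Meant for the infimum that defines the capacity, also when no function is admissible and
  the infimum is top.\<close>

lemma le_cmult_Inf_ennreal:
  fixes X :: ennreal
  assumes K: "0 < K" and le: "\<And>a. a \<in> A \<Longrightarrow> X \<le> ennreal K * a"
  shows "X \<le> ennreal K * Inf A"
proof -
  have "ennreal (1 / K) * X \<le> Inf A"
  proof (rule Inf_greatest)
    fix a assume "a \<in> A"
    then have "ennreal (1 / K) * X \<le> ennreal (1 / K) * (ennreal K * a)" by (intro mult_left_mono le) auto
    also have "\<dots> = a" using K by (simp add: mult.assoc[symmetric] ennreal_mult[symmetric])
    finally show "ennreal (1 / K) * X \<le> a" .
  qed
  then have "ennreal K * (ennreal (1 / K) * X) \<le> ennreal K * Inf A" by (rule mult_left_mono) simp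
  then show ?thesis using K by (simp add: mult.assoc[symmetric] ennreal_mult[symmetric])
qed

lemma tent_capacity_bound:
  assumes \<beta>: "0 < \<beta>" "\<beta> < real DIM('a::euclidean_space)" and \<gamma>: "0 < \<gamma>" "\<gamma> \<le> 1"
    and \<zeta>: "0 < \<zeta>" "real DIM('a) - p * \<beta> < \<zeta> + real DIM('a) * \<gamma>"
    and p: "1 \<le> p" "p * \<beta> < real DIM('a)"
  shows "\<exists>K>0. \<forall>U :: 'a set. ennpowr (emeasure (mu_weight \<gamma> \<zeta>) (tent U)) ((real DIM('a) - p * \<beta>) / (\<zeta> + real DIM('a) * \<gamma>))
    \<le> ennreal K * sobolev_cap \<beta> p U"
proof -
  let ?n = "real DIM('a)"
  define q where "q = p * (\<zeta> + ?n * \<gamma>) / (?n - p * \<beta>)"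
  have q0: "0 < q" using p \<zeta> by (simp add: q_def)
  have s: "(?n - p * \<beta>) / (\<zeta> + ?n * \<gamma>) = p / q" using p by (simp add: q_def)
  \<comment> \<open>The decay exponent of the smoothing is free in this half; 1 is the simplest
    choice.\<close>
  obtain C where C: "0 < C" "\<And>(f :: 'a \<Rightarrow> real) N. has_sobolev_norm \<beta> p f N \<Longrightarrow>
    (\<exists>H. H \<in> borel_measurable borel \<and> (\<forall>t x. 0 < t \<longrightarrow> smoothed 1 f (t, x) \<le> H (t, x)) \<and>
      (\<integral>\<^sup>+z. ennpowr (H z) q \<partial>mu_weight \<gamma> \<zeta>) \<le> ennreal C * ennpowr N q)"
    using smoothed_sobolev_bound[OF zero_less_one \<beta> \<gamma> \<zeta> p q_def] by blast
  define c where "c = 2 powr (- ?n - 1) * unit_ball_vol ?n"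
  have c: "0 < c" by (simp add: c_def)
  define D where "D = C / c powr q"
  have D: "0 < D" using C c by (simp add: D_def)
  show ?thesis
  proof (intro exI[of _ "D powr (p / q)"] conjI allI)
    show "0 < D powr (p / q)" using D by simp
    fix U :: "'a set"
    show "ennpowr (emeasure (mu_weight \<gamma> \<zeta>) (tent U)) ((?n - p * \<beta>) / (\<zeta> + ?n * \<gamma>)) \<le> ennreal (D powr (p / q)) * sobolev_cap \<beta> p U"
      unfolding sobolev_cap_def
    proof (rule le_cmult_Inf_ennreal)
      fix a assume "a \<in> {ennpowr N p |(f :: 'a \<Rightarrow> real) N. has_sobolev_norm \<beta> p f N \<and> (\<forall>x. 0 \<le> f x) \<and> U \<subseteq> interior {x. 1 \<le> f x}}"
      then obtain f :: "'a \<Rightarrow> real" and N where a: "a = ennpowr N p" and fN: "has_sobolev_norm \<beta> p f N" and U: "U \<subseteq> interior {x. 1 \<le> f x}"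
        by blast
      obtain H where Hm: "H \<in> borel_measurable borel" and H: "\<And>t x. 0 < t \<Longrightarrow> smoothed 1 f (t, x) \<le> H (t, x)"
        and HC: "(\<integral>\<^sup>+z. ennpowr (H z) q \<partial>mu_weight \<gamma> \<zeta>) \<le> ennreal C * ennpowr N q"
        using C(2)[OF fN] by blast
      have "ennreal (c powr q) * emeasure (mu_weight \<gamma> \<zeta>) (tent U) \<le> ennreal C * ennpowr N q"
      \<comment> \<open>If the tent is not measurable, its \<open>emeasure\<close> is 0 by
        convention and the bound is trivial.\<close>
      proof (cases "tent U \<in> sets (mu_weight \<gamma> \<zeta>)")
        case True
        have "ennreal (c powr q) * emeasure (mu_weight \<gamma> \<zeta>) (tent U) = (\<integral>\<^sup>+z. ennreal (c powr q) * indicator (tent U) z \<partial>mu_weight \<gamma> \<zeta>)"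
          by (rule nn_integral_cmult_indicator[OF True, symmetric])
        also have "\<dots> \<le> (\<integral>\<^sup>+z. ennpowr (H z) q \<partial>mu_weight \<gamma> \<zeta>)"
        proof (rule nn_integral_mono)
          fix z :: "real \<times> 'a"
          obtain r x where z: "z = (r, x)" by (cases z)
          show "ennreal (c powr q) * indicator (tent U) z \<le> ennpowr (H z) q"
          proof (cases "z \<in> tent U")
            case True
            then have r: "0 < r" and sub: "ball x r \<subseteq> U" by (auto simp: tent_def z)
            have "1 \<le> f y" if "y \<in> ball x r" for y
              using that sub U interior_subset by blast
            then have "ennreal c \<le> smoothed 1 f (r, x)"
              unfolding c_def by (intro smoothed_ge_of_ball r) auto
            also have "\<dots> \<le> H z" using H[OF r] by (simp add: z)
            finally have "ennpowr (ennreal c) q \<le> ennpowr (H z) q" using q0 by (intro ennpowr_mono) auto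
            then show ?thesis using True c by (simp add: ennpowr_ennreal)
          qed simp
        qed
        also note HC
        finally show ?thesis .
      qed (simp add: emeasure_notin_sets)
      then have "ennreal (1 / c powr q) * (ennreal (c powr q) * emeasure (mu_weight \<gamma> \<zeta>) (tent U)) \<le> ennreal (1 / c powr q) * (ennreal C * ennpowr N q)"
        by (rule mult_left_mono) simp
      moreover have "ennreal (1 / c powr q) * ennreal (c powr q) = 1" "ennreal (1 / c powr q) * ennreal C = ennreal D"
        using c C(1) by (simp_all add: ennreal_mult[symmetric] D_def)
      ultimately have "emeasure (mu_weight \<gamma> \<zeta>) (tent U) \<le> ennreal D * ennpowr N q"
        by (simp add: mult.assoc[symmetric])
      \<comment> \<open>The power p / q turns N^q into N^p, the quantity minimised by the capacity,
        and it is also the exponent in the claim.\<close>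
      then have "ennpowr (emeasure (mu_weight \<gamma> \<zeta>) (tent U)) (p / q) \<le> ennpowr (ennreal D * ennpowr N q) (p / q)"
        using p q0 by (intro ennpowr_mono) auto
      also have "\<dots> = ennreal (D powr (p / q)) * a"
        using q0 by (simp add: ennpowr_mult[OF D] ennpowr_ennpowr a)
      finally show "ennpowr (emeasure (mu_weight \<gamma> \<zeta>) (tent U)) ((?n - p * \<beta>) / (\<zeta> + ?n * \<gamma>)) \<le> ennreal (D powr (p / q)) * a"
        unfolding s .
    qed (use D in simp)
  qed
qed

lemma heat_ext_sobolev_bound:
  assumes \<alpha>: "0 < \<alpha>" "\<alpha> \<le> 1" and \<beta>: "0 < \<beta>" "\<beta> < real DIM('a::euclidean_space)" and \<gamma>: "0 < \<gamma>" "\<gamma> \<le> 1"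
    and \<zeta>: "0 < \<zeta>" "real DIM('a) - p * \<beta> < \<zeta> + real DIM('a) * \<gamma>"
    and p: "1 \<le> p" "p * \<beta> < real DIM('a)"
  shows "\<exists>K>0. \<forall>(v0 :: 'a \<Rightarrow> real) N. has_sobolev_norm \<beta> p v0 N \<longrightarrow>
    Lp_norm (mu_weight \<gamma> \<zeta>) ((\<zeta> + real DIM('a) * \<gamma>) * p / (real DIM('a) - p * \<beta>))
      (\<lambda>(t, x). heat_ext \<alpha> (t powr (2 * \<alpha>)) v0 x) \<le> ennreal K * N"
proof -
  let ?n = "real DIM('a)"
  define q where "q = p * (\<zeta> + ?n * \<gamma>) / (?n - p * \<beta>)"
  have q0: "0 < q" using p \<zeta> by (simp add: q_def)
  have qq: "(\<zeta> + ?n * \<gamma>) * p / (?n - p * \<beta>) = q" by (simp add: q_def mult.commute)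
  \<comment> \<open>In contrast to the capacity estimate, the decay exponent is dictated here by the
    heat kernel.\<close>
  have e: "0 < 2 * \<alpha>" using \<alpha> by simp
  obtain C where C: "0 < C" "\<And>(f :: 'a \<Rightarrow> real) N. has_sobolev_norm \<beta> p f N \<Longrightarrow>
    (\<exists>H. H \<in> borel_measurable borel \<and> (\<forall>t x. 0 < t \<longrightarrow> smoothed (2 * \<alpha>) f (t, x) \<le> H (t, x)) \<and>
      (\<integral>\<^sup>+z. ennpowr (H z) q \<partial>mu_weight \<gamma> \<zeta>) \<le> ennreal C * ennpowr N q)"
    using smoothed_sobolev_bound[OF e \<beta> \<gamma> \<zeta> p q_def] by blast
  obtain D where D: "0 < D" "\<And>t (x :: 'a). 0 < t \<Longrightarrow> cmod (heat_kernel \<alpha> (t powr (2 * \<alpha>)) x) \<le> D * majorant (2 * \<alpha>) t x"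
    using heat_kernel_bound[OF \<alpha>, where 'a='a] by blast
  show ?thesis
    unfolding qq
  proof (intro exI[of _ "D * C powr (1 / q)"] conjI allI impI)
    show "0 < D * C powr (1 / q)" using D C by simp
    fix v0 :: "'a \<Rightarrow> real" and N
    assume v0: "has_sobolev_norm \<beta> p v0 N"
    then have vm: "v0 \<in> borel_measurable lebesgue" by (simp add: has_sobolev_norm_def)
    obtain H where Hm: "H \<in> borel_measurable borel" and H: "\<And>t x. 0 < t \<Longrightarrow> smoothed (2 * \<alpha>) v0 (t, x) \<le> H (t, x)"
      and HC: "(\<integral>\<^sup>+z. ennpowr (H z) q \<partial>mu_weight \<gamma> \<zeta>) \<le> ennreal C * ennpowr N q"
      using C(2)[OF v0] by blast
    have "(\<integral>\<^sup>+z. ennreal (norm (case z of (t, x) \<Rightarrow> heat_ext \<alpha> (t powr (2 * \<alpha>)) v0 x) powr q) \<partial>mu_weight \<gamma> \<zeta>) \<le>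
      (\<integral>\<^sup>+z. ennreal (D powr q) * ennpowr (H z) q \<partial>mu_weight \<gamma> \<zeta>)"
    proof (rule nn_integral_mono)
      \<comment> \<open>The measure lives on t > 0, where the kernel bound and the domination by H
        are available.\<close>
      fix z :: "real \<times> 'a" assume "z \<in> space (mu_weight \<gamma> \<zeta>)"
      then obtain t x where z: "z = (t, x)" and t: "0 < t" by (auto simp: space_mu_weight)
      have "ennreal (cmod (heat_ext \<alpha> (t powr (2 * \<alpha>)) v0 x)) \<le> ennreal D * smoothed (2 * \<alpha>) v0 (t, x)"
        by (rule heat_ext_le_smoothed[OF D(2)[OF t] D(1) vm])
      also have "\<dots> \<le> ennreal D * H (t, x)" by (intro mult_left_mono H t) auto
      finally have "ennpowr (ennreal (cmod (heat_ext \<alpha> (t powr (2 * \<alpha>)) v0 x))) q \<le> ennpowr (ennreal D * H (t, x)) q"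
        using q0 by (intro ennpowr_mono) auto
      then show "ennreal (norm (case z of (t, x) \<Rightarrow> heat_ext \<alpha> (t powr (2 * \<alpha>)) v0 x) powr q) \<le> ennreal (D powr q) * ennpowr (H z) q"
        by (simp add: z ennpowr_ennreal ennpowr_mult[OF D(1)])
    qed
    also have "\<dots> = ennreal (D powr q) * (\<integral>\<^sup>+z. ennpowr (H z) q \<partial>mu_weight \<gamma> \<zeta>)"
      by (intro nn_integral_cmult measurable_mu_weight borel_measurable_ennpowr Hm)
    also have "\<dots> \<le> ennreal (D powr q) * (ennreal C * ennpowr N q)"
      by (intro mult_left_mono HC) auto
    also have "\<dots> = ennreal (D powr q * C) * ennpowr N q"
      using C(1) by (simp add: ennreal_mult mult.assoc)
    finally have "Lp_norm (mu_weight \<gamma> \<zeta>) q (\<lambda>(t, x). heat_ext \<alpha> (t powr (2 * \<alpha>)) v0 x) \<le> ennpowr (ennreal (D powr q * C) * ennpowr N q) (1 / q)"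
      unfolding Lp_norm_def using q0 by (intro ennpowr_mono) auto
    also have "\<dots> = ennreal ((D powr q * C) powr (1 / q)) * N"
      using D(1) C(1) q0 by (simp add: ennpowr_mult ennpowr_ennpowr)
    also have "(D powr q * C) powr (1 / q) = D * C powr (1 / q)"
      using D(1) C(1) q0 by (simp add: powr_mult powr_powr)
    finally show "Lp_norm (mu_weight \<gamma> \<zeta>) q (\<lambda>(t, x). heat_ext \<alpha> (t powr (2 * \<alpha>)) v0 x) \<le> ennreal (D * C powr (1 / q)) * N" .
  qed
qed

theorem corollary1p13:
  fixes \<alpha> \<beta> \<gamma> \<zeta> p q :: real and n :: nat
  assumes n: "n = CARD('n::finite)"
    and \<alpha>: "0 < \<alpha>" "\<alpha> \<le> 1"
    and \<beta>: "0 < \<beta>" "\<beta> < n"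
    and \<gamma>: "0 < \<gamma>" "\<gamma> \<le> 1"
    and \<zeta>: "0 < \<zeta>" "\<zeta> + n * \<gamma> > n - p * \<beta>"
    and q: "q = p * (\<zeta> + n * \<gamma>) / (n - p * \<beta>)"
    and p: "(1 < p \<and> p < min q (n / \<beta>)) \<or> (1 = p \<and> p \<le> q \<and> \<beta> \<notin> \<nat>)"
  shows "(\<exists>C>0. \<forall>U :: (real ^ 'n) set. open U \<longrightarrow>
            ennpowr (emeasure (mu_weight \<gamma> \<zeta>) (tent U)) ((n - p * \<beta>) / (\<zeta> + n * \<gamma>))
              \<le> ennreal C * sobolev_cap \<beta> p U)
       \<and> (\<exists>C>0. \<forall>(v0 :: real ^ 'n \<Rightarrow> real) N. has_sobolev_norm \<beta> p v0 N \<longrightarrow>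
            Lp_norm (mu_weight \<gamma> \<zeta>) ((\<zeta> + n * \<gamma>) * p / (n - p * \<beta>))
                (\<lambda>(t, x). heat_ext \<alpha> (t powr (2 * \<alpha>)) v0 x)
              \<le> ennreal C * N)"
proof -
  have dim: "real DIM(real ^ 'n) = real n" by (simp add: n)
  \<comment> \<open>Both alternatives give p \<beta> < n: the one through p < n / \<beta>, the other
    through p = 1 and \<beta> < n.\<close>
  have p1: "1 \<le> p" and pn: "p * \<beta> < real n"
    using p \<beta> by (auto simp: field_simps)
  note hyps = \<beta>[folded dim] \<gamma> \<zeta>(1) \<zeta>(2)[folded dim] p1 pn[folded dim]
  show ?thesis
    using tent_capacity_bound[OF hyps, unfolded dim] heat_ext_sobolev_bound[OF \<alpha> hyps, unfolded dim] by blast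
qed

end
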